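(* Let $n>0$, $\alpha>0$, and set $\beta=n-\frac32$. Let $u$ be a global strong solution of $$u_t+\partial_x\left[u^n(u_{xxx}+\alpha^2u_x-\sin x)\right]=0,\qquad x\in\Omega,$$ of mass $M>0$ that satisfies the energy inequality $$E(u(\cdot,T))+\int_0^T\int_{\{u>0\}}u^n(u_{xxx}+\alpha^2u_x-\sin x)^2\,dx\,dt\le E(u(\cdot,0))\qquad\text{for all } T>0$$ and the entropy inequality $$S(u(\cdot,t))\le S_0+K_0t\qquad\text{for all } t>0,\qquad S(u)=\int_\Omega u^{-n+\frac32}\,dx,\quad S_0=S(u(\cdot,0)),$$ where $K_0$ is a constant depending on the mass and the initial energy. Assume that $u(\cdot,t)$ converges in $H^1$ (as $t\to\infty$) to the energy-minimizing steady state $u^*$ of mass $M$. (1) If $n>\frac32$ and $u^*$ vanishes on a set of positive length $L$, then $$d_{H^1}(u(\cdot,t),u^* )\ge\frac{1}{\sqrt\pi}\cdot\Bigl(\frac{L}{S_0+K_0t}\Bigr)^{\frac1\beta}.$$ (2) If $n>2$ and $u^*$ vanishes quadratically at a point, then there exist positive constants $K_1$ and $K_2$ (depending on the initial energy and entropy) such that $$d_{H^1}(u(\cdot,t),u^* )\ge(K_1+K_2t)^{-\frac{2}{2\beta-1}}.$$ (3) If $\alpha<1$ and $u^*$ is strictly positive, then $$d_{H^1}(u(\cdot,t),u^* )\le K_3e^{-\mu t}$$ for some constant $K_3$ (depending on $u$), where $\mu=(1-\alpha^2)(\min u^* )^n$.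
   Context: $\Omega=\mathbb{R}/(2\pi\mathbb{Z})$; $\mathcal{C}_M=\{u\in L^2(\Omega)\mid u\ge0,\ \int_\Omega u\,dx=M\}$; $d_{H^1}(u,v)=\|u_x-v_x\|_{L^2}$ for $u,v\in\mathcal{C}_M$. The energy is $E(u)=\frac12\int_\Omega(u_x^2-\alpha^2u^2)\,dx-\int_\Omega u\cos x\,dx$ ($=\infty$ if $u\notin H^1$); it has a unique minimizer $u^*$ on $\mathcal{C}_M$, which is a steady state of the equation. A global strong solution is a nonnegative function $u\in L^2_{loc}((0,\infty),H^2(\Omega))$ such that $\int_0^\infty\int_\Omega\{u\phi_t-(u_{xx}+\alpha^2u+\cos x)(u^n\phi_x)_x\}\,dx\,dt=0$ for every smooth $\phi$ with compact support in $(0,\infty)\times\Omega$; it has mass $M$ if $\int_\Omega u(x,t)\,dx=M$ for all $t$. *)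

theory Defs
  imports "HOL-Analysis.Analysis" "HOL-Library.Landau_Symbols"
begin

text \<open>
  Functions on the circle are represented by their \<open>2 * pi\<close>-periodic lifts to the real line, and
  elements of Lebesgue and Sobolev spaces by Borel measurable representatives; integrals over the
  circle are integrals over \<open>{0..2*pi}\<close>. Functions of time and space are written \<open>u t x\<close>.
\<close>

definition circle_fun :: "(real \<Rightarrow> real) \<Rightarrow> bool" where
  "circle_fun v \<longleftrightarrow> (\<forall>x. v (x + 2 * pi) = v x)"

definition circle_int :: "(real \<Rightarrow> real) \<Rightarrow> real" where
  "circle_int f = (LINT x:{0..2*pi}|lborel. f x)"

definition L2 :: "(real \<Rightarrow> real) set" where
  "L2 = {v. circle_fun v \<and> v \<in> borel_measurable borel \<and>
            set_integrable lborel {0..2*pi} (\<lambda>x. (v x)\<^sup>2)}"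

definition mass_class :: "real \<Rightarrow> (real \<Rightarrow> real) set" where
  "mass_class M = {v \<in> L2. (\<forall>x. 0 \<le> v x) \<and> circle_int v = M}"

definition smooth :: "(real \<Rightarrow> real) \<Rightarrow> bool" where
  "smooth \<phi> \<longleftrightarrow> (\<forall>k x. ((deriv ^^ k) \<phi>) differentiable (at x))"

text \<open>
  \<open>g\<close> is the distributional derivative of order \<open>k\<close> of \<open>f\<close> on the open set \<open>A\<close>. Weak
  differentiability is local, so for the lift of a function on the circle, weak derivatives on the
  circle are weak derivatives on \<open>A = UNIV\<close> (and are automatically periodic up to null sets).
\<close>

definition has_weak_deriv :: "nat \<Rightarrow> real set \<Rightarrow> (real \<Rightarrow> real) \<Rightarrow> (real \<Rightarrow> real) \<Rightarrow> bool" where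
  "has_weak_deriv k A f g \<longleftrightarrow>
     (\<forall>C. compact C \<and> C \<subseteq> A \<longrightarrow> set_integrable lborel C f \<and> set_integrable lborel C g) \<and>
     (\<forall>\<phi>. smooth \<phi> \<and> (\<exists>C. compact C \<and> C \<subseteq> A \<and> (\<forall>x. x \<notin> C \<longrightarrow> \<phi> x = 0)) \<longrightarrow>
        (LINT x|lborel. f x * (deriv ^^ k) \<phi> x) = (-1) ^ k * (LINT x|lborel. g x * \<phi> x))"

text \<open>Some version of the first weak derivative; it is determined up to null sets.\<close>

definition weak_deriv :: "(real \<Rightarrow> real) \<Rightarrow> real \<Rightarrow> real" where
  "weak_deriv v = (SOME w. has_weak_deriv 1 UNIV v w)"

definition H1 :: "(real \<Rightarrow> real) set" where
  "H1 = {v \<in> L2. \<exists>w. has_weak_deriv 1 UNIV v w \<and>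
                       set_integrable lborel {0..2*pi} (\<lambda>x. (w x)\<^sup>2)}"

text \<open>Meaningful for arguments in \<open>H1\<close> only.\<close>

definition dist_H1 :: "(real \<Rightarrow> real) \<Rightarrow> (real \<Rightarrow> real) \<Rightarrow> real" where
  "dist_H1 u v = sqrt (circle_int (\<lambda>x. (weak_deriv u x - weak_deriv v x)\<^sup>2))"

definition energy :: "real \<Rightarrow> (real \<Rightarrow> real) \<Rightarrow> ereal" where
  "energy \<alpha> v =
     (if v \<in> H1
      then ereal (1/2 * circle_int (\<lambda>x. (weak_deriv v x)\<^sup>2 - \<alpha>\<^sup>2 * (v x)\<^sup>2)
                  - circle_int (\<lambda>x. v x * cos x))
      else \<infinity>)"

definition energy_minimizer :: "real \<Rightarrow> real \<Rightarrow> (real \<Rightarrow> real) \<Rightarrow> bool" where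
  "energy_minimizer \<alpha> M v \<longleftrightarrow>
     v \<in> mass_class M \<and> (\<forall>w\<in>mass_class M. energy \<alpha> v \<le> energy \<alpha> w)"

text \<open>
  The power of a nonnegative real with the value \<open>\<infinity>\<close> for negative powers of zero,
  whereas \<open>0 powr p = 0\<close> for every \<open>p\<close>.
\<close>

definition enn_powr :: "real \<Rightarrow> real \<Rightarrow> ennreal" where
  "enn_powr y p = (if 0 < y then ennreal (y powr p)
                   else if p < 0 then \<infinity> else if p = 0 then 1 else 0)"

definition entropy :: "real \<Rightarrow> (real \<Rightarrow> real) \<Rightarrow> ereal" where
  "entropy n v = enn2ereal (\<integral>\<^sup>+x\<in>{0..2*pi}. enn_powr (v x) (- n + 3/2) \<partial>lborel)"

text \<open>
  Infinite differentiability in two variables: \<open>D j k\<close> is the partial derivative of order \<open>j\<close> in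
  the first and order \<open>k\<close> in the second variable.
\<close>

definition smooth2 :: "(real \<Rightarrow> real \<Rightarrow> real) \<Rightarrow> bool" where
  "smooth2 \<phi> \<longleftrightarrow>
     (\<exists>D :: nat \<Rightarrow> nat \<Rightarrow> real \<Rightarrow> real \<Rightarrow> real. D 0 0 = \<phi> \<and>
        (\<forall>j k. continuous_on UNIV (\<lambda>(t, x). D j k t x) \<and>
           (\<forall>t x. ((\<lambda>s. D j k s x) has_real_derivative D (Suc j) k t x) (at t) \<and>
                  ((\<lambda>y. D j k t y) has_real_derivative D j (Suc k) t x) (at x))))"

text \<open>
  Smooth functions with compact support in \<open>(0,\<infinity>) \<times> \<Omega>\<close>; as the circle \<open>\<Omega>\<close> is compact, only
  the support in time is restricted.
\<close>

definition test_fun :: "(real \<Rightarrow> real \<Rightarrow> real) \<Rightarrow> bool" where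
  "test_fun \<phi> \<longleftrightarrow> smooth2 \<phi> \<and> (\<forall>t. circle_fun (\<phi> t)) \<and>
     (\<exists>a b. 0 < a \<and> a < b \<and> (\<forall>t x. t \<notin> {a..b} \<longrightarrow> \<phi> t x = 0))"

text \<open>
  Here \<open>ux\<close> and \<open>uxx\<close> are jointly measurable versions of the spatial derivatives of \<open>u\<close>, and \<open>g\<close>
  is the weak derivative in \<open>x\<close> of \<open>u^n \<phi>\<^sub>x\<close>. Integrability is required explicitly since the
  integral of a function that is not integrable is \<open>0\<close>.
\<close>

definition strong_solution :: "real \<Rightarrow> real \<Rightarrow> (real \<Rightarrow> real \<Rightarrow> real) \<Rightarrow> bool" where
  "strong_solution n \<alpha> u \<longleftrightarrow>
     (\<forall>t\<ge>0. circle_fun (u t) \<and> (\<forall>x. 0 \<le> u t x)) \<and>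
     (\<exists>ux uxx.
        (\<lambda>(t, x). ux t x) \<in> borel_measurable borel \<and>
        (\<lambda>(t, x). uxx t x) \<in> borel_measurable borel \<and>
        (AE t in lborel. 0 < t \<longrightarrow>
           has_weak_deriv 1 UNIV (u t) (ux t) \<and> has_weak_deriv 2 UNIV (u t) (uxx t)) \<and>
        (\<forall>a b. 0 < a \<and> a < b \<longrightarrow>
           set_integrable lborel ({a..b} \<times> {0..2*pi}) (\<lambda>(t, x). (u t x)\<^sup>2) \<and>
           set_integrable lborel ({a..b} \<times> {0..2*pi}) (\<lambda>(t, x). (ux t x)\<^sup>2) \<and>
           set_integrable lborel ({a..b} \<times> {0..2*pi}) (\<lambda>(t, x). (uxx t x)\<^sup>2)) \<and>
        (\<forall>\<phi>. test_fun \<phi> \<longrightarrow>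
           (\<exists>g. (\<lambda>(t, x). g t x) \<in> borel_measurable borel \<and>
              (AE t in lborel. 0 < t \<longrightarrow>
                 has_weak_deriv 1 UNIV (\<lambda>x. u t x powr n * deriv (\<phi> t) x) (g t)) \<and>
              set_integrable lborel ({0<..} \<times> {0..2*pi})
                (\<lambda>(t, x). u t x * deriv (\<lambda>s. \<phi> s x) t
                           - (uxx t x + \<alpha>\<^sup>2 * u t x + cos x) * g t x) \<and>
              (LINT (t, x):{0<..} \<times> {0..2*pi}|lborel.
                 u t x * deriv (\<lambda>s. \<phi> s x) t
                 - (uxx t x + \<alpha>\<^sup>2 * u t x + cos x) * g t x) = 0)))"

text \<open>
  The weak equation determines \<open>u(\<cdot>, t)\<close> for almost every \<open>t\<close> and up to null sets in \<open>x\<close> only. A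
  strong solution whose energy is bounded is bounded in \<open>H1\<close> and weakly continuous in time after a
  change on a null set of times, so it has a unique version that is jointly continuous for \<open>t > 0\<close>.
  Statements about \<open>u(\<cdot>, t)\<close> for every \<open>t\<close> and about the open set where \<open>u > 0\<close> refer to it.
\<close>

definition continuous_version :: "(real \<Rightarrow> real \<Rightarrow> real) \<Rightarrow> bool" where
  "continuous_version u \<longleftrightarrow> continuous_on ({0<..} \<times> UNIV) (\<lambda>(t, x). u t x)"

definition has_mass :: "real \<Rightarrow> (real \<Rightarrow> real \<Rightarrow> real) \<Rightarrow> bool" where
  "has_mass M u \<longleftrightarrow> (\<forall>t\<ge>0. circle_int (u t) = M)"

text \<open>The third derivative is only required to exist on the set where \<open>u(\<cdot>, t)\<close> is positive.\<close>

definition energy_inequality :: "real \<Rightarrow> real \<Rightarrow> (real \<Rightarrow> real \<Rightarrow> real) \<Rightarrow> bool" where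
  "energy_inequality n \<alpha> u \<longleftrightarrow>
     (\<exists>ux uxxx.
        (\<lambda>(t, x). ux t x) \<in> borel_measurable borel \<and>
        (\<lambda>(t, x). uxxx t x) \<in> borel_measurable borel \<and>
        (AE t in lborel. 0 < t \<longrightarrow>
           has_weak_deriv 1 UNIV (u t) (ux t) \<and>
           has_weak_deriv 3 {x. 0 < u t x} (u t) (uxxx t)) \<and>
        (\<forall>T>0. energy \<alpha> (u T)
           + enn2ereal (\<integral>\<^sup>+p\<in>{(t, x). 0 < t \<and> t < T \<and> x \<in> {0..2*pi} \<and> 0 < u t x}.
               (case p of (t, x) \<Rightarrow>
                  ennreal (u t x powr n * (uxxx t x + \<alpha>\<^sup>2 * ux t x - sin x)\<^sup>2)) \<partial>lborel)
           \<le> energy \<alpha> (u 0)))"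

definition entropy_inequality :: "real \<Rightarrow> real \<Rightarrow> (real \<Rightarrow> real \<Rightarrow> real) \<Rightarrow> bool" where
  "entropy_inequality n K\<^sub>0 u \<longleftrightarrow> (\<forall>t>0. entropy n (u t) \<le> entropy n (u 0) + ereal (K\<^sub>0 * t))"

text \<open>
  By the energy inequality, finiteness of the initial energy puts \<open>u(\<cdot>, t)\<close> into \<open>H1\<close> for all
  \<open>t \<ge> 0\<close>, so that \<open>dist_H1\<close> is meaningful.
\<close>

definition converging_solution ::
  "real \<Rightarrow> real \<Rightarrow> real \<Rightarrow> real \<Rightarrow> (real \<Rightarrow> real) \<Rightarrow> (real \<Rightarrow> real \<Rightarrow> real) \<Rightarrow> bool" where
  "converging_solution n \<alpha> M K\<^sub>0 v u \<longleftrightarrow>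
     strong_solution n \<alpha> u \<and> continuous_version u \<and> has_mass M u \<and>
     energy \<alpha> (u 0) < \<infinity> \<and> energy_inequality n \<alpha> u \<and> entropy_inequality n K\<^sub>0 u \<and>
     ((\<lambda>t. dist_H1 (u t) v) \<longlongrightarrow> 0) at_top"

definition vanishes_quadratically_at :: "(real \<Rightarrow> real) \<Rightarrow> real \<Rightarrow> bool" where
  "vanishes_quadratically_at v x\<^sub>0 \<longleftrightarrow> v x\<^sub>0 = 0 \<and> v \<in> \<Theta>[at x\<^sub>0](\<lambda>x. (x - x\<^sub>0)\<^sup>2)"

end

theory Submission
  imports Defs
begin

text \<open>
  On the circle, a mean-zero \<open>w\<close> satisfies \<open>sup \<bar>w\<bar> \<le> \<surd>\<pi> \<parallel>w\<^sub>x\<parallel>\<close>. If \<open>u\<close> is within \<open>\<epsilon>\<close> of \<open>u\<^sup>*\<close>,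
  then \<open>u\<close> is at most of order \<open>\<epsilon>\<close> on the zero set of \<open>u\<^sup>*\<close>, respectively on an interval of
  length \<open>\<surd>\<epsilon>\<close> at a quadratic zero, so the entropy of \<open>u\<close> is at least of order \<open>\<epsilon>\<close> to the power
  \<open>-\<beta>\<close>, respectively \<open>1/2 - \<beta>\<close>; the entropy inequality then bounds \<open>\<epsilon>\<close> from below.

  If \<open>u\<^sup>*\<close> is positive, then \<open>u\<close> is eventually bounded away from \<open>0\<close>, the energy of \<open>u\<close> relative to
  \<open>u\<^sup>*\<close> is the quadratic form \<open>Q = \<integral> (w\<^sub>x\<^sup>2 - \<alpha>\<^sup>2 w\<^sup>2) / 2\<close> of \<open>w = u - u\<^sup>*\<close>, and the dissipation is
  \<open>D = \<integral> u\<^sup>n p\<^sup>2\<close> with \<open>p = w\<^sub>x\<^sub>x\<^sub>x + \<alpha>\<^sup>2 w\<^sub>x\<close>. Wirtinger's inequality gives convexity of \<open>Q\<close> and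
  \<open>D \<ge> 2 (1 - \<alpha>\<^sup>2) (min u)\<^sup>n Q\<close>. The assumed energy inequality starts at time \<open>0\<close> only and does not
  yield decay by itself. The inequality between two positive times comes from the equation: by
  convexity, \<open>Q t - Q (t - h)\<close> is at most minus the integral of \<open>(u\<^sup>n p)(\<tau>) p(t)\<close> over
  \<open>\<tau> \<in> [t - h, t]\<close>, and averaging over \<open>t\<close> and letting \<open>h \<rightarrow> 0\<close> uses only continuity of translations
  in \<open>L\<^sup>2\<close> and weak lower semicontinuity of \<open>Q\<close>. As \<open>min u\<close> converges exponentially to \<open>min u\<^sup>*\<close>,
  a Gronwall argument attains the limiting rate exactly.
\<close>

subsection \<open>Smooth functions\<close>

text \<open>The energy is never differentiated in time: \<open>u\<close> is only known to have a
  flux, and the third derivative exists at almost every time only. The tangent inequality of the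
  convex form \<open>Q\<close> at the later time replaces the derivative; there the slope is
  regular, while the earlier state needs to lie in H1 only. The increment of \<open>u\<close> is
  minus the x-derivative of the time-integrated flux, which produces the pairing of the flux at
  \<tau> with the slope at t. The result speaks of averages in time: lower semicontinuity turns the
  later average into a value, and the supremum over later times absorbs the earlier one. Strict
  positivity of the steady state admits variations of both signs. The resulting Euler-Lagrange
  equation removes the steady state from the third-order expression and leaves a constant that
  increments of mean 0 do not see. The constant sqrt pi comes from joining two points of the circle
  by the shorter arc. \<open>Q\<close> is quadratic in the distance, hence decays at twice the
  asserted rate.\<close>

primrec differentiable_upto :: "nat \<Rightarrow> (real \<Rightarrow> real) \<Rightarrow> bool" where
  "differentiable_upto 0 f \<longleftrightarrow> True"
| "differentiable_upto (Suc k) f \<longleftrightarrow>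
     (\<forall>x. f differentiable (at x)) \<and> differentiable_upto k (deriv f)"

text \<open>The recursion removes the derivative that is applied first, so that product and chain
  rules can be iterated by induction on the order with the functions generalised;
  \<open>smooth\<close> speaks of iterated derivatives of one fixed function.\<close>

lemma differentiable_upto_iff:
  "differentiable_upto k f \<longleftrightarrow> (\<forall>j<k. \<forall>x. (deriv ^^ j) f differentiable (at x))"
  by (induction k arbitrary: f) (auto simp: All_less_Suc2 funpow_Suc_right simp del: funpow.simps(2))

lemma smooth_iff_differentiable_upto: "smooth f \<longleftrightarrow> (\<forall>k. differentiable_upto k f)"
  unfolding smooth_def differentiable_upto_iff by blast

lemma smooth_iff_deriv: "smooth f \<longleftrightarrow> (\<forall>x. f differentiable (at x)) \<and> smooth (deriv f)"
  unfolding smooth_iff_differentiable_upto by (metis differentiable_upto.simps not0_implies_Suc)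

lemma smooth_has_derivative: "smooth f \<Longrightarrow> (f has_real_derivative deriv f x) (at x)"
  using smooth_iff_deriv DERIV_deriv_iff_real_differentiable by blast

lemma smooth_deriv: "smooth f \<Longrightarrow> smooth (deriv f)"
  using smooth_iff_deriv by blast

lemma smooth_funpow_deriv: "smooth f \<Longrightarrow> smooth ((deriv ^^ k) f)"
  by (induction k) (auto simp: smooth_deriv)

lemma deriv_eqI: "(\<And>x. (f has_real_derivative f' x) (at x)) \<Longrightarrow> deriv f = f'"
  by (auto intro: DERIV_imp_deriv)

lemma smooth_antiderivative:
  assumes "\<And>x. (f has_real_derivative f' x) (at x)" "smooth f'"
  shows "smooth f"
  using assms deriv_eqI[OF assms(1)] smooth_iff_deriv real_differentiable_def by metis

lemma smooth_imp_continuous_on: "smooth f \<Longrightarrow> continuous_on A f"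
  by (meson DERIV_isCont continuous_at_imp_continuous_on smooth_has_derivative)

text \<open>Differentiation only moves the index from \<open>i\<close> to \<open>s i\<close>, so one
  derivative rule for the whole family yields all orders at once. Indices in use are polynomials for
  the flat functions and coefficient pairs for combinations of \<open>cos\<close> and
  \<open>sin\<close>.\<close>

lemma smooth_family:
  assumes "\<And>i x. (F i has_real_derivative F (s i) x) (at x)"
  shows "smooth (F i)"
proof -
  have "differentiable_upto k (F i)" for k
    using assms
  proof (induction k arbitrary: i)
    case (Suc k)
    have "deriv (F i) = F (s i)" by (rule deriv_eqI) (rule Suc.prems)
    with Suc show ?case by (metis differentiable_upto.simps(2) real_differentiable_def)
  qed simp
  then show ?thesis by (simp add: smooth_iff_differentiable_upto)
qed

lemma differentiable_upto_Suc: "differentiable_upto (Suc k) f \<Longrightarrow> differentiable_upto k f"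
  unfolding differentiable_upto_iff by simp

lemma differentiable_upto_add:
  "differentiable_upto k f \<Longrightarrow> differentiable_upto k g \<Longrightarrow> differentiable_upto k (\<lambda>x. f x + g x)"
proof (induction k arbitrary: f g)
  case (Suc k)
  have D: "(f has_real_derivative deriv f x) (at x)" "(g has_real_derivative deriv g x) (at x)" for x
    using Suc.prems by (simp_all add: DERIV_deriv_iff_real_differentiable)
  have "deriv (\<lambda>x. f x + g x) = (\<lambda>x. deriv f x + deriv g x)"
    by (rule deriv_eqI) (intro DERIV_add D)
  then show ?case using Suc by simp
qed simp

lemma differentiable_upto_mult:
  "differentiable_upto k f \<Longrightarrow> differentiable_upto k g \<Longrightarrow> differentiable_upto k (\<lambda>x. f x * g x)"
proof (induction k arbitrary: f g)
  case (Suc k)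
  have D: "(f has_real_derivative deriv f x) (at x)" "(g has_real_derivative deriv g x) (at x)" for x
    using Suc.prems by (simp_all add: DERIV_deriv_iff_real_differentiable)
  have "deriv (\<lambda>x. f x * g x) = (\<lambda>x. deriv f x * g x + f x * deriv g x)"
    by (rule deriv_eqI) (auto intro!: derivative_eq_intros D)
  moreover have "differentiable_upto k (\<lambda>x. deriv f x * g x + f x * deriv g x)"
    using Suc.prems Suc.prems[THEN differentiable_upto_Suc]
    by (intro differentiable_upto_add Suc.IH) simp_all
  ultimately show ?case using Suc by simp
qed simp

lemma differentiable_upto_compose:
  "differentiable_upto k f \<Longrightarrow> differentiable_upto k g \<Longrightarrow> differentiable_upto k (\<lambda>x. f (g x))"
proof (induction k arbitrary: f)
  case (Suc k)
  have D: "(f has_real_derivative deriv f x) (at x)" "(g has_real_derivative deriv g x) (at x)" for x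
    using Suc.prems by (simp_all add: DERIV_deriv_iff_real_differentiable)
  have D': "((\<lambda>x. f (g x)) has_real_derivative deriv f (g x) * deriv g x) (at x)" for x
    by (rule DERIV_chain2[OF D])
  have "deriv (\<lambda>x. f (g x)) = (\<lambda>x. deriv f (g x) * deriv g x)"
    using D' by (intro ext DERIV_imp_deriv)
  moreover have "differentiable_upto k (\<lambda>x. deriv f (g x) * deriv g x)"
    using Suc.prems Suc.prems(2)[THEN differentiable_upto_Suc]
    by (intro differentiable_upto_mult Suc.IH[of "deriv f"]) simp_all
  ultimately show ?case using D' by (auto simp: real_differentiable_def)
qed simp

lemma smooth_add: "smooth f \<Longrightarrow> smooth g \<Longrightarrow> smooth (\<lambda>x. f x + g x)"
  and smooth_mult: "smooth f \<Longrightarrow> smooth g \<Longrightarrow> smooth (\<lambda>x. f x * g x)"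
  and smooth_compose: "smooth f \<Longrightarrow> smooth g \<Longrightarrow> smooth (\<lambda>x. f (g x))"
  unfolding smooth_iff_differentiable_upto
  using differentiable_upto_add differentiable_upto_mult differentiable_upto_compose by blast+

lemma smooth_const: "smooth (\<lambda>x. c)"
  using smooth_family[of "\<lambda>i x. i" "\<lambda>_. 0" c] by auto

lemma smooth_affine: "smooth (\<lambda>x. a * x + b)"
  by (rule smooth_antiderivative[where f' = "\<lambda>_. a"]) (auto intro!: derivative_eq_intros smooth_const)

lemma smooth_diff: "smooth f \<Longrightarrow> smooth g \<Longrightarrow> smooth (\<lambda>x. f x - g x)"
  using smooth_add[of f "\<lambda>x. (-1) * g x"] smooth_mult[OF smooth_const, of g "-1"] by simp

lemma smooth_cos: "smooth cos"
proof -
  have "smooth (\<lambda>x. fst i * cos x + snd i * sin x)" for i :: "real \<times> real"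
    by (rule smooth_family[where F = "\<lambda>i x. fst i * cos x + snd i * sin x"
          and s = "\<lambda>i. (snd i, - fst i)"])
       (auto intro!: derivative_eq_intros)
  from this[of "(1, 0)"] show ?thesis by simp
qed

section \<open>Flat functions built from exp (-1/y)\<close>

definition exp_recip :: "real poly \<Rightarrow> real \<Rightarrow> real" where
  "exp_recip P y = (if 0 < y then poly P (1/y) * exp (- (1/y)) else 0)"

lemma poly_times_exp_minus_tendsto_0: "((\<lambda>x::real. poly P x * exp (- x)) \<longlongrightarrow> 0) at_top"
proof -
  have "((\<lambda>x::real. \<Sum>i\<le>degree P. coeff P i * (x ^ i / exp x)) \<longlongrightarrow> (\<Sum>i\<le>degree P. coeff P i * 0)) at_top"
    by (intro tendsto_intros tendsto_power_div_exp_0)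
  then show ?thesis
    by (simp add: poly_altdef sum_distrib_right exp_minus divide_inverse mult.assoc)
qed

text \<open>For y > 0 the chain rule gives (1/y^2) (P - P')(1/y) exp (-1/y), which is the member of
  the family with index \<open>[:0,0,1:] * (P - pderiv P)\<close>. At 0 the right difference
  quotient is x P(x) exp (-x) at x = 1/h and tends to 0.\<close>

lemma exp_recip_has_derivative:
  "(exp_recip P has_real_derivative exp_recip ([:0,0,1:] * (P - pderiv P)) y) (at y)"
proof (cases y "0::real" rule: linorder_cases)
  case greater
  have inv: "((\<lambda>y. 1/y) has_real_derivative - (1/y * (1/y))) (at y)"
    using greater by (auto intro!: derivative_eq_intros simp: field_simps)
  have "((\<lambda>y. poly P (1/y) * exp (- (1/y))) has_real_derivative
      poly (pderiv P) (1/y) * - (1/y * (1/y)) * exp (- (1/y))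
      + exp (- (1/y)) * - (- (1/y * (1/y))) * poly P (1/y)) (at y)"
    by (intro DERIV_mult DERIV_chain2[OF poly_DERIV inv] DERIV_chain2[OF DERIV_exp] DERIV_minus inv)
  then have "((\<lambda>y. poly P (1/y) * exp (- (1/y))) has_real_derivative
      exp_recip ([:0,0,1:] * (P - pderiv P)) y) (at y)"
    using greater by (simp add: exp_recip_def algebra_simps)
  moreover have "eventually (\<lambda>z. z \<in> {0<..}) (nhds y)"
    using greater by (intro eventually_nhds_in_open) auto
  then have "eventually (\<lambda>z. exp_recip P z = poly P (1/z) * exp (- (1/z))) (nhds y)"
    by eventually_elim (simp add: exp_recip_def)
  ultimately show ?thesis using DERIV_cong_ev by fast
next
  case less
  have "eventually (\<lambda>z. z \<in> {..<0}) (nhds y)"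
    using less by (intro eventually_nhds_in_open) auto
  then have "eventually (\<lambda>z. exp_recip P z = 0) (nhds y)"
    by eventually_elim (simp add: exp_recip_def)
  moreover have "((\<lambda>_. 0::real) has_real_derivative exp_recip ([:0,0,1:] * (P - pderiv P)) y) (at y)"
    using less by (simp add: exp_recip_def)
  ultimately show ?thesis using DERIV_cong_ev by fast
next
  case equal
  have R: "((\<lambda>h. exp_recip P h / h) \<longlongrightarrow> 0) (at_right 0)"
  proof -
    have "((\<lambda>x. poly ([:0,1:] * P) x * exp (- x)) \<longlongrightarrow> 0) at_top"
      by (rule poly_times_exp_minus_tendsto_0)
    then have "((\<lambda>h. poly ([:0,1:] * P) (inverse h) * exp (- (inverse h))) \<longlongrightarrow> 0) (at_right 0)"
      by (rule filterlim_compose[OF _ filterlim_inverse_at_top_right])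
    then show ?thesis
      by (rule Lim_transform_eventually)
         (auto simp: eventually_at_right_field exp_recip_def field_simps intro!: exI[of _ 1])
  qed
  have L: "((\<lambda>h. exp_recip P h / h) \<longlongrightarrow> 0) (at_left 0)"
    by (rule tendsto_eventually)
       (auto simp: eventually_at_left_field exp_recip_def intro!: exI[of _ "-1"])
  have "((\<lambda>h. exp_recip P h / h) \<longlongrightarrow> 0) (at 0)"
    using R L by (simp add: filterlim_at_split)
  then show ?thesis
    using equal by (simp add: DERIV_def exp_recip_def)
qed

lemma smooth_exp_recip: "smooth (exp_recip P)"
  using smooth_family[of exp_recip, OF exp_recip_has_derivative] .

lemma exp_recip_1: "exp_recip 1 y = (if 0 < y then exp (- (1/y)) else 0)"
  by (simp add: exp_recip_def)

lemma exp_recip_1_range: "0 \<le> exp_recip 1 y" "exp_recip 1 y \<le> 1"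
  by (auto simp: exp_recip_1)

text \<open>Dilation turns the flat function into the indicator of the positive half-line while its
  values stay in [0, 1]. Smooth cutoffs of intervals and arcs arise by composing with affine or
  trigonometric functions, and dominated convergence then replaces mollification.\<close>

lemma exp_recip_1_tendsto:
  "(\<lambda>k. exp_recip 1 (real (Suc k) * y)) \<longlonglongrightarrow> (if 0 < y then 1 else 0)"
proof (cases "0 < y")
  case True
  have "(\<lambda>k. 1 / y * inverse (real (Suc k))) \<longlonglongrightarrow> 1 / y * 0"
    by (intro tendsto_mult tendsto_const LIMSEQ_inverse_real_of_nat)
  then have "(\<lambda>k. exp (- (1 / y * inverse (real (Suc k))))) \<longlonglongrightarrow> exp (- (1/y * 0))"
    by (rule tendsto_exp[OF tendsto_minus])
  then have "(\<lambda>k. exp (- (1 / (real (Suc k) * y)))) \<longlonglongrightarrow> 1"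
    by (simp add: divide_inverse mult.commute del: of_nat_Suc)
  then show ?thesis using True by (simp add: exp_recip_1)
next
  case False
  then have "real (Suc k) * y \<le> 0" for k by (simp add: mult_nonneg_nonpos del: of_nat_Suc)
  then have "exp_recip 1 (real (Suc k) * y) = 0" for k by (meson exp_recip_1 not_less)
  then show ?thesis using False by simp
qed

subsection \<open>Absolutely continuous functions\<close>

lemma set_integrable_imp_continuous_primitive:
  fixes f :: "real \<Rightarrow> real"
  assumes "set_integrable lborel {a..b} f"
  shows "continuous_on {a..b} (\<lambda>x. LINT y:{a..x}|lborel. f y)"
proof -
  have "continuous_on {a..b} (\<lambda>x. integral {a..x} f)"
    using set_borel_integral_eq_integral(1)[OF assms] by (rule indefinite_integral_continuous_1)
  moreover have "integral {a..x} f = (LINT y:{a..x}|lborel. f y)" if "x \<in> {a..b}" for x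
    using that by (intro set_borel_integral_eq_integral(2)[symmetric] set_integrable_subset[OF assms]) auto
  ultimately show ?thesis by (metis (no_types, lifting) continuous_on_cong)
qed

text \<open>Absolute continuity of \<open>F\<close> with derivative \<open>f\<close>, stated through
  the integral so that differentiability almost everywhere is not involved. For b < a the property
  is trivially true, which allows quantification over all \<open>a\<close> and
  \<open>b\<close>.\<close>

definition primitive_on :: "real \<Rightarrow> real \<Rightarrow> (real \<Rightarrow> real) \<Rightarrow> (real \<Rightarrow> real) \<Rightarrow> bool" where
  "primitive_on a b f F \<longleftrightarrow> set_integrable lborel {a..b} f \<and>
     (\<forall>x\<in>{a..b}. F x = F a + (LINT y:{a..x}|lborel. f y))"

lemma primitive_on_integrable: "primitive_on a b f F \<Longrightarrow> set_integrable lborel {a..b} f"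
  by (simp add: primitive_on_def)

lemma primitive_on_eq:
  "primitive_on a b f F \<Longrightarrow> a \<le> x \<Longrightarrow> x \<le> b \<Longrightarrow> F x = F a + (LINT y:{a..x}|lborel. f y)"
  unfolding primitive_on_def by (metis atLeastAtMost_iff)

lemma set_integral_Icc_split:
  fixes f :: "real \<Rightarrow> real"
  assumes "a \<le> c" "c \<le> b" "set_integrable lborel {a..b} f"
  shows "(LINT y:{a..b}|lborel. f y) = (LINT y:{a..c}|lborel. f y) + (LINT y:{c..b}|lborel. f y)"
proof -
  have "(LINT y:{a..c} \<union> {c..b}|lborel. f y) = (LINT y:{a..c}|lborel. f y) + (LINT y:{c..b}|lborel. f y)"
  proof (rule set_integral_Un_AE)
    have "AE y in lborel. y \<noteq> c"
      by (rule AE_lborel_singleton)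
    then show "AE y in lborel. \<not> (y \<in> {a..c} \<and> y \<in> {c..b})" by eventually_elim auto
  qed (use assms in \<open>auto intro: set_integrable_subset[OF assms(3)]\<close>)
  moreover have "{a..c} \<union> {c..b} = {a..b}" using assms by auto
  ultimately show ?thesis by simp
qed

lemma primitive_on_diff_eq:
  assumes "primitive_on a b f F" "a \<le> x" "x \<le> y" "y \<le> b"
  shows "F y - F x = (LINT z:{x..y}|lborel. f z)"
proof -
  have "(LINT z:{a..y}|lborel. f z) = (LINT z:{a..x}|lborel. f z) + (LINT z:{x..y}|lborel. f z)"
    by (rule set_integral_Icc_split[OF _ _ set_integrable_subset[OF primitive_on_integrable[OF assms(1)]]])
       (use assms in auto)
  moreover have "F y = F a + (LINT z:{a..y}|lborel. f z)" "F x = F a + (LINT z:{a..x}|lborel. f z)"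
    using assms by (auto intro: primitive_on_eq[OF assms(1)])
  ultimately show ?thesis by linarith
qed

lemma primitive_on_subinterval:
  assumes "primitive_on a b f F" "a \<le> c" "d \<le> b"
  shows "primitive_on c d f F"
  unfolding primitive_on_def
proof (intro conjI ballI)
  show "set_integrable lborel {c..d} f"
    by (rule set_integrable_subset[OF primitive_on_integrable[OF assms(1)]]) (use assms in auto)
  fix x assume "x \<in> {c..d}"
  then show "F x = F c + (LINT y:{c..x}|lborel. f y)"
    using primitive_on_diff_eq[OF assms(1), of c x] assms by auto
qed

lemma primitive_on_continuous: 
  assumes "primitive_on a b f F" shows "continuous_on {a..b} F"
proof -
  have "continuous_on {a..b} (\<lambda>x. F a + (LINT y:{a..x}|lborel. f y))"
    by (intro continuous_intros set_integrable_imp_continuous_primitive primitive_on_integrable[OF assms])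
  then show ?thesis
    by (rule continuous_on_eq) (simp add: primitive_on_eq[OF assms, symmetric])
qed

lemma primitive_on_add:
  assumes "primitive_on a b f F" "primitive_on a b g G"
  shows "primitive_on a b (\<lambda>x. f x + g x) (\<lambda>x. F x + G x)"
  unfolding primitive_on_def
proof (intro conjI ballI)
  fix x assume "x \<in> {a..b}"
  then have *: "primitive_on a x f F" "primitive_on a x g G"
    using assms primitive_on_subinterval by auto
  have "(LINT y:{a..x}|lborel. f y + g y) = (LINT y:{a..x}|lborel. f y) + (LINT y:{a..x}|lborel. g y)"
    by (rule set_integral_add) (use * primitive_on_integrable in blast)+
  then show "F x + G x = F a + G a + (LINT y:{a..x}|lborel. f y + g y)"
    using \<open>x \<in> {a..b}\<close> primitive_on_eq[OF assms(1), of x] primitive_on_eq[OF assms(2), of x] by simp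
qed (use assms[THEN primitive_on_integrable] in simp)

lemma primitive_on_cmult:
  assumes "primitive_on a b f F"
  shows "primitive_on a b (\<lambda>x. c * f x) (\<lambda>x. c * F x)"
  unfolding primitive_on_def
proof (intro conjI ballI)
  fix x assume "x \<in> {a..b}"
  then have "F x = F a + (LINT y:{a..x}|lborel. f y)" by (intro primitive_on_eq[OF assms]) auto
  then show "c * F x = c * F a + (LINT y:{a..x}|lborel. c * f y)" by (simp add: distrib_left)
qed (use primitive_on_integrable[OF assms] in simp)

lemma primitive_on_diff:
  assumes "primitive_on a b f F" "primitive_on a b g G"
  shows "primitive_on a b (\<lambda>x. f x - g x) (\<lambda>x. F x - G x)"
  using primitive_on_add[OF assms(1) primitive_on_cmult[OF assms(2), of "-1"]] by simp

lemma primitive_on_const: "primitive_on a b (\<lambda>x. 0) (\<lambda>x. c)"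
  unfolding primitive_on_def set_integrable_def by simp

lemma primitive_on_C1:
  assumes "\<And>x. x \<in> {a..b} \<Longrightarrow> (F has_real_derivative f x) (at x within {a..b})"
    and "continuous_on {a..b} f"
  shows "primitive_on a b f F"
  unfolding primitive_on_def
proof (intro conjI ballI)
  show "set_integrable lborel {a..b} f" by (rule borel_integrable_atLeastAtMost'[OF assms(2)])
  fix x assume x: "x \<in> {a..b}"
  have "(LINT y:{a..x}|lborel. f y) = F x - F a"
    unfolding set_lebesgue_integral_def
    by (rule integral_FTC_atLeastAtMost)
       (use x in \<open>auto simp flip: has_real_derivative_iff_has_vector_derivative
          intro!: DERIV_subset[OF assms(1)] continuous_on_subset[OF assms(2)]\<close>)
  then show "F x = F a + (LINT y:{a..x}|lborel. f y)" by simp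
qed

lemma set_integrable_mult_continuous:
  fixes f g :: "real \<Rightarrow> real"
  assumes "set_integrable lborel {a..b} f" "continuous_on {a..b} g"
  shows "set_integrable lborel {a..b} (\<lambda>x. f x * g x)"
proof -
  have "bounded (g ` {a..b})"
    by (intro compact_imp_bounded compact_continuous_image assms) simp
  then obtain B where B: "\<And>x. x \<in> {a..b} \<Longrightarrow> \<bar>g x\<bar> \<le> B"
    unfolding bounded_iff by (metis atLeastAtMost_iff imageI real_norm_def)
  show ?thesis unfolding set_integrable_def
  proof (rule Bochner_Integration.integrable_bound)
    show "integrable lborel (\<lambda>x. B * (indicator {a..b} x *\<^sub>R f x))"
      using assms(1) by (simp add: set_integrable_def)
    have "(\<lambda>x. (indicator {a..b} x *\<^sub>R f x) * (indicator {a..b} x *\<^sub>R g x)) \<in> borel_measurable lborel"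
      using borel_measurable_integrable[OF assms(1)[unfolded set_integrable_def]]
        borel_measurable_continuous_on_indicator[OF _ assms(2)] by simp
    then show "(\<lambda>x. indicator {a..b} x *\<^sub>R (f x * g x)) \<in> borel_measurable lborel"
      by (rule measurable_cong[THEN iffD1, rotated]) (auto simp: indicator_def)
    show "AE x in lborel. norm (indicator {a..b} x *\<^sub>R (f x * g x))
        \<le> norm (B * (indicator {a..b} x *\<^sub>R f x))"
    proof (intro AE_I2)
      fix x
      have "\<bar>f x\<bar> * \<bar>g x\<bar> \<le> \<bar>f x\<bar> * \<bar>B\<bar>" if "x \<in> {a..b}"
        using B[OF that] by (intro mult_left_mono) auto
      then show "norm (indicator {a..b} x *\<^sub>R (f x * g x)) \<le> norm (B * (indicator {a..b} x *\<^sub>R f x))"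
        by (auto simp: indicator_def abs_mult mult.commute)
    qed
  qed
qed

text \<open>Fubini on the square: f(x) g(y) integrates to the product of the two increments, and the
  diagonal splits the square into a part where the inner integral yields G(x) - G(a) and a part
  where it yields F(y) - F(a).\<close>

lemma primitive_on_integral_mult:
  assumes F: "primitive_on a b f F" and G: "primitive_on a b g G" and ab: "a \<le> b"
  shows "(LINT x:{a..b}|lborel. f x * G x + F x * g x) = F b * G b - F a * G a"
proof -
  define f' where "f' = (\<lambda>x. indicator {a..b} x * f x)"
  define g' where "g' = (\<lambda>x. indicator {a..b} x * g x)"
  have fi: "integrable lborel f'" and gi: "integrable lborel g'"
    using F[THEN primitive_on_integrable] G[THEN primitive_on_integrable]
    by (simp_all add: f'_def g'_def set_integrable_def)
  have [measurable]: "f' \<in> borel_measurable borel" "g' \<in> borel_measurable borel"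
    using fi gi by auto
  have prod: "integrable (lborel \<Otimes>\<^sub>M lborel) (\<lambda>(x, y). f' x * g' y)"
    by (rule lborel_pair.Fubini_integrable) (use fi gi in \<open>auto simp: abs_mult\<close>)
  define A where "A = (\<lambda>(x::real, y::real). f' x * g' y * (if y \<le> x then 1 else 0))"
  define B where "B = (\<lambda>(x::real, y::real). f' x * g' y * (if x < y then 1 else 0))"
  have Ai: "integrable (lborel \<Otimes>\<^sub>M lborel) A"
    by (rule Bochner_Integration.integrable_bound[OF prod]) (auto simp: A_def abs_mult)
  have Bi: "integrable (lborel \<Otimes>\<^sub>M lborel) B"
    by (rule Bochner_Integration.integrable_bound[OF prod]) (auto simp: B_def abs_mult)
  have IG: "(\<integral>y. g' y * (if y \<le> x then 1 else 0) \<partial>lborel) = G x - G a" if "x \<in> {a..b}" for x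
  proof -
    have "(\<integral>y. g' y * (if y \<le> x then 1 else 0) \<partial>lborel) = (LINT y:{a..x}|lborel. g y)"
      unfolding set_lebesgue_integral_def
      by (intro Bochner_Integration.integral_cong) (use that in \<open>auto simp: g'_def indicator_def\<close>)
    then show ?thesis using primitive_on_diff_eq[OF G, of a x] that by simp
  qed
  have IF: "(\<integral>x. f' x * (if x < y then 1 else 0) \<partial>lborel) = F y - F a" if "y \<in> {a..b}" for y
  proof -
    have "(\<integral>x. f' x * (if x < y then 1 else 0) \<partial>lborel) = (LINT x:{a..y}|lborel. f x)"
      unfolding set_lebesgue_integral_def
    proof (rule integral_cong_AE)
      \<comment> \<open>The condition \<open>x < y\<close> misses the endpoint \<open>y\<close> of
        the interval, which is a null set.\<close>
      show "AE x in lborel. f' x * (if x < y then 1 else 0) = indicat_real {a..y} x *\<^sub>R f x"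
        using AE_lborel_singleton[of y] by eventually_elim (use that in \<open>auto simp: f'_def indicator_def\<close>)
      have "(\<lambda>x. f' x * indicator {a..y} x) \<in> borel_measurable lborel" by measurable
      then show "(\<lambda>x. indicat_real {a..y} x *\<^sub>R f x) \<in> borel_measurable lborel"
        by (rule measurable_cong[THEN iffD1, rotated]) (use that in \<open>auto simp: f'_def indicator_def\<close>)
    qed measurable
    then show ?thesis using primitive_on_diff_eq[OF F, of a y] that by simp
  qed
  have "(\<integral>p. A p \<partial>(lborel \<Otimes>\<^sub>M lborel)) = (\<integral>x. (\<integral>y. A (x, y) \<partial>lborel) \<partial>lborel)"
    by (rule lborel_pair.integral_fst'[symmetric, OF Ai])
  also have "\<dots> = (\<integral>x. f' x * (G x - G a) \<partial>lborel)"
  proof (intro Bochner_Integration.integral_cong refl)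
    fix x show "(\<integral>y. A (x, y) \<partial>lborel) = f' x * (G x - G a)"
      using IG[of x] by (cases "x \<in> {a..b}") (simp_all add: A_def mult.assoc f'_def)
  qed
  finally have A: "(\<integral>p. A p \<partial>(lborel \<Otimes>\<^sub>M lborel)) = (\<integral>x. f' x * (G x - G a) \<partial>lborel)" .
  have "(\<integral>p. B p \<partial>(lborel \<Otimes>\<^sub>M lborel)) = (\<integral>y. (\<integral>x. B (x, y) \<partial>lborel) \<partial>lborel)"
    using lborel_pair.integral_snd[of "\<lambda>x y. B (x, y)"] Bi by simp
  also have "\<dots> = (\<integral>y. (F y - F a) * g' y \<partial>lborel)"
  proof (intro Bochner_Integration.integral_cong refl)
    fix y 
    have "(\<integral>x. B (x, y) \<partial>lborel) = (\<integral>x. g' y * (f' x * (if x < y then 1 else 0)) \<partial>lborel)"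
      by (simp add: B_def mult.assoc mult.left_commute)
    then show "(\<integral>x. B (x, y) \<partial>lborel) = (F y - F a) * g' y"
      using IF[of y] by (cases "y \<in> {a..b}") (simp_all add: g'_def)
  qed
  finally have B: "(\<integral>p. B p \<partial>(lborel \<Otimes>\<^sub>M lborel)) = (\<integral>y. (F y - F a) * g' y \<partial>lborel)" .
  have "(\<integral>p. A p \<partial>(lborel \<Otimes>\<^sub>M lborel)) + (\<integral>p. B p \<partial>(lborel \<Otimes>\<^sub>M lborel))
      = (\<integral>p. A p + B p \<partial>(lborel \<Otimes>\<^sub>M lborel))"
    using Ai Bi by simp
  also have "\<dots> = (\<integral>(x, y). f' x * g' y \<partial>(lborel \<Otimes>\<^sub>M lborel))"
    by (intro Bochner_Integration.integral_cong) (auto simp: A_def B_def)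
  also have "\<dots> = (\<integral>x. (\<integral>y. f' x * g' y \<partial>lborel) \<partial>lborel)"
    using lborel_pair.integral_fst'[symmetric, OF prod] by simp
  also have "\<dots> = (\<integral>x. f' x \<partial>lborel) * (\<integral>y. g' y \<partial>lborel)" by simp
  also have "(\<integral>x. f' x \<partial>lborel) = F b - F a"
    using primitive_on_diff_eq[OF F, of a b] ab by (simp add: f'_def set_lebesgue_integral_def)
  also have "(\<integral>x. g' x \<partial>lborel) = G b - G a"
    using primitive_on_diff_eq[OF G, of a b] ab by (simp add: g'_def set_lebesgue_integral_def)
  finally have S: "(\<integral>x. f' x * (G x - G a) \<partial>lborel) + (\<integral>y. (F y - F a) * g' y \<partial>lborel)
      = (F b - F a) * (G b - G a)" using A B by simp
  have i1: "set_integrable lborel {a..b} (\<lambda>x. f x * G x)"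
    by (intro set_integrable_mult_continuous primitive_on_integrable[OF F] primitive_on_continuous[OF G])
  have i2: "set_integrable lborel {a..b} (\<lambda>x. F x * g x)"
    using set_integrable_mult_continuous[OF primitive_on_integrable[OF G] primitive_on_continuous[OF F]]
    by (simp add: mult.commute)
  have "(\<integral>x. f' x * (G x - G a) \<partial>lborel) = (LINT x:{a..b}|lborel. f x * G x - G a * f x)"
    unfolding set_lebesgue_integral_def f'_def
    by (intro Bochner_Integration.integral_cong) (auto simp: algebra_simps)
  also have "\<dots> = (LINT x:{a..b}|lborel. f x * G x) - G a * (F b - F a)"
    using i1 primitive_on_integrable[OF F] primitive_on_diff_eq[OF F, of a b] ab
    by (subst set_integral_diff) auto
  finally have 1: "(\<integral>x. f' x * (G x - G a) \<partial>lborel)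
      = (LINT x:{a..b}|lborel. f x * G x) - G a * (F b - F a)" .
  have "(\<integral>x. (F x - F a) * g' x \<partial>lborel) = (LINT x:{a..b}|lborel. F x * g x - F a * g x)"
    unfolding set_lebesgue_integral_def g'_def
    by (intro Bochner_Integration.integral_cong) (auto simp: algebra_simps)
  also have "\<dots> = (LINT x:{a..b}|lborel. F x * g x) - F a * (G b - G a)"
    using i2 primitive_on_integrable[OF G] primitive_on_diff_eq[OF G, of a b] ab
    by (subst set_integral_diff) auto
  finally have 2: "(\<integral>x. (F x - F a) * g' x \<partial>lborel)
      = (LINT x:{a..b}|lborel. F x * g x) - F a * (G b - G a)" .
  have "(LINT x:{a..b}|lborel. f x * G x + F x * g x)
     = (LINT x:{a..b}|lborel. f x * G x) + (LINT x:{a..b}|lborel. F x * g x)"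
    by (rule set_integral_add) (use i1 i2 in auto)
  with S 1 2 show ?thesis by (simp add: algebra_simps)
qed

lemma primitive_on_mult:
  assumes "primitive_on a b f F" "primitive_on a b g G"
  shows "primitive_on a b (\<lambda>x. f x * G x + F x * g x) (\<lambda>x. F x * G x)"
  unfolding primitive_on_def
proof (intro conjI ballI)
  have "set_integrable lborel {a..b} (\<lambda>x. f x * G x)"
    by (intro set_integrable_mult_continuous primitive_on_integrable[OF assms(1)]
        primitive_on_continuous[OF assms(2)])
  moreover have "set_integrable lborel {a..b} (\<lambda>x. F x * g x)"
    using set_integrable_mult_continuous[OF primitive_on_integrable[OF assms(2)]
        primitive_on_continuous[OF assms(1)]]
    by (simp add: mult.commute)
  ultimately show "set_integrable lborel {a..b} (\<lambda>x. f x * G x + F x * g x)" by simp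
  fix x assume x: "x \<in> {a..b}"
  have "primitive_on a x f F" "primitive_on a x g G"
    using assms x by (auto intro: primitive_on_subinterval)
  from primitive_on_integral_mult[OF this] x
  show "F x * G x = F a * G a + (LINT y:{a..x}|lborel. f y * G y + F y * g y)" by simp
qed

lemma set_integrable_square_continuous:
  fixes F :: "real \<Rightarrow> real"
  shows "continuous_on {a..b} F \<Longrightarrow> set_integrable lborel {a..b} (\<lambda>x. (F x)\<^sup>2)"
  by (intro borel_integrable_atLeastAtMost' continuous_intros)

subsection \<open>Square-integrable functions\<close>

lemma square_integrable_mult:
  fixes f g :: "'a \<Rightarrow> real"
  assumes [measurable]: "f \<in> borel_measurable M" "g \<in> borel_measurable M"
    and f: "integrable M (\<lambda>x. (f x)\<^sup>2)" and g: "integrable M (\<lambda>x. (g x)\<^sup>2)"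
  shows "integrable M (\<lambda>x. f x * g x)"
    and "\<bar>\<integral>x. f x * g x \<partial>M\<bar> \<le> sqrt (\<integral>x. (f x)\<^sup>2 \<partial>M) * sqrt (\<integral>x. (g x)\<^sup>2 \<partial>M)"
proof -
  show i: "integrable M (\<lambda>x. f x * g x)"
  proof (rule Bochner_Integration.integrable_bound)
    show "integrable M (\<lambda>x. (f x)\<^sup>2 + (g x)\<^sup>2)" using f g by simp
    have "\<bar>f x * g x\<bar> \<le> (f x)\<^sup>2 + (g x)\<^sup>2" for x
    proof -
      have "2 * \<bar>f x\<bar> * \<bar>g x\<bar> \<le> (f x)\<^sup>2 + (g x)\<^sup>2"
        using sum_squares_bound[of "\<bar>f x\<bar>" "\<bar>g x\<bar>"] by simp
      moreover have "0 \<le> \<bar>f x\<bar> * \<bar>g x\<bar>" by simp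
      ultimately show ?thesis unfolding abs_mult by linarith
    qed
    then show "AE x in M. norm (f x * g x) \<le> norm ((f x)\<^sup>2 + (g x)\<^sup>2)" by simp
  qed simp
  define F G I where "F = (\<integral>x. (f x)\<^sup>2 \<partial>M)" and "G = (\<integral>x. (g x)\<^sup>2 \<partial>M)" and "I = (\<integral>x. f x * g x \<partial>M)"
  have FG: "F \<ge> 0" "G \<ge> 0" by (simp_all add: F_def G_def)
  have q: "0 \<le> F * a\<^sup>2 + 2 * a * b * I + G * b\<^sup>2" for a b
  proof -
    have "0 \<le> (\<integral>x. (a * f x + b * g x)\<^sup>2 \<partial>M)" by simp
    also have "\<dots> = (\<integral>x. a\<^sup>2 * (f x)\<^sup>2 + 2 * a * b * (f x * g x) + b\<^sup>2 * (g x)\<^sup>2 \<partial>M)"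
      by (intro Bochner_Integration.integral_cong) (auto simp: power2_eq_square algebra_simps)
    also have "\<dots> = a\<^sup>2 * F + 2 * a * b * I + b\<^sup>2 * G"
      using f g i by (simp add: F_def G_def I_def)
    finally show ?thesis by (simp add: mult.commute)
  qed
  have "I\<^sup>2 \<le> F * G"
  proof (cases "F = 0")
    case True
    have "I = 0"
    proof (rule ccontr)
      assume "I \<noteq> 0"
      \<comment> \<open>For F = 0 the form is affine in \<open>a\<close>, and this choice makes it
        equal to -1.\<close>
      then show False using q[of "- (G + 1) / (2 * I)" 1] True by (simp add: field_simps)
    qed
    then show ?thesis using FG by simp
  next
    case False
    then have "F > 0" using FG by simp
    \<comment> \<open>At (a, b) = (-I, F) the form equals F (F G - I^2).\<close>
    have "0 \<le> F * (F * G - I\<^sup>2)" using q[of "-I" F] by (simp add: power2_eq_square algebra_simps)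
    then show ?thesis using \<open>F > 0\<close> by (simp add: zero_le_mult_iff)
  qed
  then have "\<bar>I\<bar> \<le> sqrt (F * G)"
    using real_le_rsqrt by fastforce
  then show "\<bar>I\<bar> \<le> sqrt F * sqrt G" by (simp add: real_sqrt_mult)
qed

lemma set_square_integrable_mult:
  fixes f g :: "'a \<Rightarrow> real"
  assumes "set_borel_measurable M A f" "set_borel_measurable M A g"
    and "set_integrable M A (\<lambda>x. (f x)\<^sup>2)" "set_integrable M A (\<lambda>x. (g x)\<^sup>2)"
  shows "set_integrable M A (\<lambda>x. f x * g x)"
    and "\<bar>LINT x:A|M. f x * g x\<bar> \<le> sqrt (LINT x:A|M. (f x)\<^sup>2) * sqrt (LINT x:A|M. (g x)\<^sup>2)"
proof -
  let ?f = "\<lambda>x. indicator A x *\<^sub>R f x" and ?g = "\<lambda>x. indicator A x *\<^sub>R g x"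
  have [simp]: "(indicat_real A x * y)\<^sup>2 = indicat_real A x * y\<^sup>2" for x y by (simp add: indicator_def)
  have [simp]: "indicat_real A x * y * (indicat_real A x * z) = indicat_real A x * (y * z)" for x y z
    by (simp add: indicator_def)
  note * = square_integrable_mult[of ?f M ?g]
  show "set_integrable M A (\<lambda>x. f x * g x)"
    and "\<bar>LINT x:A|M. f x * g x\<bar> \<le> sqrt (LINT x:A|M. (f x)\<^sup>2) * sqrt (LINT x:A|M. (g x)\<^sup>2)"
    using * assms by (simp_all add: set_borel_measurable_def set_integrable_def set_lebesgue_integral_def)
qed

subsection \<open>The lemma of du Bois-Reymond\<close>

text \<open>Compact intervals generate the Borel sets, so all set integrals of the extension by zero
  vanish. The extension makes every interval admissible, since it may be intersected with [a, b]
  first.\<close>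

lemma AE_eq_0_if_interval_integrals_eq_0:
  fixes f :: "real \<Rightarrow> real"
  assumes int: "set_integrable lborel {a..b} f"
    and zero: "\<And>c d. a \<le> c \<Longrightarrow> c \<le> d \<Longrightarrow> d \<le> b \<Longrightarrow> (LINT x:{c..d}|lborel. f x) = 0"
  shows "AE x in lborel. x \<in> {a..b} \<longrightarrow> f x = 0"
proof -
  define g where "g = (\<lambda>x. indicator {a..b} x *\<^sub>R f x)"
  have g: "integrable lborel g" using int by (simp add: g_def set_integrable_def)
  have sg: "set_integrable lborel A g" if "A \<in> sets borel" for A
    unfolding set_integrable_def using that g by (intro integrable_mult_indicator) auto
  have icc: "(LINT x:{c..d}|lborel. g x) = 0" for c d
  proof -
    have "(LINT x:{c..d}|lborel. g x) = (LINT x:{max a c..min b d}|lborel. f x)"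
      unfolding set_lebesgue_integral_def g_def
      by (intro Bochner_Integration.integral_cong) (auto simp: indicator_def)
    also have "\<dots> = 0"
    proof (cases "max a c \<le> min b d")
      case False
      then have "{max a c..min b d} = {}" by auto
      then show ?thesis by (simp only: set_lebesgue_integral_def) simp
    qed (intro zero; simp)
    finally show ?thesis .
  qed
  have UN: "(\<integral>x. g x \<partial>lborel) = 0"
  proof -
    have "(\<integral>x. g x \<partial>lborel) = (LINT x:{a..b}|lborel. g x)"
      unfolding set_lebesgue_integral_def g_def
      by (intro Bochner_Integration.integral_cong) (auto simp: indicator_def)
    then show ?thesis using icc by simp
  qed
  have "(LINT x:A|lborel. g x) = 0" if "A \<in> sets borel" for A
    using that
  proof (induction rule: borel_set_induct)
    case (compl A)
    have "(LINT x:UNIV|lborel. g x) = (LINT x:A \<union> -A|lborel. g x)" by simp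
    also have "\<dots> = (LINT x:A|lborel. g x) + (LINT x:-A|lborel. g x)"
      by (rule set_integral_Un) (use compl sg in \<open>auto simp: Compl_eq_Diff_UNIV\<close>)
    finally show ?case using UN compl by (simp add: set_lebesgue_integral_def)
  next
    case (union F)
    have "(LINT x:(\<Union>i. F i)|lborel. g x) = (\<Sum>i. (LINT x:F i|lborel. g x))"
    proof (rule lebesgue_integral_countable_add)
      show "\<And>i j. i \<noteq> j \<Longrightarrow> F i \<inter> F j = {}"
        using union(1) by (auto simp: disjoint_family_on_def)
      show "set_integrable lborel (\<Union>i. F i) g" using union(2) by (intro sg) auto
    qed (use union(2) in auto)
    then show ?case using union by simp
  next
    case empty
    show ?case by (simp add: set_lebesgue_integral_def)
  qed (simp add: icc)
  then have "AE x in lborel. g x = 0" by (intro sigma_finite_measure.density_zero[OF lborel.sigma_finite_measure_axioms g]) auto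
  then show ?thesis by eventually_elim (auto simp: g_def indicator_def)
qed

lemma exists_antiderivative:
  fixes f :: "real \<Rightarrow> real"
  assumes "continuous_on UNIV f"
  obtains F where "\<And>x. (F has_real_derivative f x) (at x)"
proof -
  have "\<exists>F. \<forall>x :: real. -\<infinity> < ereal x \<longrightarrow> ereal x < \<infinity> \<longrightarrow> (F has_vector_derivative f x) (at x)"
    by (rule einterval_antiderivative) (use assms in \<open>auto simp: continuous_on_eq_continuous_at\<close>)
  then show ?thesis using that by (auto simp: has_real_derivative_iff_has_vector_derivative)
qed

lemma primitive_on_DERIV:
  assumes "\<And>x. (F has_real_derivative f x) (at x)" "continuous_on UNIV f"
  shows "primitive_on a b f F"
proof (rule primitive_on_C1)
  show "(F has_real_derivative f x) (at x within {a..b})" for x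
    by (rule has_field_derivative_at_within[OF assms(1)])
  show "continuous_on {a..b} f" by (rule continuous_on_subset[OF assms(2)]) simp
qed

text \<open>\<open>B\<close> is the limit set of the multipliers; \<open>N\<close> is a finite set
  on which nothing is assumed about the limit, such as the corners of a ramp.\<close>

lemma set_integral_mult_tendsto:
  fixes f :: "real \<Rightarrow> real" and \<beta> :: "nat \<Rightarrow> real \<Rightarrow> real"
  assumes f: "set_integrable lborel A f"
    and \<beta>: "\<And>k. continuous_on UNIV (\<beta> k)" "\<And>k x. \<bar>\<beta> k x\<bar> \<le> 1"
    and lim: "\<And>x. x \<in> A \<Longrightarrow> x \<notin> N \<Longrightarrow> (\<lambda>k. \<beta> k x) \<longlonglongrightarrow> indicator B x" 
    and A: "B \<subseteq> A" "B \<in> sets borel" "finite N"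
  shows "(\<lambda>k. LINT x:A|lborel. f x * \<beta> k x) \<longlonglongrightarrow> (LINT x:B|lborel. f x)"
proof -
  have [measurable]: "\<beta> k \<in> borel_measurable borel" for k
    using \<beta>(1) by (rule borel_measurable_continuous_onI)
  have [measurable]: "(\<lambda>x. indicator A x * f x) \<in> borel_measurable borel"
    using borel_measurable_integrable[OF f[unfolded set_integrable_def]] by simp
  note [measurable] = A(2)
  have eqB: "(LINT x:B|lborel. f x) = (\<integral>x. indicator A x * f x * indicator B x \<partial>lborel)"
    unfolding set_lebesgue_integral_def
    by (intro Bochner_Integration.integral_cong) (use A(1) in \<open>auto simp: indicator_def\<close>)
  have eqA: "(LINT x:A|lborel. f x * \<beta> k x) = (\<integral>x. indicator A x * f x * \<beta> k x \<partial>lborel)" for k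
    unfolding set_lebesgue_integral_def
    by (intro Bochner_Integration.integral_cong) auto
  have "AE x in lborel. x \<notin> N"
    using A(3) by (intro AE_not_in finite_imp_null_set_lborel)
  show ?thesis unfolding eqA eqB
  proof (rule integral_dominated_convergence)
    show "integrable lborel (\<lambda>x. \<bar>indicator A x * f x\<bar>)"
      using f by (simp add: set_integrable_def)
    show "AE x in lborel. (\<lambda>k. indicator A x * f x * \<beta> k x) \<longlonglongrightarrow> indicator A x * f x * indicator B x"
      using \<open>AE x in lborel. x \<notin> N\<close>
    proof eventually_elim
      case (elim x)
      show ?case
      proof (cases "x \<in> A")
        case True
        then show ?thesis using lim[OF True elim] by (intro tendsto_intros)
      qed simp
    qed
    show "AE x in lborel. norm (indicator A x * f x * \<beta> k x) \<le> \<bar>indicator A x * f x\<bar>" for k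
      using \<beta>(2) by (intro AE_I2) (auto simp: abs_mult intro!: mult_left_le)
  qed auto
qed

text \<open>One of the two factors vanishes at every point outside the open interval, for every
  \<open>k\<close>; the support thus never leaves [s, t] while the values converge to the
  indicator.\<close>

definition interval_bump :: "real \<Rightarrow> real \<Rightarrow> nat \<Rightarrow> real \<Rightarrow> real" where
  "interval_bump s t k x = exp_recip 1 (real (Suc k) * (x - s)) * exp_recip 1 (real (Suc k) * (t - x))"

lemma smooth_interval_bump: "smooth (interval_bump s t k)"
proof -
  have 1: "smooth (\<lambda>x. exp_recip 1 (real (Suc k) * x + (- real (Suc k) * s)))"
    by (intro smooth_compose[OF smooth_exp_recip smooth_affine])
  have 2: "smooth (\<lambda>x. exp_recip 1 ((- real (Suc k)) * x + (real (Suc k) * t)))"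
    by (intro smooth_compose[OF smooth_exp_recip smooth_affine])
  have "interval_bump s t k = (\<lambda>x. exp_recip 1 (real (Suc k) * x + (- real (Suc k) * s)) *
      exp_recip 1 ((- real (Suc k)) * x + (real (Suc k) * t)))"
    unfolding interval_bump_def by (simp add: algebra_simps del: of_nat_Suc)
  then show ?thesis using smooth_mult[OF 1 2] by simp
qed

lemma interval_bump_outside: "x \<notin> {s<..<t} \<Longrightarrow> interval_bump s t k x = 0"
  by (auto simp: interval_bump_def exp_recip_1 zero_less_mult_iff)

lemma interval_bump_abs_le: "\<bar>interval_bump s t k x\<bar> \<le> 1"
  unfolding interval_bump_def abs_mult using exp_recip_1_range by (simp add: mult_le_one)

lemma interval_bump_tendsto: "(\<lambda>k. interval_bump s t k x) \<longlonglongrightarrow> indicator {s<..<t} x"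
proof -
  have "(\<lambda>k. interval_bump s t k x) \<longlonglongrightarrow> (if 0 < x - s then 1 else 0) * (if 0 < t - x then 1 else 0)"
    unfolding interval_bump_def by (intro tendsto_mult exp_recip_1_tendsto)
  then show ?thesis by (auto simp: indicator_def split: if_splits)
qed

lemma set_integral_Ioo_eq_Icc:
  fixes f :: "real \<Rightarrow> real"
  shows "(LINT x:{s<..<t}|lborel. f x) = (LINT x:{s..t}|lborel. f x)"
  unfolding set_lebesgue_integral_def
  by (rule integral_discrete_difference[where X = "{s, t}"]) (auto simp: indicator_def)

lemma set_integral_mult_interval_bump_tendsto:
  assumes "set_integrable lborel {s..t} f"
  shows "(\<lambda>k. LINT x:{s..t}|lborel. f x * interval_bump s t k x) \<longlonglongrightarrow> (LINT x:{s..t}|lborel. f x)"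
proof -
  have "(\<lambda>k. LINT x:{s..t}|lborel. f x * interval_bump s t k x) \<longlonglongrightarrow> (LINT x:{s<..<t}|lborel. f x)"
    by (rule set_integral_mult_tendsto[where N = "{}", OF assms])
       (auto intro: smooth_imp_continuous_on smooth_interval_bump interval_bump_abs_le interval_bump_tendsto)
  then show ?thesis by (simp add: set_integral_Ioo_eq_Icc)
qed

lemma set_integral_support:
  fixes f :: "'a \<Rightarrow> real"
  assumes "\<And>x. x \<notin> A \<Longrightarrow> f x = 0" "A \<subseteq> B"
  shows "(LINT x:B|M. f x) = (LINT x:A|M. f x)"
  unfolding set_lebesgue_integral_def
  by (intro Bochner_Integration.integral_cong) (use assms in \<open>auto simp: indicator_def\<close>)

lemma integral_eq_set_integral_support:
  fixes f :: "'a \<Rightarrow> real"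
  assumes "\<And>x. x \<notin> A \<Longrightarrow> f x = 0"
  shows "(\<integral>x. f x \<partial>M) = (LINT x:A|M. f x)"
  unfolding set_lebesgue_integral_def
  by (intro Bochner_Integration.integral_cong) (use assms in \<open>auto simp: indicator_def\<close>)

text \<open>A combination of two bumps with total integral 0 is the derivative of a test function,
  so \<open>f\<close> is orthogonal to it. As the bumps tend to indicators, the means of
  \<open>f\<close> over any two intervals in \<open>I\<close> turn out to agree.\<close>

lemma du_bois_reymond:
  fixes f :: "real \<Rightarrow> real" and I :: "real set"
  assumes I: "is_interval I"
    and int: "\<And>a b. {a..b} \<subseteq> I \<Longrightarrow> set_integrable lborel {a..b} f"
    and orth: "\<And>\<phi>. smooth \<phi> \<Longrightarrow> \<exists>C. compact C \<and> C \<subseteq> I \<and> (\<forall>x. x \<notin> C \<longrightarrow> \<phi> x = 0) \<Longrightarrow>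
       (\<integral>x. f x * deriv \<phi> x \<partial>lborel) = 0"
    and ab: "a\<^sub>0 < b\<^sub>0" "{a\<^sub>0..b\<^sub>0} \<subseteq> I"
  shows "\<exists>c. \<forall>a b. {a..b} \<subseteq> I \<longrightarrow> (AE x in lborel. x \<in> {a..b} \<longrightarrow> f x = c)"
proof -
  have eq: "(LINT x:{s..t}|lborel. f x) * (b\<^sub>0 - a\<^sub>0) = (LINT x:{a\<^sub>0..b\<^sub>0}|lborel. f x) * (t - s)"
    if st: "s \<le> t" "{s..t} \<subseteq> I" for s t
  proof -
    define W where "W = (\<lambda>s t g k. LINT x:{s..t}|lborel. g x * interval_bump s t k x)"
    have main: "W s t f k * W a\<^sub>0 b\<^sub>0 (\<lambda>_. 1) k = W a\<^sub>0 b\<^sub>0 f k * W s t (\<lambda>_. 1) k" for k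
    proof -
      \<comment> \<open>Each bump is weighted by the integral of the other one, which makes the
        integral of \<open>h\<close> vanish.\<close>
      define p q where "p = W a\<^sub>0 b\<^sub>0 (\<lambda>_. 1) k" and "q = W s t (\<lambda>_. 1) k"
      define h where "h = (\<lambda>x. p * interval_bump s t k x - q * interval_bump a\<^sub>0 b\<^sub>0 k x)"
      define l r where "l = min s a\<^sub>0" and "r = max t b\<^sub>0"
      have lr: "l \<le> s" "l \<le> a\<^sub>0" "t \<le> r" "b\<^sub>0 \<le> r" "l \<le> r" using st ab by (auto simp: l_def r_def)
      have "l \<in> I" "r \<in> I" using st ab by (auto simp: l_def r_def min_def max_def subset_eq)
      then have lrI: "{l..r} \<subseteq> I" using I unfolding is_interval_1 by (meson atLeastAtMost_iff subsetI)
      have sh: "smooth h" unfolding h_def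
        by (intro smooth_diff smooth_mult smooth_const smooth_interval_bump)
      have ch: "continuous_on A h" for A using sh by (rule smooth_imp_continuous_on)
      obtain F where F: "\<And>x. (F has_real_derivative h x) (at x)"
        using exists_antiderivative[OF ch] by blast
      have Fp: "primitive_on a b h F" for a b by (rule primitive_on_DERIV[OF F ch])
      have h0: "h x = 0" if "x \<notin> {l<..<r}" for x
      proof -
        have "x \<notin> {s<..<t}" "x \<notin> {a\<^sub>0<..<b\<^sub>0}" using that lr by auto
        then show ?thesis by (simp add: h_def interval_bump_outside)
      qed
      have ib: "set_integrable lborel {l..r} (interval_bump u v k)" for u v
        by (intro borel_integrable_atLeastAtMost' smooth_imp_continuous_on smooth_interval_bump)
      have "(LINT x:{l..r}|lborel. h x) = p * (LINT x:{l..r}|lborel. interval_bump s t k x)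
         - q * (LINT x:{l..r}|lborel. interval_bump a\<^sub>0 b\<^sub>0 k x)"
        unfolding h_def by (subst set_integral_diff) (use ib in auto)
      also have "(LINT x:{l..r}|lborel. interval_bump s t k x) = q"
        unfolding q_def W_def by simp (rule set_integral_support; use lr in \<open>auto intro: interval_bump_outside\<close>)
      also have "(LINT x:{l..r}|lborel. interval_bump a\<^sub>0 b\<^sub>0 k x) = p"
        unfolding p_def W_def by simp (rule set_integral_support; use lr in \<open>auto intro: interval_bump_outside\<close>)
      finally have h_int: "(LINT x:{l..r}|lborel. h x) = 0" by simp
      \<comment> \<open>Normalised to vanish at \<open>l\<close>; to the right of \<open>r\<close>
        it vanishes as well because \<open>h\<close> has integral 0, so it is an admissible test
        function.\<close>
      define \<phi> where "\<phi> = (\<lambda>x. F x - F l)"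
      have d\<phi>: "(\<phi> has_real_derivative h x) (at x)" for x
        unfolding \<phi>_def by (auto intro!: derivative_eq_intros F)
      have s\<phi>: "smooth \<phi>" by (rule smooth_antiderivative[OF d\<phi> sh])
      have zero: "(LINT x:{u..v}|lborel. h x) = 0" if "v \<le> l \<or> r \<le> u" for u v
      proof -
        have "(LINT x:{u..v}|lborel. h x) = (LINT x:{u..v}|lborel. 0)"
          by (intro set_lebesgue_integral_cong) (use that in \<open>auto intro!: h0\<close>)
        then show ?thesis by simp
      qed
      have "\<phi> x = 0" if "x \<notin> {l..r}" for x
      proof (cases "x < l")
        case True
        then show ?thesis using primitive_on_diff_eq[OF Fp, of x x l l] zero[of l x] by (simp add: \<phi>_def)
      next
        case False
        then have "r < x" using that by simp
        then show ?thesis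
          using primitive_on_diff_eq[OF Fp, of l l r r] primitive_on_diff_eq[OF Fp, of r r x x]
            zero[of x r] h_int lr by (simp add: \<phi>_def)
      qed
      then have "(\<integral>x. f x * deriv \<phi> x \<partial>lborel) = 0"
        using lrI by (intro orth[OF s\<phi>]) (auto intro!: exI[of _ "{l..r}"])
      then have "0 = (\<integral>x. f x * h x \<partial>lborel)" using deriv_eqI[OF d\<phi>] by simp
      also have "\<dots> = (LINT x:{l..r}|lborel. f x * h x)"
        by (rule integral_eq_set_integral_support) (use h0 in auto)
      also have "\<dots> = (LINT x:{l..r}|lborel. p * (f x * interval_bump s t k x) - q * (f x * interval_bump a\<^sub>0 b\<^sub>0 k x))"
        by (simp add: h_def algebra_simps)
      also have "\<dots> = p * (LINT x:{l..r}|lborel. f x * interval_bump s t k x)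
          - q * (LINT x:{l..r}|lborel. f x * interval_bump a\<^sub>0 b\<^sub>0 k x)"
      proof -
        have "set_integrable lborel {l..r} (\<lambda>x. f x * interval_bump u v k x)" for u v
          by (intro set_integrable_mult_continuous int lrI smooth_imp_continuous_on smooth_interval_bump)
        then show ?thesis by (subst set_integral_diff) auto
      qed
      also have "(LINT x:{l..r}|lborel. f x * interval_bump s t k x) = W s t f k"
        unfolding W_def by (rule set_integral_support) (use lr in \<open>auto simp: interval_bump_outside\<close>)
      also have "(LINT x:{l..r}|lborel. f x * interval_bump a\<^sub>0 b\<^sub>0 k x) = W a\<^sub>0 b\<^sub>0 f k"
        unfolding W_def by (rule set_integral_support) (use lr in \<open>auto simp: interval_bump_outside\<close>)
      finally show ?thesis by (simp add: p_def q_def mult.commute)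
    qed
    have W: "(\<lambda>k. W s t g k) \<longlonglongrightarrow> (LINT x:{s..t}|lborel. g x)" if "set_integrable lborel {s..t} g" for s t g
      unfolding W_def by (rule set_integral_mult_interval_bump_tendsto[OF that])
    have one: "set_integrable lborel {s..t} (\<lambda>_. 1::real)" for s t :: real
      by (intro borel_integrable_atLeastAtMost') auto
    have I1: "(LINT x:{s..t}|lborel. 1::real) = t - s" if "s \<le> t" for s t :: real
      unfolding set_lebesgue_integral_def using that by simp
    have "(\<lambda>k. W s t f k * W a\<^sub>0 b\<^sub>0 (\<lambda>_. 1) k) \<longlonglongrightarrow> (LINT x:{s..t}|lborel. f x) * (b\<^sub>0 - a\<^sub>0)"
      using tendsto_mult[OF W[OF int[OF st(2)]] W[OF one[of a\<^sub>0 b\<^sub>0]]] I1[of a\<^sub>0 b\<^sub>0] ab by simp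
    moreover have "(\<lambda>k. W a\<^sub>0 b\<^sub>0 f k * W s t (\<lambda>_. 1) k) \<longlonglongrightarrow> (LINT x:{a\<^sub>0..b\<^sub>0}|lborel. f x) * (t - s)"
      using tendsto_mult[OF W[OF int[OF ab(2)]] W[OF one[of s t]]] I1[OF st(1)] by simp
    ultimately show ?thesis using main LIMSEQ_unique by auto
  qed
  define c where "c = (LINT x:{a\<^sub>0..b\<^sub>0}|lborel. f x) / (b\<^sub>0 - a\<^sub>0)"
  have "AE x in lborel. x \<in> {a..b} \<longrightarrow> f x = c" if ab': "{a..b} \<subseteq> I" for a b
  proof -
    have "AE x in lborel. x \<in> {a..b} \<longrightarrow> f x - c = 0"
    proof (rule AE_eq_0_if_interval_integrals_eq_0)
      have c: "set_integrable lborel {u..v} (\<lambda>_. c)" for u v :: real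
        by (intro borel_integrable_atLeastAtMost') auto
      show "set_integrable lborel {a..b} (\<lambda>x. f x - c)" using int[OF ab'] c by simp
      fix u v assume uv: "a \<le> u" "u \<le> v" "v \<le> b"
      then have uvI: "{u..v} \<subseteq> I" using ab' by auto
      have "(LINT x:{u..v}|lborel. f x - c) = (LINT x:{u..v}|lborel. f x) - (LINT x:{u..v}|lborel. c)"
        by (rule set_integral_diff) (use int[OF uvI] c in auto)
      also have "(LINT x:{u..v}|lborel. c) = c * (v - u)"
        unfolding set_lebesgue_integral_def using uv by simp
      also have "(LINT x:{u..v}|lborel. f x) = c * (v - u)"
        using eq[OF uv(2) uvI] ab by (simp add: c_def field_simps)
      finally show "(LINT x:{u..v}|lborel. f x - c) = 0" by simp
    qed
    then show ?thesis by eventually_elim auto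
  qed
  then show ?thesis by blast
qed

text \<open>A comparison of cosines is periodic in \<open>x\<close> by construction and singles out
  the arc from \<open>s\<close> to \<open>t\<close> through its midpoint and half-length.\<close>

definition circle_bump :: "real \<Rightarrow> real \<Rightarrow> nat \<Rightarrow> real \<Rightarrow> real" where
  "circle_bump s t k x = exp_recip 1 (real (Suc k) * (cos (x - (s + t) / 2) - cos ((t - s) / 2)))"

lemma smooth_circle_bump: "smooth (circle_bump s t k)"
proof -
  have "smooth (\<lambda>x. cos (1 * x + (- ((s + t) / 2))))"
    by (rule smooth_compose[OF smooth_cos smooth_affine])
  then have "smooth (\<lambda>x. real (Suc k) * cos (1 * x + (- ((s + t) / 2))) - real (Suc k) * cos ((t - s) / 2))"
    by (intro smooth_diff smooth_mult smooth_const)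
  from smooth_compose[OF smooth_exp_recip this, of 1] show ?thesis
    unfolding circle_bump_def by (simp add: right_diff_distrib del: of_nat_Suc)
qed

lemma circle_bump_periodic: "circle_bump s t k (x + 2 * pi) = circle_bump s t k x"
  unfolding circle_bump_def using cos_periodic[of "x - (s + t) / 2"] by (simp add: add_diff_eq add.commute)

lemma circle_bump_abs_le: "\<bar>circle_bump s t k x\<bar> \<le> 1"
  unfolding circle_bump_def using exp_recip_1_range by (simp add: abs_le_iff order_trans[of _ 0])

text \<open>The distance \<open>y\<close> to the midpoint can exceed pi, where the cosine increases
  again; there it is replaced by 2 pi - y, which is still at least the half-length
  \<open>r\<close>.\<close>

lemma cos_less_iff_on_circle:
  assumes "0 \<le> s" "s \<le> t" "t \<le> 2 * pi" "x \<in> {0..2*pi}"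
  shows "cos ((t - s) / 2) < cos (x - (s + t) / 2) \<longleftrightarrow> x \<in> {s<..<t}"
proof -
  define r y where "r = (t - s) / 2" and "y = \<bar>x - (s + t) / 2\<bar>"
  have r: "0 \<le> r" "r \<le> pi" using assms by (auto simp: r_def)
  have cy: "cos (x - (s + t) / 2) = cos y" by (simp add: y_def)
  have yr: "y < r \<longleftrightarrow> x \<in> {s<..<t}" by (auto simp: y_def r_def abs_less_iff field_simps)
  have yb: "0 \<le> y" "y \<le> 2 * pi - r" using assms by (auto simp: y_def r_def abs_le_iff field_simps)
  have "cos r < cos y \<longleftrightarrow> y < r"
  proof (cases "y \<le> pi")
    case True
    then show ?thesis using cos_mono_less_eq[of r y] r yb by auto
  next
    case False
    have "cos y = cos (2 * pi - y)" by (simp add: cos_diff)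
    also have "\<dots> \<le> cos r" by (rule cos_monotone_0_pi_le) (use False r yb in auto)
    finally show ?thesis using False r by auto
  qed
  then show ?thesis using cy yr by (simp add: r_def)
qed

lemma circle_bump_tendsto:
  assumes "0 \<le> s" "s \<le> t" "t \<le> 2 * pi" "x \<in> {0..2*pi}"
  shows "(\<lambda>k. circle_bump s t k x) \<longlonglongrightarrow> indicator {s<..<t} x"
  unfolding circle_bump_def
  using exp_recip_1_tendsto[of "cos (x - (s + t) / 2) - cos ((t - s) / 2)"] cos_less_iff_on_circle[OF assms]
  by (auto simp: indicator_def simp del: of_nat_Suc)

lemma periodic_antiderivative:
  assumes F: "\<And>x. (F has_real_derivative h x) (at x)"
    and h: "\<And>x. h (x + 2 * pi) = h x" and F0: "F (2 * pi) = F 0"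
  shows "circle_fun F"
proof -
  have shift: "((\<lambda>x. F (x + 2 * pi)) has_real_derivative h (x + 2 * pi)) (at x)" for x
    using DERIV_shift[of F "h (x + 2 * pi)" x "2 * pi"] F by simp
  have "((\<lambda>x. F (x + 2 * pi) - F x) has_real_derivative 0) (at x)" for x
    using DERIV_diff[OF shift F, of x] h by simp
  then have "F (x + 2 * pi) - F x = F (0 + 2 * pi) - F 0" for x
    using DERIV_isconst_all by blast
  then show ?thesis using F0 by (simp add: circle_fun_def)
qed

text \<open>A smooth periodic function is the derivative of a periodic one as soon as its mean is 0,
  and a bump minus its mean qualifies, up to the factor \<open>T\<close>. The means of
  \<open>f\<close> over subintervals are thereby compared with the mean over the whole
  circle.\<close>

lemma du_bois_reymond_circle:
  fixes f :: "real \<Rightarrow> real"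
  assumes int: "set_integrable lborel {0..2*pi} f"
    and orth: "\<And>\<eta>. smooth \<eta> \<Longrightarrow> circle_fun \<eta> \<Longrightarrow> (LINT x:{0..2*pi}|lborel. f x * deriv \<eta> x) = 0"
  shows "\<exists>c. AE x in lborel. x \<in> {0..2*pi} \<longrightarrow> f x = c"
proof -
  define T where "T = 2 * pi"
  have T: "T > 0" by (simp add: T_def)
  have eq: "T * (LINT x:{s..t}|lborel. f x) = (t - s) * (LINT x:{0..T}|lborel. f x)"
    if st: "0 \<le> s" "s \<le> t" "t \<le> T" for s t
  proof -
    define W where "W = (\<lambda>g k. LINT x:{0..T}|lborel. g x * circle_bump s t k x)"
    have ib: "set_integrable lborel {0..T} (circle_bump s t k)" for k
      by (intro borel_integrable_atLeastAtMost' smooth_imp_continuous_on smooth_circle_bump)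
    have cb: "set_integrable lborel {0..T} (\<lambda>_. c)" for c :: real
      by (intro borel_integrable_atLeastAtMost') auto
    have cI: "(LINT x:{0..T}|lborel. c) = c * T" for c :: real
      unfolding set_lebesgue_integral_def using T by simp
    have main: "T * W f k = W (\<lambda>_. 1) k * (LINT x:{0..T}|lborel. f x)" for k
    proof -
      define q where "q = W (\<lambda>_. 1) k"
      define h where "h = (\<lambda>x. T * circle_bump s t k x - q)"
      have sh: "smooth h" unfolding h_def
        by (intro smooth_diff smooth_mult smooth_const smooth_circle_bump)
      have ch: "continuous_on A h" for A using sh by (rule smooth_imp_continuous_on)
      obtain F where F: "\<And>x. (F has_real_derivative h x) (at x)"
        using exists_antiderivative[OF ch] by blast
      have "(LINT x:{0..T}|lborel. h x) = T * (LINT x:{0..T}|lborel. circle_bump s t k x) - q * T"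
        unfolding h_def by (subst set_integral_diff) (use ib cb cI in auto)
      then have "(LINT x:{0..T}|lborel. h x) = 0" by (simp add: q_def W_def)
      then have "F T = F 0"
        using primitive_on_diff_eq[OF primitive_on_DERIV[OF F ch], of 0 0 T T] T by simp
      then have "circle_fun F"
        by (intro periodic_antiderivative[OF F]) (auto simp: T_def h_def circle_bump_periodic)
      then have "0 = (LINT x:{0..T}|lborel. f x * deriv F x)"
        using orth[OF smooth_antiderivative[OF F sh]] by (simp add: T_def)
      also have "\<dots> = (LINT x:{0..T}|lborel. T * (f x * circle_bump s t k x) - q * f x)"
        by (simp add: deriv_eqI[OF F] h_def algebra_simps)
      also have "\<dots> = T * W f k - q * (LINT x:{0..T}|lborel. f x)"
      proof -
        have "set_integrable lborel {0..T} (\<lambda>x. f x * circle_bump s t k x)"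
          using int by (intro set_integrable_mult_continuous smooth_imp_continuous_on smooth_circle_bump)
            (simp add: T_def)
        then show ?thesis using int unfolding W_def by (subst set_integral_diff) (auto simp: T_def)
      qed
      finally show ?thesis by (simp add: q_def)
    qed
    have W: "(\<lambda>k. W g k) \<longlonglongrightarrow> (LINT x:{s..t}|lborel. g x)" if "set_integrable lborel {0..T} g" for g
    proof -
      have "(\<lambda>k. W g k) \<longlonglongrightarrow> (LINT x:{s<..<t}|lborel. g x)" unfolding W_def
        by (rule set_integral_mult_tendsto[where N = "{}", OF that])
           (use st in \<open>auto intro!: smooth_imp_continuous_on smooth_circle_bump circle_bump_abs_le circle_bump_tendsto
            simp: T_def\<close>)
      then show ?thesis by (simp add: set_integral_Ioo_eq_Icc)
    qed
    have "(\<lambda>k. T * W f k) \<longlonglongrightarrow> T * (LINT x:{s..t}|lborel. f x)"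
      using int by (intro tendsto_mult tendsto_const W) (simp add: T_def)
    moreover have "(\<lambda>k. W (\<lambda>_. 1) k * (LINT x:{0..T}|lborel. f x)) \<longlonglongrightarrow>
        (LINT x:{s..t}|lborel. 1) * (LINT x:{0..T}|lborel. f x)"
      by (intro tendsto_mult tendsto_const W cb)
    moreover have "(LINT x:{s..t}|lborel. 1::real) = t - s"
      unfolding set_lebesgue_integral_def using st by simp
    ultimately show ?thesis using main LIMSEQ_unique by auto
  qed
  define c where "c = (LINT x:{0..T}|lborel. f x) / T"
  have "AE x in lborel. x \<in> {0..T} \<longrightarrow> f x - c = 0"
  proof (rule AE_eq_0_if_interval_integrals_eq_0)
    have c: "set_integrable lborel {u..v} (\<lambda>_. c)" for u v :: real
      by (intro borel_integrable_atLeastAtMost') auto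
    show "set_integrable lborel {0..T} (\<lambda>x. f x - c)" using int c by (simp add: T_def)
    fix u v assume uv: "0 \<le> u" "u \<le> v" "v \<le> T"
    have "set_integrable lborel {u..v} f"
      by (rule set_integrable_subset[OF int]) (use uv in \<open>auto simp: T_def\<close>)
    then have "(LINT x:{u..v}|lborel. f x - c) = (LINT x:{u..v}|lborel. f x) - (LINT x:{u..v}|lborel. c)"
      using c by (intro set_integral_diff) auto
    also have "(LINT x:{u..v}|lborel. c) = c * (v - u)"
      unfolding set_lebesgue_integral_def using uv by simp
    also have "(LINT x:{u..v}|lborel. f x) = c * (v - u)"
      using eq[OF uv] T by (simp add: c_def field_simps)
    finally show "(LINT x:{u..v}|lborel. f x - c) = 0" by simp
  qed
  then have "AE x in lborel. x \<in> {0..2*pi} \<longrightarrow> f x = c" by eventually_elim (auto simp: T_def)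
  then show ?thesis by blast
qed

subsection \<open>Weak derivatives and absolutely continuous representatives\<close>

lemma compact_subset_open_interval:
  fixes I :: "real set"
  assumes "compact C" "C \<subseteq> I" "open I" "is_interval I" "I \<noteq> {}"
  obtains l r where "l < r" "{l..r} \<subseteq> I" "C \<subseteq> {l<..<r}"
proof -
  obtain p q where pq: "p \<in> I" "q \<in> I" "p \<le> q" "C \<subseteq> {p..q}"
  proof (cases "C = {}")
    case True
    then show ?thesis using assms(5) that by (metis all_not_in_conv empty_subsetI order_refl)
  next
    case False
    obtain p where "p \<in> C" "\<forall>x\<in>C. p \<le> x"
      using compact_attains_inf[OF assms(1) False] by blast
    moreover obtain q where "q \<in> C" "\<forall>x\<in>C. x \<le> q"
      using compact_attains_sup[OF assms(1) False] by blast
    ultimately show ?thesis using that[of p q] assms(2) by (meson atLeastAtMost_iff subset_iff)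
  qed
  obtain d where d: "d > 0" "cball p d \<subseteq> I" using assms(3) pq(1) by (auto simp: open_contains_cball)
  obtain e where e: "e > 0" "cball q e \<subseteq> I" using assms(3) pq(2) by (auto simp: open_contains_cball)
  have "p - d \<in> I" "q + e \<in> I" using d e by (auto simp: cball_eq_atLeastAtMost subset_eq)
  then have "{p - d..q + e} \<subseteq> I"
    using assms(4) unfolding is_interval_1 by (meson atLeastAtMost_iff subsetI)
  moreover have "C \<subseteq> {p - d<..<q + e}" using pq d e by fastforce
  ultimately show ?thesis using that[of "p - d" "q + e"] pq d e by auto
qed

lemma exists_primitive:
  assumes I: "is_interval I" and int: "\<And>a b. {a..b} \<subseteq> I \<Longrightarrow> set_integrable lborel {a..b} g"
  obtains G where "\<And>a b. {a..b} \<subseteq> I \<Longrightarrow> primitive_on a b g G"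
proof (cases "I = {}")
  case True
  have "primitive_on a b g G" if "{a..b} \<subseteq> I" for a b G
    using that True by (simp add: primitive_on_def set_integrable_def)
  then show ?thesis using that by blast
next
  case False
  then obtain x\<^sub>0 where x0: "x\<^sub>0 \<in> I" by blast
  define G where "G = (\<lambda>x. if x\<^sub>0 \<le> x then LINT y:{x\<^sub>0..x}|lborel. g y else - (LINT y:{x..x\<^sub>0}|lborel. g y))"
  have G: "G y - G x = (LINT z:{x..y}|lborel. g z)" if "x \<le> y" "x \<in> I" "y \<in> I" for x y
  proof -
    have i: "set_integrable lborel {u..v} g" if "u \<in> I" "v \<in> I" for u v
      using that I unfolding is_interval_1 by (intro int) (meson atLeastAtMost_iff subsetI)
    consider "x\<^sub>0 \<le> x" | "x < x\<^sub>0" "x\<^sub>0 \<le> y" | "y < x\<^sub>0" by linarith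
    then show ?thesis
    proof cases
      case 1
      then show ?thesis using set_integral_Icc_split[OF 1 that(1) i[OF x0 that(3)]] that by (simp add: G_def)
    next
      case 2
      then show ?thesis using set_integral_Icc_split[of x x\<^sub>0 y, OF _ _ i[OF that(2,3)]] that by (simp add: G_def)
    next
      case 3
      then show ?thesis using set_integral_Icc_split[of x y x\<^sub>0, OF _ _ i[OF that(2) x0]] that by (simp add: G_def)
    qed
  qed
  have "primitive_on a b g G" if ab: "{a..b} \<subseteq> I" for a b
    unfolding primitive_on_def
  proof (intro conjI ballI int[OF ab])
    fix x assume "x \<in> {a..b}"
    then show "G x = G a + (LINT y:{a..x}|lborel. g y)" using G[of a x] ab by force
  qed
  then show ?thesis using that by blast
qed

lemma primitive_on_cong:
  assumes "primitive_on a b f F" "\<And>x. x \<in> {a..b} \<Longrightarrow> F x = G x"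
  shows "primitive_on a b f G"
  unfolding primitive_on_def
proof (intro conjI ballI)
  fix x assume x: "x \<in> {a..b}"
  then have "F x = F a + (LINT y:{a..x}|lborel. f y)" using assms(1) by (auto intro: primitive_on_eq)
  then show "G x = G a + (LINT y:{a..x}|lborel. f y)" using assms(2)[of x] assms(2)[of a] x by auto
qed (rule primitive_on_integrable[OF assms(1)])

lemma primitive_on_unique:
  assumes "primitive_on a b f F" "primitive_on a b g F"
  shows "AE x in lborel. x \<in> {a..b} \<longrightarrow> f x = g x"
proof -
  have d: "primitive_on a b (\<lambda>x. f x - g x) (\<lambda>x. F x - F x)" by (rule primitive_on_diff[OF assms])
  have "AE x in lborel. x \<in> {a..b} \<longrightarrow> f x - g x = 0"
    by (rule AE_eq_0_if_interval_integrals_eq_0[OF primitive_on_integrable[OF d]])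
       (use primitive_on_diff_eq[OF d] in force)
  then show ?thesis by eventually_elim simp
qed

lemma continuous_AE_eq_imp_eq:
  fixes f g :: "real \<Rightarrow> real"
  assumes "continuous_on {a..b} f" "continuous_on {a..b} g" "a < b"
    and "AE x in lborel. x \<in> {a..b} \<longrightarrow> f x = g x" and x: "x \<in> {a..b}"
  shows "f x = g x"
proof -
  define h where "h = (\<lambda>x. (f x - g x)\<^sup>2)"
  have c: "continuous_on {a..b} h" unfolding h_def by (intro continuous_intros assms)
  have i: "set_integrable lborel {a..b} h" by (rule borel_integrable_atLeastAtMost'[OF c])
  have "(LINT x:{a..b}|lborel. h x) = 0"
    unfolding set_lebesgue_integral_def
    by (rule integral_eq_zero_AE) (use assms(4) in \<open>eventually_elim, auto simp: h_def indicator_def\<close>)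
  then have "integral {a..b} h = 0" using set_borel_integral_eq_integral(2)[OF i] by simp
  then have "h x = 0" using integral_eq_0_iff[OF c assms(3)] x by (simp add: h_def)
  then show ?thesis by (simp add: h_def)
qed

lemma AE_all_intervals:
  fixes P :: "real \<Rightarrow> bool"
  assumes "\<And>a b. AE x in lborel. x \<in> {a..b} \<longrightarrow> P x"
  shows "AE x in lborel. P x"
proof -
  have "AE x in lborel. \<forall>N::nat. x \<in> {- real N..real N} \<longrightarrow> P x"
    unfolding AE_all_countable using assms by blast
  then show ?thesis
  proof eventually_elim
    case (elim x)
    obtain N :: nat where "\<bar>x\<bar> \<le> real N" using real_arch_simple by blast
    then show ?case using elim[rule_format, of N] by (auto simp: abs_le_iff)
  qed
qed

lemma AE_lborel_shift:
  assumes "AE x in lborel. P x" shows "AE x in lborel. P (x + c :: real)"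
proof -
  have "AE x in distr lborel borel ((+) c). P x" using assms by (subst lborel_distr_plus)
  then have "AE x in lborel. P (c + x)" by (rule AE_distrD[rotated]) auto
  then show ?thesis by (simp add: add.commute)
qed

lemma deriv_outside_support:
  fixes \<phi> :: "real \<Rightarrow> real"
  assumes "closed C" "\<And>x. x \<notin> C \<Longrightarrow> \<phi> x = 0" "x \<notin> C"
  shows "deriv \<phi> x = 0"
proof -
  have "eventually (\<lambda>y. y \<in> - C) (nhds x)" using assms by (intro eventually_nhds_in_open) auto
  then have "eventually (\<lambda>y. \<phi> y = 0) (nhds x)" by eventually_elim (use assms(2) in auto)
  then have "deriv \<phi> x = deriv (\<lambda>_. 0) x" by (intro deriv_cong_ev) auto
  then show ?thesis by simp
qed

lemma has_weak_deriv_integrable: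
  assumes "has_weak_deriv k A f g" "{a..b} \<subseteq> A"
  shows "set_integrable lborel {a..b} f" "set_integrable lborel {a..b} g"
  using assms unfolding has_weak_deriv_def by auto

lemma has_weak_deriv_1D:
  assumes "has_weak_deriv 1 A f g" "smooth \<phi>" "compact C" "C \<subseteq> A" "\<And>x. x \<notin> C \<Longrightarrow> \<phi> x = 0"
  shows "(\<integral>x. f x * deriv \<phi> x \<partial>lborel) = - (\<integral>x. g x * \<phi> x \<partial>lborel)"
proof -
  have "(\<integral>x. f x * (deriv ^^ 1) \<phi> x \<partial>lborel) = (-1) ^ 1 * (\<integral>x. g x * \<phi> x \<partial>lborel)"
    using assms unfolding has_weak_deriv_def by blast
  then show ?thesis by simp
qed

text \<open>A primitive \<open>G\<close> of \<open>g\<close> has the same weak derivative as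
  \<open>f\<close>, so \<open>f - G\<close> is orthogonal to all derivatives of test functions and
  therefore constant almost everywhere.\<close>

lemma has_weak_deriv_primitive:
  assumes w: "has_weak_deriv 1 I f g" and I: "open I" "is_interval I" "I \<noteq> {}"
  obtains F where "\<And>a b. {a..b} \<subseteq> I \<Longrightarrow> primitive_on a b g F"
    and "\<And>a b. {a..b} \<subseteq> I \<Longrightarrow> AE x in lborel. x \<in> {a..b} \<longrightarrow> f x = F x"
proof -
  note int = has_weak_deriv_integrable[OF w]
  obtain G where G: "\<And>a b. {a..b} \<subseteq> I \<Longrightarrow> primitive_on a b g G"
    using exists_primitive[OF I(2) int(2)] by blast
  have Gi: "set_integrable lborel {a..b} G" if "{a..b} \<subseteq> I" for a b
    using G[OF that] by (intro borel_integrable_atLeastAtMost' primitive_on_continuous)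
  obtain a0 b0 where ab: "a0 < b0" "{a0..b0} \<subseteq> I"
    using compact_subset_open_interval[OF compact_empty _ I] by auto
  have "\<exists>c. \<forall>a b. {a..b} \<subseteq> I \<longrightarrow> (AE x in lborel. x \<in> {a..b} \<longrightarrow> f x - G x = c)"
  proof (rule du_bois_reymond[OF I(2) _ _ ab])
    show "set_integrable lborel {a..b} (\<lambda>x. f x - G x)" if "{a..b} \<subseteq> I" for a b
      using int(1)[OF that] Gi[OF that] by simp
    fix \<phi> assume \<phi>: "smooth \<phi>" and "\<exists>C. compact C \<and> C \<subseteq> I \<and> (\<forall>x. x \<notin> C \<longrightarrow> \<phi> x = 0)"
    then obtain C where C: "compact C" "C \<subseteq> I" "\<And>x. x \<notin> C \<Longrightarrow> \<phi> x = 0" by blast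
    obtain l r where lr: "l < r" "{l..r} \<subseteq> I" "C \<subseteq> {l<..<r}"
      using compact_subset_open_interval[OF C(1,2) I] by blast
    have lr0: "\<phi> x = 0" "deriv \<phi> x = 0" if "x \<notin> {l<..<r}" for x
    proof -
      have "x \<notin> C" using lr(3) that by blast
      then show "\<phi> x = 0" "deriv \<phi> x = 0"
        using C(3) deriv_outside_support[OF compact_imp_closed[OF C(1)], of \<phi> x] by blast+
    qed
    have cd: "continuous_on A (deriv \<phi>)" for A
      by (intro smooth_imp_continuous_on smooth_deriv \<phi>)
    have i: "set_integrable lborel {l..r} (\<lambda>x. f x * deriv \<phi> x)"
      "set_integrable lborel {l..r} (\<lambda>x. G x * deriv \<phi> x)"
      "set_integrable lborel {l..r} (\<lambda>x. g x * \<phi> x)"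
      by (intro set_integrable_mult_continuous int Gi lr cd smooth_imp_continuous_on \<phi>)+
    have "primitive_on l r (deriv \<phi>) \<phi>"
      by (rule primitive_on_DERIV[OF smooth_has_derivative[OF \<phi>] cd])
    then have "(LINT x:{l..r}|lborel. g x * \<phi> x + G x * deriv \<phi> x) = 0"
      using primitive_on_integral_mult[OF G[OF lr(2)]] lr lr0[of l] lr0[of r] by simp
    then have GI: "(LINT x:{l..r}|lborel. g x * \<phi> x) + (LINT x:{l..r}|lborel. G x * deriv \<phi> x) = 0"
      using i by (subst (asm) set_integral_add) auto
    have "(\<integral>x. (f x - G x) * deriv \<phi> x \<partial>lborel) = (LINT x:{l..r}|lborel. f x * deriv \<phi> x - G x * deriv \<phi> x)"
      by (subst integral_eq_set_integral_support[of "{l..r}"]) (auto simp: lr0 left_diff_distrib)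
    also have "\<dots> = (LINT x:{l..r}|lborel. f x * deriv \<phi> x) - (LINT x:{l..r}|lborel. G x * deriv \<phi> x)"
      by (rule set_integral_diff) (use i in auto)
    also have "(LINT x:{l..r}|lborel. f x * deriv \<phi> x) = (\<integral>x. f x * deriv \<phi> x \<partial>lborel)"
      by (rule integral_eq_set_integral_support[symmetric]) (auto simp: lr0)
    also have "\<dots> = - (\<integral>x. g x * \<phi> x \<partial>lborel)"
      by (rule has_weak_deriv_1D[OF w \<phi> C])
    also have "(\<integral>x. g x * \<phi> x \<partial>lborel) = (LINT x:{l..r}|lborel. g x * \<phi> x)"
      by (rule integral_eq_set_integral_support) (auto simp: lr0)
    finally show "(\<integral>x. (f x - G x) * deriv \<phi> x \<partial>lborel) = 0" using GI by simp
  qed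
  then obtain c where c: "\<And>a b. {a..b} \<subseteq> I \<Longrightarrow> AE x in lborel. x \<in> {a..b} \<longrightarrow> f x - G x = c" by blast
  show ?thesis
  proof (rule that[of "\<lambda>x. G x + c"])
    show "primitive_on a b g (\<lambda>x. G x + c)" if "{a..b} \<subseteq> I" for a b
      using primitive_on_add[OF G[OF that] primitive_on_const[of a b c]] by simp
    show "AE x in lborel. x \<in> {a..b} \<longrightarrow> f x = G x + c" if "{a..b} \<subseteq> I" for a b
      using c[OF that] by eventually_elim auto
  qed
qed

text \<open>A continuous \<open>f\<close> coincides with its absolutely continuous representative
  everywhere, so no change on a null set remains. The comparison is made on a larger nondegenerate
  interval, because equality almost everywhere says nothing on [a, a].\<close>

lemma has_weak_deriv_continuous_primitive:
  assumes w: "has_weak_deriv 1 I f g" and I: "open I" "is_interval I"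
    and f: "continuous_on I f" and ab: "{a..b} \<subseteq> I"
  shows "primitive_on a b g f"
proof (cases "a \<le> b")
  case False
  then show ?thesis by (simp add: primitive_on_def set_integrable_def)
next
  case True
  have ne: "I \<noteq> {}" using True ab by auto
  obtain F where F: "\<And>a b. {a..b} \<subseteq> I \<Longrightarrow> primitive_on a b g F"
    "\<And>a b. {a..b} \<subseteq> I \<Longrightarrow> AE x in lborel. x \<in> {a..b} \<longrightarrow> f x = F x"
    using has_weak_deriv_primitive[OF w I ne] by blast
  obtain l r where lr: "l < r" "{l..r} \<subseteq> I" "{a..b} \<subseteq> {l<..<r}"
    using compact_subset_open_interval[OF compact_Icc ab I ne] by blast
  have "F x = f x" if "x \<in> {l..r}" for x
    by (rule continuous_AE_eq_imp_eq[OF continuous_on_subset[OF f lr(2)]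
          primitive_on_continuous[OF F(1)[OF lr(2)]] lr(1) F(2)[OF lr(2)] that, symmetric])
  then have "primitive_on l r g f" using primitive_on_cong[OF F(1)[OF lr(2)]] by blast
  moreover have "a \<in> {a..b}" "b \<in> {a..b}" using True by auto
  then have "l \<le> a" "b \<le> r" using lr(3) by (meson greaterThanLessThan_iff less_imp_le subsetD)+
  ultimately show ?thesis by (rule primitive_on_subinterval)
qed

lemma has_weak_deriv_unique:
  assumes "has_weak_deriv 1 UNIV v w" "has_weak_deriv 1 UNIV v' w'" "AE x in lborel. v x = v' x"
  shows "AE x in lborel. w x = w' x"
proof (rule AE_all_intervals)
  fix a b :: real
  obtain F where F: "\<And>a b. primitive_on a b w F" "\<And>a b. AE x in lborel. x \<in> {a..b} \<longrightarrow> v x = F x"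
    using has_weak_deriv_primitive[OF assms(1)] by (metis UNIV_not_empty open_UNIV is_interval_univ subset_UNIV)
  obtain G where G: "\<And>a b. primitive_on a b w' G" "\<And>a b. AE x in lborel. x \<in> {a..b} \<longrightarrow> v' x = G x"
    using has_weak_deriv_primitive[OF assms(2)] by (metis UNIV_not_empty open_UNIV is_interval_univ subset_UNIV)
  \<comment> \<open>Extended to \<open>b + 1\<close> to include the case a = b, in which equality
    almost everywhere carries no information.\<close>
  have "G x = F x" if "x \<in> {a..b+1}" "a < b + 1" for x
  proof (rule continuous_AE_eq_imp_eq[OF primitive_on_continuous[OF G(1)] primitive_on_continuous[OF F(1)] that(2) _ that(1)])
    show "AE x in lborel. x \<in> {a..b+1} \<longrightarrow> G x = F x"
      using assms(3) F(2)[of a "b+1"] G(2)[of a "b+1"] by eventually_elim auto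
  qed
  then have "primitive_on a (b + 1) w' F" if "a < b + 1" 
    using that by (intro primitive_on_cong[OF G(1)]) auto
  then have "AE x in lborel. x \<in> {a..b+1} \<longrightarrow> w x = w' x" if "a \<le> b"
    using primitive_on_unique[OF F(1)] that by auto
  moreover have "AE x in lborel. x \<in> {a..b} \<longrightarrow> w x = w' x" if "\<not> a \<le> b"
    using that by (intro AE_I2) auto
  ultimately show "AE x in lborel. x \<in> {a..b} \<longrightarrow> w x = w' x"
    by (cases "a \<le> b") (auto elim!: eventually_mono)
qed

text \<open>Integration by parts against the continuous \<open>V\<close>; the converse of the
  representation by primitives, with \<open>v\<close> any measurable version of
  \<open>V\<close>.\<close>

lemma primitive_imp_has_weak_deriv:
  assumes P: "\<And>a b. primitive_on a b w V" and v: "v \<in> borel_measurable borel"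
    and AE: "AE x in lborel. v x = V x"
  shows "has_weak_deriv 1 UNIV v w"
proof -
  have w: "set_integrable lborel {a..b} w" for a b by (rule primitive_on_integrable[OF P])
  have V: "set_integrable lborel {a..b} V" for a b
    by (intro borel_integrable_atLeastAtMost' primitive_on_continuous[OF P])
  have v': "set_integrable lborel {a..b} v" for a b
  proof (subst set_integrable_cong_AE[where g = V])
    show "AE x\<in>{a..b} in lborel. v x = V x" using AE by eventually_elim simp
    have "isCont V x" for x
      using primitive_on_continuous[OF P, of "x - 1" "x + 1"] 
      by (rule continuous_on_interior) (simp add: interior_atLeastAtMost_real)
    then show "V \<in> borel_measurable lborel"
      by (simp add: borel_measurable_continuous_onI continuous_at_imp_continuous_on)
  qed (use v V in auto)
  have compact_sub: "\<exists>a b. C \<subseteq> {a..b}" if "compact C" for C :: "real set"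
    using that compact_imp_bounded bounded_subset_cbox_symmetric by (metis cbox_interval)
  have int: "set_integrable lborel C v" "set_integrable lborel C w" if C: "compact C" for C
  proof -
    obtain a b where ab: "C \<subseteq> {a..b}" using compact_sub[OF C] by blast
    have "C \<in> sets lborel" using borel_compact[OF C] by simp
    then show "set_integrable lborel C v" "set_integrable lborel C w"
      using set_integrable_subset[OF v' _ ab] set_integrable_subset[OF w _ ab] by auto
  qed
  have parts: "(\<integral>x. v x * deriv \<phi> x \<partial>lborel) = - (\<integral>x. w x * \<phi> x \<partial>lborel)"
    if \<phi>: "smooth \<phi>" and C: "compact C" "\<And>x. x \<notin> C \<Longrightarrow> \<phi> x = 0" for \<phi> C
  proof -
    obtain l r where lr: "l < r" "C \<subseteq> {l<..<r}"
      using compact_subset_open_interval[OF C(1), of UNIV] by auto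
    have lr0: "\<phi> x = 0" "deriv \<phi> x = 0" if "x \<notin> {l<..<r}" for x
    proof -
      have "x \<notin> C" using lr(2) that by blast
      then show "\<phi> x = 0" "deriv \<phi> x = 0"
        using C(2) deriv_outside_support[OF compact_imp_closed[OF C(1)], of \<phi> x] by blast+
    qed
    have cd: "continuous_on A (deriv \<phi>)" for A
      by (intro smooth_imp_continuous_on smooth_deriv \<phi>)
    have i: "set_integrable lborel {l..r} (\<lambda>x. V x * deriv \<phi> x)"
      "set_integrable lborel {l..r} (\<lambda>x. w x * \<phi> x)"
      by (intro set_integrable_mult_continuous V w cd smooth_imp_continuous_on \<phi>)+
    have vi: "set_integrable lborel {l..r} (\<lambda>x. v x * deriv \<phi> x)"
      by (intro set_integrable_mult_continuous v' cd)
    have "primitive_on l r (deriv \<phi>) \<phi>"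
      by (rule primitive_on_DERIV[OF smooth_has_derivative[OF \<phi>] cd])
    then have "(LINT x:{l..r}|lborel. w x * \<phi> x + V x * deriv \<phi> x) = 0"
      using primitive_on_integral_mult[OF P] lr lr0[of l] lr0[of r] by simp
    then have "(LINT x:{l..r}|lborel. w x * \<phi> x) + (LINT x:{l..r}|lborel. V x * deriv \<phi> x) = 0"
      using i by (subst (asm) set_integral_add) auto
    moreover have "(LINT x:{l..r}|lborel. V x * deriv \<phi> x) = (LINT x:{l..r}|lborel. v x * deriv \<phi> x)"
      unfolding set_lebesgue_integral_def
      by (rule integral_cong_AE)
         (use i(1) vi AE in \<open>auto simp: set_integrable_def elim!: eventually_mono\<close>)
    moreover have "(LINT x:{l..r}|lborel. v x * deriv \<phi> x) = (\<integral>x. v x * deriv \<phi> x \<partial>lborel)"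
      by (rule integral_eq_set_integral_support[symmetric]) (auto simp: lr0)
    moreover have "(LINT x:{l..r}|lborel. w x * \<phi> x) = (\<integral>x. w x * \<phi> x \<partial>lborel)"
      by (rule integral_eq_set_integral_support[symmetric]) (auto simp: lr0)
    ultimately show ?thesis by simp
  qed
  show ?thesis unfolding has_weak_deriv_def using int parts by auto
qed

text \<open>Derivatives of a test function vanish outside the same compact set, so the first-order
  identity may be applied to the derivative of order \<open>k\<close> of \<phi>. Used repeatedly,
  this turns a third weak derivative into a chain of first ones.\<close>

lemma has_weak_deriv_Suc:
  assumes f: "has_weak_deriv 1 A f g" and h: "has_weak_deriv (Suc k) A f h"
  shows "has_weak_deriv k A g h"
  unfolding has_weak_deriv_def
proof (intro conjI allI impI)
  fix C assume "compact C \<and> C \<subseteq> A"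
  then show "set_integrable lborel C g" "set_integrable lborel C h"
    using f h unfolding has_weak_deriv_def by auto
next
  fix \<phi> assume "smooth \<phi> \<and> (\<exists>C. compact C \<and> C \<subseteq> A \<and> (\<forall>x. x \<notin> C \<longrightarrow> \<phi> x = 0))"
  then obtain C where \<phi>: "smooth \<phi>" and C: "compact C" "C \<subseteq> A" "\<And>x. x \<notin> C \<Longrightarrow> \<phi> x = 0" by blast
  have 0: "x \<notin> C \<Longrightarrow> (deriv ^^ j) \<phi> x = 0" for j x
  proof (induction j arbitrary: x)
    case (Suc j)
    then show ?case using deriv_outside_support[OF compact_imp_closed[OF C(1)], of "(deriv ^^ j) \<phi>"] by auto
  qed (use C in auto)
  have "(\<integral>x. f x * (deriv ^^ Suc k) \<phi> x \<partial>lborel) = (-1) ^ Suc k * (\<integral>x. h x * \<phi> x \<partial>lborel)"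
    using h \<phi> C unfolding has_weak_deriv_def by blast
  moreover have "(\<integral>x. f x * deriv ((deriv ^^ k) \<phi>) x \<partial>lborel) = - (\<integral>x. g x * (deriv ^^ k) \<phi> x \<partial>lborel)"
    by (rule has_weak_deriv_1D[OF f smooth_funpow_deriv[OF \<phi>] C(1,2) 0])
  ultimately show "(\<integral>x. g x * (deriv ^^ k) \<phi> x \<partial>lborel) = (-1) ^ k * (\<integral>x. h x * \<phi> x \<partial>lborel)"
    by simp
qed

subsection \<open>Periodic functions\<close>

lemma primitive_on_continuous_UNIV:
  assumes "\<And>a b. primitive_on a b f F" shows "continuous_on UNIV F"
proof -
  have "isCont F x" for x
    using primitive_on_continuous[OF assms, of "x - 1" "x + 1"] 
    by (rule continuous_on_interior) (simp add: interior_atLeastAtMost_real)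
  then show ?thesis by (simp add: continuous_at_imp_continuous_on)
qed

lemma continuous_AE_eq_imp_eq_UNIV:
  fixes f g :: "real \<Rightarrow> real"
  assumes "continuous_on UNIV f" "continuous_on UNIV g" "AE x in lborel. f x = g x"
  shows "f x = g x"
proof (rule continuous_AE_eq_imp_eq[where a = x and b = "x + 1" and f = f and g = g])
  show "AE y in lborel. y \<in> {x..x+1} \<longrightarrow> f y = g y" using assms(3) by eventually_elim simp
qed (use assms in \<open>auto intro: continuous_on_subset\<close>)

lemma set_integral_shift:
  fixes f :: "real \<Rightarrow> real"
  shows "(LINT x:{a..b}|lborel. f (x + c)) = (LINT x:{a + c..b + c}|lborel. f x)"
    and "set_integrable lborel {a..b} (\<lambda>x. f (x + c)) \<longleftrightarrow> set_integrable lborel {a + c..b + c} f"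
proof -
  have e: "indicat_real {a + c..b + c} (c + x) *\<^sub>R f (c + x) = indicator {a..b} x *\<^sub>R f (x + c)" for x
    by (auto simp: indicator_def add.commute)
  show "(LINT x:{a..b}|lborel. f (x + c)) = (LINT x:{a + c..b + c}|lborel. f x)"
    using lborel_integral_real_affine[of 1 "\<lambda>x. indicator {a + c..b + c} x *\<^sub>R f x" c] e
    by (simp add: set_lebesgue_integral_def)
  show "set_integrable lborel {a..b} (\<lambda>x. f (x + c)) \<longleftrightarrow> set_integrable lborel {a + c..b + c} f"
    using lborel_integrable_real_affine_iff[of 1 "\<lambda>x. indicator {a + c..b + c} x *\<^sub>R f x" c] e
    by (simp add: set_integrable_def)
qed

lemma primitive_on_shift:
  assumes "primitive_on (a + c) (b + c) f F"
  shows "primitive_on a b (\<lambda>x. f (x + c)) (\<lambda>x. F (x + c))"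
  unfolding primitive_on_def set_integral_shift
proof (intro conjI ballI)
  fix x assume "x \<in> {a..b}"
  then show "F (x + c) = F (a + c) + (LINT y:{a + c..x + c}|lborel. f y)"
    by (intro primitive_on_eq[OF assms]) auto
qed (rule primitive_on_integrable[OF assms])

lemma primitive_periodic:
  assumes "\<And>a b. primitive_on a b f F" "circle_fun F"
  shows "AE x in lborel. f (x + 2 * pi) = f x"
proof (rule AE_all_intervals)
  fix a b
  have "primitive_on a b (\<lambda>x. f (x + 2 * pi)) (\<lambda>x. F (x + 2 * pi))"
    by (rule primitive_on_shift[OF assms(1)])
  then have "primitive_on a b (\<lambda>x. f (x + 2 * pi)) F" using assms(2) by (simp add: circle_fun_def)
  from primitive_on_unique[OF this assms(1)]
  show "AE x in lborel. x \<in> {a..b} \<longrightarrow> f (x + 2 * pi) = f x" .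
qed

text \<open>The window of integration has to start at a point where a suitable zero is found rather
  than at 0; the part cut off on the left reappears on the right.\<close>

lemma set_integral_periodic_shift:
  fixes g :: "real \<Rightarrow> real"
  assumes per: "AE x in lborel. g (x + 2 * pi) = g x" and int: "set_integrable lborel {0..2*pi} g"
    and meas: "g \<in> borel_measurable borel"
    and c: "0 \<le> c" "c \<le> 2 * pi"
  shows "set_integrable lborel {c..c + 2 * pi} g"
    and "(LINT x:{c..c + 2 * pi}|lborel. g x) = (LINT x:{0..2*pi}|lborel. g x)"
proof -
  note [measurable] = meas
  have i1: "set_integrable lborel {0..c} g" "set_integrable lborel {c..2*pi} g"
    by (rule set_integrable_subset[OF int]; use c in auto)+
  have AE: "AE x\<in>{0..c} in lborel. g (x + 2 * pi) = g x"
    using per by eventually_elim simp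
  have "set_integrable lborel {0..c} (\<lambda>x. g (x + 2 * pi))"
    by (subst set_integrable_cong_AE[OF _ _ AE]) (use i1 in auto)
  then have i2: "set_integrable lborel {2*pi..c + 2*pi} g" using set_integral_shift(2)[of 0 c g] by simp
  have un: "{c..2*pi} \<union> {2*pi..c + 2*pi} = {c..c + 2*pi}" using c by auto
  show i3: "set_integrable lborel {c..c + 2 * pi} g"
    using set_integrable_Un[OF i1(2) i2] un by simp
  have "(LINT x:{2*pi..c + 2*pi}|lborel. g x) = (LINT x:{0..c}|lborel. g (x + 2 * pi))"
    using set_integral_shift(1)[of 0 c g "2*pi"] by simp
  also have "\<dots> = (LINT x:{0..c}|lborel. g x)"
    by (rule set_lebesgue_integral_cong_AE) (use AE in auto)
  finally show "(LINT x:{c..c + 2 * pi}|lborel. g x) = (LINT x:{0..2*pi}|lborel. g x)"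
    using set_integral_Icc_split[OF c int] set_integral_Icc_split[of c "2*pi" "c + 2*pi", OF c(2) _ i3] c by simp
qed

subsection \<open>The inequalities of Wirtinger and Sobolev on the circle\<close>

lemma set_integral_const_Icc: "a \<le> b \<Longrightarrow> (LINT x:{a..b}|lborel. c::real) = (b - a) * c"
  unfolding set_lebesgue_integral_def by simp

lemma set_integrable_continuous_Icc:
  fixes f :: "real \<Rightarrow> real"
  shows "continuous_on {a..b} f \<Longrightarrow> set_integrable lborel {a..b} f"
  by (rule borel_integrable_atLeastAtMost')

lemma set_integrable_continuous_UNIV:
  fixes f :: "real \<Rightarrow> real"
  shows "continuous_on UNIV f \<Longrightarrow> set_integrable lborel {a..b} f"
  by (rule set_integrable_continuous_Icc) (auto elim: continuous_on_subset)

lemma set_integral_nonneg_real: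
  fixes f :: "'a \<Rightarrow> real"
  assumes "\<And>x. x \<in> A \<Longrightarrow> 0 \<le> f x" shows "0 \<le> (LINT x:A|M. f x)"
  unfolding set_lebesgue_integral_def
  by (intro Bochner_Integration.integral_nonneg) (use assms in \<open>auto simp: indicator_def\<close>)

text \<open>
  With \<open>r = k cot (k (x - c) + \<theta>)\<close>, which is a bounded solution of the Riccati equation
  \<open>r' = - k\<^sup>2 - r\<^sup>2\<close> for \<open>k < 1\<close>, one has \<open>f\<^sup>2 - k\<^sup>2 F\<^sup>2 = (f - r F)\<^sup>2 + (r F\<^sup>2)'\<close>.
\<close>

lemma wirtinger_dirichlet_aux:
  assumes F: "primitive_on c (c + pi) f F" and f2: "set_integrable lborel {c..c + pi} (\<lambda>x. (f x)\<^sup>2)"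
    and F0: "F c = 0" "F (c + pi) = 0" and k: "0 < k" "k < 1"
  shows "k\<^sup>2 * (LINT x:{c..c + pi}|lborel. (F x)\<^sup>2) \<le> (LINT x:{c..c + pi}|lborel. (f x)\<^sup>2)"
proof -
  \<comment> \<open>Centres the argument of the cotangent in (0, pi): it runs from \<theta> to pi -
    \<theta>, so \<open>sin (y x)\<close> has no zero.\<close>
  define \<theta> where "\<theta> = (pi - k * pi) / 2"
  define y where "y = (\<lambda>x. k * (x - c) + \<theta>)"
  define r where "r = (\<lambda>x. k * cos (y x) / sin (y x))"
  let ?I = "{c..c + pi}"
  have sin: "sin (y x) \<noteq> 0" if "x \<in> ?I" for x
  proof -
    have "0 < \<theta>" using k by (simp add: \<theta>_def)
    have "0 \<le> k * (x - c)" "k * (x - c) \<le> k * pi" using k that by (auto intro!: mult_left_mono)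
    moreover have "k * pi + \<theta> = pi - \<theta>" by (simp add: \<theta>_def field_simps)
    ultimately have "0 < y x" "y x < pi" using \<open>0 < \<theta>\<close> unfolding y_def by linarith+
    then show ?thesis using sin_gt_zero by fastforce
  qed
  have dr: "(r has_real_derivative - k\<^sup>2 - (r x)\<^sup>2) (at x within ?I)" if "x \<in> ?I" for x
  proof -
    have "(r has_real_derivative ((- k * sin (y x) * k) * sin (y x) - k * cos (y x) * (cos (y x) * k))
        / (sin (y x) * sin (y x))) (at x within ?I)"
      unfolding r_def y_def
      by (rule derivative_eq_intros refl | use sin[OF that] in \<open>simp add: y_def algebra_simps\<close>)+
    moreover have "((- k * sin (y x) * k) * sin (y x) - k * cos (y x) * (cos (y x) * k))
        / (sin (y x) * sin (y x)) = - k\<^sup>2 - (r x)\<^sup>2"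
      using sin[OF that] by (simp add: r_def field_simps power2_eq_square)
    ultimately show ?thesis by simp
  qed
  have cr: "continuous_on ?I r" by (rule DERIV_continuous_on[OF dr])
  have cF: "continuous_on ?I F" by (rule primitive_on_continuous[OF F])
  have R: "primitive_on c (c + pi) (\<lambda>x. - k\<^sup>2 - (r x)\<^sup>2) r"
    by (rule primitive_on_C1[OF dr]) (auto intro!: continuous_intros cr)
  have FF: "primitive_on c (c + pi) (\<lambda>x. f x * F x + F x * f x) (\<lambda>x. F x * F x)"
    by (rule primitive_on_mult[OF F F])
  have z: "(LINT x:?I|lborel. (f x * F x + F x * f x) * r x + F x * F x * (- k\<^sup>2 - (r x)\<^sup>2)) = 0"
    using primitive_on_integral_mult[OF FF R] F0 by simp
  have i1: "set_integrable lborel ?I (\<lambda>x. (f x * F x + F x * f x) * r x + F x * F x * (- k\<^sup>2 - (r x)\<^sup>2))"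
    using primitive_on_integrable[OF primitive_on_mult[OF FF R]] .
  have i2: "set_integrable lborel ?I (\<lambda>x. k\<^sup>2 * (F x)\<^sup>2)"
    by (intro set_integrable_continuous_Icc continuous_intros cF)
  have "0 \<le> (LINT x:?I|lborel. (f x - F x * r x)\<^sup>2)" by (intro set_integral_nonneg_real) simp
  also have "\<dots> = (LINT x:?I|lborel. ((f x)\<^sup>2 - k\<^sup>2 * (F x)\<^sup>2)
      - ((f x * F x + F x * f x) * r x + F x * F x * (- k\<^sup>2 - (r x)\<^sup>2)))"
    by (simp add: power2_eq_square algebra_simps)
  also have "\<dots> = (LINT x:?I|lborel. (f x)\<^sup>2 - k\<^sup>2 * (F x)\<^sup>2)"
    by (subst set_integral_diff) (use i1 i2 f2 z in auto)
  also have "\<dots> = (LINT x:?I|lborel. (f x)\<^sup>2) - (LINT x:?I|lborel. k\<^sup>2 * (F x)\<^sup>2)"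
    by (rule set_integral_diff) (use i2 f2 in auto)
  finally show ?thesis by simp
qed

text \<open>For frequency 1 the cotangent would be singular at both ends; all frequencies
  \<open>sqrt z\<close> below 1 are used instead, with \<open>z\<close> arbitrarily close to
  1.\<close>

lemma wirtinger_dirichlet:
  assumes "primitive_on c (c + pi) f F" "set_integrable lborel {c..c + pi} (\<lambda>x. (f x)\<^sup>2)"
    and "F c = 0" "F (c + pi) = 0"
  shows "(LINT x:{c..c + pi}|lborel. (F x)\<^sup>2) \<le> (LINT x:{c..c + pi}|lborel. (f x)\<^sup>2)"
proof (rule field_le_mult_one_interval)
  fix z :: real assume "0 < z" "z < 1"
  then show "z * (LINT x:{c..c + pi}|lborel. (F x)\<^sup>2) \<le> (LINT x:{c..c + pi}|lborel. (f x)\<^sup>2)"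
    using wirtinger_dirichlet_aux[OF assms, of "sqrt z"] by simp
qed

text \<open>The intermediate value theorem gives \<open>c\<close> with F(c + pi) = F(c). Subtracting
  this value produces zeros at c, c + pi and c + 2 pi, and the Dirichlet inequality applies on both
  halves. Since \<open>F\<close> has mean 0, subtracting a constant can only increase the square
  integral.\<close>

lemma wirtinger_circle:
  assumes F: "\<And>a b. primitive_on a b f F" and per: "circle_fun F" and f: "f \<in> borel_measurable borel"
    and f2: "set_integrable lborel {0..2*pi} (\<lambda>x. (f x)\<^sup>2)"
    and mean: "(LINT x:{0..2*pi}|lborel. F x) = 0"
  shows "(LINT x:{0..2*pi}|lborel. (F x)\<^sup>2) \<le> (LINT x:{0..2*pi}|lborel. (f x)\<^sup>2)"
proof -
  have cF: "continuous_on UNIV F" by (rule primitive_on_continuous_UNIV[OF F])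
  then have cF': "continuous_on A F" for A by (rule continuous_on_subset) simp
  have perF: "F (x + 2 * pi) = F x" for x using per by (simp add: circle_fun_def)
  obtain c where c: "0 \<le> c" "c \<le> pi" "F (c + pi) = F c"
  proof -
    define g where "g = (\<lambda>x. F (x + pi) - F x)"
    have "continuous_on UNIV (\<lambda>x. F (x + pi))"
      by (rule continuous_on_compose2[OF cF]) (auto intro!: continuous_intros)
    then have cg: "continuous_on {0..pi} g" unfolding g_def
      by (intro continuous_on_diff cF') (auto intro: continuous_on_subset)
    \<comment> \<open>Periodicity makes the two end values opposite, which forces a zero in
      between.\<close>
    have "g pi = - g 0" using perF[of 0] by (simp add: g_def)
    then have "\<exists>c\<ge>0. c \<le> pi \<and> g c = 0"
      using IVT'[of g 0 0 pi] IVT2'[of g pi 0 0] cg by fastforce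
    then show ?thesis using that by (auto simp: g_def)
  qed
  define d where "d = F c"
  have Fd: "primitive_on a b f (\<lambda>x. F x - d)" for a b
    using primitive_on_diff[OF F primitive_on_const, of a b d] by simp
  have AEf: "AE x in lborel. (f (x + 2 * pi))\<^sup>2 = (f x)\<^sup>2"
    using primitive_periodic[OF F per] by eventually_elim simp
  have [measurable]: "f \<in> borel_measurable borel" by (rule f)
  have [measurable]: "F \<in> borel_measurable borel" by (rule borel_measurable_continuous_onI[OF cF])
  have c2: "c \<le> 2 * pi" using c pi_gt_zero by linarith
  have fc: "set_integrable lborel {c..c + 2 * pi} (\<lambda>x. (f x)\<^sup>2)"
    "(LINT x:{c..c + 2 * pi}|lborel. (f x)\<^sup>2) = (LINT x:{0..2*pi}|lborel. (f x)\<^sup>2)"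
    using set_integral_periodic_shift[OF AEf f2 _ c(1) c2] by simp_all
  have iF: "set_integrable lborel {a..b} (\<lambda>x. (F x - d)\<^sup>2)" for a b
    by (intro set_integrable_continuous_Icc continuous_intros cF')
  have Fc: "(LINT x:{c..c + 2 * pi}|lborel. (F x - d)\<^sup>2) = (LINT x:{0..2*pi}|lborel. (F x - d)\<^sup>2)"
    by (rule set_integral_periodic_shift(2)[OF _ iF _ c(1) c2]) (auto simp: perF)
  have fi: "set_integrable lborel {c..c + pi} (\<lambda>x. (f x)\<^sup>2)"
     "set_integrable lborel {c + pi..c + pi + pi} (\<lambda>x. (f x)\<^sup>2)"
    by (rule set_integrable_subset[OF fc(1)]; simp)+
  have "F (c + 2 * pi) = d" using perF by (simp add: d_def)
  then have "(LINT x:{c..c + pi}|lborel. (F x - d)\<^sup>2) \<le> (LINT x:{c..c + pi}|lborel. (f x)\<^sup>2)"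
    "(LINT x:{c + pi..c + pi + pi}|lborel. (F x - d)\<^sup>2) \<le> (LINT x:{c + pi..c + pi + pi}|lborel. (f x)\<^sup>2)"
    by (intro wirtinger_dirichlet Fd fi; simp add: c d_def add.assoc)+
  moreover have "(LINT x:{c..c + 2 * pi}|lborel. (F x - d)\<^sup>2)
      = (LINT x:{c..c + pi}|lborel. (F x - d)\<^sup>2) + (LINT x:{c + pi..c + pi + pi}|lborel. (F x - d)\<^sup>2)"
    using set_integral_Icc_split[of c "c + pi" "c + 2 * pi", OF _ _ iF] by (simp add: add.assoc)
  moreover have "(LINT x:{c..c + 2 * pi}|lborel. (f x)\<^sup>2)
      = (LINT x:{c..c + pi}|lborel. (f x)\<^sup>2) + (LINT x:{c + pi..c + pi + pi}|lborel. (f x)\<^sup>2)"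
    using set_integral_Icc_split[of c "c + pi" "c + 2 * pi", OF _ _ fc(1)] by (simp add: add.assoc)
  ultimately have le: "(LINT x:{0..2*pi}|lborel. (F x - d)\<^sup>2) \<le> (LINT x:{0..2*pi}|lborel. (f x)\<^sup>2)"
    using fc(2) Fc by simp
  have "(LINT x:{0..2*pi}|lborel. (F x - d)\<^sup>2)
      = (LINT x:{0..2*pi}|lborel. ((F x)\<^sup>2 - 2 * d * F x) + d\<^sup>2)"
    by (simp add: power2_eq_square algebra_simps)
  also have "\<dots> = (LINT x:{0..2*pi}|lborel. (F x)\<^sup>2 - 2 * d * F x) + (LINT x:{0..2*pi}|lborel. d\<^sup>2)"
    by (rule set_integral_add) (intro set_integrable_continuous_Icc continuous_intros cF')+
  also have "(LINT x:{0..2*pi}|lborel. (F x)\<^sup>2 - 2 * d * F x)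
      = (LINT x:{0..2*pi}|lborel. (F x)\<^sup>2) - (LINT x:{0..2*pi}|lborel. 2 * d * F x)"
    by (rule set_integral_diff) (intro set_integrable_continuous_Icc continuous_intros cF')+
  finally have "(LINT x:{0..2*pi}|lborel. (F x - d)\<^sup>2) = (LINT x:{0..2*pi}|lborel. (F x)\<^sup>2) + 2 * pi * d\<^sup>2"
    using mean by (simp add: set_integral_const_Icc)
  moreover have "0 \<le> 2 * pi * d\<^sup>2" by simp
  ultimately show ?thesis using le by linarith
qed

text \<open>Cauchy-Schwarz against the indicator of \<open>A\<close>. The set is general because an
  arc through the cut point of the circle is a union of two intervals.\<close>

lemma set_integral_abs_le_sqrt_measure:
  fixes f :: "real \<Rightarrow> real"
  assumes f: "set_integrable lborel {a..b} f" and f2: "set_integrable lborel {a..b} (\<lambda>x. (f x)\<^sup>2)"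
    and A: "A \<subseteq> {a..b}" "A \<in> sets borel"
  shows "\<bar>LINT x:A|lborel. f x\<bar> \<le> sqrt (measure lborel A) * sqrt (LINT x:{a..b}|lborel. (f x)\<^sup>2)"
proof -
  have m: "set_borel_measurable lborel {a..b} f"
    using f by (auto simp: set_integrable_def set_borel_measurable_def)
  have "emeasure lborel A < \<infinity>"
    using emeasure_mono[OF A(1), of lborel] by (auto simp: emeasure_lborel_Icc_eq less_top[symmetric] top_unique split: if_splits)
  then have iA: "integrable lborel (indicat_real A)" using A(2) by simp
  have i1: "set_integrable lborel {a..b} (\<lambda>x. (indicat_real A x)\<^sup>2)"
    unfolding set_integrable_def
    by (rule Bochner_Integration.integrable_cong[THEN iffD1, OF refl _ iA]) (use A(1) in \<open>auto simp: indicator_def\<close>)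
  have "(LINT x:{a..b}|lborel. (indicat_real A x)\<^sup>2) = (\<integral>x. indicat_real A x \<partial>lborel)"
    unfolding set_lebesgue_integral_def
    by (intro Bochner_Integration.integral_cong) (use A(1) in \<open>auto simp: indicator_def\<close>)
  then have e1: "(LINT x:{a..b}|lborel. (indicat_real A x)\<^sup>2) = measure lborel A" by simp
  have e2: "(LINT x:{a..b}|lborel. indicat_real A x * f x) = (LINT x:A|lborel. f x)"
    unfolding set_lebesgue_integral_def
    by (intro Bochner_Integration.integral_cong) (use A(1) in \<open>auto simp: indicator_def\<close>)
  have "set_borel_measurable lborel {a..b} (indicat_real A)"
    unfolding set_borel_measurable_def using A(2) by simp
  from set_square_integrable_mult(2)[OF this m i1 f2] show ?thesis unfolding e1 e2 .
qed

lemma mean_zero_has_zero: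
  fixes F :: "real \<Rightarrow> real"
  assumes F: "continuous_on {a..b} F" and ab: "a < b" and mean: "(LINT x:{a..b}|lborel. F x) = 0"
  obtains z where "z \<in> {a..b}" "F z = 0"
proof (rule ccontr)
  note found = that
  assume "\<not> thesis"
  then have nz: "F x \<noteq> 0" if "x \<in> {a..b}" for x using found[OF that] by blast
  have int: "integral {a..b} F = 0"
    using set_borel_integral_eq_integral(2)[OF set_integrable_continuous_Icc[OF F]] mean by simp
  have "(\<forall>x\<in>{a..b}. F x \<ge> 0) \<or> (\<forall>x\<in>{a..b}. F x \<le> 0)"
  proof (rule ccontr)
    assume "\<not> ?thesis"
    then obtain p q where pq: "p \<in> {a..b}" "F p < 0" "q \<in> {a..b}" "F q > 0" by (auto simp: not_le)
    have "connected (F ` {a..b})" by (intro connected_continuous_image F) simp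
    then have "0 \<in> F ` {a..b}"
      using pq unfolding connected_iff_interval by (meson imageI less_imp_le)
    then show False using nz by auto
  qed
  then show False
  proof
    assume "\<forall>x\<in>{a..b}. F x \<ge> 0"
    then have "F a = 0" using integral_eq_0_iff[OF F ab] int ab by auto
    then show False using nz[of a] ab by simp
  next
    assume neg: "\<forall>x\<in>{a..b}. F x \<le> 0"
    have "continuous_on {a..b} (\<lambda>x. - F x)" by (intro continuous_intros F)
    from integral_eq_0_iff[OF this ab] have "F a = 0" using neg int ab by auto
    then show False using nz[of a] ab by simp
  qed
qed

text \<open>Two points are joined by an arc of length at most pi, on which Cauchy-Schwarz bounds the
  increment; one of the points is taken to be a zero of \<open>F\<close>, which exists because the
  mean is 0. This is the origin of the factor 1 / sqrt pi in the first lower bound.\<close>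

lemma sup_bound_circle:
  assumes F: "primitive_on 0 (2*pi) f F" and per: "F (2*pi) = F 0"
    and f2: "set_integrable lborel {0..2*pi} (\<lambda>x. (f x)\<^sup>2)"
    and mean: "(LINT x:{0..2*pi}|lborel. F x) = 0" and x: "x \<in> {0..2*pi}"
  shows "\<bar>F x\<bar> \<le> sqrt pi * sqrt (LINT x:{0..2*pi}|lborel. (f x)\<^sup>2)"
proof -
  let ?N = "sqrt (LINT x:{0..2*pi}|lborel. (f x)\<^sup>2)"
  have N: "0 \<le> ?N" by (intro real_sqrt_ge_zero set_integral_nonneg_real) simp
  have fi: "set_integrable lborel {0..2*pi} f" by (rule primitive_on_integrable[OF F])
  have key: "\<bar>F q - F p\<bar> \<le> sqrt pi * ?N" if pq: "0 \<le> p" "p \<le> q" "q \<le> 2 * pi" for p q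
  proof (cases "q - p \<le> pi")
    case True
    have "\<bar>F q - F p\<bar> \<le> sqrt (measure lborel {p..q}) * ?N"
      unfolding primitive_on_diff_eq[OF F pq]
      by (rule set_integral_abs_le_sqrt_measure[OF fi f2]) (use pq in auto)
    also have "\<dots> \<le> sqrt pi * ?N" using True pq N by (intro mult_right_mono) auto
    finally show ?thesis .
  next
    case False
    then have "p < q" using pi_gt_zero by linarith
    \<comment> \<open>The arc from \<open>q\<close> to \<open>p\<close> through the cut point 0 = 2
      pi.\<close>
    let ?A = "{0..p} \<union> {q..2*pi}"
    have "(LINT x:?A|lborel. f x) = (LINT x:{0..p}|lborel. f x) + (LINT x:{q..2*pi}|lborel. f x)"
      by (rule set_integral_Un; (rule set_integrable_subset[OF fi])?) (use \<open>p < q\<close> pq in auto)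
    also have "\<dots> = (F p - F 0) + (F (2*pi) - F q)"
      using primitive_on_diff_eq[OF F, of 0 p] primitive_on_diff_eq[OF F, of q "2*pi"] pq by simp
    finally have e: "F q - F p = - (LINT x:?A|lborel. f x)" using per by simp
    have "measure lborel ?A = measure lborel {0..p} + measure lborel {q..2*pi}"
      by (rule measure_Union) (use \<open>p < q\<close> in \<open>auto simp: emeasure_lborel_Icc_eq\<close>)
    then have m: "measure lborel ?A = 2 * pi - (q - p)" using pq by simp
    have "\<bar>F q - F p\<bar> \<le> sqrt (measure lborel ?A) * ?N"
      unfolding e abs_minus_cancel
      by (rule set_integral_abs_le_sqrt_measure[OF fi f2]) (use pq in auto)
    also have "\<dots> \<le> sqrt pi * ?N" using False N by (intro mult_right_mono) (auto simp: m)
    finally show ?thesis .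
  qed
  obtain z where z: "z \<in> {0..2*pi}" "F z = 0"
    by (rule mean_zero_has_zero[OF primitive_on_continuous[OF F] _ mean]) (use pi_gt_zero in auto)
  show ?thesis using key[of z x] key[of x z] x z by (cases "z \<le> x") auto
qed

subsection \<open>The Sobolev space and the energy\<close>

lemma locally_integrable_measurable:
  fixes f :: "real \<Rightarrow> real"
  assumes "\<And>a b. set_integrable lborel {a..b} f" shows "f \<in> borel_measurable borel"
proof (rule borel_measurable_LIMSEQ_real)
  fix x :: real
  obtain N :: nat where N: "\<bar>x\<bar> \<le> real N" using real_arch_simple by blast
  have "eventually (\<lambda>k. indicator {- real k..real k} x * f x = f x) sequentially"
    using eventually_ge_at_top[of N] by eventually_elim (use N in \<open>auto simp: indicator_def abs_le_iff\<close>)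
  then show "(\<lambda>k. indicator {- real k..real k} x * f x) \<longlonglongrightarrow> f x" by (rule tendsto_eventually)
next
  fix k :: nat
  show "(\<lambda>x. indicator {- real k..real k} x * f x) \<in> borel_measurable borel"
    using borel_measurable_integrable[OF assms[unfolded set_integrable_def]] by simp
qed

lemma primitive_measurable: "(\<And>a b. primitive_on a b f F) \<Longrightarrow> f \<in> borel_measurable borel"
  by (intro locally_integrable_measurable primitive_on_integrable)

lemma has_weak_deriv_measurable:
  assumes "has_weak_deriv k UNIV v w" shows "v \<in> borel_measurable borel" "w \<in> borel_measurable borel"
  using has_weak_deriv_integrable[OF assms] by (auto intro: locally_integrable_measurable)

lemma has_weak_deriv_UNIV_primitive:
  assumes "has_weak_deriv 1 UNIV v w"
  obtains V where "\<And>a b. primitive_on a b w V" "AE x in lborel. v x = V x"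
proof -
  obtain V where V: "\<And>a b. {a..b} \<subseteq> UNIV \<Longrightarrow> primitive_on a b w V"
    "\<And>a b. {a..b} \<subseteq> UNIV \<Longrightarrow> AE x in lborel. x \<in> {a..b} \<longrightarrow> v x = V x"
    using has_weak_deriv_primitive[OF assms open_UNIV is_interval_univ UNIV_not_empty] by blast
  show ?thesis
  proof (rule that)
    show "primitive_on a b w V" for a b using V(1) by blast
    show "AE x in lborel. v x = V x" by (rule AE_all_intervals) (use V(2) in blast)
  qed
qed

text \<open>The chosen weak derivative agrees almost everywhere with any other, so it inherits the
  square integrability that membership grants to one of them.\<close>

lemma H1_weak_deriv:
  assumes "v \<in> H1"
  shows "has_weak_deriv 1 UNIV v (weak_deriv v)"
    and "set_integrable lborel {0..2*pi} (\<lambda>x. (weak_deriv v x)\<^sup>2)"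
proof -
  obtain w where w: "has_weak_deriv 1 UNIV v w" "set_integrable lborel {0..2*pi} (\<lambda>x. (w x)\<^sup>2)"
    using assms by (auto simp: H1_def)
  show d: "has_weak_deriv 1 UNIV v (weak_deriv v)"
    unfolding weak_deriv_def using someI[of "has_weak_deriv 1 UNIV v", OF w(1)] by simp
  have "AE x in lborel. weak_deriv v x = w x" by (rule has_weak_deriv_unique[OF d w(1)]) simp
  then have AE: "AE x\<in>{0..2*pi} in lborel. (weak_deriv v x)\<^sup>2 = (w x)\<^sup>2" by eventually_elim simp
  note [measurable] = has_weak_deriv_measurable(2)[OF d] has_weak_deriv_measurable(2)[OF w(1)]
  show "set_integrable lborel {0..2*pi} (\<lambda>x. (weak_deriv v x)\<^sup>2)"
    by (subst set_integrable_cong_AE[OF _ _ AE]) (use w(2) in auto)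
qed

lemma AE_eq_weak_deriv:
  assumes "v \<in> H1" "has_weak_deriv 1 UNIV v w"
  shows "AE x in lborel. weak_deriv v x = w x"
  by (rule has_weak_deriv_unique[OF H1_weak_deriv(1)[OF assms(1)] assms(2)]) simp

text \<open>The representative is periodic at every point: its shift by a period is continuous and
  equals it almost everywhere, because \<open>v\<close> itself is periodic.\<close>

lemma H1_primitive:
  assumes "v \<in> H1"
  obtains V where "\<And>a b. primitive_on a b (weak_deriv v) V" "AE x in lborel. v x = V x" "circle_fun V"
proof -
  obtain V where V: "\<And>a b. primitive_on a b (weak_deriv v) V" "AE x in lborel. v x = V x"
    using has_weak_deriv_UNIV_primitive[OF H1_weak_deriv(1)[OF assms]] by blast
  have cV: "continuous_on UNIV V" by (rule primitive_on_continuous_UNIV[OF V(1)])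
  have "V (x + 2 * pi) = V x" for x
  proof (rule continuous_AE_eq_imp_eq_UNIV[where f = "\<lambda>x. V (x + 2 * pi)" and g = V])
    show "continuous_on UNIV (\<lambda>x. V (x + 2 * pi))"
      by (rule continuous_on_compose2[OF cV]) (auto intro!: continuous_intros)
    show "AE x in lborel. V (x + 2 * pi) = V x"
      using V(2) AE_lborel_shift[OF V(2), of "2 * pi"]
    proof eventually_elim
      case (elim x)
      then show ?case using assms by (simp add: H1_def L2_def circle_fun_def)
    qed
  qed (rule cV)
  then show ?thesis by (intro that[OF V]) (simp add: circle_fun_def)
qed

lemma set_lebesgue_integral_cong_AE':
  fixes f g :: "'a \<Rightarrow> real"
  assumes "AE x in M. f x = g x" "f \<in> borel_measurable M" "g \<in> borel_measurable M" "A \<in> sets M"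
  shows "(LINT x:A|M. f x) = (LINT x:A|M. g x)"
  by (rule set_lebesgue_integral_cong_AE) (use assms in \<open>auto elim: eventually_mono\<close>)

lemma set_integrable_cong_AE':
  fixes f g :: "'a \<Rightarrow> real"
  assumes "AE x in M. f x = g x" "f \<in> borel_measurable M" "g \<in> borel_measurable M" "A \<in> sets M"
  shows "set_integrable M A f \<longleftrightarrow> set_integrable M A g"
  by (rule set_integrable_cong_AE) (use assms in \<open>auto elim: eventually_mono\<close>)

lemma set_square_integrable_add:
  fixes f g :: "'a \<Rightarrow> real"
  assumes m: "f \<in> borel_measurable M" "g \<in> borel_measurable M" "A \<in> sets M"
    and f: "set_integrable M A (\<lambda>x. (f x)\<^sup>2)" and g: "set_integrable M A (\<lambda>x. (g x)\<^sup>2)"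
  shows "set_integrable M A (\<lambda>x. (a * f x + b * g x)\<^sup>2)"
proof -
  have "set_integrable M A (\<lambda>x. f x * g x)"
    by (rule set_square_integrable_mult(1)[OF _ _ f g]) (use m in \<open>auto simp: set_borel_measurable_def\<close>)
  then have "set_integrable M A (\<lambda>x. a\<^sup>2 * (f x)\<^sup>2 + 2 * a * b * (f x * g x) + b\<^sup>2 * (g x)\<^sup>2)"
    using f g by (intro set_integral_add(1) set_integrable_mult_right) auto
  moreover have "(a * f x + b * g x)\<^sup>2 = a\<^sup>2 * (f x)\<^sup>2 + 2 * a * b * (f x * g x) + b\<^sup>2 * (g x)\<^sup>2" for x
    by (simp add: power2_eq_square algebra_simps)
  ultimately show ?thesis by simp
qed

lemma set_square_integrable_diff:
  fixes f g :: "'a \<Rightarrow> real"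
  assumes "f \<in> borel_measurable M" "g \<in> borel_measurable M" "A \<in> sets M"
    "set_integrable M A (\<lambda>x. (f x)\<^sup>2)" "set_integrable M A (\<lambda>x. (g x)\<^sup>2)"
  shows "set_integrable M A (\<lambda>x. (f x - g x)\<^sup>2)"
  using set_square_integrable_add[OF assms, of 1 "-1"] by simp

lemma H1_L2: "v \<in> H1 \<Longrightarrow> v \<in> L2" by (simp add: H1_def)

lemma L2_measurable: "v \<in> L2 \<Longrightarrow> v \<in> borel_measurable borel" by (simp add: L2_def)

lemma weak_deriv_measurable: "v \<in> H1 \<Longrightarrow> weak_deriv v \<in> borel_measurable borel"
  using has_weak_deriv_measurable(2)[OF H1_weak_deriv(1)] by blast

lemma dist_H1_nonneg: "0 \<le> dist_H1 u v"
  unfolding dist_H1_def circle_int_def by (intro real_sqrt_ge_zero set_integral_nonneg_real) simp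

text \<open>Lets the distance be computed with any weak derivatives; along a solution these will be
  the jointly measurable or the classical ones instead of the chosen ones.\<close>

lemma dist_H1_square:
  assumes "u \<in> H1" "v \<in> H1" "has_weak_deriv 1 UNIV u u'" "has_weak_deriv 1 UNIV v v'"
  shows "(dist_H1 u v)\<^sup>2 = (LINT x:{0..2*pi}|lborel. (u' x - v' x)\<^sup>2)"
proof -
  note [measurable] = weak_deriv_measurable[OF assms(1)] weak_deriv_measurable[OF assms(2)]
    has_weak_deriv_measurable(2)[OF assms(3)] has_weak_deriv_measurable(2)[OF assms(4)]
  have "(LINT x:{0..2*pi}|lborel. (weak_deriv u x - weak_deriv v x)\<^sup>2) = (LINT x:{0..2*pi}|lborel. (u' x - v' x)\<^sup>2)"
    by (rule set_lebesgue_integral_cong_AE')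
       (use AE_eq_weak_deriv[OF assms(1,3)] AE_eq_weak_deriv[OF assms(2,4)] in \<open>auto elim: eventually_elim2\<close>)
  then show ?thesis unfolding dist_H1_def circle_int_def
    by (simp add: real_sqrt_pow2 set_integral_nonneg_real)
qed

text \<open>The sup bound applies to the continuous representatives, whose difference has mean 0 by
  equality of masses; for the given versions it carries over to almost every point.\<close>

lemma AE_abs_diff_le_dist_H1:
  assumes u: "u \<in> H1" and v: "v \<in> H1" and mass: "circle_int u = circle_int v"
  shows "AE x in lborel. x \<in> {0..2*pi} \<longrightarrow> \<bar>u x - v x\<bar> \<le> sqrt pi * dist_H1 u v"
proof -
  obtain U where U: "\<And>a b. primitive_on a b (weak_deriv u) U" "AE x in lborel. u x = U x" "circle_fun U"
    using H1_primitive[OF u] by blast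
  obtain V where V: "\<And>a b. primitive_on a b (weak_deriv v) V" "AE x in lborel. v x = V x" "circle_fun V"
    using H1_primitive[OF v] by blast
  have cUV: "continuous_on UNIV U" "continuous_on UNIV V"
    by (auto intro: primitive_on_continuous_UNIV U V)
  have iUV: "set_integrable lborel {0..2*pi} U" "set_integrable lborel {0..2*pi} V"
    by (intro set_integrable_continuous_Icc continuous_on_subset[OF cUV(1)] continuous_on_subset[OF cUV(2)]; simp)+
  note [measurable] = weak_deriv_measurable[OF u] weak_deriv_measurable[OF v]
    L2_measurable[OF H1_L2[OF u]] L2_measurable[OF H1_L2[OF v]]
    cUV(1)[THEN borel_measurable_continuous_onI] cUV(2)[THEN borel_measurable_continuous_onI]
  define F where "F = (\<lambda>x. U x - V x)"
  define f where "f = (\<lambda>x. weak_deriv u x - weak_deriv v x)"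
  have F: "primitive_on 0 (2*pi) f F" unfolding F_def f_def by (rule primitive_on_diff[OF U(1) V(1)])
  have per: "F (2*pi) = F 0" using U(3) V(3) unfolding circle_fun_def F_def by (metis add_0)
  have f2: "set_integrable lborel {0..2*pi} (\<lambda>x. (f x)\<^sup>2)"
    unfolding f_def by (rule set_square_integrable_diff) (use H1_weak_deriv(2) u v in auto)
  have "(LINT x:{0..2*pi}|lborel. U x) = circle_int u" "(LINT x:{0..2*pi}|lborel. V x) = circle_int v"
    unfolding circle_int_def by (rule set_lebesgue_integral_cong_AE'; use U V in \<open>auto elim: eventually_mono\<close>)+
  then have mean: "(LINT x:{0..2*pi}|lborel. F x) = 0"
    unfolding F_def using iUV mass by (subst set_integral_diff) auto
  have d: "dist_H1 u v = sqrt (LINT x:{0..2*pi}|lborel. (f x)\<^sup>2)"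
    by (simp add: dist_H1_def circle_int_def f_def)
  show ?thesis using U(2) V(2)
  proof eventually_elim
    case (elim x)
    then show ?case using sup_bound_circle[OF F per f2 mean, of x] by (auto simp: d F_def)
  qed
qed

lemma energy_less_infinity_iff: "energy \<alpha> v < \<infinity> \<longleftrightarrow> v \<in> H1"
  by (simp add: energy_def)

lemma continuous_circle_L2:
  assumes "continuous_on UNIV v" "circle_fun v" shows "v \<in> L2"
  unfolding L2_def using assms
  by (auto intro: borel_measurable_continuous_onI set_integrable_square_continuous continuous_on_subset)

lemma primitive_H1:
  assumes P: "\<And>a b. primitive_on a b w v" and v: "circle_fun v"
    and w: "set_integrable lborel {0..2*pi} (\<lambda>x. (w x)\<^sup>2)"
  shows "v \<in> H1" "has_weak_deriv 1 UNIV v w"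
proof -
  have c: "continuous_on UNIV v" by (rule primitive_on_continuous_UNIV[OF P])
  show d: "has_weak_deriv 1 UNIV v w"
    by (rule primitive_imp_has_weak_deriv[OF P borel_measurable_continuous_onI[OF c]]) simp
  show "v \<in> H1" unfolding H1_def using continuous_circle_L2[OF c v] d w by auto
qed

lemma energy_eq:
  assumes v: "v \<in> H1" and w: "has_weak_deriv 1 UNIV v w"
  shows "energy \<alpha> v = ereal (1/2 * (LINT x:{0..2*pi}|lborel. (w x)\<^sup>2 - \<alpha>\<^sup>2 * (v x)\<^sup>2)
     - (LINT x:{0..2*pi}|lborel. v x * cos x))"
proof -
  note [measurable] = weak_deriv_measurable[OF v] L2_measurable[OF H1_L2[OF v]] has_weak_deriv_measurable(2)[OF w]
  have "(LINT x:{0..2*pi}|lborel. (weak_deriv v x)\<^sup>2 - \<alpha>\<^sup>2 * (v x)\<^sup>2)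
      = (LINT x:{0..2*pi}|lborel. (w x)\<^sup>2 - \<alpha>\<^sup>2 * (v x)\<^sup>2)"
    by (rule set_lebesgue_integral_cong_AE') (use AE_eq_weak_deriv[OF v w] in \<open>auto elim: eventually_mono\<close>)
  then show ?thesis using v by (simp add: energy_def circle_int_def)
qed

lemma const_H1: "(\<lambda>_. c) \<in> H1"
  by (rule primitive_H1(1)[OF primitive_on_const]) (auto simp: circle_fun_def set_integrable_def)

text \<open>Comparison with the constant function of mass \<open>M\<close>, which has finite
  energy.\<close>

lemma energy_minimizer_H1:
  assumes "energy_minimizer \<alpha> M v" "0 < M" shows "v \<in> H1"
proof -
  define c where "c = M / (2 * pi)"
  have "(\<lambda>_. c) \<in> mass_class M"
    using H1_L2[OF const_H1[of c]] assms(2)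
    by (simp add: mass_class_def circle_int_def set_integral_const_Icc c_def)
  then have "energy \<alpha> v \<le> energy \<alpha> (\<lambda>_. c)" using assms(1) by (simp add: energy_minimizer_def)
  also have "\<dots> < \<infinity>" by (simp only: energy_less_infinity_iff const_H1)
  finally show ?thesis by (simp only: energy_less_infinity_iff)
qed

text \<open>The dissipation is nonnegative, so the energy stays below its finite initial
  value.\<close>

lemma converging_solution_H1:
  assumes "converging_solution n \<alpha> M K v u" "t \<ge> 0" shows "u t \<in> H1"
proof (cases "t = 0")
  case True
  then show ?thesis using assms(1) unfolding converging_solution_def by (metis energy_less_infinity_iff)
next
  case False
  then have "t > 0" using assms by simp
  then obtain X where X: "energy \<alpha> (u t) + enn2ereal X \<le> energy \<alpha> (u 0)"
    using assms(1) unfolding converging_solution_def energy_inequality_def by meson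
  have "energy \<alpha> (u t) \<le> energy \<alpha> (u t) + enn2ereal X"
    using add_left_mono[OF enn2ereal_nonneg[of X], of "energy \<alpha> (u t)"] by simp
  also have "\<dots> \<le> energy \<alpha> (u 0)" by (rule X)
  also have "\<dots> < \<infinity>" using assms(1) unfolding converging_solution_def by blast
  finally show ?thesis by (simp only: energy_less_infinity_iff)
qed

lemma converging_solution_mass:
  assumes "converging_solution n \<alpha> M K v u" "t \<ge> 0" shows "circle_int (u t) = M" "0 \<le> u t x"
  using assms by (auto simp: converging_solution_def has_mass_def strong_solution_def)

subsection \<open>Lower bounds from the entropy\<close>

text \<open>The integrand is at least the power of \<epsilon> on all of \<open>Z\<close>. For
  \<epsilon> = 0 it would be infinite on a set of positive measure, against the finite bound
  \<open>S\<close>; hence the strict positivity, which later permits inverting the power.\<close>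

lemma entropy_lower_bound:
  assumes v: "AE x in lborel. x \<in> Z \<longrightarrow> v x \<le> \<epsilon>" and Z: "Z \<in> sets borel" "Z \<subseteq> {0..2*pi}"
    and L: "L = measure lborel Z" "0 < L"
    and \<beta>: "\<beta> = n - 3/2" "0 < \<beta>" and S: "entropy n v \<le> ereal S" and \<epsilon>: "0 \<le> \<epsilon>"
  shows "0 < \<epsilon>" "L * \<epsilon> powr (- \<beta>) \<le> S"
proof -
  have "emeasure lborel Z < \<infinity>"
    using emeasure_mono[OF Z(2), of lborel] by (auto simp: emeasure_lborel_Icc_eq less_top[symmetric] top_unique)
  then have eZ: "emeasure lborel Z = ennreal L" using L by (simp add: emeasure_eq_ennreal_measure)
  have exp: "- n + 3/2 = - \<beta>" using \<beta> by simp
  have mono: "enn_powr \<epsilon> (- \<beta>) \<le> enn_powr y (- \<beta>)" if "y \<le> \<epsilon>" for y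
    using that \<beta>(2) by (auto simp: enn_powr_def intro!: ennreal_leI powr_mono2')
  have "enn_powr \<epsilon> (- \<beta>) * emeasure lborel Z = (\<integral>\<^sup>+x. enn_powr \<epsilon> (- \<beta>) * indicator Z x \<partial>lborel)"
    using Z(1) by (simp add: nn_integral_cmult_indicator)
  also have "\<dots> \<le> (\<integral>\<^sup>+x\<in>{0..2*pi}. enn_powr (v x) (- n + 3/2) \<partial>lborel)"
    unfolding exp
  proof (rule nn_integral_mono_AE)
    show "AE x in lborel. enn_powr \<epsilon> (- \<beta>) * indicator Z x
        \<le> enn_powr (v x) (- \<beta>) * indicator {0..2*pi} x"
      using v by eventually_elim (use mono Z(2) in \<open>auto simp: indicator_def\<close>)
  qed
  finally have le: "enn2ereal (enn_powr \<epsilon> (- \<beta>) * ennreal L) \<le> ereal S"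
    using S eZ unfolding entropy_def by (metis less_eq_ennreal.rep_eq order_trans)
  show "0 < \<epsilon>"
  proof (rule ccontr)
    assume "\<not> 0 < \<epsilon>"
    then have "enn_powr \<epsilon> (- \<beta>) = \<infinity>" using \<beta>(2) by (simp add: enn_powr_def)
    then show False using le L(2) by (simp add: ennreal_top_mult)
  qed
  then have "enn_powr \<epsilon> (- \<beta>) * ennreal L = ennreal (L * \<epsilon> powr (- \<beta>))"
    using L(2) by (simp add: enn_powr_def ennreal_mult'[symmetric] mult.commute)
  then show "L * \<epsilon> powr (- \<beta>) \<le> S" using le L(2) by (simp add: enn2ereal_ennreal)
qed

lemma converging_solution_entropy:
  assumes "converging_solution n \<alpha> M K v u" "entropy n (u 0) = ereal S" "t \<ge> 0"
  shows "entropy n (u t) \<le> ereal (S + K * t)"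
proof (cases "t = 0")
  case False
  then show ?thesis using assms unfolding converging_solution_def entropy_inequality_def by auto
qed (use assms in simp)

lemma lower_bound_if_vanishing_on_set:
  assumes conv: "converging_solution n \<alpha> M K v u" and S: "entropy n (u 0) = ereal S"
    and v: "energy_minimizer \<alpha> M v" "continuous_on UNIV v" and M: "0 < M"
    and \<beta>: "\<beta> = n - 3/2" "0 < \<beta>"
    and A: "A \<in> sets lebesgue" "A \<subseteq> {0..2*pi}" "\<forall>x\<in>A. v x = 0" "L = measure lebesgue A" "L > 0"
    and t: "t \<ge> 0"
  shows "1 / sqrt pi * (L / (S + K * t)) powr (1 / \<beta>) \<le> dist_H1 (u t) v"
proof -
  \<comment> \<open>The full zero set in one period replaces \<open>A\<close>, which is only
    Lebesgue measurable: it is closed, hence Borel, and its measure is at least as large.\<close>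
  define Z where "Z = {0..2*pi} \<inter> v -` {0}"
  have "closed Z" unfolding Z_def
    by (intro closed_Int closed_vimage) (use v(2) in auto)
  then have Z: "Z \<in> sets borel" "Z \<subseteq> {0..2*pi}" "A \<subseteq> Z" using A by (auto simp: Z_def)
  have "Z \<in> lmeasurable"
    using Z(1,2) by (metis bounded_closed_interval bounded_set_imp_lmeasurable bounded_subset sets_completionI_sets sets_lborel)
  then have "L \<le> measure lebesgue Z"
    unfolding A(4) using A Z by (intro measure_mono_fmeasurable) auto
  also have "\<dots> = measure lborel Z" using Z(1) by simp
  finally have L: "L \<le> measure lborel Z" .
  define \<epsilon> where "\<epsilon> = sqrt pi * dist_H1 (u t) v"
  have \<epsilon>: "0 \<le> \<epsilon>" by (simp add: \<epsilon>_def dist_H1_nonneg)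
  have "circle_int v = M" using v by (simp add: energy_minimizer_def mass_class_def)
  then have "AE x in lborel. x \<in> {0..2*pi} \<longrightarrow> \<bar>u t x - v x\<bar> \<le> \<epsilon>"
    unfolding \<epsilon>_def using converging_solution_mass[OF conv t]
    by (intro AE_abs_diff_le_dist_H1 converging_solution_H1[OF conv t] energy_minimizer_H1[OF v(1) M]) simp
  then have le: "AE x in lborel. x \<in> Z \<longrightarrow> u t x \<le> \<epsilon>"
    by eventually_elim (auto simp: Z_def)
  note lb = entropy_lower_bound[OF le Z(1,2) refl _ \<beta> converging_solution_entropy[OF conv S t] \<epsilon>]
  have pos: "0 < \<epsilon>" using lb(1) L A(5) by simp
  define R where "R = S + K * t"
  have "L * \<epsilon> powr (- \<beta>) \<le> measure lborel Z * \<epsilon> powr (- \<beta>)" using L by (intro mult_right_mono) auto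
  also have "\<dots> \<le> R" unfolding R_def using lb(2) L A(5) by simp
  finally have ineq: "L * \<epsilon> powr (- \<beta>) \<le> R" .
  have "0 < L * \<epsilon> powr (- \<beta>)" using A(5) pos by simp
  then have R: "0 < R" using ineq by linarith
  have "L / R \<le> \<epsilon> powr \<beta>" using ineq R pos by (simp add: powr_minus field_simps)
  then have "(L / R) powr (1 / \<beta>) \<le> (\<epsilon> powr \<beta>) powr (1 / \<beta>)"
    using A(5) R \<beta> by (intro powr_mono2) auto
  also have "\<dots> = \<epsilon>" using pos \<beta> by (simp add: powr_powr)
  finally show ?thesis by (simp add: \<epsilon>_def R_def field_simps)
qed

section \<open>Zeros of second order\<close>

lemma circle_fun_shift:
  assumes per: "circle_fun v" shows "v (y + 2 * pi * of_int k) = v y"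
proof (induction k arbitrary: y rule: int_induct[where k = 0])
  case (step1 i)
  then show ?case using per step1(2)[of "y + 2 * pi"] unfolding circle_fun_def by (simp add: algebra_simps)
next
  case (step2 i)
  have "v (y + 2 * pi * of_int (i - 1)) = v (y - 2 * pi + 2 * pi * of_int i)" by (simp add: algebra_simps)
  also have "\<dots> = v (y - 2 * pi)" by (rule step2(2))
  also have "\<dots> = v y" using per unfolding circle_fun_def by (metis diff_add_cancel)
  finally show ?case .
qed simp

text \<open>The zero is moved into [0, 2 pi) and the side to its right is kept, so that the interval
  stays inside the period over which the entropy is integrated.\<close>

lemma vanishes_quadratically_in_period:
  assumes v: "vanishes_quadratically_at v x\<^sub>0" and per: "circle_fun v"
  obtains x \<delta> C where "0 \<le> x" "0 < \<delta>" "x + \<delta> \<le> 2 * pi" "0 < C"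
    "\<And>y. y \<in> {x..x + \<delta>} \<Longrightarrow> v y \<le> C * (y - x)\<^sup>2"
proof -
  note shift = circle_fun_shift[OF per]
  have v0: "v x\<^sub>0 = 0" using v by (simp add: vanishes_quadratically_at_def)
  have "v \<in> O[at x\<^sub>0](\<lambda>x. (x - x\<^sub>0)\<^sup>2)"
    using v unfolding vanishes_quadratically_at_def by (auto simp: bigtheta_def)
  then obtain C where C: "C > 0" "eventually (\<lambda>x. norm (v x) \<le> C * norm ((x - x\<^sub>0)\<^sup>2)) (at x\<^sub>0)"
    by (auto elim: landau_o.bigE)
  then obtain d where d: "d > 0" "\<And>x. x \<noteq> x\<^sub>0 \<Longrightarrow> dist x x\<^sub>0 < d \<Longrightarrow> norm (v x) \<le> C * norm ((x - x\<^sub>0)\<^sup>2)"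
    by (auto simp: eventually_at)
  define k where "k = \<lfloor>x\<^sub>0 / (2 * pi)\<rfloor>"
  define x where "x = x\<^sub>0 - 2 * pi * of_int k"
  have "of_int k \<le> x\<^sub>0 / (2 * pi)" "x\<^sub>0 / (2 * pi) < of_int k + 1" unfolding k_def by linarith+
  then have x: "0 \<le> x" "x < 2 * pi" by (auto simp: x_def field_simps)
  define \<delta> where "\<delta> = min (d / 2) (2 * pi - x)"
  have bound: "v y \<le> C * (y - x)\<^sup>2" if "y \<in> {x..x + \<delta>}" for y
  proof (cases "y = x")
    case True
    then show ?thesis using shift[of x k] v0 by (simp add: x_def)
  next
    case False
    have "v y = v (y + 2 * pi * of_int k)" by (rule shift[symmetric])
    moreover have "norm (v (y + 2 * pi * of_int k)) \<le> C * norm ((y + 2 * pi * of_int k - x\<^sub>0)\<^sup>2)"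
      using that False d(1) by (intro d(2)) (auto simp: x_def \<delta>_def dist_real_def)
    ultimately show ?thesis by (simp add: x_def algebra_simps)
  qed
  show ?thesis by (rule that[OF x(1) _ _ C(1) bound]) (use x d in \<open>auto simp: \<delta>_def\<close>)
qed

text \<open>For small \<epsilon> above sqrt pi times the distance, \<open>u\<close> is at most (C +
  1) \<epsilon> on an interval of length sqrt \<epsilon>, so the entropy bound controls \<epsilon>
  to the power 1/2 - \<beta> by a multiple of S + K t. The exponent \<gamma> is the reciprocal of
  \<beta> - 1/2.\<close>

lemma lower_bound_if_vanishing_quadratically:
  assumes v: "energy_minimizer \<alpha> M v" and M: "0 < M"
    and \<beta>: "\<beta> = n - 3/2" "1/2 < \<beta>" and x0: "vanishes_quadratically_at v x\<^sub>0"
  shows "\<exists>K\<^sub>1>0. \<exists>K\<^sub>2>0. \<forall>u t. converging_solution n \<alpha> M K v u \<longrightarrow> entropy n (u 0) = ereal S \<longrightarrow> 0 \<le> t \<longrightarrow>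
     (K\<^sub>1 + K\<^sub>2 * t) powr (- (2 / (2 * \<beta> - 1))) \<le> dist_H1 (u t) v"
proof -
  have vm: "circle_int v = M" "circle_fun v" using v by (auto simp: energy_minimizer_def mass_class_def L2_def)
  obtain x \<delta> C where x: "0 \<le> x" "0 < \<delta>" "x + \<delta> \<le> 2 * pi" "0 < C"
    "\<And>y. y \<in> {x..x + \<delta>} \<Longrightarrow> v y \<le> C * (y - x)\<^sup>2"
    using vanishes_quadratically_in_period[OF x0 vm(2)] by blast
  define \<gamma> where "\<gamma> = 2 / (2 * \<beta> - 1)"
  have \<gamma>: "0 < \<gamma>" using \<beta> by (simp add: \<gamma>_def)
  define B where "B = (C + 1) powr \<beta>"
  have B: "0 < B" using x(4) by (simp add: B_def)
  \<comment> \<open>Moves the factor sqrt pi of the sup bound inside the power.\<close>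
  define p where "p = sqrt pi powr (1 / \<gamma>)"
  have p: "0 < p" "p powr \<gamma> = sqrt pi" using \<gamma> by (auto simp: p_def powr_powr)
  \<comment> \<open>Takes care of distances so large that sqrt \<epsilon> exceeds the range \<delta>
    of the quadratic bound: sqrt pi times \<open>a\<close> to the power -\<gamma> is
    \<delta>^2.\<close>
  define a where "a = (sqrt pi / \<delta>\<^sup>2) powr (1 / \<gamma>)"
  have a: "0 < a" "a powr \<gamma> = sqrt pi / \<delta>\<^sup>2" using \<gamma> x(2) by (auto simp: a_def powr_powr)
  define K\<^sub>1 where "K\<^sub>1 = a + p * B * \<bar>S\<bar>"
  \<comment> \<open>The summand 1 keeps the constant positive also for K = 0.\<close>
  define K\<^sub>2 where "K\<^sub>2 = p * B * \<bar>K\<bar> + 1"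
  have "(K\<^sub>1 + K\<^sub>2 * t) powr (- \<gamma>) \<le> dist_H1 (u t) v"
    if conv: "converging_solution n \<alpha> M K v u" and S: "entropy n (u 0) = ereal S" and t: "0 \<le> t" for u t
  proof -
    define R where "R = S + K * t"
    define \<kappa> where "\<kappa> = K\<^sub>1 + K\<^sub>2 * t"
    have kt: "\<bar>K * t\<bar> = \<bar>K\<bar> * t" using t by (simp add: abs_mult)
    have "R \<le> \<bar>S\<bar> + \<bar>K\<bar> * t" using kt by (auto simp: R_def)
    then have "p * B * R \<le> p * B * (\<bar>S\<bar> + \<bar>K\<bar> * t)" using p B by (intro mult_left_mono) auto
    also have "\<dots> \<le> \<kappa>" using a t by (simp add: \<kappa>_def K\<^sub>1_def K\<^sub>2_def algebra_simps)
    finally have \<kappa>R: "p * B * R \<le> \<kappa>" .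
    have \<kappa>a: "a \<le> \<kappa>" using p B t by (simp add: \<kappa>_def K\<^sub>1_def K\<^sub>2_def)
    have \<kappa>: "0 < \<kappa>" using \<kappa>a a by linarith
    \<comment> \<open>An \<epsilon> strictly above the bound is positive even if the distance were
      0; the passage to the infimum of all such \<epsilon> comes at the end.\<close>
    have "sqrt pi * \<kappa> powr (- \<gamma>) \<le> \<epsilon>" if \<epsilon>: "sqrt pi * dist_H1 (u t) v < \<epsilon>" for \<epsilon>
    proof (cases "\<epsilon> \<le> \<delta>\<^sup>2")
      case False
      have "\<kappa> powr (- \<gamma>) \<le> a powr (- \<gamma>)" using \<kappa>a a \<gamma> by (intro powr_mono2') auto
      also have "\<dots> = \<delta>\<^sup>2 / sqrt pi" using a by (simp add: powr_minus)
      finally have "sqrt pi * \<kappa> powr (- \<gamma>) \<le> \<delta>\<^sup>2" by (simp add: field_simps)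
      then show ?thesis using False by simp
    next
      case True
      have "0 \<le> sqrt pi * dist_H1 (u t) v" by (simp add: dist_H1_nonneg)
      then have \<epsilon>0: "0 < \<epsilon>" using \<epsilon> by linarith
      have s\<delta>: "sqrt \<epsilon> \<le> \<delta>" using True x(2) by (simp add: real_le_lsqrt)
      have "AE y in lborel. y \<in> {0..2*pi} \<longrightarrow> \<bar>u t y - v y\<bar> \<le> sqrt pi * dist_H1 (u t) v"
        using converging_solution_mass[OF conv t] vm
        by (intro AE_abs_diff_le_dist_H1 converging_solution_H1[OF conv t] energy_minimizer_H1[OF v M]) simp
      then have le: "AE y in lborel. y \<in> {x..x + sqrt \<epsilon>} \<longrightarrow> u t y \<le> (C + 1) * \<epsilon>"
      proof eventually_elim
        case (elim y)
        show ?case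
        proof
          assume y: "y \<in> {x..x + sqrt \<epsilon>}"
          have "v y \<le> C * (y - x)\<^sup>2" using y s\<delta> by (intro x(5)) auto
          also have "(y - x)\<^sup>2 \<le> (sqrt \<epsilon>)\<^sup>2" using y by (intro power_mono) auto
          then have "C * (y - x)\<^sup>2 \<le> C * \<epsilon>" using x(4) \<epsilon>0 by simp
          finally have "v y \<le> C * \<epsilon>" .
          moreover have "\<bar>u t y - v y\<bar> \<le> \<epsilon>" using elim y x s\<delta> \<epsilon> by fastforce
          ultimately show "u t y \<le> (C + 1) * \<epsilon>" by (simp add: algebra_simps)
        qed
      qed
      have lb: "sqrt \<epsilon> * ((C + 1) * \<epsilon>) powr (- \<beta>) \<le> R" unfolding R_def
        by (rule entropy_lower_bound(2)[OF le _ _ _ _ \<beta>(1) _ converging_solution_entropy[OF conv S t]])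
           (use x s\<delta> \<epsilon>0 \<beta> in auto)
      have "\<epsilon> powr (1/2 - \<beta>) = sqrt \<epsilon> * \<epsilon> powr (- \<beta>)"
        using \<epsilon>0 by (simp add: powr_half_sqrt[symmetric] powr_add[symmetric])
      also have "\<dots> = B * (sqrt \<epsilon> * ((C + 1) * \<epsilon>) powr (- \<beta>))"
      proof -
        have "((C + 1) * \<epsilon>) powr (- \<beta>) = (C + 1) powr (- \<beta>) * \<epsilon> powr (- \<beta>)"
          by (rule powr_mult)
        moreover have "B * (C + 1) powr (- \<beta>) = 1"
          using x(4) by (simp add: B_def powr_minus)
        ultimately show ?thesis by (metis (no_types, opaque_lifting) mult.assoc mult.commute mult_1)
      qed
      also have "\<dots> \<le> B * R" using lb B by simp
      finally have e: "\<epsilon> powr (1/2 - \<beta>) \<le> B * R" .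
      have "0 < \<epsilon> powr (1/2 - \<beta>)" using \<epsilon>0 by simp
      then have "0 < B * R" using e by linarith
      then have "0 < p * (B * R)" using p by simp
      have "\<kappa> powr (- \<gamma>) \<le> (p * (B * R)) powr (- \<gamma>)"
        using \<kappa>R \<open>0 < p * (B * R)\<close> \<gamma> by (intro powr_mono2') (auto simp: mult.assoc)
      also have "\<dots> = (B * R) powr (- \<gamma>) / sqrt pi"
        using p \<open>0 < B * R\<close> by (simp add: powr_mult powr_minus field_simps)
      also have "(B * R) powr (- \<gamma>) \<le> (\<epsilon> powr (1/2 - \<beta>)) powr (- \<gamma>)"
        using e \<epsilon>0 \<gamma> by (intro powr_mono2') auto
      also have "(\<epsilon> powr (1/2 - \<beta>)) powr (- \<gamma>) = \<epsilon>"
      proof -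
        have "(1/2 - \<beta>) * (- \<gamma>) = 1" using \<beta> by (simp add: \<gamma>_def field_simps)
        then show ?thesis using \<epsilon>0 by (simp add: powr_powr del: mult_minus_right)
      qed
      finally show ?thesis by (simp add: field_simps divide_right_mono)
    qed
    then have "sqrt pi * \<kappa> powr (- \<gamma>) \<le> sqrt pi * dist_H1 (u t) v" by (rule dense_ge)
    then show ?thesis by (simp add: \<kappa>_def)
  qed
  moreover have "0 < K\<^sub>1" "0 < K\<^sub>2" using a p B by (auto simp: K\<^sub>1_def K\<^sub>2_def add_pos_nonneg add_nonneg_pos)
  ultimately show ?thesis unfolding \<gamma>_def by blast
qed

subsection \<open>Positive minimizers\<close>

lemma circle_fun_2pi: "circle_fun v \<Longrightarrow> v (2 * pi) = v 0"
  unfolding circle_fun_def by (metis add_0)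

lemma circle_fun_reduce:
  assumes "circle_fun v"
  obtains y where "y \<in> {0..2*pi}" "v y = v x"
proof -
  define k where "k = \<lfloor>x / (2 * pi)\<rfloor>"
  have "of_int k \<le> x / (2 * pi)" "x / (2 * pi) < of_int k + 1" unfolding k_def by linarith+
  then have "x - 2 * pi * of_int k \<in> {0..2*pi}" by (auto simp: field_simps)
  moreover have "v (x - 2 * pi * of_int k) = v x"
    using circle_fun_shift[OF assms, of "x - 2 * pi * of_int k" k] by simp
  ultimately show ?thesis using that by blast
qed

lemma continuous_circle_bounded:
  assumes "continuous_on UNIV v" "circle_fun v"
  obtains B where "0 < B" "\<And>x. \<bar>v x\<bar> \<le> B"
proof -
  have "bounded (v ` {0..2*pi})"
    by (intro compact_imp_bounded compact_continuous_image continuous_on_subset[OF assms(1)]) auto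
  then obtain B where B: "B > 0" "\<forall>y\<in>{0..2*pi}. \<bar>v y\<bar> \<le> B" by (auto simp: bounded_pos)
  have "\<bar>v x\<bar> \<le> B" for x using B(2) circle_fun_reduce[OF assms(2), of x] by metis
  then show ?thesis using that B(1) by blast
qed

lemma continuous_circle_attains_inf:
  fixes v :: "real \<Rightarrow> real"
  assumes "continuous_on UNIV v" "circle_fun v"
  obtains y where "y \<in> {0..2*pi}" "\<And>x. v y \<le> v x"
proof -
  have "\<exists>y\<in>{0..2*pi}. \<forall>x\<in>{0..2*pi}. v y \<le> v x"
    by (rule continuous_attains_inf) (auto intro: continuous_on_subset[OF assms(1)])
  then obtain y where y: "y \<in> {0..2*pi}" "\<forall>x\<in>{0..2*pi}. v y \<le> v x" by blast
  have "v y \<le> v x" for x using y(2) circle_fun_reduce[OF assms(2), of x] by metis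
  then show ?thesis using that y(1) by blast
qed

text \<open>For small \<epsilon> of sign opposite to \<open>L\<close> the linear term dominates;
  \<open>s\<close> is so small that the quadratic term is at most half of it.\<close>

lemma quadratic_nonneg_imp_linear_coeff_0:
  fixes L R \<delta> :: real
  assumes "0 < \<delta>" "\<And>\<epsilon>. \<bar>\<epsilon>\<bar> < \<delta> \<Longrightarrow> 0 \<le> \<epsilon> * L + \<epsilon>\<^sup>2 * R"
  shows "L = 0"
proof (rule ccontr)
  assume L: "L \<noteq> 0"
  define s where "s = min (\<delta> / 2) (\<bar>L\<bar> / (2 * (\<bar>R\<bar> + 1)))"
  have s: "0 < s" "s < \<delta>" using L assms(1) by (auto simp: s_def)
  have "s \<le> \<bar>L\<bar> / (2 * (\<bar>R\<bar> + 1))" by (simp add: s_def)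
  then have "s * (2 * (\<bar>R\<bar> + 1)) \<le> \<bar>L\<bar>" by (simp add: pos_le_divide_eq)
  moreover have "s * (2 * R) \<le> s * (2 * (\<bar>R\<bar> + 1))" using s by (intro mult_left_mono) auto
  ultimately have sR: "2 * (s * R) \<le> \<bar>L\<bar>" by simp
  have "\<bar>- sgn L * s\<bar> < \<delta>" using s L by (simp add: abs_mult)
  then have "0 \<le> (- sgn L * s) * L + (- sgn L * s)\<^sup>2 * R" by (rule assms(2))
  also have "\<dots> = s * (s * R - \<bar>L\<bar>)" 
    using L by (simp add: power2_eq_square algebra_simps abs_sgn sgn_mult_self_eq)
  finally have "0 \<le> s * R - \<bar>L\<bar>" using s by (simp add: zero_le_mult_iff)
  then show False using sR L by linarith
qed

text \<open>
  The test direction \<open>\<eta>\<close> is chosen so that its derivative is the defect \<open>v' + H - const\<close> of the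
  integrated Euler-Lagrange equation; the first variation is then the square integral of this defect.
\<close>

lemma euler_lagrange:
  assumes min: "energy_minimizer \<alpha> M v" and M: "0 < M" and cv: "continuous_on UNIV v"
    and pos: "\<And>x. 0 < v x"
  obtains v' C where "\<And>x. (v has_real_derivative v' x) (at x)"
    and "\<And>x. (v' has_real_derivative C - \<alpha>\<^sup>2 * v x - cos x) (at x)"
proof -
  let ?I = "{0..2*pi}"
  have vH1: "v \<in> H1" by (rule energy_minimizer_H1[OF min M])
  have vM: "v \<in> mass_class M" using min by (simp add: energy_minimizer_def)
  have pv: "circle_fun v" using H1_L2[OF vH1] by (simp add: L2_def)
  define w where "w = weak_deriv v"
  obtain V where V: "\<And>a b. primitive_on a b w V" "AE x in lborel. v x = V x" "circle_fun V"
    using H1_primitive[OF vH1, folded w_def] by blast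
  have vV: "v x = V x" for x
    by (rule continuous_AE_eq_imp_eq_UNIV[OF cv primitive_on_continuous_UNIV[OF V(1)] V(2)])
  have wv: "primitive_on a b w v" for a b by (rule primitive_on_cong[OF V(1)]) (simp add: vV)
  have w2: "set_integrable lborel ?I (\<lambda>x. (w x)\<^sup>2)" using H1_weak_deriv(2)[OF vH1] by (simp add: w_def)
  have wm: "w \<in> borel_measurable borel" by (rule primitive_measurable[OF wv])
  define h\<^sub>0 where "h\<^sub>0 = (\<lambda>x. \<alpha>\<^sup>2 * v x + cos x)"
  \<comment> \<open>The Lagrange multiplier of the mass constraint; being the mean of
    \<open>h\<^sub>0\<close>, it makes the antiderivative \<open>H\<close> periodic.\<close>
  define C where "C = (LINT x:?I|lborel. h\<^sub>0 x) / (2 * pi)"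
  define h where "h = (\<lambda>x. h\<^sub>0 x - C)"
  have ch0: "continuous_on UNIV h\<^sub>0" unfolding h\<^sub>0_def by (intro continuous_intros cv)
  have ch: "continuous_on UNIV h" unfolding h_def by (intro continuous_intros ch0)
  obtain H where H: "\<And>x. (H has_real_derivative h x) (at x)" using exists_antiderivative[OF ch] by blast
  have Hp: "primitive_on a b h H" for a b by (rule primitive_on_DERIV[OF H ch])
  have cH: "continuous_on UNIV H" by (rule primitive_on_continuous_UNIV[OF Hp])
  have "(LINT x:?I|lborel. h x) = 0"
    unfolding h_def by (subst set_integral_diff) (auto intro: set_integrable_continuous_UNIV ch0 simp: set_integral_const_Icc C_def)
  then have "H (2 * pi) = H 0" using primitive_on_diff_eq[OF Hp, of 0 0 "2*pi" "2*pi"] by simp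
  then have pH: "circle_fun H"
    by (intro periodic_antiderivative[OF H]) (use pv in \<open>auto simp: h_def h\<^sub>0_def circle_fun_def\<close>)
  define m where "m = (LINT x:?I|lborel. H x) / (2 * pi)"
  have cHm: "continuous_on UNIV (\<lambda>x. H x - m)" by (intro continuous_intros cH)
  obtain P where P: "\<And>x. (P has_real_derivative H x - m) (at x)" using exists_antiderivative[OF cHm] by blast
  have Pp: "primitive_on a b (\<lambda>x. H x - m) P" for a b by (rule primitive_on_DERIV[OF P cHm])
  have cP: "continuous_on UNIV P" by (rule primitive_on_continuous_UNIV[OF Pp])
  have "(LINT x:?I|lborel. H x - m) = 0"
    by (subst set_integral_diff) (auto intro: set_integrable_continuous_UNIV cH simp: set_integral_const_Icc m_def)
  then have "P (2 * pi) = P 0" using primitive_on_diff_eq[OF Pp, of 0 0 "2*pi" "2*pi"] by simp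
  then have pP: "circle_fun P"
    by (intro periodic_antiderivative[OF P]) (use pH in \<open>auto simp: circle_fun_def\<close>)
  \<comment> \<open>Makes \<eta> a variation of mean 0, so that the mass is preserved.\<close>
  define c where "c = (LINT x:?I|lborel. v x + P x) / (2 * pi)"
  define \<eta> where "\<eta> = (\<lambda>x. v x + P x - c)"
  define f where "f = (\<lambda>x. w x + (H x - m))"
  have cvP: "continuous_on UNIV (\<lambda>x. v x + P x)" by (intro continuous_intros cv cP)
  have c\<eta>: "continuous_on UNIV \<eta>" unfolding \<eta>_def by (intro continuous_intros cvP)
  have p\<eta>: "circle_fun \<eta>" using pv pP by (simp add: circle_fun_def \<eta>_def)
  have f\<eta>: "primitive_on a b f \<eta>" for a b
    using primitive_on_diff[OF primitive_on_add[OF wv Pp] primitive_on_const[of a b c]]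
    by (simp add: f_def \<eta>_def)
  have \<eta>0: "(LINT x:?I|lborel. \<eta> x) = 0"
    unfolding \<eta>_def by (subst set_integral_diff) (auto intro: set_integrable_continuous_UNIV cvP simp: set_integral_const_Icc c_def)
  have fm: "f \<in> borel_measurable borel" by (rule primitive_measurable[OF f\<eta>])
  have f2: "set_integrable lborel ?I (\<lambda>x. (f x)\<^sup>2)"
  proof -
    have "set_integrable lborel ?I (\<lambda>x. (H x - m)\<^sup>2)" by (intro set_integrable_continuous_UNIV continuous_intros cH)
    then show ?thesis
      using set_square_integrable_add[of w lborel "\<lambda>x. H x - m" ?I 1 1] w2 wm
        borel_measurable_continuous_onI[OF cHm] by (simp add: f_def)
  qed
  have wf: "set_integrable lborel ?I (\<lambda>x. w x * f x)"
    by (rule set_square_integrable_mult(1)[OF _ _ w2 f2]) (use wm fm in \<open>auto simp: set_borel_measurable_def\<close>)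
  obtain y where y: "\<And>x. v y \<le> v x" using continuous_circle_attains_inf[OF cv pv] by blast
  obtain B where B: "0 < B" "\<And>x. \<bar>\<eta> x\<bar> \<le> B" using continuous_circle_bounded[OF c\<eta> p\<eta>] by blast
  define L where "L = (LINT x:?I|lborel. w x * f x - \<alpha>\<^sup>2 * (v x * \<eta> x)) - (LINT x:?I|lborel. \<eta> x * cos x)"
  define R where "R = 1/2 * (LINT x:?I|lborel. (f x)\<^sup>2 - \<alpha>\<^sup>2 * (\<eta> x)\<^sup>2)"
  \<comment> \<open>Below this threshold the perturbation keeps the function nonnegative. It is
    positive because the minimum \<open>v y\<close> is, so both signs of \<epsilon> are
    admissible.\<close>
  have "0 \<le> \<epsilon> * L + \<epsilon>\<^sup>2 * R" if \<epsilon>: "\<bar>\<epsilon>\<bar> < v y / B" for \<epsilon>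
  proof -
    define z where "z = (\<lambda>x. v x + \<epsilon> * \<eta> x)"
    have z0: "0 \<le> z x" for x
    proof -
      have "\<bar>\<epsilon> * \<eta> x\<bar> \<le> \<bar>\<epsilon>\<bar> * B" using B(2)[of x] by (simp add: abs_mult mult_left_mono)
      also have "\<dots> < v y" using \<epsilon> B(1) by (simp add: pos_less_divide_eq)
      finally show ?thesis using y[of x] by (simp add: z_def)
    qed
    have zp: "primitive_on a b (\<lambda>x. w x + \<epsilon> * f x) z" for a b
      unfolding z_def by (intro primitive_on_add primitive_on_cmult wv f\<eta>)
    have pz: "circle_fun z" using pv p\<eta> by (simp add: circle_fun_def z_def)
    have z2: "set_integrable lborel ?I (\<lambda>x. (w x + \<epsilon> * f x)\<^sup>2)"
      using set_square_integrable_add[of w lborel f ?I 1 \<epsilon>] w2 f2 wm fm by simp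
    note zH1 = primitive_H1[OF zp pz z2]
    have "circle_int z = circle_int v + \<epsilon> * (LINT x:?I|lborel. \<eta> x)"
      unfolding circle_int_def z_def by (subst set_integral_add) (auto intro: set_integrable_continuous_UNIV cv c\<eta>)
    then have "z \<in> mass_class M" using vM H1_L2[OF zH1(1)] z0 \<eta>0 by (simp add: mass_class_def)
    then have "energy \<alpha> v \<le> energy \<alpha> z" using min by (simp add: energy_minimizer_def)
    moreover have "has_weak_deriv 1 UNIV v w" using H1_weak_deriv(1)[OF vH1] by (simp add: w_def)
    ultimately have le: "1/2 * (LINT x:?I|lborel. (w x)\<^sup>2 - \<alpha>\<^sup>2 * (v x)\<^sup>2) - (LINT x:?I|lborel. v x * cos x)
       \<le> 1/2 * (LINT x:?I|lborel. (w x + \<epsilon> * f x)\<^sup>2 - \<alpha>\<^sup>2 * (z x)\<^sup>2) - (LINT x:?I|lborel. z x * cos x)"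
      by (simp add: energy_eq[OF vH1] energy_eq[OF zH1])
    have i1: "set_integrable lborel ?I (\<lambda>x. (w x)\<^sup>2 - \<alpha>\<^sup>2 * (v x)\<^sup>2)"
      by (rule set_integral_diff(1)[OF w2]) (intro set_integrable_continuous_UNIV continuous_intros cv)
    have i2: "set_integrable lborel ?I (\<lambda>x. w x * f x - \<alpha>\<^sup>2 * (v x * \<eta> x))"
      by (rule set_integral_diff(1)[OF wf]) (intro set_integrable_continuous_UNIV continuous_intros cv c\<eta>)
    have i3: "set_integrable lborel ?I (\<lambda>x. (f x)\<^sup>2 - \<alpha>\<^sup>2 * (\<eta> x)\<^sup>2)"
      by (rule set_integral_diff(1)[OF f2]) (intro set_integrable_continuous_UNIV continuous_intros c\<eta>)
    have "(LINT x:?I|lborel. (w x + \<epsilon> * f x)\<^sup>2 - \<alpha>\<^sup>2 * (z x)\<^sup>2)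
      = (LINT x:?I|lborel. ((w x)\<^sup>2 - \<alpha>\<^sup>2 * (v x)\<^sup>2) + (2 * \<epsilon> * (w x * f x - \<alpha>\<^sup>2 * (v x * \<eta> x))
          + \<epsilon>\<^sup>2 * ((f x)\<^sup>2 - \<alpha>\<^sup>2 * (\<eta> x)\<^sup>2)))"
      by (simp add: z_def power2_eq_square algebra_simps)
    also have "\<dots> = (LINT x:?I|lborel. (w x)\<^sup>2 - \<alpha>\<^sup>2 * (v x)\<^sup>2)
        + (LINT x:?I|lborel. 2 * \<epsilon> * (w x * f x - \<alpha>\<^sup>2 * (v x * \<eta> x)) + \<epsilon>\<^sup>2 * ((f x)\<^sup>2 - \<alpha>\<^sup>2 * (\<eta> x)\<^sup>2))"
      by (intro set_integral_add set_integrable_mult_right i1 i2 i3)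
    also have "(LINT x:?I|lborel. 2 * \<epsilon> * (w x * f x - \<alpha>\<^sup>2 * (v x * \<eta> x)) + \<epsilon>\<^sup>2 * ((f x)\<^sup>2 - \<alpha>\<^sup>2 * (\<eta> x)\<^sup>2))
      = (LINT x:?I|lborel. 2 * \<epsilon> * (w x * f x - \<alpha>\<^sup>2 * (v x * \<eta> x))) + (LINT x:?I|lborel. \<epsilon>\<^sup>2 * ((f x)\<^sup>2 - \<alpha>\<^sup>2 * (\<eta> x)\<^sup>2))"
      by (intro set_integral_add set_integrable_mult_right i2 i3)
    finally have e1: "(LINT x:?I|lborel. (w x + \<epsilon> * f x)\<^sup>2 - \<alpha>\<^sup>2 * (z x)\<^sup>2)
      = (LINT x:?I|lborel. (w x)\<^sup>2 - \<alpha>\<^sup>2 * (v x)\<^sup>2) + (2 * \<epsilon> * (LINT x:?I|lborel. w x * f x - \<alpha>\<^sup>2 * (v x * \<eta> x))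
         + \<epsilon>\<^sup>2 * (LINT x:?I|lborel. (f x)\<^sup>2 - \<alpha>\<^sup>2 * (\<eta> x)\<^sup>2))" by simp
    have "(LINT x:?I|lborel. z x * cos x) = (LINT x:?I|lborel. v x * cos x + \<epsilon> * (\<eta> x * cos x))"
      by (simp add: z_def algebra_simps)
    also have "\<dots> = (LINT x:?I|lborel. v x * cos x) + (LINT x:?I|lborel. \<epsilon> * (\<eta> x * cos x))"
      by (intro set_integral_add set_integrable_continuous_UNIV continuous_intros cv c\<eta>)
    finally show ?thesis using le e1 by (simp add: L_def R_def algebra_simps)
  qed
  moreover have "0 < v y / B" using pos B(1) by simp
  ultimately have L0: "L = 0" using quadratic_nonneg_imp_linear_coeff_0 by blast
  have fint: "(LINT x:?I|lborel. f x) = 0"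
    using primitive_on_diff_eq[OF f\<eta>, of 0 0 "2*pi" "2*pi"] circle_fun_2pi[OF p\<eta>] by simp
  have fi: "set_integrable lborel ?I f" by (rule primitive_on_integrable[OF f\<eta>])
  have Hf: "set_integrable lborel ?I (\<lambda>x. H x * f x)"
    using set_integrable_mult_continuous[OF fi, of H] continuous_on_subset[OF cH] by (simp add: mult.commute)
  have "(LINT x:?I|lborel. h x * \<eta> x + H x * f x) = 0"
    using primitive_on_integral_mult[OF Hp f\<eta>, of 0 "2*pi"] circle_fun_2pi[OF p\<eta>] circle_fun_2pi[OF pH]
    by simp
  then have "(LINT x:?I|lborel. h x * \<eta> x) + (LINT x:?I|lborel. H x * f x) = 0"
    using Hf by (subst (asm) set_integral_add) (auto intro!: set_integrable_continuous_UNIV continuous_intros ch c\<eta>)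
  moreover have "(LINT x:?I|lborel. h x * \<eta> x) = (LINT x:?I|lborel. \<alpha>\<^sup>2 * (v x * \<eta> x) + \<eta> x * cos x - C * \<eta> x)"
    by (simp add: h_def h\<^sub>0_def algebra_simps)
  moreover have "\<dots> = (LINT x:?I|lborel. \<alpha>\<^sup>2 * (v x * \<eta> x) + \<eta> x * cos x) - (LINT x:?I|lborel. C * \<eta> x)"
    by (intro set_integral_diff set_integrable_continuous_UNIV continuous_intros cv c\<eta>)
  moreover have "(LINT x:?I|lborel. \<alpha>\<^sup>2 * (v x * \<eta> x) + \<eta> x * cos x)
      = (LINT x:?I|lborel. \<alpha>\<^sup>2 * (v x * \<eta> x)) + (LINT x:?I|lborel. \<eta> x * cos x)"
    by (intro set_integral_add set_integrable_continuous_UNIV continuous_intros cv c\<eta>)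
  moreover have "(LINT x:?I|lborel. w x * f x - \<alpha>\<^sup>2 * (v x * \<eta> x))
      = (LINT x:?I|lborel. w x * f x) - (LINT x:?I|lborel. \<alpha>\<^sup>2 * (v x * \<eta> x))"
    by (intro set_integral_diff wf set_integrable_continuous_UNIV continuous_intros cv c\<eta>)
  ultimately have "(LINT x:?I|lborel. w x * f x) + (LINT x:?I|lborel. H x * f x) = 0"
    using L0 \<eta>0 by (simp add: L_def)
  then have "(LINT x:?I|lborel. w x * f x + H x * f x) = 0"
    using wf Hf by (subst set_integral_add) auto
  \<comment> \<open>Since \<open>w + H = f + m\<close> and \<open>f\<close> has integral 0, the
    vanishing first variation reduces to the square integral of \<open>f\<close>.\<close>
  moreover have "(LINT x:?I|lborel. w x * f x + H x * f x) = (LINT x:?I|lborel. (f x)\<^sup>2 + m * f x)"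
    by (simp add: f_def power2_eq_square algebra_simps)
  moreover have "\<dots> = (LINT x:?I|lborel. (f x)\<^sup>2) + (LINT x:?I|lborel. m * f x)"
    by (intro set_integral_add f2 set_integrable_mult_right fi)
  ultimately have f20: "(LINT x:?I|lborel. (f x)\<^sup>2) = 0" using fint by simp
  \<comment> \<open>A derivative with vanishing square integral leaves \<eta> constant; hence
    \<open>v\<close> is a constant minus \<open>P\<close>, which is twice differentiable.\<close>
  have \<eta>I: "\<eta> x = \<eta> 0" if "x \<in> ?I" for x
  proof -
    have "\<bar>LINT z:{0..x}|lborel. f z\<bar> \<le> sqrt (measure lborel {0..x}) * sqrt (LINT x:?I|lborel. (f x)\<^sup>2)"
      by (rule set_integral_abs_le_sqrt_measure[OF fi f2]) (use that in auto)
    then have "(LINT z:{0..x}|lborel. f z) = 0" using f20 by simp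
    then show ?thesis using primitive_on_diff_eq[OF f\<eta>, of 0 0 x "2*pi"] that by simp
  qed
  have "\<eta> x = \<eta> 0" for x
  proof -
    obtain z where "z \<in> ?I" "\<eta> z = \<eta> x" using circle_fun_reduce[OF p\<eta>] by blast
    then show ?thesis using \<eta>I by metis
  qed
  then have veq: "v = (\<lambda>x. \<eta> 0 + c - P x)" by (auto simp: \<eta>_def fun_eq_iff algebra_simps) 
  show ?thesis
  proof (rule that[of "\<lambda>x. m - H x" C])
    show "(v has_real_derivative m - H x) (at x)" for x
      by (subst veq) (auto intro!: derivative_eq_intros P)
    show "((\<lambda>x. m - H x) has_real_derivative C - \<alpha>\<^sup>2 * v x - cos x) (at x)" for x
      by (auto intro!: derivative_eq_intros H simp: h_def h\<^sub>0_def)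
  qed
qed

text \<open>Wirtinger's inequality for \<open>u\<close> minus its mean bounds the negative quadratic
  term by \<alpha>^2 times the Dirichlet integral, up to the explicit M^2 term, and nonnegativity of
  \<open>u\<close> bounds the potential term by \<open>M\<close>.\<close>

lemma energy_coercive:
  assumes u: "u \<in> H1" "\<And>x. 0 \<le> u x" "circle_int u = M" and \<alpha>: "0 < \<alpha>" "\<alpha> < 1"
    and E: "energy \<alpha> u \<le> ereal E"
  shows "(1 - \<alpha>\<^sup>2) * (LINT x:{0..2*pi}|lborel. (weak_deriv u x)\<^sup>2) \<le> 2 * E + 2 * M + \<alpha>\<^sup>2 * (M\<^sup>2 / (2 * pi))"
proof -
  let ?I = "{0..2*pi}"
  obtain U where U: "\<And>a b. primitive_on a b (weak_deriv u) U" "AE x in lborel. u x = U x" "circle_fun U"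
    using H1_primitive[OF u(1)] by blast
  have cU: "continuous_on UNIV U" by (rule primitive_on_continuous_UNIV[OF U(1)])
  note [measurable] = weak_deriv_measurable[OF u(1)] L2_measurable[OF H1_L2[OF u(1)]]
    borel_measurable_continuous_onI[OF cU]
  define a where "a = M / (2 * pi)"
  have UM: "(LINT x:?I|lborel. U x) = M"
    unfolding u(3)[symmetric] circle_int_def
    by (rule set_lebesgue_integral_cong_AE') (use U(2) in \<open>auto elim: eventually_mono\<close>)
  then have mean: "(LINT x:?I|lborel. U x - a) = 0"
    by (subst set_integral_diff) (auto intro: set_integrable_continuous_UNIV cU simp: set_integral_const_Icc a_def)
  have W: "(LINT x:?I|lborel. (U x - a)\<^sup>2) \<le> (LINT x:?I|lborel. (weak_deriv u x)\<^sup>2)"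
  proof (rule wirtinger_circle[OF _ _ _ H1_weak_deriv(2)[OF u(1)] mean])
    show "primitive_on b c (weak_deriv u) (\<lambda>x. U x - a)" for b c
      using primitive_on_diff[OF U(1) primitive_on_const[of b c a]] by simp
  qed (use U(3) in \<open>auto simp: circle_fun_def\<close>)
  have "(LINT x:?I|lborel. (U x - a)\<^sup>2) = (LINT x:?I|lborel. (U x)\<^sup>2 - (2 * a * (U x - a) + a\<^sup>2))"
    by (simp add: power2_eq_square algebra_simps)
  also have "\<dots> = (LINT x:?I|lborel. (U x)\<^sup>2) - (LINT x:?I|lborel. 2 * a * (U x - a) + a\<^sup>2)"
    by (intro set_integral_diff set_integrable_continuous_UNIV continuous_intros cU)
  also have "(LINT x:?I|lborel. 2 * a * (U x - a) + a\<^sup>2) = (LINT x:?I|lborel. 2 * a * (U x - a)) + (LINT x:?I|lborel. a\<^sup>2)"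
    by (intro set_integral_add set_integrable_continuous_UNIV continuous_intros cU)
  finally have "(LINT x:?I|lborel. (U x - a)\<^sup>2) = (LINT x:?I|lborel. (U x)\<^sup>2) - 2 * pi * a\<^sup>2"
    using mean by (simp add: set_integral_const_Icc)
  moreover have "2 * pi * a\<^sup>2 = M\<^sup>2 / (2 * pi)" by (simp add: a_def power2_eq_square)
  ultimately have U2: "(LINT x:?I|lborel. (U x)\<^sup>2) \<le> (LINT x:?I|lborel. (weak_deriv u x)\<^sup>2) + M\<^sup>2 / (2 * pi)"
    using W by simp
  have uU: "(LINT x:?I|lborel. (u x)\<^sup>2) = (LINT x:?I|lborel. (U x)\<^sup>2)"
    by (rule set_lebesgue_integral_cong_AE') (use U(2) in \<open>auto elim: eventually_mono\<close>)
  have u2: "set_integrable lborel ?I (\<lambda>x. (u x)\<^sup>2)" using H1_L2[OF u(1)] by (simp add: L2_def)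
  have ucos: "(LINT x:?I|lborel. u x * cos x) = (LINT x:?I|lborel. U x * cos x)"
    by (rule set_lebesgue_integral_cong_AE') (use U(2) in \<open>auto elim: eventually_mono\<close>)
  have U0: "AE x in lborel. 0 \<le> U x" using U(2) by eventually_elim (use u(2) in metis)
  have "(LINT x:?I|lborel. U x * cos x) \<le> (LINT x:?I|lborel. U x)"
  proof (rule set_integral_mono_AE)
    show "AE x\<in>?I in lborel. U x * cos x \<le> U x" using U0 by eventually_elim (simp add: mult_left_le)
  qed (auto intro!: set_integrable_continuous_UNIV continuous_intros cU)
  then have C: "(LINT x:?I|lborel. u x * cos x) \<le> M" using ucos UM by simp
  have "energy \<alpha> u = ereal (1/2 * (LINT x:?I|lborel. (weak_deriv u x)\<^sup>2 - \<alpha>\<^sup>2 * (u x)\<^sup>2) - (LINT x:?I|lborel. u x * cos x))"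
    by (rule energy_eq[OF u(1) H1_weak_deriv(1)[OF u(1)]])
  moreover have "(LINT x:?I|lborel. (weak_deriv u x)\<^sup>2 - \<alpha>\<^sup>2 * (u x)\<^sup>2)
      = (LINT x:?I|lborel. (weak_deriv u x)\<^sup>2) - (LINT x:?I|lborel. \<alpha>\<^sup>2 * (u x)\<^sup>2)"
    by (intro set_integral_diff H1_weak_deriv(2)[OF u(1)] set_integrable_mult_right u2)
  ultimately have "1/2 * ((LINT x:?I|lborel. (weak_deriv u x)\<^sup>2) - \<alpha>\<^sup>2 * (LINT x:?I|lborel. (u x)\<^sup>2))
      - (LINT x:?I|lborel. u x * cos x) \<le> E" using E by simp
  moreover have "\<alpha>\<^sup>2 * (LINT x:?I|lborel. (u x)\<^sup>2) \<le> \<alpha>\<^sup>2 * ((LINT x:?I|lborel. (weak_deriv u x)\<^sup>2) + M\<^sup>2 / (2 * pi))"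
    unfolding uU by (rule mult_left_mono[OF U2]) simp
  ultimately show ?thesis using C by (simp add: algebra_simps)
qed

subsection \<open>Integrals over rectangles\<close>

lemma set_integral_prod:
  fixes h :: "real \<times> real \<Rightarrow> real"
  assumes AB: "A \<in> sets borel" "B \<in> sets borel" and h: "set_integrable lborel (A \<times> B) h"
  shows "(LINT z:A \<times> B|lborel. h z) = (LINT t:A|lborel. (LINT x:B|lborel. h (t, x)))"
    and "set_integrable lborel A (\<lambda>t. LINT x:B|lborel. h (t, x))"
    and "AE t in lborel. t \<in> A \<longrightarrow> set_integrable lborel B (\<lambda>x. h (t, x))"
    and "(LINT z:A \<times> B|lborel. h z) = (LINT x:B|lborel. (LINT t:A|lborel. h (t, x)))"
    and "set_integrable lborel B (\<lambda>x. LINT t:A|lborel. h (t, x))"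
proof -
  define k where "k = (\<lambda>z. indicator (A \<times> B) z *\<^sub>R h z)"
  have k: "integrable (lborel \<Otimes>\<^sub>M lborel) k"
    using h by (simp add: k_def set_integrable_def lborel_prod)
  have kt: "k (t, x) = indicator A t *\<^sub>R (indicator B x *\<^sub>R h (t, x))" for t x
    by (simp add: k_def indicator_def)
  have i1: "(\<integral>x. k (t, x) \<partial>lborel) = indicator A t *\<^sub>R (LINT x:B|lborel. h (t, x))" for t
    by (simp add: kt set_lebesgue_integral_def)
  have i2: "(\<integral>t. k (t, x) \<partial>lborel) = indicator B x *\<^sub>R (LINT t:A|lborel. h (t, x))" for x
  proof -
    have "k (t, x) = indicator B x *\<^sub>R (indicator A t *\<^sub>R h (t, x))" for t
      by (auto simp: k_def indicator_def)
    then show ?thesis by (simp add: set_lebesgue_integral_def)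
  qed
  have tot: "(LINT z:A \<times> B|lborel. h z) = (\<integral>z. k z \<partial>(lborel \<Otimes>\<^sub>M lborel))"
    by (simp add: set_lebesgue_integral_def k_def lborel_prod)
  show "(LINT z:A \<times> B|lborel. h z) = (LINT t:A|lborel. (LINT x:B|lborel. h (t, x)))"
    using lborel_pair.integral_fst'[OF k] unfolding tot i1 by (simp add: set_lebesgue_integral_def)
  show "set_integrable lborel A (\<lambda>t. LINT x:B|lborel. h (t, x))"
    using lborel_pair.integrable_fst'[OF k] unfolding i1 by (simp add: set_integrable_def)
  show "AE t in lborel. t \<in> A \<longrightarrow> set_integrable lborel B (\<lambda>x. h (t, x))"
    using lborel_pair.AE_integrable_fst'[OF k]
    by eventually_elim (auto simp: set_integrable_def kt)
  have k': "integrable (lborel \<Otimes>\<^sub>M lborel) (\<lambda>(t, x). k (t, x))" using k by simp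
  show "(LINT z:A \<times> B|lborel. h z) = (LINT x:B|lborel. (LINT t:A|lborel. h (t, x)))"
    using lborel_pair.integral_snd[OF k'] unfolding tot i2 by (simp add: set_lebesgue_integral_def)
  show "set_integrable lborel B (\<lambda>x. LINT t:A|lborel. h (t, x))"
    using lborel_pair.integrable_snd[OF k'] unfolding i2 by (simp add: set_integrable_def)
qed

section \<open>Approximation and translation of square-integrable functions\<close>

lemma set_square_integrable_imp_integrable:
  fixes f :: "'a::euclidean_space \<Rightarrow> real"
  assumes f: "f \<in> borel_measurable borel" "set_integrable lborel S (\<lambda>x. (f x)\<^sup>2)"
    and S: "S \<in> sets borel" "bounded S"
  shows "set_integrable lborel S f"
proof -
  have "set_integrable lborel S (\<lambda>x. 1::real)"
    unfolding set_integrable_def using emeasure_bounded_finite[OF S(2)] S(1) by simp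
  then have "set_integrable lborel S (\<lambda>x. f x * 1)"
    using f S by (intro set_square_integrable_mult(1)) (auto simp: set_borel_measurable_def)
  then show ?thesis by simp
qed

lemma set_integrable_bounded:
  fixes f :: "'a::euclidean_space \<Rightarrow> real"
  assumes f: "f \<in> borel_measurable borel" "\<And>x. x \<in> S \<Longrightarrow> \<bar>f x\<bar> \<le> B"
    and S: "S \<in> sets borel" "bounded S"
  shows "set_integrable lborel S f"
  unfolding set_integrable_def
proof (rule Bochner_Integration.integrable_bound)
  show "integrable lborel (\<lambda>x. B * indicator S x)"
    using emeasure_bounded_finite[OF S(2)] S(1) by simp
  show "AE x in lborel. norm (indicator S x *\<^sub>R f x) \<le> norm (B * indicator S x)"
    using f(2) by (intro AE_I2) (auto simp: indicator_def intro: order_trans[OF _ abs_ge_self])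
  show "(\<lambda>x. indicator S x *\<^sub>R f x) \<in> borel_measurable lborel" using f(1) S(1) by simp
qed

lemma AE_lborel_if_negligible:
  assumes "negligible N" "\<And>x. x \<notin> N \<Longrightarrow> P x" shows "AE x in lborel. P x"
proof -
  have "AE x in lebesgue. x \<notin> N" using assms(1) by (intro AE_not_in) (simp add: negligible_iff_null_sets)
  then have "AE x in lborel. x \<notin> N" by (simp add: AE_completion_iff)
  then show ?thesis by eventually_elim (rule assms(2))
qed

text \<open>Truncation at a height \<open>k\<close> costs little; the truncated function is a limit
  almost everywhere of continuous functions, and clamping these to the same height makes dominated
  convergence applicable on the bounded set.\<close>

lemma square_integrable_continuous_approx:
  fixes f :: "'a::euclidean_space \<Rightarrow> real"
  assumes f: "f \<in> borel_measurable borel" "set_integrable lborel S (\<lambda>x. (f x)\<^sup>2)"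
    and S: "S \<in> sets borel" "bounded S" and e: "0 < e"
  obtains g where "continuous_on UNIV g" "set_integrable lborel S (\<lambda>x. (f x - g x)\<^sup>2)"
    "(LINT x:S|lborel. (f x - g x)\<^sup>2) < e"
proof -
  note [measurable] = f(1) S(1)
  define clamp where "clamp = (\<lambda>k y. max (- real k) (min (real k) y))"
  have [measurable]: "(\<lambda>x. clamp k (h x)) \<in> borel_measurable borel" if "h \<in> borel_measurable borel" for k and h :: "'a \<Rightarrow> real"
    using that unfolding clamp_def by measurable
  have f2: "integrable lborel (\<lambda>x. indicator S x * (f x)\<^sup>2)" using f(2) by (simp add: set_integrable_def)
  have clamp_le: "\<bar>y - clamp k y\<bar> \<le> \<bar>y\<bar>" for k y by (auto simp: clamp_def)
  have sq: "(f x - clamp k (f x))\<^sup>2 \<le> (f x)\<^sup>2" for k x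
    using clamp_le[of "f x" k] by (simp add: abs_le_square_iff)
  have ik: "set_integrable lborel S (\<lambda>x. (f x - clamp k (f x))\<^sup>2)" for k
    by (rule set_integrable_bound[OF f(2)]) (use sq in \<open>auto simp: set_borel_measurable_def\<close>)
  have "(\<lambda>k. LINT x:S|lborel. (f x - clamp k (f x))\<^sup>2) \<longlonglongrightarrow> (\<integral>x. 0 \<partial>(lborel :: 'a measure))"
    unfolding set_lebesgue_integral_def
  proof (rule integral_dominated_convergence[OF _ _ f2])
    show "AE x in lborel. (\<lambda>k. indicator S x *\<^sub>R (f x - clamp k (f x))\<^sup>2) \<longlonglongrightarrow> 0"
    proof (rule AE_I2)
      fix x
      obtain N :: nat where N: "\<bar>f x\<bar> \<le> real N" using real_arch_simple by blast
      have "eventually (\<lambda>k. indicator S x *\<^sub>R (f x - clamp k (f x))\<^sup>2 = 0) sequentially"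
        using eventually_ge_at_top[of N]
      proof eventually_elim
        case (elim k)
        then have "real N \<le> real k" by simp
        then have "clamp k (f x) = f x" using N by (auto simp: clamp_def)
        then show ?case by simp
      qed
      then show "(\<lambda>k. indicator S x *\<^sub>R (f x - clamp k (f x))\<^sup>2) \<longlonglongrightarrow> 0" by (rule tendsto_eventually)
    qed
    show "AE x in lborel. norm (indicator S x *\<^sub>R (f x - clamp k (f x))\<^sup>2) \<le> indicator S x * (f x)\<^sup>2" for k
      using sq by (intro AE_I2) (auto simp: indicator_def)
  qed measurable
  then have "eventually (\<lambda>k. (LINT x:S|lborel. (f x - clamp k (f x))\<^sup>2) < e / 4) sequentially"
    using e by (intro order_tendstoD(2)) auto
  then obtain k where k: "(LINT x:S|lborel. (f x - clamp k (f x))\<^sup>2) < e / 4"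
    by (auto simp: eventually_sequentially)
  define fk where "fk = (\<lambda>x. clamp k (f x))"
  have [measurable]: "fk \<in> borel_measurable borel" unfolding fk_def by measurable
  have "fk \<in> borel_measurable lebesgue"
    using \<open>fk \<in> borel_measurable borel\<close> by (intro measurable_completion) simp
  then have "fk measurable_on UNIV" by (intro lebesgue_measurable_imp_measurable_on) auto
  \<comment> \<open>Measurability in the sense of \<open>measurable_on\<close> is approximability by
    continuous functions off a negligible set.\<close>
  then obtain N g where N: "negligible N" and cg: "\<And>n. continuous_on UNIV (g n)"
    and lim: "\<And>x. x \<notin> N \<Longrightarrow> (\<lambda>n. g n x) \<longlonglongrightarrow> fk x"
    unfolding measurable_on_def by auto
  define G where "G = (\<lambda>n x. clamp k (g n x))"
  have cG: "continuous_on UNIV (G n)" for n unfolding G_def clamp_def by (intro continuous_intros cg)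
  have [measurable]: "G n \<in> borel_measurable borel" for n by (rule borel_measurable_continuous_onI[OF cG])
  have "\<bar>fk x - G n x\<bar> \<le> 2 * real k" for x n by (auto simp: fk_def G_def clamp_def)
  then have Gb2: "(fk x - G n x)\<^sup>2 \<le> (2 * real k)\<^sup>2" for x n
    by (metis abs_ge_zero power2_abs power_mono)
  have iG: "set_integrable lborel S (\<lambda>x. (fk x - G n x)\<^sup>2)" for n
    by (rule set_integrable_bounded[where B = "(2 * real k)\<^sup>2"]) (use S Gb2 in auto)
  have "(\<lambda>n. LINT x:S|lborel. (fk x - G n x)\<^sup>2) \<longlonglongrightarrow> (\<integral>x. 0 \<partial>(lborel :: 'a measure))"
    unfolding set_lebesgue_integral_def
  proof (rule integral_dominated_convergence)
    show "integrable lborel (\<lambda>x. (2 * real k)\<^sup>2 * indicat_real S x)"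
      using emeasure_bounded_finite[OF S(2)] S(1) by simp
    show "AE x in lborel. (\<lambda>n. indicator S x *\<^sub>R (fk x - G n x)\<^sup>2) \<longlonglongrightarrow> 0"
    proof (rule AE_lborel_if_negligible[OF N])
      fix x assume x: "x \<notin> N"
      have "(\<lambda>n. G n x) \<longlonglongrightarrow> clamp k (fk x)" unfolding G_def clamp_def by (intro tendsto_intros lim x)
      also have "clamp k (fk x) = fk x" by (auto simp: fk_def clamp_def)
      finally have "(\<lambda>n. indicator S x *\<^sub>R (fk x - G n x)\<^sup>2) \<longlonglongrightarrow> indicator S x *\<^sub>R (fk x - fk x)\<^sup>2"
        by (intro tendsto_intros)
      then show "(\<lambda>n. indicator S x *\<^sub>R (fk x - G n x)\<^sup>2) \<longlonglongrightarrow> 0" by simp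
    qed
    show "AE x in lborel. norm (indicator S x *\<^sub>R (fk x - G n x)\<^sup>2) \<le> (2 * real k)\<^sup>2 * indicat_real S x" for n
      using Gb2 by (intro AE_I2) (auto simp: indicator_def)
  qed measurable
  then have "eventually (\<lambda>n. (LINT x:S|lborel. (fk x - G n x)\<^sup>2) < e / 4) sequentially"
    using e by (intro order_tendstoD(2)) auto
  then obtain n where n: "(LINT x:S|lborel. (fk x - G n x)\<^sup>2) < e / 4"
    by (auto simp: eventually_sequentially)
  have ik': "set_integrable lborel S (\<lambda>x. (f x - fk x)\<^sup>2)" using ik by (simp add: fk_def)
  have ptw: "(f x - G n x)\<^sup>2 \<le> 2 * (f x - fk x)\<^sup>2 + 2 * (fk x - G n x)\<^sup>2" for x
    using sum_squares_bound[of "f x - fk x" "fk x - G n x"] by (simp add: power2_eq_square algebra_simps)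
  have "set_integrable lborel S (\<lambda>x. 2 * (f x - fk x)\<^sup>2 + 2 * (fk x - G n x)\<^sup>2)"
    by (intro set_integral_add set_integrable_mult_right ik' iG)
  note B = this
  have iF: "set_integrable lborel S (\<lambda>x. (f x - G n x)\<^sup>2)"
    by (rule set_integrable_bound[OF B]) (use ptw in \<open>auto simp: set_borel_measurable_def intro: order_trans[OF _ abs_ge_self]\<close>)
  have "(LINT x:S|lborel. (f x - G n x)\<^sup>2) \<le> (LINT x:S|lborel. 2 * (f x - fk x)\<^sup>2 + 2 * (fk x - G n x)\<^sup>2)"
    by (rule set_integral_mono[OF iF B ptw])
  also have "\<dots> = (LINT x:S|lborel. 2 * (f x - fk x)\<^sup>2) + (LINT x:S|lborel. 2 * (fk x - G n x)\<^sup>2)"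
    by (intro set_integral_add set_integrable_mult_right ik' iG)
  also have "\<dots> < e" using k n by (simp add: fk_def)
  finally show ?thesis using that[OF cG iF] by blast
qed

lemma set_integral_translate:
  fixes f :: "'a::euclidean_space \<Rightarrow> real"
  assumes [measurable]: "f \<in> borel_measurable borel" "S \<in> sets borel"
  shows "(LINT z:{z. z + c \<in> S}|lborel. f (z + c)) = (LINT z:S|lborel. f z)"
    and "set_integrable lborel {z. z + c \<in> S} (\<lambda>z. f (z + c)) \<longleftrightarrow> set_integrable lborel S f"
proof -
  have e: "indicat_real S (c + z) *\<^sub>R f (c + z) = indicator {z. z + c \<in> S} z *\<^sub>R f (z + c)" for z
    by (auto simp: indicator_def add.commute)
  have "(LINT z:S|lborel. f z) = (\<integral>z. indicator S z *\<^sub>R f z \<partial>distr lborel borel ((+) c))"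
    unfolding set_lebesgue_integral_def by (subst lborel_distr_plus) simp
  also have "\<dots> = (\<integral>z. indicat_real S (c + z) *\<^sub>R f (c + z) \<partial>lborel)" by (subst integral_distr) auto
  finally show "(LINT z:{z. z + c \<in> S}|lborel. f (z + c)) = (LINT z:S|lborel. f z)"
    by (simp only: e set_lebesgue_integral_def)
  have "set_integrable lborel S f \<longleftrightarrow> integrable (distr lborel borel ((+) c)) (\<lambda>z. indicator S z *\<^sub>R f z)"
    unfolding set_integrable_def by (subst lborel_distr_plus) simp
  also have "\<dots> \<longleftrightarrow> integrable lborel (\<lambda>z. indicat_real S (c + z) *\<^sub>R f (c + z))"
    by (subst integrable_distr_eq) auto
  finally show "set_integrable lborel {z. z + c \<in> S} (\<lambda>z. f (z + c)) \<longleftrightarrow> set_integrable lborel S f"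
    by (simp only: e set_integrable_def)
qed

lemma bounded_rectangle: "bounded ({a..b} \<times> {c..d} :: (real \<times> real) set)"
  by (intro bounded_Times) auto

lemma rectangle_borel [measurable]: "{a..b} \<times> {c..d} \<in> sets (borel :: (real \<times> real) measure)"
  by (intro borel_closed closed_Times) auto

text \<open>Translations go back in time by at most 1, so the rectangle is enlarged by 1 on the
  left; this is the origin of the offset between \<open>T\<close> and \<open>T + 1\<close> in the
  energy balance.\<close>

lemma translation_square_integrable:
  fixes f :: "real \<times> real \<Rightarrow> real"
  assumes f: "f \<in> borel_measurable borel" "set_integrable lborel ({a - 1..b} \<times> {c..d}) (\<lambda>z. (f z)\<^sup>2)"
    and \<theta>: "0 \<le> \<theta>" "\<theta> \<le> 1"
  shows "set_integrable lborel ({a..b} \<times> {c..d}) (\<lambda>z. (f (z + (- \<theta>, 0)))\<^sup>2)"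
    and "(LINT z:{a..b} \<times> {c..d}|lborel. (f (z + (- \<theta>, 0)))\<^sup>2) \<le> (LINT z:{a - 1..b} \<times> {c..d}|lborel. (f z)\<^sup>2)"
proof -
  note [measurable] = f(1)
  let ?S = "{a..b} \<times> {c..d}" and ?R = "{a - \<theta>..b - \<theta>} \<times> {c..d}" and ?S' = "{a - 1..b} \<times> {c..d}"
  have sub: "?R \<subseteq> ?S'" using \<theta> by auto
  have pre: "{z. z + (- \<theta>, 0) \<in> ?R} = ?S" by auto
  have iR: "set_integrable lborel ?R (\<lambda>z. (f z)\<^sup>2)"
    by (rule set_integrable_subset[OF f(2) _ sub]) simp
  have m2: "(\<lambda>z. (f z)\<^sup>2) \<in> borel_measurable borel" by measurable
  note tr = set_integral_translate[OF m2 rectangle_borel, of "(- \<theta>, 0)" "a - \<theta>" "b - \<theta>" c d, unfolded pre]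
  show "set_integrable lborel ?S (\<lambda>z. (f (z + (- \<theta>, 0)))\<^sup>2)" using tr(2) iR by simp
  have "(LINT z:?R|lborel. (f z)\<^sup>2) \<le> (LINT z:?S'|lborel. (f z)\<^sup>2)"
    unfolding set_lebesgue_integral_def
    by (rule integral_mono) (use iR f(2) sub in \<open>auto simp: set_integrable_def indicator_def\<close>)
  then show "(LINT z:?S|lborel. (f (z + (- \<theta>, 0)))\<^sup>2) \<le> (LINT z:?S'|lborel. (f z)\<^sup>2)" using tr(1) by simp
qed

text \<open>With a uniformly continuous approximant \<open>g\<close> the difference splits into the
  translated error, the oscillation of \<open>g\<close> and the plain error. Each has square
  integral at most e/12 and enters with weight 3.\<close>

lemma translation_continuous:
  fixes f :: "real \<times> real \<Rightarrow> real"
  assumes f: "f \<in> borel_measurable borel" "set_integrable lborel ({a - 1..b} \<times> {c..d}) (\<lambda>z. (f z)\<^sup>2)"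
    and e: "0 < e"
  obtains \<delta> where "0 < \<delta>" "\<delta> \<le> 1"
    "\<And>\<theta>. 0 \<le> \<theta> \<Longrightarrow> \<theta> < \<delta> \<Longrightarrow> (LINT z:{a..b} \<times> {c..d}|lborel. (f (z + (- \<theta>, 0)) - f z)\<^sup>2) < e"
proof -
  let ?S = "{a..b} \<times> {c..d}" and ?S' = "{a - 1..b} \<times> {c..d}"
  obtain g where g: "continuous_on UNIV g" "set_integrable lborel ?S' (\<lambda>z. (f z - g z)\<^sup>2)"
    "(LINT z:?S'|lborel. (f z - g z)\<^sup>2) < e / 12"
    by (rule square_integrable_continuous_approx[OF f rectangle_borel bounded_rectangle, of "e / 12"]) (use e in auto)
  have gm: "g \<in> borel_measurable borel" by (rule borel_measurable_continuous_onI[OF g(1)])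
  note [measurable] = f(1) gm
  define \<mu> where "\<mu> = measure lborel ?S"
  \<comment> \<open>Chosen so that \<omega>^2 \<mu> is at most e/12; the summand 1 covers rectangles
    of measure 0.\<close>
  define \<omega> where "\<omega> = sqrt (e / (12 * (\<mu> + 1)))"
  have \<mu>: "0 \<le> \<mu>" by (simp add: \<mu>_def)
  have \<omega>: "0 < \<omega>" "\<omega>\<^sup>2 * \<mu> \<le> e / 12" 
  proof -
    show "0 < \<omega>" using e \<mu> by (simp add: \<omega>_def)
    have "\<omega>\<^sup>2 = e / (12 * (\<mu> + 1))" using e \<mu> by (simp add: \<omega>_def)
    then have "\<omega>\<^sup>2 * \<mu> = (e / 12) * (\<mu> / (\<mu> + 1))" by simp
    also have "\<dots> \<le> (e / 12) * 1" using e \<mu> by (intro mult_left_mono) auto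
    finally show "\<omega>\<^sup>2 * \<mu> \<le> e / 12" by simp
  qed
  have "uniformly_continuous_on ?S' g"
    by (intro compact_uniformly_continuous continuous_on_subset[OF g(1)] compact_Times) auto
  then obtain d\<^sub>0 where d0: "d\<^sub>0 > 0" "\<And>y z. y \<in> ?S' \<Longrightarrow> z \<in> ?S' \<Longrightarrow> dist z y < d\<^sub>0 \<Longrightarrow> dist (g z) (g y) < \<omega>"
    using \<omega>(1) unfolding uniformly_continuous_on_def by metis
  have "(LINT z:?S|lborel. (f (z + (- \<theta>, 0)) - f z)\<^sup>2) < e" if \<theta>: "0 \<le> \<theta>" "\<theta> < min 1 d\<^sub>0" for \<theta>
  proof -
    let ?s = "\<lambda>z. z + (- \<theta>, 0) :: real \<times> real"
    have \<theta>1: "\<theta> \<le> 1" using \<theta> by simp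
    have fg: "(\<lambda>z. f z - g z) \<in> borel_measurable borel" by measurable
    note T = translation_square_integrable[OF fg g(2) \<theta>(1) \<theta>1]
    have SS': "?S \<subseteq> ?S'" by auto
    have i3: "set_integrable lborel ?S (\<lambda>z. (f z - g z)\<^sup>2)" by (rule set_integrable_subset[OF g(2) _ SS']) simp
    have le3: "(LINT z:?S|lborel. (f z - g z)\<^sup>2) \<le> (LINT z:?S'|lborel. (f z - g z)\<^sup>2)"
      unfolding set_lebesgue_integral_def
      by (rule integral_mono) (use i3 g(2) SS' in \<open>auto simp: set_integrable_def indicator_def\<close>)
    have gw: "(g (?s z) - g z)\<^sup>2 \<le> \<omega>\<^sup>2" if z: "z \<in> ?S" for z
    proof -
      have "dist (g (?s z)) (g z) < \<omega>"
        by (rule d0(2)) (use z \<theta> in \<open>auto simp: dist_prod_def dist_real_def\<close>)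
      then show ?thesis by (simp add: dist_real_def abs_le_square_iff[symmetric] less_imp_le)
    qed
    have [measurable]: "(\<lambda>z. g (?s z)) \<in> borel_measurable borel" by measurable
    have i2: "set_integrable lborel ?S (\<lambda>z. (g (?s z) - g z)\<^sup>2)"
      by (rule set_integrable_bounded[where B = "\<omega>\<^sup>2"]) (use gw bounded_rectangle in auto)
    have iw: "set_integrable lborel ?S (\<lambda>z. \<omega>\<^sup>2)"
      by (rule set_integrable_bounded[where B = "\<omega>\<^sup>2"]) (use bounded_rectangle in auto)
    have "(LINT z:?S|lborel. (g (?s z) - g z)\<^sup>2) \<le> (LINT z:?S|lborel. \<omega>\<^sup>2)"
      by (rule set_integral_mono[OF i2 iw gw])
    also have "\<dots> = \<omega>\<^sup>2 * \<mu>" by (simp add: set_lebesgue_integral_def \<mu>_def)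
    finally have le2: "(LINT z:?S|lborel. (g (?s z) - g z)\<^sup>2) \<le> e / 12" using \<omega>(2) by simp
    define A B D where "A = (\<lambda>z. (f (?s z) - g (?s z))\<^sup>2)" and "B = (\<lambda>z. (g (?s z) - g z)\<^sup>2)" and "D = (\<lambda>z. (f z - g z)\<^sup>2)"
    have iA: "set_integrable lborel ?S A" using T(1) by (simp add: A_def)
    have iBD: "set_integrable lborel ?S (\<lambda>z. B z + D z)" using i2 i3 by (simp add: B_def D_def)
    have ptw: "(f (?s z) - f z)\<^sup>2 \<le> 3 * (A z + (B z + D z))" for z
    proof -
      \<comment> \<open>The defect of the inequality is a sum of three squares.\<close>
      have "3 * (p\<^sup>2 + (q\<^sup>2 + r\<^sup>2)) - (p + q - r)\<^sup>2 = (p - q)\<^sup>2 + (p + r)\<^sup>2 + (q + r)\<^sup>2" for p q r :: real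
        by (simp add: power2_eq_square algebra_simps)
      moreover have "0 \<le> (p - q)\<^sup>2 + (p + r)\<^sup>2 + (q + r)\<^sup>2" for p q r :: real by simp
      ultimately have *: "(p + q - r)\<^sup>2 \<le> 3 * (p\<^sup>2 + (q\<^sup>2 + r\<^sup>2))" for p q r :: real by (metis diff_ge_0_iff_ge)
      show ?thesis using *[of "f (?s z) - g (?s z)" "g (?s z) - g z" "f z - g z"] by (simp add: A_def B_def D_def)
    qed
    have b3: "set_integrable lborel ?S (\<lambda>z. 3 * (A z + (B z + D z)))"
      by (intro set_integrable_mult_right set_integral_add(1) iA iBD)
    have "(LINT z:?S|lborel. (f (?s z) - f z)\<^sup>2) \<le> (LINT z:?S|lborel. 3 * (A z + (B z + D z)))"
    proof (rule set_integral_mono[OF _ b3 ptw])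
      show "set_integrable lborel ?S (\<lambda>z. (f (?s z) - f z)\<^sup>2)"
        by (rule set_integrable_bound[OF b3])
           (use ptw in \<open>auto simp: set_borel_measurable_def intro: order_trans[OF _ abs_ge_self]\<close>)
    qed
    also have "\<dots> = 3 * ((LINT z:?S|lborel. A z) + ((LINT z:?S|lborel. B z) + (LINT z:?S|lborel. D z)))"
    proof -
      have "(LINT z:?S|lborel. A z + (B z + D z)) = (LINT z:?S|lborel. A z) + (LINT z:?S|lborel. B z + D z)"
        by (rule set_integral_add(2)[OF iA iBD])
      moreover have "(LINT z:?S|lborel. B z + D z) = (LINT z:?S|lborel. B z) + (LINT z:?S|lborel. D z)"
        by (rule set_integral_add(2)) (use i2 i3 in \<open>auto simp: B_def D_def\<close>)
      moreover have "(LINT z:?S|lborel. 3 * (A z + (B z + D z))) = 3 * (LINT z:?S|lborel. A z + (B z + D z))"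
        by (rule set_integral_mult_right)
      ultimately show ?thesis by (simp only:)
    qed
    also have "\<dots> < e"
    proof -
      have "(LINT z:?S|lborel. A z) < e / 12" using T(2) g(3) by (simp add: A_def)
      moreover have "(LINT z:?S|lborel. B z) \<le> e / 12" using le2 by (simp add: B_def)
      moreover have "(LINT z:?S|lborel. D z) < e / 12" using le3 g(3) by (simp add: D_def)
      ultimately show ?thesis using e by argo
    qed
    finally show ?thesis .
  qed
  then show ?thesis using that[of "min 1 d\<^sub>0"] d0(1) by auto
qed

text \<open>Strong continuity of the translates of \<open>f\<close> and Cauchy-Schwarz against the
  fixed \<open>g\<close>.\<close>

lemma translation_correlation_continuous:
  fixes f g :: "real \<times> real \<Rightarrow> real"
  assumes f: "f \<in> borel_measurable borel" "set_integrable lborel ({a - 1..b} \<times> {c..d}) (\<lambda>z. (f z)\<^sup>2)"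
    and g: "g \<in> borel_measurable borel" "set_integrable lborel ({a..b} \<times> {c..d}) (\<lambda>z. (g z)\<^sup>2)"
    and e: "0 < e"
  obtains \<delta> where "0 < \<delta>" "\<delta> \<le> 1"
    "\<And>\<theta>. 0 \<le> \<theta> \<Longrightarrow> \<theta> < \<delta> \<Longrightarrow>
       \<bar>(LINT z:{a..b} \<times> {c..d}|lborel. f (z + (- \<theta>, 0)) * g z) - (LINT z:{a..b} \<times> {c..d}|lborel. f z * g z)\<bar> \<le> e"
proof -
  let ?S = "{a..b} \<times> {c..d}"
  note [measurable] = f(1) g(1)
  define G where "G = (LINT z:?S|lborel. (g z)\<^sup>2)"
  have G: "0 \<le> G" unfolding G_def by (rule set_integral_nonneg_real) simp
  \<comment> \<open>Its square root times the norm of \<open>g\<close> is at most \<open>e\<close>,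
    also when that norm is 0.\<close>
  define e' where "e' = (e / (sqrt G + 1))\<^sup>2"
  have G1: "0 < sqrt G + 1" using real_sqrt_ge_zero[OF G] by linarith
  then have "0 < e'" using e by (simp add: e'_def)
  then obtain \<delta> where \<delta>: "0 < \<delta>" "\<delta> \<le> 1"
    "\<And>\<theta>. 0 \<le> \<theta> \<Longrightarrow> \<theta> < \<delta> \<Longrightarrow> (LINT z:?S|lborel. (f (z + (- \<theta>, 0)) - f z)\<^sup>2) < e'"
    by (rule translation_continuous[OF f]) blast
  have "\<bar>(LINT z:?S|lborel. f (z + (- \<theta>, 0)) * g z) - (LINT z:?S|lborel. f z * g z)\<bar> \<le> e"
    if \<theta>: "0 \<le> \<theta>" "\<theta> < \<delta>" for \<theta>
  proof -
    let ?F = "\<lambda>z. f (z + (- \<theta>, 0))"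
    have i1: "set_integrable lborel ?S (\<lambda>z. (?F z)\<^sup>2)"
      by (rule translation_square_integrable(1)[OF f]) (use \<theta> \<delta>(2) in auto)
    have i2: "set_integrable lborel ?S (\<lambda>z. (f z)\<^sup>2)"
      by (rule set_integrable_subset[OF f(2)]) auto
    have i3: "set_integrable lborel ?S (\<lambda>z. (?F z - f z)\<^sup>2)"
      by (rule set_square_integrable_diff[OF _ _ _ i1 i2]) auto
    have p: "set_integrable lborel ?S (\<lambda>z. ?F z * g z)" "set_integrable lborel ?S (\<lambda>z. f z * g z)"
      by (rule set_square_integrable_mult(1)[OF _ _ i1 g(2)] set_square_integrable_mult(1)[OF _ _ i2 g(2)];
          simp add: set_borel_measurable_def)+
    have "\<bar>(LINT z:?S|lborel. ?F z * g z) - (LINT z:?S|lborel. f z * g z)\<bar> = \<bar>LINT z:?S|lborel. (?F z - f z) * g z\<bar>"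
      by (subst set_integral_diff(2)[OF p, symmetric]) (simp add: left_diff_distrib)
    also have "\<dots> \<le> sqrt (LINT z:?S|lborel. (?F z - f z)\<^sup>2) * sqrt G"
      unfolding G_def by (rule set_square_integrable_mult(2)[OF _ _ i3 g(2)]) (simp_all add: set_borel_measurable_def)
    also have "\<dots> \<le> sqrt e' * sqrt G"
      using \<delta>(3)[OF \<theta>] G by (intro mult_right_mono) auto
    also have "\<dots> = e * (sqrt G / (sqrt G + 1))" using e G1 by (simp add: e'_def)
    also have "\<dots> \<le> e * 1" using e G1 by (intro mult_left_mono) (auto simp: pos_divide_le_eq)
    finally show ?thesis by simp
  qed
  then show ?thesis using that \<delta>(1,2) by blast
qed

section \<open>Averages over small time shifts\<close>

lemma set_integral_reflect:
  fixes f :: "real \<Rightarrow> real"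
  shows "(LINT \<theta>:{0..h}|lborel. f (t - \<theta>)) = (LINT \<tau>:{t - h..t}|lborel. f \<tau>)"
proof -
  have "(LINT \<tau>:{t - h..t}|lborel. f \<tau>) = (\<integral>\<theta>. indicator {t - h..t} (t + - 1 * \<theta>) *\<^sub>R f (t + - 1 * \<theta>) \<partial>lborel)"
    unfolding set_lebesgue_integral_def by (subst lborel_integral_real_affine[of "-1" _ t]) auto
  also have "\<dots> = (LINT \<theta>:{0..h}|lborel. f (t - \<theta>))"
    unfolding set_lebesgue_integral_def
    by (intro Bochner_Integration.integral_cong) (auto simp: indicator_def)
  finally show ?thesis by simp
qed

text \<open>Fubini in (\<theta>, z) with the substitution \<tau> = t - \<theta>: pairing the time
  integral over [t - h, t] with \<open>g\<close> amounts to integrating correlations over the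
  shifts. Cauchy-Schwarz on each slice bounds the absolute integrals by \<open>N\<close>, uniformly
  in \<theta>.\<close>

lemma translation_average:
  fixes f g :: "real \<times> real \<Rightarrow> real"
  assumes f: "f \<in> borel_measurable borel" "set_integrable lborel ({a - 1..b} \<times> {c..d}) (\<lambda>z. (f z)\<^sup>2)"
    and g: "g \<in> borel_measurable borel" "set_integrable lborel ({a..b} \<times> {c..d}) (\<lambda>z. (g z)\<^sup>2)"
    and h: "0 < h" "h \<le> 1"
  shows "set_integrable lborel {0..h} (\<lambda>\<theta>. LINT z:{a..b} \<times> {c..d}|lborel. f (z + (- \<theta>, 0)) * g z)"
    and "set_integrable lborel ({a..b} \<times> {c..d}) (\<lambda>z. (LINT \<tau>:{fst z - h..fst z}|lborel. f (\<tau>, snd z)) * g z)"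
    and "(LINT z:{a..b} \<times> {c..d}|lborel. (LINT \<tau>:{fst z - h..fst z}|lborel. f (\<tau>, snd z)) * g z)
      = (LINT \<theta>:{0..h}|lborel. LINT z:{a..b} \<times> {c..d}|lborel. f (z + (- \<theta>, 0)) * g z)"
proof -
  let ?S = "{a..b} \<times> {c..d}"
  note [measurable] = f(1) g(1)
  have [measurable]: "?S \<in> sets borel" by (rule rectangle_borel)
  define \<Theta> where "\<Theta> = (\<lambda>(\<theta>::real, z::real \<times> real).
      indicator {0..h} \<theta> * (indicator ?S z * (f (z + (- \<theta>, 0)) * g z)))"
  define N where "N = sqrt (LINT z:{a - 1..b} \<times> {c..d}|lborel. (f z)\<^sup>2) * sqrt (LINT z:?S|lborel. (g z)\<^sup>2)"
  have i\<theta>: "set_integrable lborel ?S (\<lambda>z. (f (z + (- \<theta>, 0)))\<^sup>2)"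
    and l\<theta>: "(LINT z:?S|lborel. (f (z + (- \<theta>, 0)))\<^sup>2) \<le> (LINT z:{a - 1..b} \<times> {c..d}|lborel. (f z)\<^sup>2)"
    if "\<theta> \<in> {0..h}" for \<theta>
    using translation_square_integrable[OF f, of \<theta>] that h by auto
  have [measurable]: "(\<lambda>p. f (snd p + (- fst p, 0))) \<in> borel_measurable (lborel \<Otimes>\<^sub>M lborel)"
    by (rule measurable_compose[OF _ f(1)]) measurable
  have \<Theta>m: "\<Theta> \<in> borel_measurable (lborel \<Otimes>\<^sub>M lborel)"
    unfolding \<Theta>_def split_beta' by measurable
  have prod: "set_integrable lborel ?S (\<lambda>z. f (z + (- \<theta>, 0)) * g z)" if "\<theta> \<in> {0..h}" for \<theta>
    by (rule set_square_integrable_mult(1)[OF _ _ i\<theta>[OF that] g(2)]) (simp_all add: set_borel_measurable_def)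
  have \<Theta>s: "\<Theta> (\<theta>, z) = indicator {0..h} \<theta> * (indicator ?S z *\<^sub>R (f (z + (- \<theta>, 0)) * g z))" for \<theta> z
    by (simp add: \<Theta>_def)
  have \<Theta>i: "integrable (lborel \<Otimes>\<^sub>M lborel) \<Theta>"
  proof (rule lborel_pair.Fubini_integrable[OF \<Theta>m])
    show "AE \<theta> in lborel. integrable lborel (\<lambda>z. \<Theta> (\<theta>, z))"
    proof (rule AE_I2)
      fix \<theta> show "integrable lborel (\<lambda>z. \<Theta> (\<theta>, z))"
        using prod[of \<theta>] by (cases "\<theta> \<in> {0..h}") (simp_all add: \<Theta>s set_integrable_def)
    qed
    show "integrable lborel (\<lambda>\<theta>. \<integral>z. norm (\<Theta> (\<theta>, z)) \<partial>lborel)"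
    proof (rule Bochner_Integration.integrable_bound)
      show "integrable lborel (\<lambda>\<theta>. N * indicator {0..h} \<theta>)"
        by (intro integrable_mult_right integrable_real_indicator) (auto simp: emeasure_lborel_Icc_eq)
      show "(\<lambda>\<theta>. \<integral>z. norm (\<Theta> (\<theta>, z)) \<partial>lborel) \<in> borel_measurable lborel"
        using \<Theta>m by measurable
      show "AE \<theta> in lborel. norm (\<integral>z. norm (\<Theta> (\<theta>, z)) \<partial>lborel) \<le> norm (N * indicator {0..h} \<theta>)"
      proof (rule AE_I2)
        fix \<theta>
        show "norm (\<integral>z. norm (\<Theta> (\<theta>, z)) \<partial>lborel) \<le> norm (N * indicator {0..h} \<theta>)"
        proof (cases "\<theta> \<in> {0..h}")
          case True
          have "(\<integral>z. norm (\<Theta> (\<theta>, z)) \<partial>lborel) = (LINT z:?S|lborel. \<bar>f (z + (- \<theta>, 0))\<bar> * \<bar>g z\<bar>)"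
            unfolding set_lebesgue_integral_def
            by (intro Bochner_Integration.integral_cong) (use True in \<open>auto simp: \<Theta>s abs_mult indicator_def\<close>)
          also have "\<dots> \<le> \<bar>LINT z:?S|lborel. \<bar>f (z + (- \<theta>, 0))\<bar> * \<bar>g z\<bar>\<bar>" by simp
          also have "\<dots> \<le> sqrt (LINT z:?S|lborel. \<bar>f (z + (- \<theta>, 0))\<bar>\<^sup>2) * sqrt (LINT z:?S|lborel. \<bar>g z\<bar>\<^sup>2)"
            by (rule set_square_integrable_mult(2)) (use i\<theta>[OF True] g(2) in \<open>simp_all add: set_borel_measurable_def\<close>)
          also have "\<dots> \<le> N" unfolding N_def power2_abs
            by (intro mult_mono real_sqrt_le_mono l\<theta>[OF True]) (auto intro!: set_integral_nonneg_real)
          finally show ?thesis using True by simp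
        qed (simp add: \<Theta>s)
      qed
    qed
  qed
  have fst: "(\<integral>z. \<Theta> (\<theta>, z) \<partial>lborel) = indicator {0..h} \<theta> *\<^sub>R (LINT z:?S|lborel. f (z + (- \<theta>, 0)) * g z)" for \<theta>
    by (simp add: \<Theta>s set_lebesgue_integral_def)
  have snd: "(\<integral>\<theta>. \<Theta> (\<theta>, z) \<partial>lborel) = indicator ?S z *\<^sub>R ((LINT \<tau>:{fst z - h..fst z}|lborel. f (\<tau>, snd z)) * g z)" for z
  proof -
    have "(\<integral>\<theta>. \<Theta> (\<theta>, z) \<partial>lborel) = (\<integral>\<theta>. (indicator ?S z * g z) * (indicator {0..h} \<theta> * f (fst z - \<theta>, snd z)) \<partial>lborel)"
      by (intro Bochner_Integration.integral_cong refl)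
         (simp add: \<Theta>_def prod_eq_iff mult_ac minus_prod_def[symmetric], simp add: plus_prod_def)
    also have "\<dots> = (indicator ?S z * g z) * (LINT \<theta>:{0..h}|lborel. f (fst z - \<theta>, snd z))"
      by (simp add: set_lebesgue_integral_def)
    also have "(LINT \<theta>:{0..h}|lborel. f (fst z - \<theta>, snd z)) = (LINT \<tau>:{fst z - h..fst z}|lborel. f (\<tau>, snd z))"
      by (rule set_integral_reflect)
    finally show ?thesis by (simp add: mult_ac)
  qed
  show "set_integrable lborel {0..h} (\<lambda>\<theta>. LINT z:?S|lborel. f (z + (- \<theta>, 0)) * g z)"
    using lborel_pair.integrable_fst'[OF \<Theta>i] unfolding fst set_integrable_def .
  have \<Theta>i': "integrable (lborel \<Otimes>\<^sub>M lborel) (\<lambda>(\<theta>, z). \<Theta> (\<theta>, z))" using \<Theta>i by simp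
  show "set_integrable lborel ?S (\<lambda>z. (LINT \<tau>:{fst z - h..fst z}|lborel. f (\<tau>, snd z)) * g z)"
    using lborel_pair.integrable_snd[OF \<Theta>i'] unfolding snd set_integrable_def .
  show "(LINT z:?S|lborel. (LINT \<tau>:{fst z - h..fst z}|lborel. f (\<tau>, snd z)) * g z)
      = (LINT \<theta>:{0..h}|lborel. LINT z:?S|lborel. f (z + (- \<theta>, 0)) * g z)"
    using lborel_pair.integral_snd[OF \<Theta>i'] lborel_pair.integral_fst'[OF \<Theta>i]
    unfolding fst snd set_lebesgue_integral_def by simp
qed

lemma average_tendsto:
  fixes \<rho> :: "real \<Rightarrow> real"
  assumes int: "\<And>h. 0 < h \<Longrightarrow> h \<le> 1 \<Longrightarrow> set_integrable lborel {0..h} \<rho>"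
    and cont: "\<And>e. 0 < e \<Longrightarrow> \<exists>\<delta>>0. \<forall>\<theta>. 0 \<le> \<theta> \<longrightarrow> \<theta> < \<delta> \<longrightarrow> \<bar>\<rho> \<theta> - r\<bar> \<le> e"
  shows "(\<lambda>k. (LINT \<theta>:{0..inverse (real (Suc k))}|lborel. \<rho> \<theta>) / inverse (real (Suc k))) \<longlonglongrightarrow> r"
proof (rule LIMSEQ_I)
  fix e :: real assume e: "0 < e"
  obtain \<delta> where \<delta>: "0 < \<delta>" "\<And>\<theta>. 0 \<le> \<theta> \<Longrightarrow> \<theta> < \<delta> \<Longrightarrow> \<bar>\<rho> \<theta> - r\<bar> \<le> e / 2"
    using cont[of "e / 2"] e by auto
  obtain N where N: "inverse (real (Suc N)) < \<delta>" using reals_Archimedean[OF \<delta>(1)] by blast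
  have "norm ((LINT \<theta>:{0..inverse (real (Suc k))}|lborel. \<rho> \<theta>) / inverse (real (Suc k)) - r) < e" if k: "k \<ge> N" for k
  proof -
    define h where "h = inverse (real (Suc k))"
    have h: "0 < h" "h \<le> 1" by (auto simp: h_def inverse_le_1_iff)
    have "h \<le> inverse (real (Suc N))" using k unfolding h_def by (intro le_imp_inverse_le) auto
    then have h\<delta>: "h < \<delta>" using N by simp
    note i = int[OF h]
    have ci: "set_integrable lborel {0..h} (\<lambda>_. c)" for c :: real by (intro set_integrable_continuous_Icc) auto
    have cI: "(LINT \<theta>:{0..h}|lborel. c) = h * c" for c :: real using h by (simp add: set_integral_const_Icc)
    have b: "r - e / 2 \<le> \<rho> \<theta> \<and> \<rho> \<theta> \<le> r + e / 2" if "\<theta> \<in> {0..h}" for \<theta>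
    proof -
      have "\<bar>\<rho> \<theta> - r\<bar> \<le> e / 2" using that h\<delta> by (intro \<delta>(2)) auto
      then show ?thesis unfolding abs_le_iff by linarith
    qed
    have "(LINT \<theta>:{0..h}|lborel. \<rho> \<theta>) \<le> (LINT \<theta>:{0..h}|lborel. r + e / 2)"
      by (rule set_integral_mono[OF i ci]) (use b in blast)
    moreover have "(LINT \<theta>:{0..h}|lborel. r - e / 2) \<le> (LINT \<theta>:{0..h}|lborel. \<rho> \<theta>)"
      by (rule set_integral_mono[OF ci i]) (use b in blast)
    ultimately have "(LINT \<theta>:{0..h}|lborel. \<rho> \<theta>) / h \<le> r + e / 2" "r - e / 2 \<le> (LINT \<theta>:{0..h}|lborel. \<rho> \<theta>) / h"
      using h by (simp_all add: cI pos_divide_le_eq pos_le_divide_eq mult.commute)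
    then show ?thesis using e unfolding h_def[symmetric] real_norm_def abs_less_iff by linarith
  qed
  then show "\<exists>N. \<forall>k\<ge>N. norm ((LINT \<theta>:{0..inverse (real (Suc k))}|lborel. \<rho> \<theta>) / inverse (real (Suc k)) - r) < e"
    by blast
qed

text \<open>A Lipschitz cutoff in time. Its forward difference quotients tend to the uniform density
  on (s, s'), so that testing with it produces averages instead of point values.\<close>

definition ramp :: "real \<Rightarrow> real \<Rightarrow> real \<Rightarrow> real" where
  "ramp s s' t = max 0 (min 1 ((t - s) / (s' - s)))"

lemma ramp_range: "0 \<le> ramp s s' t" "ramp s s' t \<le> 1"
  by (auto simp: ramp_def)

lemma ramp_simps:
  assumes "s < s'"
  shows "t \<le> s \<Longrightarrow> ramp s s' t = 0" "s' \<le> t \<Longrightarrow> ramp s s' t = 1"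
    "s \<le> t \<Longrightarrow> t \<le> s' \<Longrightarrow> ramp s s' t = (t - s) / (s' - s)"
proof -
  assume "t \<le> s"
  then have "(t - s) / (s' - s) \<le> 0" using assms by (intro divide_nonpos_pos) auto
  then show "ramp s s' t = 0" by (simp add: ramp_def)
next
  assume "s' \<le> t"
  then have "1 \<le> (t - s) / (s' - s)" using assms by (simp add: pos_le_divide_eq)
  then show "ramp s s' t = 1" by (simp add: ramp_def)
next
  assume "s \<le> t" "t \<le> s'"
  then have "0 \<le> (t - s) / (s' - s)" "(t - s) / (s' - s) \<le> 1" using assms by (simp_all add: pos_divide_le_eq)
  then show "ramp s s' t = (t - s) / (s' - s)" by (simp add: ramp_def)
qed

lemma ramp_Lipschitz:
  assumes "s < s'" "0 \<le> h" shows "\<bar>ramp s s' (t + h) - ramp s s' t\<bar> \<le> h / (s' - s)"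
proof -
  have "\<bar>ramp s s' (t + h) - ramp s s' t\<bar> \<le> \<bar>(t + h - s) / (s' - s) - (t - s) / (s' - s)\<bar>"
    unfolding ramp_def by (auto simp: max_def min_def abs_if)
  also have "(t + h - s) / (s' - s) - (t - s) / (s' - s) = h / (s' - s)"
    by (simp add: diff_divide_distrib[symmetric])
  finally show ?thesis using assms by simp
qed

lemma continuous_on_ramp: "continuous_on A (ramp s s')"
  unfolding ramp_def divide_inverse by (intro continuous_intros)

text \<open>Off the two corners the difference quotient is eventually equal to 1 / (s' - s) or 0,
  and the Lipschitz bound dominates it; \<open>R\<close> is rescaled to have bound 1.\<close>

lemma ramp_difference_tendsto:
  assumes q: "set_integrable lborel {A..B} q" and s: "A \<le> s" "s < s'" "s' \<le> B"
  shows "(\<lambda>k. LINT t:{A..B}|lborel. q t * ((ramp s s' (t + inverse (real (Suc k))) - ramp s s' t) / inverse (real (Suc k))))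
    \<longlonglongrightarrow> (LINT t:{s..s'}|lborel. q t) / (s' - s)"
proof -
  define H where "H = (\<lambda>k. inverse (real (Suc k)))"
  have H0: "0 < H k" for k by (simp add: H_def)
  have Hlim: "H \<longlonglongrightarrow> 0" unfolding H_def by (rule LIMSEQ_inverse_real_of_nat)
  have Hsmall: "eventually (\<lambda>k. H k < d) sequentially" if "0 < d" for d
    using Hlim that by (rule order_tendstoD(2))
  define R where "R = (\<lambda>k t. (ramp s s' (t + H k) - ramp s s' t) / H k * (s' - s))"
  have cR: "continuous_on UNIV (R k)" for k
    unfolding R_def ramp_def divide_inverse by (intro continuous_intros)
  have bR: "\<bar>R k t\<bar> \<le> 1" for k t
  proof -
    have "\<bar>R k t\<bar> = \<bar>ramp s s' (t + H k) - ramp s s' t\<bar> / H k * (s' - s)"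
      using H0[of k] s(2) by (simp add: R_def abs_mult)
    also have "\<dots> \<le> (H k / (s' - s)) / H k * (s' - s)"
      using H0[of k] s(2) ramp_Lipschitz[OF s(2), of "H k" t]
      by (intro mult_right_mono divide_right_mono) auto
    finally show ?thesis using H0[of k] s(2) by simp
  qed
  have lR: "(\<lambda>k. R k t) \<longlonglongrightarrow> indicator {s<..<s'} t" if "t \<notin> {s, s'}" for t
  proof -
    have "t < s \<or> (s < t \<and> t < s') \<or> s' < t" using that by auto
    then have "eventually (\<lambda>k. R k t = indicator {s<..<s'} t) sequentially"
    proof (elim disjE)
      assume t: "t < s"
      show ?thesis using Hsmall[of "s - t"] t
        by (auto elim!: eventually_mono simp: R_def ramp_simps[OF s(2)])
    next
      assume t: "s < t \<and> t < s'"
      then have "eventually (\<lambda>k. H k < s' - t) sequentially" by (intro Hsmall) simp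
      then show ?thesis
      proof eventually_elim
        case (elim k)
        have "ramp s s' (t + H k) - ramp s s' t = H k / (s' - s)"
          using t elim H0[of k] by (simp add: ramp_simps[OF s(2)] diff_divide_distrib[symmetric])
        then show ?case using t H0[of k] by (simp add: R_def)
      qed
    next
      assume t: "s' < t"
      then have "R k t = 0" for k using H0[of k] s(2) by (simp add: R_def ramp_simps[OF s(2)])
      then show ?thesis using t by simp
    qed
    then show ?thesis by (rule tendsto_eventually)
  qed
  have "(\<lambda>k. LINT t:{A..B}|lborel. q t * R k t) \<longlonglongrightarrow> (LINT t:{s<..<s'}|lborel. q t)"
    by (rule set_integral_mult_tendsto[OF q cR bR, where N = "{s, s'}"]) (use lR s in auto)
  then have "(\<lambda>k. (LINT t:{A..B}|lborel. q t * R k t) / (s' - s)) \<longlonglongrightarrow> (LINT t:{s..s'}|lborel. q t) / (s' - s)"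
    unfolding set_integral_Ioo_eq_Icc by (intro tendsto_divide tendsto_const) (use s in auto)
  moreover have "(LINT t:{A..B}|lborel. q t * R k t) / (s' - s)
    = (LINT t:{A..B}|lborel. q t * ((ramp s s' (t + H k) - ramp s s' t) / H k))" for k
    using s by (simp add: R_def flip: set_integral_divide_zero)
  ultimately show ?thesis by (simp add: H_def)
qed

lemma integral_continuous_in_parameter:
  fixes F :: "real \<Rightarrow> real \<Rightarrow> real"
  assumes F: "continuous_on (U \<times> {a..b}) (\<lambda>(t, x). F t x)"
  shows "continuous_on U (\<lambda>t. LINT x:{a..b}|lborel. F t x)"
proof -
  have "continuous_on U (\<lambda>t. integral (cbox a b) (F t))"
    by (rule integral_continuous_on_param) (use F in simp)
  moreover have "integral (cbox a b) (F t) = (LINT x:{a..b}|lborel. F t x)" if "t \<in> U" for t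
  proof -
    have "continuous_on {a..b} (\<lambda>x. (\<lambda>(t, x). F t x) (t, x))"
      by (rule continuous_on_compose2[OF F]) (use that in \<open>auto intro!: continuous_intros\<close>)
    then have "set_integrable lborel {a..b} (F t)" by (intro set_integrable_continuous_Icc) simp
    from set_borel_integral_eq_integral(2)[OF this] show ?thesis by simp
  qed
  ultimately show ?thesis by (rule continuous_on_eq)
qed

text \<open>
  The hypothesis \<open>key\<close> is the energy balance up to the convexity of the energy. Testing it with the
  trapezoid \<open>\<chi>\<close> and letting \<open>h \<rightarrow> 0\<close> yields the dissipation inequality for time averages.
\<close>

lemma averaged_dissipation:
  fixes J p :: "real \<times> real \<Rightarrow> real" and q :: "real \<Rightarrow> real"
  assumes q: "q \<in> borel_measurable borel" "\<And>a b. T \<le> a \<Longrightarrow> set_integrable lborel {a..b} q"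
    and J: "J \<in> borel_measurable borel" "\<And>a b. T \<le> a \<Longrightarrow> set_integrable lborel ({a..b} \<times> {c..d}) (\<lambda>z. (J z)\<^sup>2)"
    and p: "p \<in> borel_measurable borel" "\<And>a b. T \<le> a \<Longrightarrow> set_integrable lborel ({a..b} \<times> {c..d}) (\<lambda>z. (p z)\<^sup>2)"
    and Jp: "\<And>z. 0 \<le> J z * p z"
    and key: "\<And>h. 0 < h \<Longrightarrow> h \<le> 1 \<Longrightarrow> AE t in lborel. T + 1 < t \<longrightarrow>
       q t - q (t - h) \<le> - (LINT x:{c..d}|lborel. (LINT \<tau>:{t - h..t}|lborel. J (\<tau>, x)) * p (t, x))"
    and ab: "T + 1 < a\<^sub>1" "a\<^sub>1 < a\<^sub>2" "a\<^sub>2 \<le> b\<^sub>1" "b\<^sub>1 < b\<^sub>2"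
  shows "(LINT t:{b\<^sub>1..b\<^sub>2}|lborel. q t) / (b\<^sub>2 - b\<^sub>1)
      + (LINT t:{a\<^sub>2..b\<^sub>1}|lborel. LINT x:{c..d}|lborel. J (t, x) * p (t, x))
      \<le> (LINT t:{a\<^sub>1..a\<^sub>2}|lborel. q t) / (a\<^sub>2 - a\<^sub>1)"
proof -
  note [measurable] = q(1) J(1) p(1)
  let ?S = "{a\<^sub>1..b\<^sub>2} \<times> {c..d}"
  define ch where "ch = (\<lambda>t. ramp a\<^sub>1 a\<^sub>2 t - ramp b\<^sub>1 b\<^sub>2 t)"
  have ch_cont: "continuous_on A ch" for A unfolding ch_def by (intro continuous_intros continuous_on_ramp)
  have [measurable]: "ch \<in> borel_measurable borel" by (rule borel_measurable_continuous_onI[OF ch_cont])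
  have ch_out: "ch t = 0" if "t \<notin> {a\<^sub>1<..<b\<^sub>2}" for t
    using that ab by (auto simp: ch_def ramp_simps not_less)
  have ch_in: "ch t = 1" if "t \<in> {a\<^sub>2..b\<^sub>1}" for t
    using that ab by (auto simp: ch_def ramp_simps)
  have ch_range: "0 \<le> ch t" "ch t \<le> 1" for t
  proof -
    show "ch t \<le> 1" using ramp_range[of a\<^sub>1 a\<^sub>2 t] ramp_range[of b\<^sub>1 b\<^sub>2 t] by (simp add: ch_def)
    show "0 \<le> ch t"
    proof (cases "t \<le> b\<^sub>1")
      case True
      then show ?thesis using ab ramp_range[of a\<^sub>1 a\<^sub>2 t] by (simp add: ch_def ramp_simps)
    next
      case False
      then show ?thesis using ab ramp_range[of b\<^sub>1 b\<^sub>2 t] by (simp add: ch_def ramp_simps)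
    qed
  qed
  define g where "g = (\<lambda>z. ch (fst z) * p z)"
  have "continuous_on UNIV (\<lambda>z::real \<times> real. ch (fst z))"
    by (rule continuous_on_compose2[OF ch_cont[of UNIV] continuous_on_fst]) (auto intro!: continuous_intros)
  then have [measurable]: "(\<lambda>z::real \<times> real. ch (fst z)) \<in> borel_measurable borel"
    by (rule borel_measurable_continuous_onI)
  have gm[measurable]: "g \<in> borel_measurable borel" unfolding g_def by measurable
  have J2: "set_integrable lborel ({a\<^sub>1 - 1..b\<^sub>2} \<times> {c..d}) (\<lambda>z. (J z)\<^sup>2)" using ab by (intro J(2)) simp
  have g2: "set_integrable lborel ?S (\<lambda>z. (g z)\<^sup>2)"
  proof (rule set_integrable_bound[OF p(2)])
    have "(ch t)\<^sup>2 \<le> 1" for t using ch_range[of t] by (simp add: power_le_one)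
    then show "AE z in lborel. z \<in> ?S \<longrightarrow> norm ((g z)\<^sup>2) \<le> norm ((p z)\<^sup>2)"
      by (intro AE_I2) (auto simp: g_def power_mult_distrib mult_left_le_one_le)
  qed (use ab in \<open>auto simp: set_borel_measurable_def\<close>)
  define \<rho> where "\<rho> = (\<lambda>\<theta>. LINT z:?S|lborel. J (z + (- \<theta>, 0)) * g z)"
  define K where "K = (\<lambda>h z. LINT \<tau>:{fst z - h..fst z}|lborel. J (\<tau>, snd z))"
  note avg = translation_average[OF J(1) J2 gm g2]
  have rho0: "\<rho> 0 = (LINT z:?S|lborel. J z * g z)" by (simp add: \<rho>_def zero_prod_def[symmetric])
  have lim1: "(\<lambda>k. (LINT \<theta>:{0..inverse (real (Suc k))}|lborel. \<rho> \<theta>) / inverse (real (Suc k))) \<longlonglongrightarrow> \<rho> 0"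
  proof (rule average_tendsto)
    show "set_integrable lborel {0..h} \<rho>" if "0 < h" "h \<le> 1" for h
      using avg(1)[OF that] by (simp add: \<rho>_def)
    fix e :: real assume "0 < e"
    then obtain \<delta> where "0 < \<delta>" "\<And>\<theta>. 0 \<le> \<theta> \<Longrightarrow> \<theta> < \<delta> \<Longrightarrow>
       \<bar>(LINT z:?S|lborel. J (z + (- \<theta>, 0)) * g z) - (LINT z:?S|lborel. J z * g z)\<bar> \<le> e"
      by (rule translation_correlation_continuous[OF J(1) J2 gm g2]) blast
    then show "\<exists>\<delta>>0. \<forall>\<theta>. 0 \<le> \<theta> \<longrightarrow> \<theta> < \<delta> \<longrightarrow> \<bar>\<rho> \<theta> - \<rho> 0\<bar> \<le> e" unfolding rho0 unfolding \<rho>_def by blast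
  qed
  have qi: "set_integrable lborel {a\<^sub>1 - 1..b\<^sub>2} q" using ab by (intro q(2)) simp
  \<comment> \<open>Summation by parts in time: a substitution moves the difference from
    \<open>q\<close> to the cutoff, without boundary terms because the cutoff vanishes outside (a1,
    b2).\<close>
  have step: "(LINT t:{a\<^sub>1 - 1..b\<^sub>2}|lborel. q t * (ch t - ch (t + h))) \<le> - (LINT \<theta>:{0..h}|lborel. \<rho> \<theta>)"
    if h: "0 < h" "h \<le> 1" for h
  proof -
    have ch: "continuous_on A (\<lambda>t. ch (t + h))" for A
      by (rule continuous_on_compose2[OF ch_cont[of UNIV]]) (auto intro!: continuous_intros)
    have i1: "set_integrable lborel {a\<^sub>1 - 1..b\<^sub>2} (\<lambda>t. q t * ch t)"
      "set_integrable lborel {a\<^sub>1 - 1..b\<^sub>2} (\<lambda>t. q t * ch (t + h))"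
      by (intro set_integrable_mult_continuous qi ch_cont ch)+
    have sub: "set_integrable lborel {a\<^sub>1 - h..b\<^sub>2 - h} (\<lambda>t. q t * ch (t + h))"
      by (rule set_integrable_subset[OF i1(2)]) (use h in auto)
    have "set_integrable lborel {a\<^sub>1 - h + h..b\<^sub>2 - h + h} (\<lambda>t. q (t - h) * ch t)"
      using sub by (subst set_integral_shift(2)[symmetric]) simp
    then have i2: "set_integrable lborel {a\<^sub>1..b\<^sub>2} (\<lambda>t. q (t - h) * ch t)" by simp
    have i3: "set_integrable lborel {a\<^sub>1..b\<^sub>2} (\<lambda>t. q t * ch t)"
      by (rule set_integrable_subset[OF i1(1)]) auto
    have "(LINT t:{a\<^sub>1..b\<^sub>2}|lborel. q (t - h) * ch t) = (LINT t:{a\<^sub>1 - h..b\<^sub>2 - h}|lborel. q t * ch (t + h))"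
      using set_integral_shift(1)[of "a\<^sub>1 - h" "b\<^sub>2 - h" "\<lambda>t. q (t - h) * ch t" h] by simp
    also have "\<dots> = (LINT t:{a\<^sub>1 - 1..b\<^sub>2}|lborel. q t * ch (t + h))"
      by (rule set_integral_support[symmetric]) (use h in \<open>auto intro!: ch_out\<close>)
    finally have e1: "(LINT t:{a\<^sub>1..b\<^sub>2}|lborel. q (t - h) * ch t) = (LINT t:{a\<^sub>1 - 1..b\<^sub>2}|lborel. q t * ch (t + h))" .
    have e2: "(LINT t:{a\<^sub>1..b\<^sub>2}|lborel. q t * ch t) = (LINT t:{a\<^sub>1 - 1..b\<^sub>2}|lborel. q t * ch t)"
      by (rule set_integral_support[symmetric]) (auto intro!: ch_out)
    note pr = set_integral_prod[OF _ _ avg(2)[OF h], simplified]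
    have "(LINT t:{a\<^sub>1 - 1..b\<^sub>2}|lborel. q t * (ch t - ch (t + h)))
        = (LINT t:{a\<^sub>1 - 1..b\<^sub>2}|lborel. q t * ch t) - (LINT t:{a\<^sub>1 - 1..b\<^sub>2}|lborel. q t * ch (t + h))"
      by (subst set_integral_diff(2)[OF i1, symmetric]) (simp add: right_diff_distrib)
    also have "\<dots> = (LINT t:{a\<^sub>1..b\<^sub>2}|lborel. q t * ch t - q (t - h) * ch t)"
      by (subst set_integral_diff(2)[OF i3 i2]) (simp only: e1 e2)
    also have "\<dots> \<le> (LINT t:{a\<^sub>1..b\<^sub>2}|lborel. - (LINT x:{c..d}|lborel. (LINT \<tau>:{t - h..t}|lborel. J (\<tau>, x)) * g (t, x)))"
    proof (rule set_integral_mono_AE)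
      show "set_integrable lborel {a\<^sub>1..b\<^sub>2} (\<lambda>t. q t * ch t - q (t - h) * ch t)"
        by (rule set_integral_diff(1)[OF i3 i2])
      show "set_integrable lborel {a\<^sub>1..b\<^sub>2} (\<lambda>t. - (LINT x:{c..d}|lborel. (LINT \<tau>:{t - h..t}|lborel. J (\<tau>, x)) * g (t, x)))"
      proof -
        have "set_integrable lborel {a\<^sub>1..b\<^sub>2}
            (\<lambda>t. (-1) * (LINT x:{c..d}|lborel. (LINT \<tau>:{t - h..t}|lborel. J (\<tau>, x)) * g (t, x)))"
          by (rule set_integrable_mult_right) (rule pr(2))
        then show ?thesis by simp
      qed
      show "AE t\<in>{a\<^sub>1..b\<^sub>2} in lborel. q t * ch t - q (t - h) * ch t
         \<le> - (LINT x:{c..d}|lborel. (LINT \<tau>:{t - h..t}|lborel. J (\<tau>, x)) * g (t, x))"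
        using key[OF h]
      proof (eventually_elim, intro impI)
        fix t assume k: "T + 1 < t \<longrightarrow> q t - q (t - h) \<le> - (LINT x:{c..d}|lborel. (LINT \<tau>:{t - h..t}|lborel. J (\<tau>, x)) * p (t, x))"
          and t: "t \<in> {a\<^sub>1..b\<^sub>2}"
        have "ch t * (q t - q (t - h)) \<le> ch t * - (LINT x:{c..d}|lborel. (LINT \<tau>:{t - h..t}|lborel. J (\<tau>, x)) * p (t, x))"
          using k t ab ch_range by (intro mult_left_mono) auto
        also have "\<dots> = - (LINT x:{c..d}|lborel. (LINT \<tau>:{t - h..t}|lborel. J (\<tau>, x)) * g (t, x))"
          by (simp add: g_def mult.left_commute)
        finally show "q t * ch t - q (t - h) * ch t
          \<le> - (LINT x:{c..d}|lborel. (LINT \<tau>:{t - h..t}|lborel. J (\<tau>, x)) * g (t, x))"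
          by (simp add: algebra_simps)
      qed
    qed
    also have "\<dots> = - (LINT t:{a\<^sub>1..b\<^sub>2}|lborel. LINT x:{c..d}|lborel. (LINT \<tau>:{t - h..t}|lborel. J (\<tau>, x)) * g (t, x))"
      by (rule set_integral_uminus[OF pr(2)])
    also have "(LINT t:{a\<^sub>1..b\<^sub>2}|lborel. LINT x:{c..d}|lborel. (LINT \<tau>:{t - h..t}|lborel. J (\<tau>, x)) * g (t, x))
      = (LINT \<theta>:{0..h}|lborel. \<rho> \<theta>)"
      using pr(1) avg(3)[OF h] by (simp add: \<rho>_def)
    finally show ?thesis .
  qed
  \<comment> \<open>The rise and the fall of the trapezoid contribute the averages over [a1, a2] and
    [b1, b2] with opposite signs.\<close>
  have lim2: "(\<lambda>k. LINT t:{a\<^sub>1 - 1..b\<^sub>2}|lborel. q t * ((ch t - ch (t + inverse (real (Suc k)))) / inverse (real (Suc k))))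
     \<longlonglongrightarrow> (LINT t:{b\<^sub>1..b\<^sub>2}|lborel. q t) / (b\<^sub>2 - b\<^sub>1) - (LINT t:{a\<^sub>1..a\<^sub>2}|lborel. q t) / (a\<^sub>2 - a\<^sub>1)"
  proof -
    define R where "R = (\<lambda>s s' k t. q t * ((ramp s s' (t + inverse (real (Suc k))) - ramp s s' t) / inverse (real (Suc k))))"
    have iR: "set_integrable lborel {a\<^sub>1 - 1..b\<^sub>2} (R s s' k)" for s s' k
      unfolding R_def ramp_def divide_inverse
      by (intro set_integrable_mult_continuous qi continuous_intros)
    have "(\<lambda>k. (LINT t:{a\<^sub>1 - 1..b\<^sub>2}|lborel. R b\<^sub>1 b\<^sub>2 k t) - (LINT t:{a\<^sub>1 - 1..b\<^sub>2}|lborel. R a\<^sub>1 a\<^sub>2 k t))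
       \<longlonglongrightarrow> (LINT t:{b\<^sub>1..b\<^sub>2}|lborel. q t) / (b\<^sub>2 - b\<^sub>1) - (LINT t:{a\<^sub>1..a\<^sub>2}|lborel. q t) / (a\<^sub>2 - a\<^sub>1)"
      unfolding R_def by (intro tendsto_diff ramp_difference_tendsto qi) (use ab in auto)
    moreover have "(LINT t:{a\<^sub>1 - 1..b\<^sub>2}|lborel. R b\<^sub>1 b\<^sub>2 k t) - (LINT t:{a\<^sub>1 - 1..b\<^sub>2}|lborel. R a\<^sub>1 a\<^sub>2 k t)
      = (LINT t:{a\<^sub>1 - 1..b\<^sub>2}|lborel. q t * ((ch t - ch (t + inverse (real (Suc k)))) / inverse (real (Suc k))))" for k
      by (subst set_integral_diff(2)[OF iR iR, symmetric])
         (simp add: R_def ch_def divide_inverse algebra_simps del: of_nat_Suc)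
    ultimately show ?thesis by simp
  qed
  have "(LINT t:{b\<^sub>1..b\<^sub>2}|lborel. q t) / (b\<^sub>2 - b\<^sub>1) - (LINT t:{a\<^sub>1..a\<^sub>2}|lborel. q t) / (a\<^sub>2 - a\<^sub>1) \<le> - \<rho> 0"
  proof (rule LIMSEQ_le[OF lim2 tendsto_minus[OF lim1]], intro exI allI impI)
    fix k
    let ?h = "inverse (real (Suc k))"
    have h: "0 < ?h" "?h \<le> 1" by (auto simp: inverse_le_1_iff)
    have "(LINT t:{a\<^sub>1 - 1..b\<^sub>2}|lborel. q t * ((ch t - ch (t + ?h)) / ?h))
        = (LINT t:{a\<^sub>1 - 1..b\<^sub>2}|lborel. q t * (ch t - ch (t + ?h))) / ?h"
      by (simp flip: set_integral_divide_zero)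
    also have "\<dots> \<le> (- (LINT \<theta>:{0..?h}|lborel. \<rho> \<theta>)) / ?h"
      using step[OF h] h by (intro divide_right_mono) auto
    finally show "(LINT t:{a\<^sub>1 - 1..b\<^sub>2}|lborel. q t * ((ch t - ch (t + ?h)) / ?h))
      \<le> - ((LINT \<theta>:{0..?h}|lborel. \<rho> \<theta>) / ?h)" by simp
  qed
  \<comment> \<open>The integrand of \<open>\<rho> 0\<close> is nonnegative, so the part where the
    trapezoid equals 1 bounds it from below.\<close>
  moreover have "(LINT t:{a\<^sub>2..b\<^sub>1}|lborel. LINT x:{c..d}|lborel. J (t, x) * p (t, x)) \<le> \<rho> 0"
  proof -
    have iJp: "set_integrable lborel ?S (\<lambda>z. J z * p z)"
      by (rule set_square_integrable_mult(1)) (use J(2) p(2) ab in \<open>auto simp: set_borel_measurable_def\<close>)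
    have iJg: "set_integrable lborel ?S (\<lambda>z. J z * g z)"
      by (rule set_square_integrable_mult(1)) (use J(2) g2 ab in \<open>auto simp: set_borel_measurable_def\<close>)
    have sub: "{a\<^sub>2..b\<^sub>1} \<times> {c..d} \<subseteq> ?S" using ab by auto
    have iJp': "set_integrable lborel ({a\<^sub>2..b\<^sub>1} \<times> {c..d}) (\<lambda>z. J z * p z)"
      by (rule set_integrable_subset[OF iJp _ sub]) simp
    have "(LINT t:{a\<^sub>2..b\<^sub>1}|lborel. LINT x:{c..d}|lborel. J (t, x) * p (t, x)) = (LINT z:{a\<^sub>2..b\<^sub>1} \<times> {c..d}|lborel. J z * p z)"
      using set_integral_prod(1)[OF _ _ iJp'] by simp
    also have "\<dots> \<le> (LINT z:?S|lborel. J z * g z)"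
      unfolding set_lebesgue_integral_def
    proof (rule integral_mono)
      fix z
      have "J z * p z * ch (fst z) = J z * g z" by (simp add: g_def)
      moreover have "0 \<le> J z * p z * ch (fst z)" using Jp ch_range by simp
      ultimately have "0 \<le> J z * g z" by metis
      moreover have "g z = p z" if "fst z \<in> {a\<^sub>2..b\<^sub>1}" using ch_in[OF that] by (simp add: g_def)
      ultimately show "indicator ({a\<^sub>2..b\<^sub>1} \<times> {c..d}) z *\<^sub>R (J z * p z) \<le> indicator ?S z *\<^sub>R (J z * g z)"
        using sub by (auto simp: indicator_def mem_Times_iff)
    qed (use iJp' iJg in \<open>auto simp: set_integrable_def\<close>)
    finally show ?thesis by (simp add: rho0)
  qed
  ultimately show ?thesis by linarith
qed

subsection \<open>The equation in the positive regime\<close>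

lemma primitive_on_cong_AE:
  assumes "primitive_on a b f F" "AE x in lborel. f x = g x"
    and [measurable]: "f \<in> borel_measurable borel" "g \<in> borel_measurable borel"
  shows "primitive_on a b g F"
  unfolding primitive_on_def
proof (intro conjI ballI)
  show "set_integrable lborel {a..b} g"
    using primitive_on_integrable[OF assms(1)] set_integrable_cong_AE'[OF assms(2), of "{a..b}"] by simp
  fix x assume x: "x \<in> {a..b}"
  have "(LINT y:{a..x}|lborel. f y) = (LINT y:{a..x}|lborel. g y)"
    by (rule set_lebesgue_integral_cong_AE'[OF assms(2)]) auto
  then show "F x = F a + (LINT y:{a..x}|lborel. g y)"
    using primitive_on_eq[OF assms(1), of x] x by (metis atLeastAtMost_iff)
qed

lemma primitive_continuous_DERIV:
  assumes F: "\<And>a b. primitive_on a b f F" and f: "continuous_on UNIV f"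
  shows "(F has_real_derivative f x) (at x)"
proof -
  obtain G where G: "\<And>x. (G has_real_derivative f x) (at x)" using exists_antiderivative[OF f] by blast
  note Gp = primitive_on_DERIV[OF G f]
  have eq: "F y - F z = G y - G z" for y z
    using primitive_on_diff_eq[OF F, of z z y y] primitive_on_diff_eq[OF Gp, of z z y y]
      primitive_on_diff_eq[OF F, of y y z z] primitive_on_diff_eq[OF Gp, of y y z z]
    by (cases "z \<le> y") auto
  have "F = (\<lambda>y. G y + (F 0 - G 0))"
  proof
    fix y show "F y = G y + (F 0 - G 0)" using eq[of y 0] by simp
  qed
  moreover have "((\<lambda>y. G y + (F 0 - G 0)) has_real_derivative f x) (at x)"
    by (auto intro!: derivative_eq_intros G)
  ultimately show ?thesis by simp
qed

lemma circle_fun_DERIV: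
  assumes F: "circle_fun F" and d: "\<And>x. (F has_real_derivative f x) (at x)" shows "circle_fun f"
  unfolding circle_fun_def
proof
  fix x
  have "((\<lambda>x. F (x + 2 * pi)) has_real_derivative f (x + 2 * pi)) (at x)"
    using DERIV_shift[of F "f (x + 2 * pi)" x "2 * pi"] d by simp
  moreover have "(\<lambda>x. F (x + 2 * pi)) = F" using F by (simp add: circle_fun_def)
  ultimately show "f (x + 2 * pi) = f x" using d DERIV_unique by metis
qed

lemma DERIV_continuous_on_UNIV: "(\<And>x. (F has_real_derivative f x) (at x)) \<Longrightarrow> continuous_on A F"
  by (meson DERIV_isCont continuous_at_imp_continuous_on)

text \<open>The solution concept supplies derivatives of order 1 and 2, the energy inequality those
  of order 1 and 3, each with versions of its own. Removing one order at a time identifies those of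
  order 1 and 2 with classical derivatives \<open>V1\<close> and \<open>V2\<close>, and
  \<open>v3\<close> becomes the derivative of \<open>V2\<close>.\<close>

lemma has_weak_deriv_3_regular:
  assumes v: "circle_fun v" "continuous_on UNIV v"
    and w: "has_weak_deriv 1 UNIV v v1" "has_weak_deriv 2 UNIV v v2"
    and y: "has_weak_deriv 1 UNIV v y1" "has_weak_deriv 3 UNIV v v3"
  obtains V1 V2 where
    "\<And>x. (v has_real_derivative V1 x) (at x)" "\<And>x. (V1 has_real_derivative V2 x) (at x)"
    "circle_fun V1" "circle_fun V2" "continuous_on UNIV V2"
    "AE x in lborel. v1 x = V1 x" "AE x in lborel. v2 x = V2 x" "AE x in lborel. y1 x = V1 x"
    "\<And>a b. primitive_on a b v3 V2"
proof -
  have s2: "(2::nat) = Suc 1" and s3: "(3::nat) = Suc 2" by simp_all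
  have w12: "has_weak_deriv 1 UNIV v1 v2" by (rule has_weak_deriv_Suc[OF w(1) w(2)[unfolded s2]])
  have "has_weak_deriv 2 UNIV v1 v3" by (rule has_weak_deriv_Suc[OF w(1) y(2)[unfolded s3]])
  then have w23: "has_weak_deriv 1 UNIV v2 v3" unfolding s2 by (rule has_weak_deriv_Suc[OF w12])
  obtain V1 where V1: "\<And>a b. primitive_on a b v2 V1" "AE x in lborel. v1 x = V1 x"
    using has_weak_deriv_UNIV_primitive[OF w12] by blast
  obtain V2 where V2: "\<And>a b. primitive_on a b v3 V2" "AE x in lborel. v2 x = V2 x"
    using has_weak_deriv_UNIV_primitive[OF w23] by blast
  have c1: "continuous_on UNIV V1" by (rule primitive_on_continuous_UNIV[OF V1(1)])
  have c2: "continuous_on UNIV V2" by (rule primitive_on_continuous_UNIV[OF V2(1)])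
  note m = has_weak_deriv_measurable[OF w12] borel_measurable_continuous_onI[OF c1] borel_measurable_continuous_onI[OF c2]
  have p0: "primitive_on a b v1 v" for a b
    by (rule has_weak_deriv_continuous_primitive[OF w(1) open_UNIV is_interval_univ v(2)]) simp
  have d0: "(v has_real_derivative V1 x) (at x)" for x
    by (rule primitive_continuous_DERIV[OF primitive_on_cong_AE[OF p0 V1(2) m(1,3)] c1])
  have d1: "(V1 has_real_derivative V2 x) (at x)" for x
    by (rule primitive_continuous_DERIV[OF primitive_on_cong_AE[OF V1(1) V2(2) m(2,4)] c2])
  have per1: "circle_fun V1" by (rule circle_fun_DERIV[OF v(1) d0])
  have per2: "circle_fun V2" by (rule circle_fun_DERIV[OF per1 d1])
  have "AE x in lborel. y1 x = v1 x" by (rule has_weak_deriv_unique[OF y(1) w(1)]) simp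
  then have "AE x in lborel. y1 x = V1 x" using V1(2) by eventually_elim simp
  then show ?thesis using that[OF d0 d1 per1 per2 c2 V1(2) V2(2) _ V2(1)] by blast
qed

lemma set_integral_cong_AE_integrable:
  fixes f g :: "'a \<Rightarrow> real"
  assumes "set_integrable M A f" "set_integrable M A g" "AE x in M. x \<in> A \<longrightarrow> f x = g x"
  shows "(LINT x:A|M. f x) = (LINT x:A|M. g x)"
  unfolding set_lebesgue_integral_def
proof (rule integral_cong_AE)
  show "AE x in M. indicator A x *\<^sub>R f x = indicator A x *\<^sub>R g x"
    using assms(3) by eventually_elim (auto simp: indicator_def)
qed (use assms(1,2) in \<open>auto simp: set_integrable_def\<close>)

lemma set_integrable_support:
  fixes f :: "'a \<Rightarrow> real"
  assumes "set_integrable M A f" "\<And>x. x \<notin> A \<Longrightarrow> f x = 0" "A \<subseteq> B"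
  shows "set_integrable M B f"
proof -
  have "(\<lambda>x. indicat_real B x *\<^sub>R f x) = (\<lambda>x. indicat_real A x *\<^sub>R f x)"
    using assms(2,3) by (auto simp: indicator_def fun_eq_iff)
  then show ?thesis using assms(1) by (simp add: set_integrable_def)
qed

text \<open>The partial derivative of order (j, k) of a product in separated variables is the
  product of the derivatives of the factors.\<close>

lemma test_fun_product:
  assumes \<psi>: "smooth \<psi>" "\<And>t. t \<notin> {a..b} \<Longrightarrow> \<psi> t = 0" and ab: "0 < a" "a < b"
    and \<eta>: "smooth \<eta>" "circle_fun \<eta>"
  shows "test_fun (\<lambda>t x. \<psi> t * \<eta> x)"
  unfolding test_fun_def
proof (intro conjI exI)
  define D where "D = (\<lambda>j k t x. (deriv ^^ j) \<psi> t * (deriv ^^ k) \<eta> x)"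
  have "continuous_on UNIV (\<lambda>(t, x). D j k t x)" for j k
    unfolding D_def split_beta'
    by (intro continuous_on_mult continuous_on_compose2[OF smooth_imp_continuous_on[OF smooth_funpow_deriv[OF \<psi>(1)], of UNIV] continuous_on_fst]
        continuous_on_compose2[OF smooth_imp_continuous_on[OF smooth_funpow_deriv[OF \<eta>(1)], of UNIV] continuous_on_snd])
       (auto intro!: continuous_intros)
  moreover have "((\<lambda>s. D j k s x) has_real_derivative D (Suc j) k t x) (at t)" for j k t x
    unfolding D_def
    using DERIV_cmult_right[OF smooth_has_derivative[OF smooth_funpow_deriv[OF \<psi>(1)], of j t]] by simp
  moreover have "((\<lambda>y. D j k t y) has_real_derivative D j (Suc k) t x) (at x)" for j k t x
    unfolding D_def
    using DERIV_cmult[OF smooth_has_derivative[OF smooth_funpow_deriv[OF \<eta>(1)], of k x]] by simp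
  moreover have "D 0 0 = (\<lambda>t x. \<psi> t * \<eta> x)" by (simp add: D_def)
  ultimately show "smooth2 (\<lambda>t x. \<psi> t * \<eta> x)" unfolding smooth2_def by blast
  show "\<forall>t. circle_fun (\<lambda>x. \<psi> t * \<eta> x)" using \<eta>(2) by (simp add: circle_fun_def)
  show "0 < a" "a < b" by (fact ab)+
  show "\<forall>t x. t \<notin> {a..b} \<longrightarrow> \<psi> t * \<eta> x = 0" using \<psi>(2) by simp
qed

text \<open>Testing with products of a function of time and \<eta> shows that the moment
  \<open>a\<eta>\<close> has weak time derivative \<open>b\<eta>\<close>. The moment is continuous,
  so the integrated identity holds between all times, although the spatial integration by parts is
  performed at almost every time only.\<close>

lemma integrated_equation:
  fixes u uxx :: "real \<Rightarrow> real \<Rightarrow> real" and J p :: "real \<times> real \<Rightarrow> real"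
  assumes T: "0 \<le> T"
    and cu: "continuous_on ({0<..} \<times> UNIV) (\<lambda>(t, x). u t x)"
    and pu: "\<And>t. 0 \<le> t \<Longrightarrow> circle_fun (u t)"
    and pos: "\<And>t x. T < t \<Longrightarrow> 0 < u t x"
    and weak: "\<And>\<phi>. test_fun \<phi> \<Longrightarrow>
      \<exists>g. (AE t in lborel. 0 < t \<longrightarrow> has_weak_deriv 1 UNIV (\<lambda>x. u t x powr n * deriv (\<phi> t) x) (g t)) \<and>
          set_integrable lborel ({0<..} \<times> {0..2*pi})
            (\<lambda>(t, x). u t x * deriv (\<lambda>s. \<phi> s x) t - (uxx t x + \<alpha>\<^sup>2 * u t x + cos x) * g t x) \<and>
          (LINT (t, x):{0<..} \<times> {0..2*pi}|lborel.
             u t x * deriv (\<lambda>s. \<phi> s x) t - (uxx t x + \<alpha>\<^sup>2 * u t x + cos x) * g t x) = 0"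
    and good: "AE t in lborel. T < t \<longrightarrow> (\<exists>V. continuous_on UNIV V \<and> circle_fun V \<and>
       (AE x in lborel. uxx t x = V x) \<and>
       (\<forall>a b. primitive_on a b (\<lambda>x. p (t, x)) (\<lambda>x. V x + \<alpha>\<^sup>2 * u t x + cos x)))"
    and J: "J \<in> borel_measurable borel" "\<And>a b. T \<le> a \<Longrightarrow> set_integrable lborel ({a..b} \<times> {0..2*pi}) (\<lambda>z. (J z)\<^sup>2)"
    and Jp: "\<And>t x. T < t \<Longrightarrow> J (t, x) = u t x powr n * p (t, x)"
    and \<eta>: "smooth \<eta>" "circle_fun \<eta>" and st: "T < s" "s \<le> t"
  shows "(LINT x:{0..2*pi}|lborel. u t x * \<eta> x) - (LINT x:{0..2*pi}|lborel. u s x * \<eta> x)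
    = (LINT \<tau>:{s..t}|lborel. LINT x:{0..2*pi}|lborel. J (\<tau>, x) * deriv \<eta> x)"
proof -
  let ?I = "{0..2*pi}"
  note [measurable] = J(1)
  define a\<eta> where "a\<eta> = (\<lambda>t. LINT x:?I|lborel. u t x * \<eta> x)"
  define b\<eta> where "b\<eta> = (\<lambda>t. LINT x:?I|lborel. J (t, x) * deriv \<eta> x)"
  have c\<eta>: "continuous_on A \<eta>" for A by (rule smooth_imp_continuous_on[OF \<eta>(1)])
  have c\<eta>': "continuous_on A (deriv \<eta>)" for A by (rule smooth_imp_continuous_on[OF smooth_deriv[OF \<eta>(1)]])
  have p\<eta>': "circle_fun (deriv \<eta>)" by (rule circle_fun_DERIV[OF \<eta>(2) smooth_has_derivative[OF \<eta>(1)]])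
  have cut: "continuous_on UNIV (u t)" if "0 < t" for t
  proof -
    have "continuous_on UNIV (\<lambda>x. (\<lambda>(t, x). u t x) (t, x))"
      by (rule continuous_on_compose2[OF cu]) (use that in \<open>auto intro!: continuous_intros\<close>)
    then show ?thesis by simp
  qed
  have ca: "continuous_on {0<..} a\<eta>" unfolding a\<eta>_def
  proof (rule integral_continuous_in_parameter)
    have "continuous_on ({0<..} \<times> ?I) (\<lambda>z. (\<lambda>(t, x). u t x) z * \<eta> (snd z))"
      by (intro continuous_on_mult continuous_on_subset[OF cu] continuous_on_compose2[OF c\<eta>[of UNIV] continuous_on_snd])
         (auto intro!: continuous_intros)
    then show "continuous_on ({0<..} \<times> ?I) (\<lambda>(t, x). u t x * \<eta> x)" by (simp add: split_beta')
  qed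
  have ib: "set_integrable lborel {a..b} b\<eta>" if "T \<le> a" for a b
  proof -
    have Ji: "set_integrable lborel ({a..b} \<times> ?I) (\<lambda>z. (J z)\<^sup>2)" by (rule J(2)[OF that])
    have ce: "continuous_on UNIV (\<lambda>z::real \<times> real. deriv \<eta> (snd z))"
      by (intro continuous_on_compose2[OF c\<eta>'[of UNIV] continuous_on_snd]) (auto intro!: continuous_intros)
    have me: "(\<lambda>z::real \<times> real. deriv \<eta> (snd z)) \<in> borel_measurable borel"
      by (rule borel_measurable_continuous_onI[OF ce])
    have "bounded ((\<lambda>z. (deriv \<eta> (snd z))\<^sup>2) ` ({a..b} \<times> ?I))"
      by (intro compact_imp_bounded compact_continuous_image compact_Times continuous_on_power continuous_on_subset[OF ce]) auto
    then obtain B where B: "\<And>z. z \<in> {a..b} \<times> ?I \<Longrightarrow> \<bar>(deriv \<eta> (snd z))\<^sup>2\<bar> \<le> B"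
      unfolding bounded_iff by (metis imageI real_norm_def)
    have e2: "set_integrable lborel ({a..b} \<times> ?I) (\<lambda>z. (deriv \<eta> (snd z))\<^sup>2)"
      by (rule set_integrable_bounded[where B = B]) (use me B bounded_rectangle in auto)
    have "set_integrable lborel ({a..b} \<times> ?I) (\<lambda>z. J z * deriv \<eta> (snd z))"
      by (rule set_square_integrable_mult(1)[OF _ _ Ji e2]) (use me in \<open>auto simp: set_borel_measurable_def\<close>)
    from set_integral_prod(2)[OF _ _ this] show ?thesis by (simp add: b\<eta>_def)
  qed
  have wd: "has_weak_deriv 1 {T<..} a\<eta> b\<eta>"
    unfolding has_weak_deriv_def
  proof (intro conjI allI impI)
    fix C assume C: "compact C \<and> C \<subseteq> {T<..}"
    obtain l r where lr: "l < r" "{l..r} \<subseteq> {T<..}" "C \<subseteq> {l<..<r}"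
      by (rule compact_subset_open_interval[of C "{T<..}"]) (use C in \<open>auto simp: is_interval_1\<close>)
    have Tl: "T < l" using lr by (auto simp: subset_eq)
    have Cb: "C \<in> sets lborel" "C \<subseteq> {l..r}" using borel_compact C lr(3) by auto
    have "set_integrable lborel {l..r} a\<eta>"
      by (rule set_integrable_continuous_Icc[OF continuous_on_subset[OF ca]]) (use Tl T in auto)
    then show "set_integrable lborel C a\<eta>" by (rule set_integrable_subset[OF _ Cb])
    show "set_integrable lborel C b\<eta>" by (rule set_integrable_subset[OF ib Cb]) (use Tl in simp)
  next
    fix \<psi> assume "smooth \<psi> \<and> (\<exists>C. compact C \<and> C \<subseteq> {T<..} \<and> (\<forall>x. x \<notin> C \<longrightarrow> \<psi> x = 0))"
    then obtain C where \<psi>: "smooth \<psi>" and C: "compact C" "C \<subseteq> {T<..}" "\<And>x. x \<notin> C \<Longrightarrow> \<psi> x = 0" by blast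
    obtain l r where lr: "l < r" "{l..r} \<subseteq> {T<..}" "C \<subseteq> {l<..<r}"
      by (rule compact_subset_open_interval[of C "{T<..}"]) (use C in \<open>auto simp: is_interval_1\<close>)
    have Tl: "T < l" using lr by (auto simp: subset_eq)
    have out: "\<psi> t = 0" "deriv \<psi> t = 0" if "t \<notin> {l..r}" for t
    proof -
      have "t \<notin> C" using lr(3) that by auto
      then show "\<psi> t = 0" "deriv \<psi> t = 0"
        using C(3) deriv_outside_support[OF compact_imp_closed[OF C(1)], of \<psi> t] by blast+
    qed
    have tf: "test_fun (\<lambda>t x. \<psi> t * \<eta> x)"
      by (rule test_fun_product[OF \<psi> out(1) _ lr(1) \<eta>]) (use Tl T in auto)
    have d1: "deriv (\<lambda>s. \<psi> s * \<eta> x) t = deriv \<psi> t * \<eta> x" for t x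
      by (rule DERIV_imp_deriv) (rule DERIV_cmult_right[OF smooth_has_derivative[OF \<psi>]])
    have d2: "deriv (\<lambda>x. \<psi> t * \<eta> x) x = \<psi> t * deriv \<eta> x" for t x
      by (rule DERIV_imp_deriv) (rule DERIV_cmult[OF smooth_has_derivative[OF \<eta>(1)]])
    define h where "h = (\<lambda>g (t, x). u t x * (deriv \<psi> t * \<eta> x) - (uxx t x + \<alpha>\<^sup>2 * u t x + cos x) * g t x)"
    obtain g where g: "AE t in lborel. 0 < t \<longrightarrow> has_weak_deriv 1 UNIV (\<lambda>x. u t x powr n * (\<psi> t * deriv \<eta> x)) (g t)"
      and hi: "set_integrable lborel ({0<..} \<times> ?I) (h g)"
      and h0: "(LINT z:{0<..} \<times> ?I|lborel. h g z) = 0"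
      using weak[OF tf] unfolding d1 d2 h_def by blast
    note pr = set_integral_prod[OF _ _ hi, simplified]
    have ae: "AE t in lborel. t \<in> {0<..} \<longrightarrow> (LINT x:?I|lborel. h g (t, x)) = deriv \<psi> t * a\<eta> t + \<psi> t * b\<eta> t"
      using g good pr(3)
    proof (eventually_elim, intro impI)
      fix t
      assume g: "0 < t \<longrightarrow> has_weak_deriv 1 UNIV (\<lambda>x. u t x powr n * (\<psi> t * deriv \<eta> x)) (g t)"
        and gd: "T < t \<longrightarrow> (\<exists>V. continuous_on UNIV V \<and> circle_fun V \<and> (AE x in lborel. uxx t x = V x) \<and>
            (\<forall>a b. primitive_on a b (\<lambda>x. p (t, x)) (\<lambda>x. V x + \<alpha>\<^sup>2 * u t x + cos x)))"
        and int: "0 < t \<longrightarrow> set_integrable lborel ?I (\<lambda>x. h g (t, x))"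
        and "t \<in> {0<..}"
      then have t: "0 < t" and gt: "has_weak_deriv 1 UNIV (\<lambda>x. u t x powr n * (\<psi> t * deriv \<eta> x)) (g t)"
        and it: "set_integrable lborel ?I (\<lambda>x. h g (t, x))" by auto
      show "(LINT x:?I|lborel. h g (t, x)) = deriv \<psi> t * a\<eta> t + \<psi> t * b\<eta> t"
      proof (cases "T < t")
        case False
        \<comment> \<open>Up to time \<open>T\<close> the factor in time vanishes, so the
          differentiated product is 0 and its weak derivative \<open>g t\<close> is 0 almost
          everywhere.\<close>
        then have z: "\<psi> t = 0" "deriv \<psi> t = 0" using out Tl by auto
        have "has_weak_deriv 1 UNIV (\<lambda>_. 0) (\<lambda>_. 0)"
          by (rule primitive_imp_has_weak_deriv[OF primitive_on_const]) auto
        from has_weak_deriv_unique[OF gt this] have "AE x in lborel. g t x = 0" using z by simp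
        have "(LINT x:?I|lborel. h g (t, x)) = 0"
          unfolding set_lebesgue_integral_def
        proof (rule integral_eq_zero_AE)
          show "AE x in lborel. indicator ?I x *\<^sub>R h g (t, x) = 0"
            using \<open>AE x in lborel. g t x = 0\<close> by eventually_elim (simp add: h_def z)
        qed
        then show ?thesis using z by simp
      next
        case True
        then obtain V where V: "continuous_on UNIV V" "circle_fun V" "AE x in lborel. uxx t x = V x"
          "\<And>a b. primitive_on a b (\<lambda>x. p (t, x)) (\<lambda>x. V x + \<alpha>\<^sup>2 * u t x + cos x)" using gd by blast
        define G where "G = (\<lambda>x. V x + \<alpha>\<^sup>2 * u t x + cos x)"
        define W where "W = (\<lambda>x. u t x powr n * (\<psi> t * deriv \<eta> x))"
        have cG: "continuous_on UNIV G" unfolding G_def by (intro continuous_intros V cut t)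
        \<comment> \<open>Positivity makes the power continuous; \<open>W\<close> is then its own
          absolutely continuous representative, with derivative \<open>g t\<close>.\<close>
        have cW: "continuous_on UNIV W" unfolding W_def
          by (intro continuous_intros cut t c\<eta>') (use pos[OF True] in \<open>auto simp: less_imp_neq[symmetric]\<close>)
        have pG: "primitive_on a b (\<lambda>x. p (t, x)) G" for a b using V(4) by (simp add: G_def)
        have pW: "primitive_on a b (g t) W" for a b
          by (rule has_weak_deriv_continuous_primitive[OF _ open_UNIV is_interval_univ cW]) (use gt in \<open>auto simp: W_def\<close>)
        have per: "G (2*pi) = G 0" "W (2*pi) = W 0"
          using circle_fun_2pi[OF V(2)] circle_fun_2pi[OF pu[of t]] circle_fun_2pi[OF p\<eta>'] t by (simp_all add: G_def W_def)
        have gi: "set_integrable lborel ?I (\<lambda>x. G x * g t x)"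
          using set_integrable_mult_continuous[OF primitive_on_integrable[OF pW] continuous_on_subset[OF cG]]
          by (simp add: mult.commute)
        have pWi: "set_integrable lborel ?I (\<lambda>x. p (t, x) * W x)"
          by (rule set_integrable_mult_continuous[OF primitive_on_integrable[OF pG] continuous_on_subset[OF cW]]) simp
        have "(LINT x:?I|lborel. p (t, x) * W x + G x * g t x) = 0"
          using primitive_on_integral_mult[OF pG pW, of 0 "2*pi"] per by simp
        then have parts: "(LINT x:?I|lborel. G x * g t x) = - (LINT x:?I|lborel. p (t, x) * W x)"
          using set_integral_add(2)[OF pWi gi] by simp
        have ui: "set_integrable lborel ?I (\<lambda>x. u t x * (deriv \<psi> t * \<eta> x))"
          by (intro set_integrable_continuous_Icc continuous_intros continuous_on_subset[OF cut[OF t]] c\<eta>) simp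
        have "(LINT x:?I|lborel. h g (t, x)) = (LINT x:?I|lborel. u t x * (deriv \<psi> t * \<eta> x) - G x * g t x)"
        proof (rule set_integral_cong_AE_integrable[OF it])
          show "set_integrable lborel ?I (\<lambda>x. u t x * (deriv \<psi> t * \<eta> x) - G x * g t x)"
            by (rule set_integral_diff(1)[OF ui gi])
          show "AE x in lborel. x \<in> ?I \<longrightarrow> h g (t, x) = u t x * (deriv \<psi> t * \<eta> x) - G x * g t x"
            using V(3) by eventually_elim (simp add: h_def G_def)
        qed
        also have "\<dots> = (LINT x:?I|lborel. u t x * (deriv \<psi> t * \<eta> x)) + (LINT x:?I|lborel. p (t, x) * W x)"
          using set_integral_diff(2)[OF ui gi] parts by simp
        also have "(LINT x:?I|lborel. u t x * (deriv \<psi> t * \<eta> x)) = (LINT x:?I|lborel. deriv \<psi> t * (u t x * \<eta> x))"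
          by (simp only: mult.left_commute)
        also have "(LINT x:?I|lborel. p (t, x) * W x) = (LINT x:?I|lborel. \<psi> t * (J (t, x) * deriv \<eta> x))"
          by (simp add: Jp[OF True] W_def mult_ac)
        finally show ?thesis by (simp add: a\<eta>_def b\<eta>_def)
      qed
    qed
    have ai: "set_integrable lborel {l..r} (\<lambda>t. deriv \<psi> t * a\<eta> t)"
      by (intro set_integrable_continuous_Icc continuous_intros smooth_imp_continuous_on smooth_deriv \<psi>
          continuous_on_subset[OF ca]) (use Tl T in auto)
    have "set_integrable lborel {l..r} (\<lambda>t. b\<eta> t * \<psi> t)"
      by (rule set_integrable_mult_continuous[OF ib smooth_imp_continuous_on[OF \<psi>]]) (use Tl in simp)
    then have bi: "set_integrable lborel {l..r} (\<lambda>t. \<psi> t * b\<eta> t)" by (simp add: mult.commute)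
    have sub: "{l..r} \<subseteq> {0<..}" using Tl T by auto
    have si: "set_integrable lborel {0<..} (\<lambda>t. deriv \<psi> t * a\<eta> t + \<psi> t * b\<eta> t)"
      by (rule set_integrable_support[OF set_integral_add(1)[OF ai bi] _ sub]) (use out in auto)
    have "0 = (LINT t:{0<..}|lborel. LINT x:?I|lborel. h g (t, x))" using h0 pr(1) by simp
    also have "\<dots> = (LINT t:{0<..}|lborel. deriv \<psi> t * a\<eta> t + \<psi> t * b\<eta> t)"
      by (rule set_integral_cong_AE_integrable[OF pr(2) si ae])
    also have "\<dots> = (LINT t:{l..r}|lborel. deriv \<psi> t * a\<eta> t + \<psi> t * b\<eta> t)"
      by (rule set_integral_support[OF _ sub]) (use out in auto)
    also have "\<dots> = (LINT t:{l..r}|lborel. deriv \<psi> t * a\<eta> t) + (LINT t:{l..r}|lborel. \<psi> t * b\<eta> t)"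
      by (rule set_integral_add(2)[OF ai bi])
    also have "(LINT t:{l..r}|lborel. deriv \<psi> t * a\<eta> t) = (\<integral>t. deriv \<psi> t * a\<eta> t \<partial>lborel)"
      by (rule integral_eq_set_integral_support[symmetric]) (use out in auto)
    also have "(LINT t:{l..r}|lborel. \<psi> t * b\<eta> t) = (\<integral>t. \<psi> t * b\<eta> t \<partial>lborel)"
      by (rule integral_eq_set_integral_support[symmetric]) (use out in auto)
    finally show "(\<integral>t. a\<eta> t * (deriv ^^ 1) \<psi> t \<partial>lborel) = (- 1) ^ 1 * (\<integral>t. b\<eta> t * \<psi> t \<partial>lborel)"
      by (simp add: mult.commute)
  qed
  have "primitive_on s t b\<eta> a\<eta>"
    by (rule has_weak_deriv_continuous_primitive[OF wd _ _ continuous_on_subset[OF ca]])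
       (use st T in \<open>auto simp: is_interval_1\<close>)
  then show ?thesis using primitive_on_diff_eq[of s t b\<eta> a\<eta> s t] st by (simp add: a\<eta>_def b\<eta>_def)
qed

text \<open>The identity is known for smooth \<eta> but required for \<open>G\<close>, whose
  derivative \<open>g\<close> is merely integrable. With a primitive \<open>V\<close> of the
  increment, which takes equal values at 0 and 2 pi by equality of masses, the circle version of du
  Bois-Reymond makes K + V constant almost everywhere. Replacing \<open>K\<close> by a constant
  minus \<open>V\<close> then reduces the claim to an integration by parts.\<close>

lemma increment_identity:
  fixes u :: "real \<Rightarrow> real \<Rightarrow> real" and J :: "real \<times> real \<Rightarrow> real"
  assumes eq: "\<And>\<eta>. smooth \<eta> \<Longrightarrow> circle_fun \<eta> \<Longrightarrow>
      (LINT x:{0..2*pi}|lborel. u t x * \<eta> x) - (LINT x:{0..2*pi}|lborel. u s x * \<eta> x)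
       = (LINT \<tau>:{s..t}|lborel. LINT x:{0..2*pi}|lborel. J (\<tau>, x) * deriv \<eta> x)"
    and J: "J \<in> borel_measurable borel" "set_integrable lborel ({s..t} \<times> {0..2*pi}) (\<lambda>z. (J z)\<^sup>2)"
    and u: "continuous_on UNIV (u t)" "continuous_on UNIV (u s)"
    and mass: "(LINT x:{0..2*pi}|lborel. u t x) = (LINT x:{0..2*pi}|lborel. u s x)"
    and G: "primitive_on 0 (2*pi) g G" "G (2*pi) = G 0"
  shows "(LINT x:{0..2*pi}|lborel. (u t x - u s x) * G x)
      = (LINT x:{0..2*pi}|lborel. (LINT \<tau>:{s..t}|lborel. J (\<tau>, x)) * g x)"
proof -
  let ?I = "{0..2*pi}"
  note [measurable] = J(1)
  define w where "w = (\<lambda>x. u t x - u s x)"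
  define K where "K = (\<lambda>x. LINT \<tau>:{s..t}|lborel. J (\<tau>, x))"
  have cw: "continuous_on UNIV w" unfolding w_def by (intro continuous_intros u)
  obtain V where V: "\<And>x. (V has_real_derivative w x) (at x)" using exists_antiderivative[OF cw] by blast
  have Vp: "primitive_on a b w V" for a b by (rule primitive_on_DERIV[OF V cw])
  have cV: "continuous_on UNIV V" by (rule primitive_on_continuous_UNIV[OF Vp])
  have "(LINT x:?I|lborel. w x) = 0" unfolding w_def using mass by (subst set_integral_diff(2)) (auto intro: set_integrable_continuous_UNIV u)
  then have V0: "V (2*pi) = V 0" using primitive_on_diff_eq[OF Vp, of 0 0 "2*pi" "2*pi"] by simp
  have Ji: "set_integrable lborel ({s..t} \<times> ?I) J"
    by (rule set_square_integrable_imp_integrable[OF J rectangle_borel bounded_rectangle])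
  have Ki: "set_integrable lborel ?I K" unfolding K_def by (rule set_integral_prod(5)[OF _ _ Ji]) auto
  have "\<exists>c. AE x in lborel. x \<in> ?I \<longrightarrow> K x + V x = c"
  proof (rule du_bois_reymond_circle)
    show "set_integrable lborel ?I (\<lambda>x. K x + V x)" by (rule set_integral_add(1)[OF Ki set_integrable_continuous_UNIV[OF cV]])
    fix \<eta> assume \<eta>: "smooth \<eta>" "circle_fun \<eta>"
    have c\<eta>: "continuous_on A \<eta>" "continuous_on A (deriv \<eta>)" for A
      by (intro smooth_imp_continuous_on smooth_deriv \<eta>)+
    have \<eta>p: "primitive_on a b (deriv \<eta>) \<eta>" for a b
      by (rule primitive_on_DERIV[OF smooth_has_derivative[OF \<eta>(1)] c\<eta>(2)])
    have ce: "continuous_on UNIV (\<lambda>z::real \<times> real. deriv \<eta> (snd z))"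
      by (intro continuous_on_compose2[OF c\<eta>(2)[of UNIV] continuous_on_snd]) (auto intro!: continuous_intros)
    have me: "(\<lambda>z::real \<times> real. deriv \<eta> (snd z)) \<in> borel_measurable borel"
      by (rule borel_measurable_continuous_onI[OF ce])
    have "bounded ((\<lambda>z. (deriv \<eta> (snd z))\<^sup>2) ` ({s..t} \<times> ?I))"
      by (intro compact_imp_bounded compact_continuous_image compact_Times continuous_on_power continuous_on_subset[OF ce]) auto
    then obtain B where B: "\<And>z. z \<in> {s..t} \<times> ?I \<Longrightarrow> \<bar>(deriv \<eta> (snd z))\<^sup>2\<bar> \<le> B"
      unfolding bounded_iff by (metis imageI real_norm_def)
    have e2: "set_integrable lborel ({s..t} \<times> ?I) (\<lambda>z. (deriv \<eta> (snd z))\<^sup>2)"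
      by (rule set_integrable_bounded[where B = B]) (use me B bounded_rectangle in auto)
    have Jd: "set_integrable lborel ({s..t} \<times> ?I) (\<lambda>z. J z * deriv \<eta> (snd z))"
      by (rule set_square_integrable_mult(1)[OF _ _ J(2) e2]) (use me in \<open>auto simp: set_borel_measurable_def\<close>)
    have "(LINT x:?I|lborel. K x * deriv \<eta> x) = (LINT x:?I|lborel. LINT \<tau>:{s..t}|lborel. J (\<tau>, x) * deriv \<eta> x)"
      by (simp add: K_def)
    also have "\<dots> = (LINT \<tau>:{s..t}|lborel. LINT x:?I|lborel. J (\<tau>, x) * deriv \<eta> x)"
      using set_integral_prod(1)[OF _ _ Jd] set_integral_prod(4)[OF _ _ Jd] by simp
    also have "\<dots> = (LINT x:?I|lborel. u t x * \<eta> x) - (LINT x:?I|lborel. u s x * \<eta> x)"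
      by (rule eq[OF \<eta>, symmetric])
    also have "\<dots> = (LINT x:?I|lborel. u t x * \<eta> x - u s x * \<eta> x)"
      by (rule set_integral_diff(2)[symmetric]) (intro set_integrable_continuous_UNIV continuous_intros u c\<eta>)+
    also have "\<dots> = (LINT x:?I|lborel. w x * \<eta> x)" by (simp add: w_def left_diff_distrib)
    finally have 1: "(LINT x:?I|lborel. K x * deriv \<eta> x) = (LINT x:?I|lborel. w x * \<eta> x)" .
    have "(LINT x:?I|lborel. w x * \<eta> x + V x * deriv \<eta> x) = 0"
      using primitive_on_integral_mult[OF Vp \<eta>p, of 0 "2*pi"] V0 circle_fun_2pi[OF \<eta>(2)] by simp
    then have 2: "(LINT x:?I|lborel. w x * \<eta> x) + (LINT x:?I|lborel. V x * deriv \<eta> x) = 0"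
      by (subst (asm) set_integral_add(2)) (intro set_integrable_continuous_UNIV continuous_intros cw cV c\<eta>)+
    have "(LINT x:?I|lborel. (K x + V x) * deriv \<eta> x) = (LINT x:?I|lborel. K x * deriv \<eta> x + V x * deriv \<eta> x)"
      by (simp add: distrib_right)
    also have "\<dots> = (LINT x:?I|lborel. K x * deriv \<eta> x) + (LINT x:?I|lborel. V x * deriv \<eta> x)"
      by (intro set_integral_add(2) set_integrable_mult_continuous[OF Ki c\<eta>(2)] set_integrable_continuous_UNIV continuous_intros cV c\<eta>)
    finally show "(LINT x:?I|lborel. (K x + V x) * deriv \<eta> x) = 0" using 1 2 by simp
  qed
  then obtain c where c: "AE x in lborel. x \<in> ?I \<longrightarrow> K x + V x = c" by blast
  have gi: "set_integrable lborel ?I g" by (rule primitive_on_integrable[OF G(1)])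
  have cG: "continuous_on ?I G" by (rule primitive_on_continuous[OF G(1)])
  have Vg: "set_integrable lborel ?I (\<lambda>x. V x * g x)"
    using set_integrable_mult_continuous[OF gi continuous_on_subset[OF cV]] by (simp add: mult.commute)
  have wG: "set_integrable lborel ?I (\<lambda>x. w x * G x)"
    by (intro set_integrable_continuous_Icc continuous_intros continuous_on_subset[OF cw] cG) simp
  have "(LINT x:?I|lborel. w x * G x + V x * g x) = 0"
    using primitive_on_integral_mult[OF Vp G(1)] V0 G(2) by simp
  then have "(LINT x:?I|lborel. w x * G x) = - (LINT x:?I|lborel. V x * g x)"
    using set_integral_add(2)[OF wG Vg] by simp
  moreover have "(LINT x:?I|lborel. g x) = 0"
    using primitive_on_diff_eq[OF G(1), of 0 "2*pi"] G(2) by simp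
  moreover have "(LINT x:?I|lborel. c * g x - V x * g x) = (LINT x:?I|lborel. c * g x) - (LINT x:?I|lborel. V x * g x)"
    by (intro set_integral_diff(2) set_integrable_mult_right gi Vg)
  moreover have "(LINT x:?I|lborel. K x * g x) = (LINT x:?I|lborel. c * g x - V x * g x)"
    unfolding set_lebesgue_integral_def
  proof (rule integral_cong_AE)
    show "AE x in lborel. indicator ?I x *\<^sub>R (K x * g x) = indicator ?I x *\<^sub>R (c * g x - V x * g x)"
      using c
    proof eventually_elim
      case (elim x)
      then show ?case by (cases "x \<in> ?I") (auto simp: algebra_simps)
    qed
    have "(\<lambda>x. (indicat_real ?I x *\<^sub>R K x) * (indicat_real ?I x *\<^sub>R g x)) \<in> borel_measurable lborel"
      using Ki gi unfolding set_integrable_def by (intro borel_measurable_times borel_measurable_integrable)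
    then show "(\<lambda>x. indicat_real ?I x *\<^sub>R (K x * g x)) \<in> borel_measurable lborel"
      by (rule measurable_cong[THEN iffD1, rotated]) (auto simp: indicator_def)
    have "set_integrable lborel ?I (\<lambda>x. c * g x - V x * g x)"
      by (intro set_integral_diff(1) set_integrable_mult_right gi Vg)
    then show "(\<lambda>x. indicat_real ?I x *\<^sub>R (c * g x - V x * g x)) \<in> borel_measurable lborel"
      unfolding set_integrable_def by (rule borel_measurable_integrable)
  qed
  ultimately show ?thesis by (simp add: w_def K_def)
qed

subsection \<open>Energy balance along the flow\<close>

lemma set_integral_square_add:
  fixes f g :: "real \<Rightarrow> real"
  assumes "f \<in> borel_measurable borel" "g \<in> borel_measurable borel"
    and f: "set_integrable lborel {a..b} (\<lambda>x. (f x)\<^sup>2)" and g: "set_integrable lborel {a..b} (\<lambda>x. (g x)\<^sup>2)"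
  shows "(LINT x:{a..b}|lborel. (f x + g x)\<^sup>2)
    = (LINT x:{a..b}|lborel. (f x)\<^sup>2) + 2 * (LINT x:{a..b}|lborel. f x * g x) + (LINT x:{a..b}|lborel. (g x)\<^sup>2)"
proof -
  have fg: "set_integrable lborel {a..b} (\<lambda>x. f x * g x)"
    by (rule set_square_integrable_mult(1)[OF _ _ f g]) (use assms in \<open>auto simp: set_borel_measurable_def\<close>)
  have "(LINT x:{a..b}|lborel. (f x + g x)\<^sup>2) = (LINT x:{a..b}|lborel. ((f x)\<^sup>2 + 2 * (f x * g x)) + (g x)\<^sup>2)"
    by (simp add: power2_eq_square algebra_simps)
  also have "\<dots> = (LINT x:{a..b}|lborel. (f x)\<^sup>2 + 2 * (f x * g x)) + (LINT x:{a..b}|lborel. (g x)\<^sup>2)"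
    by (intro set_integral_add set_integrable_mult_right f g fg)
  also have "(LINT x:{a..b}|lborel. (f x)\<^sup>2 + 2 * (f x * g x))
      = (LINT x:{a..b}|lborel. (f x)\<^sup>2) + (LINT x:{a..b}|lborel. 2 * (f x * g x))"
    by (intro set_integral_add set_integrable_mult_right f fg)
  finally show ?thesis by simp
qed

text \<open>With D = H - F, the difference Q(F) - Q(H) equals the right-hand side minus Q(D), and
  Q(D) is nonnegative by Wirtinger's inequality. \<open>F\<close> is the state at the later, regular
  time; \<open>H\<close> is an arbitrary earlier state in H1.\<close>

lemma quadratic_form_convex:
  assumes F: "\<And>x. (F has_real_derivative F1 x) (at x)" "\<And>x. (F1 has_real_derivative F2 x) (at x)"
    and cF2: "continuous_on UNIV F2" and pF: "circle_fun F"
    and H: "\<And>a b. primitive_on a b h H" "circle_fun H" "set_integrable lborel {0..2*pi} (\<lambda>x. (h x)\<^sup>2)"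
    and mean: "(LINT x:{0..2*pi}|lborel. H x) = (LINT x:{0..2*pi}|lborel. F x)"
    and \<alpha>: "\<alpha>\<^sup>2 \<le> 1"
  shows "1/2 * ((LINT x:{0..2*pi}|lborel. (F1 x)\<^sup>2) - \<alpha>\<^sup>2 * (LINT x:{0..2*pi}|lborel. (F x)\<^sup>2))
      - 1/2 * ((LINT x:{0..2*pi}|lborel. (h x)\<^sup>2) - \<alpha>\<^sup>2 * (LINT x:{0..2*pi}|lborel. (H x)\<^sup>2))
    \<le> - (LINT x:{0..2*pi}|lborel. (F x - H x) * (F2 x + \<alpha>\<^sup>2 * F x))"
proof -
  let ?I = "{0..2*pi}"
  have cF: "continuous_on UNIV F" "continuous_on UNIV F1"
    by (rule DERIV_continuous_on_UNIV[OF F(1)] DERIV_continuous_on_UNIV[OF F(2)])+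
  have cH: "continuous_on UNIV H" by (rule primitive_on_continuous_UNIV[OF H(1)])
  have pF1: "circle_fun F1" by (rule circle_fun_DERIV[OF pF F(1)])
  have hm: "h \<in> borel_measurable borel" by (rule primitive_measurable[OF H(1)])
  note mF = borel_measurable_continuous_onI[OF cF(1)] borel_measurable_continuous_onI[OF cF(2)]
    borel_measurable_continuous_onI[OF cH]
  define d D where "d = (\<lambda>x. h x - F1 x)" and "D = (\<lambda>x. H x - F x)"
  have Fp: "primitive_on a b F1 F" for a b by (rule primitive_on_DERIV[OF F(1) cF(2)])
  have F1p: "primitive_on a b F2 F1" for a b by (rule primitive_on_DERIV[OF F(2) cF2])
  have Dp: "primitive_on a b d D" for a b unfolding d_def D_def by (rule primitive_on_diff[OF H(1) Fp])
  have pD: "circle_fun D" using H(2) pF by (simp add: D_def circle_fun_def)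
  have dm: "d \<in> borel_measurable borel" by (rule primitive_measurable[OF Dp])
  have cD: "continuous_on UNIV D" by (rule primitive_on_continuous_UNIV[OF Dp])
  have F12: "set_integrable lborel ?I (\<lambda>x. (F1 x)\<^sup>2)" by (intro set_integrable_continuous_UNIV continuous_intros cF)
  have d2: "set_integrable lborel ?I (\<lambda>x. (d x)\<^sup>2)"
    unfolding d_def by (rule set_square_integrable_diff[OF _ _ _ H(3) F12]) (use hm mF in auto)
  have D0: "(LINT x:?I|lborel. D x) = 0"
    unfolding D_def using mean by (subst set_integral_diff(2)) (auto intro: set_integrable_continuous_UNIV cH cF)
  have W: "(LINT x:?I|lborel. (D x)\<^sup>2) \<le> (LINT x:?I|lborel. (d x)\<^sup>2)"
    by (rule wirtinger_circle[OF Dp pD dm d2 D0])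
  have "0 \<le> (LINT x:?I|lborel. (D x)\<^sup>2)" by (rule set_integral_nonneg_real) simp
  then have "\<alpha>\<^sup>2 * (LINT x:?I|lborel. (D x)\<^sup>2) \<le> 1 * (LINT x:?I|lborel. (D x)\<^sup>2)"
    using \<alpha> by (intro mult_right_mono)
  then have nn: "0 \<le> (LINT x:?I|lborel. (d x)\<^sup>2) - \<alpha>\<^sup>2 * (LINT x:?I|lborel. (D x)\<^sup>2)" using W by simp
  have D2: "set_integrable lborel ?I (\<lambda>x. (D x)\<^sup>2)" "set_integrable lborel ?I (\<lambda>x. (F x)\<^sup>2)"
    by (intro set_integrable_continuous_UNIV continuous_intros cD cF)+
  have e1: "(LINT x:?I|lborel. (h x)\<^sup>2) = (LINT x:?I|lborel. (F1 x)\<^sup>2) + 2 * (LINT x:?I|lborel. F1 x * d x)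
      + (LINT x:?I|lborel. (d x)\<^sup>2)"
    using set_integral_square_add[OF mF(2) dm F12 d2] by (simp add: d_def)
  have e2: "(LINT x:?I|lborel. (H x)\<^sup>2) = (LINT x:?I|lborel. (F x)\<^sup>2) + 2 * (LINT x:?I|lborel. F x * D x)
      + (LINT x:?I|lborel. (D x)\<^sup>2)"
    using set_integral_square_add[OF mF(1) borel_measurable_continuous_onI[OF cD] D2(2,1)] by (simp add: D_def)
  have dF1: "set_integrable lborel ?I (\<lambda>x. d x * F1 x)"
    by (rule set_integrable_mult_continuous[OF primitive_on_integrable[OF Dp] continuous_on_subset[OF cF(2)]]) simp
  have DF2: "set_integrable lborel ?I (\<lambda>x. D x * F2 x)" by (intro set_integrable_continuous_UNIV continuous_intros cD cF2)
  have "(LINT x:?I|lborel. d x * F1 x + D x * F2 x) = 0"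
    using primitive_on_integral_mult[OF Dp F1p, of 0 "2*pi"] circle_fun_2pi[OF pD] circle_fun_2pi[OF pF1] by simp
  then have parts: "(LINT x:?I|lborel. F1 x * d x) = - (LINT x:?I|lborel. D x * F2 x)"
    using set_integral_add(2)[OF dF1 DF2] by (simp add: mult.commute)
  have "(LINT x:?I|lborel. (F x - H x) * (F2 x + \<alpha>\<^sup>2 * F x)) = (LINT x:?I|lborel. (- 1) * (D x * F2 x) - \<alpha>\<^sup>2 * (F x * D x))"
    by (simp add: D_def algebra_simps)
  also have "\<dots> = (LINT x:?I|lborel. (- 1) * (D x * F2 x)) - (LINT x:?I|lborel. \<alpha>\<^sup>2 * (F x * D x))"
    by (intro set_integral_diff set_integrable_continuous_UNIV continuous_intros cD cF cF2)
  finally have "(LINT x:?I|lborel. (F x - H x) * (F2 x + \<alpha>\<^sup>2 * F x))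
      = - (LINT x:?I|lborel. D x * F2 x) - \<alpha>\<^sup>2 * (LINT x:?I|lborel. F x * D x)"
    by (simp add: set_integral_uminus[OF DF2])
  then show ?thesis using e1 e2 parts nn by (simp add: algebra_simps)
qed

text \<open>
  In Fourier variables the estimate reads \<open>k\<^sup>2 (k\<^sup>2 - \<alpha>\<^sup>2)\<^sup>2 \<ge> (1 - \<alpha>\<^sup>2) (k\<^sup>2 - \<alpha>\<^sup>2)\<close> for \<open>k \<ge> 1\<close>.
\<close>

lemma quadratic_form_dissipation:
  assumes F: "\<And>x. (F has_real_derivative F1 x) (at x)" "\<And>x. (F1 has_real_derivative F2 x) (at x)"
    and cF2: "continuous_on UNIV F2" and pF: "circle_fun F" and pF2: "circle_fun F2"
    and mean: "(LINT x:{0..2*pi}|lborel. F x) = 0"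
    and p: "\<And>a b. primitive_on a b p (\<lambda>x. F2 x + \<alpha>\<^sup>2 * F x)" "set_integrable lborel {0..2*pi} (\<lambda>x. (p x)\<^sup>2)"
    and \<alpha>: "\<alpha>\<^sup>2 < 1"
  shows "(1 - \<alpha>\<^sup>2) * ((LINT x:{0..2*pi}|lborel. (F1 x)\<^sup>2) - \<alpha>\<^sup>2 * (LINT x:{0..2*pi}|lborel. (F x)\<^sup>2))
    \<le> (LINT x:{0..2*pi}|lborel. (p x)\<^sup>2)"
proof -
  let ?I = "{0..2*pi}"
  have cF: "continuous_on UNIV F" "continuous_on UNIV F1"
    by (rule DERIV_continuous_on_UNIV[OF F(1)] DERIV_continuous_on_UNIV[OF F(2)])+
  have pF1: "circle_fun F1" by (rule circle_fun_DERIV[OF pF F(1)])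
  have Fp: "primitive_on a b F1 F" for a b by (rule primitive_on_DERIV[OF F(1) cF(2)])
  have F1p: "primitive_on a b F2 F1" for a b by (rule primitive_on_DERIV[OF F(2) cF2])
  have pm: "p \<in> borel_measurable borel" by (rule primitive_measurable[OF p(1)])
  \<comment> \<open>Removing the mean makes Wirtinger's inequality applicable to \<open>G\<close>;
    the derivative \<open>p\<close> is unchanged, and the pairing with \<open>F\<close>, which has
    mean 0, does not see the constant.\<close>
  define g where "g = (LINT x:?I|lborel. F2 x + \<alpha>\<^sup>2 * F x) / (2 * pi)"
  define G where "G = (\<lambda>x. F2 x + \<alpha>\<^sup>2 * F x - g)"
  have cG: "continuous_on UNIV G" unfolding G_def by (intro continuous_intros cF cF2)
  have Gp: "primitive_on a b p G" for a b
    using primitive_on_diff[OF p(1) primitive_on_const[of a b g]] by (simp add: G_def)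
  have G0: "(LINT x:?I|lborel. G x) = 0"
    unfolding G_def
    by (subst set_integral_diff(2)) (auto intro!: set_integrable_continuous_UNIV continuous_intros cF cF2 simp: set_integral_const_Icc g_def)
  have pG: "circle_fun G" using pF pF2 by (simp add: circle_fun_def G_def)
  have WG: "(LINT x:?I|lborel. (G x)\<^sup>2) \<le> (LINT x:?I|lborel. (p x)\<^sup>2)"
    by (rule wirtinger_circle[OF Gp pG pm p(2) G0])
  have F12: "set_integrable lborel ?I (\<lambda>x. (F1 x)\<^sup>2)" by (intro set_integrable_continuous_UNIV continuous_intros cF)
  have WF: "(LINT x:?I|lborel. (F x)\<^sup>2) \<le> (LINT x:?I|lborel. (F1 x)\<^sup>2)"
    by (rule wirtinger_circle[OF Fp pF borel_measurable_continuous_onI[OF cF(2)] F12 mean])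
  define X N P where "X = (LINT x:?I|lborel. (F1 x)\<^sup>2) - \<alpha>\<^sup>2 * (LINT x:?I|lborel. (F x)\<^sup>2)"
    and "N = (LINT x:?I|lborel. (F x)\<^sup>2)" and "P = (LINT x:?I|lborel. (p x)\<^sup>2)"
  have N: "0 \<le> N" unfolding N_def by (rule set_integral_nonneg_real) simp
  have P: "0 \<le> P" unfolding P_def by (rule set_integral_nonneg_real) simp
  have XN: "(1 - \<alpha>\<^sup>2) * N \<le> X" using WF by (simp add: X_def N_def algebra_simps)
  have X0: "0 \<le> X" using XN N \<alpha> by (smt (verit) mult_nonneg_nonneg)
  have "(LINT x:?I|lborel. F1 x * F1 x + F x * F2 x) = 0"
    using primitive_on_integral_mult[OF Fp F1p, of 0 "2*pi"] circle_fun_2pi[OF pF] circle_fun_2pi[OF pF1] by simp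
  moreover have "(LINT x:?I|lborel. F1 x * F1 x + F x * F2 x) = (LINT x:?I|lborel. F1 x * F1 x) + (LINT x:?I|lborel. F x * F2 x)"
    by (intro set_integral_add set_integrable_continuous_UNIV continuous_intros cF cF2)
  ultimately have parts: "(LINT x:?I|lborel. (F1 x)\<^sup>2) = - (LINT x:?I|lborel. F x * F2 x)"
    by (simp add: power2_eq_square)
  have "(LINT x:?I|lborel. F x * G x) = (LINT x:?I|lborel. (F x * F2 x + \<alpha>\<^sup>2 * (F x)\<^sup>2) - g * F x)"
    by (simp add: G_def power2_eq_square algebra_simps)
  also have "\<dots> = (LINT x:?I|lborel. F x * F2 x + \<alpha>\<^sup>2 * (F x)\<^sup>2) - (LINT x:?I|lborel. g * F x)"
    by (intro set_integral_diff set_integrable_continuous_UNIV continuous_intros cF cF2)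
  also have "(LINT x:?I|lborel. F x * F2 x + \<alpha>\<^sup>2 * (F x)\<^sup>2) = (LINT x:?I|lborel. F x * F2 x) + (LINT x:?I|lborel. \<alpha>\<^sup>2 * (F x)\<^sup>2)"
    by (intro set_integral_add set_integrable_continuous_UNIV continuous_intros cF cF2)
  finally have XG: "X = - (LINT x:?I|lborel. F x * G x)" using parts mean by (simp add: X_def)
  have "\<bar>LINT x:?I|lborel. F x * G x\<bar> \<le> sqrt N * sqrt (LINT x:?I|lborel. (G x)\<^sup>2)"
    unfolding N_def
    by (rule set_square_integrable_mult(2))
       (use cF(1) cG borel_measurable_continuous_onI[OF cF(1)] borel_measurable_continuous_onI[OF cG]
        in \<open>auto simp: set_borel_measurable_def intro!: set_integrable_continuous_UNIV continuous_intros\<close>)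
  also have "\<dots> \<le> sqrt N * sqrt P" using WG N by (intro mult_left_mono) (auto simp: P_def)
  finally have "X \<le> sqrt N * sqrt P" using XG by simp
  then have "X * X \<le> (sqrt N * sqrt P) * (sqrt N * sqrt P)" using X0 by (intro mult_mono) auto
  also have "\<dots> = N * P" using N P by (simp add: mult_ac real_sqrt_mult_self)
  finally have XX: "X * X \<le> N * P" .
  \<comment> \<open>Combine X^2 \<le> N P with (1 - \<alpha>^2) N \<le> X and divide by
    \<open>X\<close>.\<close>
  have "(1 - \<alpha>\<^sup>2) * X \<le> P"
  proof (cases "X = 0")
    case False
    then have Xp: "0 < X" using X0 by simp
    have "(1 - \<alpha>\<^sup>2) * (X * X) \<le> (1 - \<alpha>\<^sup>2) * (N * P)" using XX \<alpha> by (intro mult_left_mono) auto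
    also have "\<dots> = ((1 - \<alpha>\<^sup>2) * N) * P" by simp
    also have "\<dots> \<le> X * P" using XN P by (intro mult_right_mono) auto
    finally have "X * ((1 - \<alpha>\<^sup>2) * X) \<le> X * P" by (simp add: mult_ac)
    then show ?thesis using Xp by simp
  qed (use P in simp)
  then show ?thesis by (simp add: X_def P_def)
qed

text \<open>A continuous approximant is not enough here, since it will be differentiated in an
  integration by parts; polynomials supply the derivative.\<close>

lemma square_integrable_polynomial_approx:
  fixes f :: "real \<Rightarrow> real"
  assumes f: "f \<in> borel_measurable borel" "set_integrable lborel {a..b} (\<lambda>x. (f x)\<^sup>2)" and ab: "a \<le> b" and e: "0 < e"
  obtains P P' where "\<And>x. (P has_real_derivative P' x) (at x)" "continuous_on UNIV P'"
    "(LINT x:{a..b}|lborel. (f x - P x)\<^sup>2) < e"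
proof -
  obtain g where g: "continuous_on UNIV g" "set_integrable lborel {a..b} (\<lambda>x. (f x - g x)\<^sup>2)"
    "(LINT x:{a..b}|lborel. (f x - g x)\<^sup>2) < e / 4"
    by (rule square_integrable_continuous_approx[OF f, of "e / 4"]) (use e in auto)
  define \<omega> where "\<omega> = sqrt (e / (4 * (b - a + 1)))"
  have \<omega>: "0 < \<omega>" "\<omega>\<^sup>2 = e / (4 * (b - a + 1))" using e ab by (auto simp: \<omega>_def)
  obtain P where P: "real_polynomial_function P" "\<And>x. x \<in> {a..b} \<Longrightarrow> \<bar>g x - P x\<bar> < \<omega>"
    using Stone_Weierstrass_real_polynomial_function[of "{a..b}" g \<omega>] \<omega>(1) continuous_on_subset[OF g(1)] by auto
  have "polynomial_function P" using P(1) real_polynomial_function_eq by blast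
  then obtain P' where P': "polynomial_function P'" "\<And>x. (P has_vector_derivative P' x) (at x)"
    using has_vector_derivative_polynomial_function by blast
  have cP': "continuous_on UNIV P'" using P'(1) continuous_on_polymonial_function by blast
  have dP: "(P has_real_derivative P' x) (at x)" for x
    using P'(2) by (simp add: has_real_derivative_iff_has_vector_derivative)
  have cP: "continuous_on UNIV P" by (rule DERIV_continuous_on_UNIV[OF dP])
  have i2: "set_integrable lborel {a..b} (\<lambda>x. (g x - P x)\<^sup>2)"
    by (intro set_integrable_continuous_Icc continuous_intros continuous_on_subset[OF g(1)] continuous_on_subset[OF cP]) auto
  have "(LINT x:{a..b}|lborel. (g x - P x)\<^sup>2) \<le> (LINT x:{a..b}|lborel. \<omega>\<^sup>2)"
  proof (rule set_integral_mono[OF i2])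
    fix x assume "x \<in> {a..b}"
    then show "(g x - P x)\<^sup>2 \<le> \<omega>\<^sup>2" using P(2)[of x] by (simp add: abs_le_square_iff[symmetric] less_imp_le)
  qed (intro set_integrable_continuous_Icc continuous_intros)
  also have "\<dots> = (e / 4) * ((b - a) / (b - a + 1))" using ab by (simp add: set_integral_const_Icc \<omega>(2))
  also have "\<dots> \<le> (e / 4) * 1" using e ab by (intro mult_left_mono) auto
  finally have le2: "(LINT x:{a..b}|lborel. (g x - P x)\<^sup>2) \<le> e / 4" by simp
  have ptw: "(f x - P x)\<^sup>2 \<le> 2 * (f x - g x)\<^sup>2 + 2 * (g x - P x)\<^sup>2" for x
    using sum_squares_bound[of "f x - g x" "g x - P x"] by (simp add: power2_eq_square algebra_simps)
  have b: "set_integrable lborel {a..b} (\<lambda>x. 2 * (f x - g x)\<^sup>2 + 2 * (g x - P x)\<^sup>2)"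
    by (intro set_integral_add set_integrable_mult_right g i2)
  have iP: "set_integrable lborel {a..b} (\<lambda>x. (P x)\<^sup>2)"
    by (intro set_integrable_continuous_Icc continuous_intros continuous_on_subset[OF cP]) auto
  have "(LINT x:{a..b}|lborel. (f x - P x)\<^sup>2) \<le> (LINT x:{a..b}|lborel. 2 * (f x - g x)\<^sup>2 + 2 * (g x - P x)\<^sup>2)"
    by (rule set_integral_mono[OF _ b ptw], rule set_square_integrable_diff[OF _ _ _ f(2) iP])
       (use f(1) borel_measurable_continuous_onI[OF cP] in auto)
  also have "\<dots> = (LINT x:{a..b}|lborel. 2 * (f x - g x)\<^sup>2) + (LINT x:{a..b}|lborel. 2 * (g x - P x)\<^sup>2)"
    by (intro set_integral_add set_integrable_mult_right g i2)
  also have "\<dots> < e"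
  proof -
    have "(LINT x:{a..b}|lborel. 2 * (f x - g x)\<^sup>2) < e / 2" using g(3) by simp
    moreover have "(LINT x:{a..b}|lborel. 2 * (g x - P x)\<^sup>2) \<le> e / 2" using le2 by simp
    ultimately show ?thesis by simp
  qed
  finally show ?thesis using that[OF dP cP'] by blast
qed

text \<open>
  Lower semicontinuity of the Dirichlet integral: \<open>2 P w\<^sub>x - P\<^sup>2 \<le> w\<^sub>x\<^sup>2\<close> with a polynomial \<open>P\<close>
  close to \<open>w\<^sub>x\<close>, and the integral of \<open>P w\<^sub>x\<close> is continuous in time after integration by parts.
\<close>

lemma dirichlet_integral_lsc:
  fixes w wx :: "real \<Rightarrow> real \<Rightarrow> real"
  assumes cw: "continuous_on ({T<..} \<times> UNIV) (\<lambda>(t, x). w t x)"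
    and wp: "\<And>t a b. T < t \<Longrightarrow> primitive_on a b (wx t) (w t)"
    and w2: "\<And>t. T < t \<Longrightarrow> set_integrable lborel {a..b} (\<lambda>x. (wx t x)\<^sup>2)"
    and t: "T < t" and ab: "a \<le> b" and e: "0 < e"
  shows "eventually (\<lambda>s. (LINT x:{a..b}|lborel. (wx t x)\<^sup>2) - e < (LINT x:{a..b}|lborel. (wx s x)\<^sup>2)) (nhds t)"
proof -
  have wm: "wx s \<in> borel_measurable borel" if "T < s" for s by (rule primitive_measurable[OF wp[OF that]])
  obtain P P' where P: "\<And>x. (P has_real_derivative P' x) (at x)" "continuous_on UNIV P'"
    "(LINT x:{a..b}|lborel. (wx t x - P x)\<^sup>2) < e / 2"
    by (rule square_integrable_polynomial_approx[OF wm[OF t] w2[OF t] ab, of "e / 2"]) (use e in auto)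
  have cP: "continuous_on UNIV P" by (rule DERIV_continuous_on_UNIV[OF P(1)])
  have mP: "P \<in> borel_measurable borel" by (rule borel_measurable_continuous_onI[OF cP])
  have Pp: "primitive_on a b P' P" by (rule primitive_on_DERIV[OF P(1,2)])
  have P2: "set_integrable lborel {a..b} (\<lambda>x. (P x)\<^sup>2)"
    by (intro set_integrable_continuous_Icc continuous_intros continuous_on_subset[OF cP]) auto
  define \<Phi> where "\<Phi> = (\<lambda>s. w s b * P b - w s a * P a - (LINT x:{a..b}|lborel. w s x * P' x))"
  have cs: "continuous_on {T<..} (\<lambda>s. w s x)" for x
  proof -
    have "continuous_on {T<..} (\<lambda>s. (\<lambda>(t, x). w t x) (s, x))"
      by (rule continuous_on_compose2[OF cw]) (auto intro!: continuous_intros)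
    then show ?thesis by simp
  qed
  have "continuous_on ({T<..} \<times> {a..b}) (\<lambda>z. (\<lambda>(t, x). w t x) z * P' (snd z))"
    by (intro continuous_on_mult continuous_on_subset[OF cw] continuous_on_compose2[OF P(2) continuous_on_snd])
       (auto intro!: continuous_intros)
  then have "continuous_on {T<..} (\<lambda>s. LINT x:{a..b}|lborel. w s x * P' x)"
    by (intro integral_continuous_in_parameter) (simp add: split_beta')
  then have "continuous_on {T<..} \<Phi>" unfolding \<Phi>_def by (intro continuous_intros cs)
  then have "(\<Phi> \<longlongrightarrow> \<Phi> t) (nhds t)"
    using t by (metis continuous_on_eq_continuous_at greaterThan_iff isCont_def open_greaterThan tendsto_at_iff_tendsto_nhds)
  then have ev1: "eventually (\<lambda>s. \<Phi> t - e / 4 < \<Phi> s) (nhds t)" by (rule order_tendstoD(1)) (use e in simp)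
  have ev2: "eventually (\<lambda>s. s \<in> {T<..}) (nhds t)" using t by (intro eventually_nhds_in_open) auto
  have expand: "(LINT x:{a..b}|lborel. (wx s x - P x)\<^sup>2)
      = (LINT x:{a..b}|lborel. (wx s x)\<^sup>2) - 2 * \<Phi> s + (LINT x:{a..b}|lborel. (P x)\<^sup>2)" if s: "T < s" for s
  proof -
    have wi: "set_integrable lborel {a..b} (\<lambda>x. wx s x * P x)"
      by (rule set_integrable_mult_continuous[OF primitive_on_integrable[OF wp[OF s]] continuous_on_subset[OF cP]]) simp
    have wi': "set_integrable lborel {a..b} (\<lambda>x. w s x * P' x)"
      by (intro set_integrable_continuous_Icc continuous_on_mult primitive_on_continuous[OF wp[OF s]] continuous_on_subset[OF P(2)]) simp
    have c: "(LINT x:{a..b}|lborel. wx s x * P x) = \<Phi> s"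
      using primitive_on_integral_mult[OF wp[OF s] Pp ab] set_integral_add(2)[OF wi wi'] by (simp add: \<Phi>_def)
    have "set_integrable lborel {a..b} (\<lambda>x. (- P x)\<^sup>2)" using P2 by simp
    from set_integral_square_add[OF wm[OF s] _ w2[OF s] this] mP
    show "(LINT x:{a..b}|lborel. (wx s x - P x)\<^sup>2)
      = (LINT x:{a..b}|lborel. (wx s x)\<^sup>2) - 2 * \<Phi> s + (LINT x:{a..b}|lborel. (P x)\<^sup>2)"
      using c set_integral_uminus[OF wi] by simp
  qed
  show ?thesis using ev1 ev2
  proof eventually_elim
    case (elim s)
    then have s: "T < s" by simp
    have "0 \<le> (LINT x:{a..b}|lborel. (wx s x - P x)\<^sup>2)" by (rule set_integral_nonneg_real) simp
    \<comment> \<open>The approximation error at \<open>t\<close> costs e/2, and the change of 2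
      \<Phi> between \<open>t\<close> and \<open>s\<close> costs another e/2.\<close>
    then show ?case using expand[OF s] expand[OF t] P(3) elim(1) e by linarith
  qed
qed

subsection \<open>A Gronwall argument\<close>

text \<open>Mean value theorem. On [m/2, m] the derivative of the power is largest at
  \<open>m\<close> for n \<ge> 1 and at m/2 for n < 1; adding both values covers the two cases with
  one constant.\<close>

lemma powr_diff_le_linear:
  fixes m n :: real
  assumes m: "0 < m" and n: "0 < n"
  obtains c where "0 \<le> c" "\<And>x. 0 \<le> x \<Longrightarrow> x \<le> m / 2 \<Longrightarrow> m powr n - (m - x) powr n \<le> c * x"
proof -
  define c where "c = n * (m powr (n - 1) + (m / 2) powr (n - 1))"
  have "m powr n - (m - x) powr n \<le> c * x" if x: "0 \<le> x" "x \<le> m / 2" for x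
  proof (cases "x = 0")
    case False
    then have lt: "m - x < m" using x by simp
    have "\<exists>z. m - x < z \<and> z < m \<and> m powr n - (m - x) powr n = (m - (m - x)) * (n * z powr (n - 1))"
      by (rule MVT2[OF lt]) (use x m in \<open>auto intro!: derivative_eq_intros\<close>)
    then obtain z where z: "m - x < z" "z < m" "m powr n - (m - x) powr n = x * (n * z powr (n - 1))" by auto
    have "z powr (n - 1) \<le> m powr (n - 1) + (m / 2) powr (n - 1)"
    proof (cases "1 \<le> n")
      case True
      then have "z powr (n - 1) \<le> m powr (n - 1)" using z x m by (intro powr_mono2) auto
      then show ?thesis by (simp add: add_increasing2)
    next
      case False
      then have "z powr (n - 1) \<le> (m / 2) powr (n - 1)" using z x m by (intro powr_mono2') auto
      then show ?thesis by (simp add: add_increasing)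
    qed
    then have "n * z powr (n - 1) \<le> c" using n by (simp add: c_def)
    then have "x * (n * z powr (n - 1)) \<le> x * c" using x(1) by (rule mult_left_mono)
    then show ?thesis using z(3) by (simp add: mult.commute)
  qed simp
  moreover have "0 \<le> c" using n by (simp add: c_def)
  ultimately show ?thesis using that by blast
qed

lemma exp_le_if_power_le:
  fixes x y A :: real
  assumes "\<And>N::nat. 0 < N \<Longrightarrow> y * (1 + x / real N) ^ N \<le> A" shows "y * exp x \<le> A"
proof (rule LIMSEQ_le_const2)
  show "(\<lambda>N. y * (1 + x / real N) ^ N) \<longlonglongrightarrow> y * exp x"
    by (intro tendsto_mult tendsto_const tendsto_exp_limit_sequentially)
  show "\<exists>N. \<forall>n\<ge>N. y * (1 + x / real n) ^ n \<le> A" using assms by (intro exI[of _ 1]) auto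
qed

text \<open>
  The decay rate depends on the decaying quantity itself. Since \<open>Y\<close> decays exponentially at some
  positive rate, the deviation of the rate from its limit is summable along integer times, so that
  the limiting rate is attained exactly.
\<close>

lemma decay_with_limiting_rate:
  fixes Y :: "real \<Rightarrow> real"
  assumes mono: "\<And>a b. T < a \<Longrightarrow> a \<le> b \<Longrightarrow> Y b \<le> Y a" and nonneg: "\<And>a. T < a \<Longrightarrow> 0 \<le> Y a"
    and pos: "0 < m" "0 < n" "0 < C" "0 < \<kappa>"
    and small: "\<And>a. T < a \<Longrightarrow> C * sqrt (Y a) \<le> m / 2"
    and step: "\<And>a b. T < a \<Longrightarrow> a < b \<Longrightarrow> Y b * (1 + \<kappa> * (m - C * sqrt (Y a)) powr n * (b - a)) \<le> Y a"
  obtains K where "\<And>t. T + 1 \<le> t \<Longrightarrow> Y t \<le> K * exp (- (\<kappa> * m powr n) * t)"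
proof -
  define rt where "rt = (\<lambda>a. \<kappa> * (m - C * sqrt (Y a)) powr n)"
  have lpos: "0 < rt a" if "T < a" for a
  proof -
    have "0 < m - C * sqrt (Y a)" using small[OF that] pos by linarith
    then show ?thesis using pos by (simp add: rt_def)
  qed
  have lmono: "rt a \<le> rt b" if "T < a" "a \<le> b" for a b
  proof -
    have "C * sqrt (Y b) \<le> C * sqrt (Y a)" using mono[OF that] pos by simp
    then show ?thesis using small[OF that(1)] pos unfolding rt_def
      by (intro mult_left_mono powr_mono2) auto
  qed
  \<comment> \<open>One step of length b - a gives a linear factor only; N equal steps give a
    compound factor that tends to the exponential. The rate at \<open>a\<close> serves for all of
    them, since the rate increases as \<open>Y\<close> decreases.\<close>
  have expstep: "Y b \<le> Y a * exp (- rt a * (b - a))" if ab: "T < a" "a \<le> b" for a b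
  proof -
    have "Y b * (1 + rt a * (b - a) / real N) ^ N \<le> Y a" if N: "0 < N" for N :: nat
    proof -
      define d where "d = (b - a) / real N"
      have d: "0 \<le> d" using ab by (simp add: d_def)
      define q where "q = 1 + rt a * d"
      have q: "1 \<le> q" using d lpos[OF ab(1)] by (simp add: q_def)
      have "Y (a + real k * d) * q ^ k \<le> Y a" for k
      proof (induction k)
        case (Suc k)
        let ?a = "a + real k * d"
        have "0 \<le> real k * d" using d by simp
        then have Ta: "T < ?a" "a \<le> ?a" using ab by linarith+
        have le: "Y (?a + d) * q \<le> Y ?a"
        proof (cases "d = 0")
          case False
          then have "Y (?a + d) * (1 + rt ?a * d) \<le> Y ?a"
            using step[OF Ta(1), of "?a + d"] d by (simp add: rt_def)
          moreover have "q \<le> 1 + rt ?a * d" using lmono[OF ab(1) Ta(2)] d by (simp add: q_def mult_right_mono)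
          moreover have "0 \<le> Y (?a + d)" using Ta d by (intro nonneg) auto
          ultimately show ?thesis by (meson mult_left_mono order_trans)
        qed (simp add: q_def)
        have "Y (a + real (Suc k) * d) * q ^ Suc k = (Y (?a + d) * q) * q ^ k" by (simp add: algebra_simps)
        also have "\<dots> \<le> Y ?a * q ^ k" using le q by (intro mult_right_mono) auto
        finally show ?case using Suc by simp
      qed simp
      from this[of N] show ?thesis using N by (simp add: d_def q_def)
    qed
    then have "Y b * exp (rt a * (b - a)) \<le> Y a" by (rule exp_le_if_power_le)
    then have "Y b * exp (rt a * (b - a)) * exp (- (rt a * (b - a))) \<le> Y a * exp (- (rt a * (b - a)))"
      by (rule mult_right_mono) simp
    then show ?thesis by (simp add: mult.assoc exp_minus_inverse)
  qed
  define a0 where "a0 = T + 1"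
  have a0: "T < a0" by (simp add: a0_def)
  define Y0 where "Y0 = Y a0"
  have Y0: "0 \<le> Y0" using nonneg[OF a0] by (simp add: Y0_def)
  obtain c where c: "0 \<le> c" "\<And>x. 0 \<le> x \<Longrightarrow> x \<le> m / 2 \<Longrightarrow> m powr n - (m - x) powr n \<le> c * x"
    using powr_diff_le_linear[OF pos(1,2)] by blast
  \<comment> \<open>The exponent is halved because the deviation of the rate is controlled by the
    square root of \<open>Y\<close>.\<close>
  define r where "r = exp (- rt a0 / 2)"
  have r: "0 < r" "r < 1" using lpos[OF a0] by (auto simp: r_def)
  define \<mu> where "\<mu> = \<kappa> * m powr n"
  have mu: "0 \<le> \<mu>" using pos by (simp add: \<mu>_def)
  define E where "E = \<kappa> * c * C * sqrt Y0"
  have E: "0 \<le> E" using pos c Y0 by (simp add: E_def)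
  have rate: "\<mu> - E * r ^ k \<le> rt (a0 + real k)" for k
  proof -
    have Ta: "T < a0 + real k" using a0 by linarith
    have "Y (a0 + real k) \<le> Y0 * exp (- rt a0 * real k)" using expstep[OF a0, of "a0 + real k"] by (simp add: Y0_def)
    also have "\<dots> = Y0 * (r ^ k)\<^sup>2"
      by (simp add: r_def exp_of_nat_mult[symmetric] power2_eq_square exp_add[symmetric] mult.commute)
    finally have "sqrt (Y (a0 + real k)) \<le> sqrt (Y0 * (r ^ k)\<^sup>2)" by simp
    also have "\<dots> = sqrt Y0 * r ^ k" using r by (simp add: real_sqrt_mult)
    finally have sq: "sqrt (Y (a0 + real k)) \<le> sqrt Y0 * r ^ k" .
    define x where "x = C * sqrt (Y (a0 + real k))"
    have x: "0 \<le> x" "x \<le> m / 2" using pos nonneg[OF Ta] small[OF Ta] by (auto simp: x_def)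
    have "\<mu> - rt (a0 + real k) = \<kappa> * (m powr n - (m - x) powr n)" by (simp add: \<mu>_def rt_def x_def right_diff_distrib)
    also have "\<dots> \<le> \<kappa> * (c * x)" using c(2)[OF x] pos by (intro mult_left_mono) auto
    also have "\<dots> \<le> \<kappa> * (c * (C * (sqrt Y0 * r ^ k)))"
      using sq pos c(1) unfolding x_def by (intro mult_left_mono) auto
    also have "\<dots> = E * r ^ k" by (simp add: E_def)
    finally show ?thesis by simp
  qed
  have disc: "Y (a0 + real k) \<le> Y0 * exp (- \<mu> * real k + E * (\<Sum>j<k. r ^ j))" for k
  proof (induction k)
    case (Suc k)
    have Ta: "T < a0 + real k" using a0 by linarith
    have "Y (a0 + real (Suc k)) \<le> Y (a0 + real k) * exp (- rt (a0 + real k))"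
      using expstep[OF Ta, of "a0 + real (Suc k)"] by (simp add: algebra_simps)
    also have "\<dots> \<le> Y (a0 + real k) * exp (- \<mu> + E * r ^ k)"
      using rate[of k] nonneg[OF Ta] by (intro mult_left_mono) auto
    also have "\<dots> \<le> (Y0 * exp (- \<mu> * real k + E * (\<Sum>j<k. r ^ j))) * exp (- \<mu> + E * r ^ k)"
      using Suc by (intro mult_right_mono) auto
    also have "\<dots> = Y0 * exp (- \<mu> * real (Suc k) + E * (\<Sum>j<Suc k. r ^ j))"
      by (simp add: exp_add[symmetric] algebra_simps)
    finally show ?case .
  qed (simp add: Y0_def)
  \<comment> \<open>The geometric series of the deviations contributes E / (1 - r), and
    \<open>a0 + 1\<close> accounts for the starting time and for rounding to an integer number of
    steps.\<close>
  define K where "K = Y0 * exp (E / (1 - r)) * exp (\<mu> * (a0 + 1))"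
  have "Y t \<le> K * exp (- \<mu> * t)" if t: "T + 1 \<le> t" for t
  proof -
    define k where "k = nat \<lfloor>t - a0\<rfloor>"
    have "0 \<le> t - a0" using t by (simp add: a0_def)
    then have k: "real k \<le> t - a0" "t - a0 < real k + 1" unfolding k_def by linarith+
    have "(\<Sum>j<k. r ^ j) \<le> (\<Sum>j. r ^ j)"
      using r by (intro sum_le_suminf summable_geometric) auto
    also have "\<dots> = 1 / (1 - r)" using r by (simp add: suminf_geometric)
    finally have "E * (\<Sum>j<k. r ^ j) \<le> E * (1 / (1 - r))" using E by (rule mult_left_mono)
    moreover have "\<mu> * (t - a0) \<le> \<mu> * (real k + 1)" using k mu by (intro mult_left_mono) auto
    ultimately have ex: "- \<mu> * real k + E * (\<Sum>j<k. r ^ j) \<le> E / (1 - r) + \<mu> * (a0 + 1) + - \<mu> * t"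
      by (simp add: algebra_simps)
    have "Y t \<le> Y (a0 + real k)" using k a0 by (intro mono) auto
    also have "\<dots> \<le> Y0 * exp (- \<mu> * real k + E * (\<Sum>j<k. r ^ j))" by (rule disc)
    also have "\<dots> \<le> Y0 * exp (E / (1 - r) + \<mu> * (a0 + 1) + - \<mu> * t)" using ex Y0 by (intro mult_left_mono) auto
    also have "\<dots> = K * exp (- \<mu> * t)" unfolding K_def exp_add by (simp only: mult.assoc)
    finally show ?thesis .
  qed
  then show ?thesis using that unfolding \<mu>_def by blast
qed

text \<open>A later value is bounded by an average of earlier ones, which does not compare single
  values of \<open>Q\<close>. The supremum over all later times is monotone, dominates every such
  average and inherits a step inequality.\<close>

lemma averaged_gronwall:
  fixes Q q D :: "real \<Rightarrow> real"
  assumes Q: "\<And>t. T < t \<Longrightarrow> 0 \<le> Q t" "\<And>t. T < t \<Longrightarrow> C * sqrt (Q t) \<le> m / 2"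
    and pos: "0 < m" "0 < n" "0 < C" "0 < \<kappa>"
    and q: "AE t in lborel. T < t \<longrightarrow> q t = Q t" "\<And>a b. T < a \<Longrightarrow> set_integrable lborel {a..b} q"
    and D: "\<And>a b. T < a \<Longrightarrow> set_integrable lborel {a..b} D"
      "AE t in lborel. T < t \<longrightarrow> \<kappa> * (m - C * sqrt (Q t)) powr n * Q t \<le> D t"
    and avg: "\<And>a\<^sub>1 a\<^sub>2 b. T < a\<^sub>1 \<Longrightarrow> a\<^sub>1 < a\<^sub>2 \<Longrightarrow> a\<^sub>2 < b \<Longrightarrow>
       Q b + (LINT t:{a\<^sub>2..b}|lborel. D t) \<le> (LINT t:{a\<^sub>1..a\<^sub>2}|lborel. q t) / (a\<^sub>2 - a\<^sub>1)"
  obtains K where "\<And>t. T + 1 \<le> t \<Longrightarrow> Q t \<le> K * exp (- (\<kappa> * m powr n) * t)"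
proof -
  define B where "B = (m / (2 * C))\<^sup>2"
  have QB: "Q t \<le> B" if "T < t" for t
  proof -
    have "sqrt (Q t) \<le> m / (2 * C)" using Q(2)[OF that] pos by (simp add: field_simps)
    then have "(sqrt (Q t))\<^sup>2 \<le> B" unfolding B_def using Q(1)[OF that] by (intro power_mono) auto
    then show ?thesis using Q(1)[OF that] by simp
  qed
  define Y where "Y = (\<lambda>a. Sup (Q ` {a..}))"
  have bdd: "bdd_above (Q ` {a..})" if "T < a" for a
    by (rule bdd_aboveI2[where M = B]) (use QB that in auto)
  have QY: "Q t \<le> Y a" if "T < a" "a \<le> t" for t a
    unfolding Y_def using that by (intro cSup_upper bdd) auto
  have YI: "Y a \<le> z" if "\<And>t. a \<le> t \<Longrightarrow> Q t \<le> z" for a z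
    unfolding Y_def by (rule cSup_least) (use that in auto)
  have Ymono: "Y b \<le> Y a" if "T < a" "a \<le> b" for a b
    by (rule YI) (use that in \<open>auto intro!: QY\<close>)
  have Ynn: "0 \<le> Y a" if "T < a" for a using QY[OF that order_refl] Q(1)[OF that] by linarith
  have YB: "Y a \<le> B" if "T < a" for a by (rule YI) (use QB that in auto)
  have Ysmall: "C * sqrt (Y a) \<le> m / 2" if "T < a" for a
  proof -
    have "sqrt (Y a) \<le> sqrt B" using YB[OF that] by simp
    also have "sqrt B = m / (2 * C)" using pos by (simp add: B_def)
    finally show ?thesis using pos by (simp add: field_simps)
  qed
  have D0: "AE t in lborel. T < t \<longrightarrow> 0 \<le> D t"
    using D(2)
  proof eventually_elim
    case (elim t)
    show ?case
    proof
      assume "T < t"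
      then have "0 \<le> \<kappa> * (m - C * sqrt (Q t)) powr n * Q t" using Q(1) pos by simp
      then show "0 \<le> D t" using elim \<open>T < t\<close> by linarith
    qed
  qed
  have Dnn: "0 \<le> (LINT t:{a..b}|lborel. D t)" if "T < a" for a b
    unfolding set_lebesgue_integral_def
    by (rule integral_nonneg_AE) (use D0 that in \<open>auto elim!: eventually_mono simp: indicator_def\<close>)
  have mean_le: "(LINT t:{a..b}|lborel. q t) / (b - a) \<le> Y a" if ab: "T < a" "a < b" for a b
  proof -
    have "(LINT t:{a..b}|lborel. q t) \<le> (LINT t:{a..b}|lborel. Y a)"
    proof (rule set_integral_mono_AE)
      show "AE t\<in>{a..b} in lborel. q t \<le> Y a"
        using q(1) by eventually_elim (use ab QY in auto)
    next
      show "set_integrable lborel {a..b} q" using ab by (intro q(2))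
    qed (intro set_integrable_continuous_Icc continuous_intros)
    then show ?thesis using ab by (simp add: set_integral_const_Icc pos_divide_le_eq mult.commute)
  qed
  define rt where "rt = (\<lambda>a. \<kappa> * (m - C * sqrt (Y a)) powr n)"
  have lnn: "0 \<le> rt a" for a using pos by (simp add: rt_def)
  \<comment> \<open>Without its dissipation term the inequality bounds \<open>Q s\<close> by the
    average of \<open>q\<close> over [a2, c]; hence the dissipation over [a2, c] is at least the
    rate times (c - a2) Q s. This enters the inequality that starts from the average over
    [a1, a2].\<close>
  have core: "Q s + rt a\<^sub>1 * (c - a\<^sub>2) * Q s \<le> Y a\<^sub>1" if o: "T < a\<^sub>1" "a\<^sub>1 < a\<^sub>2" "a\<^sub>2 < c" "c < s" for a\<^sub>1 a\<^sub>2 c s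
  proof -
    have T2: "T < a\<^sub>2" using o by simp
    have "Q s \<le> Q s + (LINT t:{c..s}|lborel. D t)" using Dnn[of c s] o by simp
    also have "\<dots> \<le> (LINT t:{a\<^sub>2..c}|lborel. q t) / (c - a\<^sub>2)" by (rule avg) (use o in auto)
    finally have "(c - a\<^sub>2) * Q s \<le> (LINT t:{a\<^sub>2..c}|lborel. q t)" using o by (simp add: pos_le_divide_eq mult.commute)
    then have "rt a\<^sub>1 * ((c - a\<^sub>2) * Q s) \<le> rt a\<^sub>1 * (LINT t:{a\<^sub>2..c}|lborel. q t)" by (rule mult_left_mono[OF _ lnn])
    also have "\<dots> = (LINT t:{a\<^sub>2..c}|lborel. rt a\<^sub>1 * q t)" by simp
    also have "\<dots> \<le> (LINT t:{a\<^sub>2..c}|lborel. D t)"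
    proof (rule set_integral_mono_AE)
      show "AE t\<in>{a\<^sub>2..c} in lborel. rt a\<^sub>1 * q t \<le> D t"
        using q(1) D(2)
      proof eventually_elim
        case (elim t)
        show ?case
        proof
          assume "t \<in> {a\<^sub>2..c}"
          then have t: "T < t" "a\<^sub>1 \<le> t" using o by auto
          have "C * sqrt (Q t) \<le> C * sqrt (Y a\<^sub>1)" using QY[OF o(1) t(2)] pos by simp
          then have "rt a\<^sub>1 \<le> \<kappa> * (m - C * sqrt (Q t)) powr n"
            using Ysmall[OF o(1)] pos unfolding rt_def by (intro mult_left_mono powr_mono2) auto
          then have "rt a\<^sub>1 * Q t \<le> \<kappa> * (m - C * sqrt (Q t)) powr n * Q t"
            using Q(1)[OF t(1)] by (rule mult_right_mono)
          then show "rt a\<^sub>1 * q t \<le> D t" using elim t by simp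
        qed
      qed
    qed (use T2 in \<open>auto intro!: set_integrable_mult_right q(2) D(1)\<close>)
    also have "\<dots> \<le> (LINT t:{a\<^sub>2..s}|lborel. D t)"
      using set_integral_Icc_split[of a\<^sub>2 c s D] Dnn[of c s] o D(1)[OF T2] by simp
    finally have "Q s + rt a\<^sub>1 * ((c - a\<^sub>2) * Q s) \<le> Q s + (LINT t:{a\<^sub>2..s}|lborel. D t)" by simp
    also have "\<dots> \<le> (LINT t:{a\<^sub>1..a\<^sub>2}|lborel. q t) / (a\<^sub>2 - a\<^sub>1)" by (rule avg) (use o in auto)
    also have "\<dots> \<le> Y a\<^sub>1" by (rule mean_le) (use o in auto)
    finally show ?thesis by (simp add: mult.assoc)
  qed
  have core2: "Q s * (1 + rt a * (s - a)) \<le> Y a" if o: "T < a" "a < s" for a s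
  proof -
    have "rt a * (s - a) * Q s \<le> Y a - Q s"
    proof (rule field_le_mult_one_interval)
      fix z :: real assume z: "0 < z" "z < 1"
      \<comment> \<open>A fraction 1 - z of [a, s] is left for the averaging windows at both ends;
        \<open>z\<close> may be arbitrarily close to 1.\<close>
      define d where "d = (1 - z) * (s - a) / 2"
      have d: "0 < d" "(s - d) - (a + d) = z * (s - a)" using z o by (simp add: d_def, simp add: d_def field_simps)
      have "0 < z * (s - a)" using z o by simp
      then have "Q s + rt a * ((s - d) - (a + d)) * Q s \<le> Y a" using d o by (intro core) auto
      then show "z * (rt a * (s - a) * Q s) \<le> Y a - Q s" unfolding d(2) by (simp add: mult_ac)
    qed
    then show ?thesis by (simp add: algebra_simps)
  qed
  have Ystep: "Y b * (1 + \<kappa> * (m - C * sqrt (Y a)) powr n * (b - a)) \<le> Y a" if ab: "T < a" "a < b" for a b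
  proof -
    have p: "0 < 1 + rt a * (b - a)" using lnn[of a] ab by (simp add: add_pos_nonneg)
    have "Y b \<le> Y a / (1 + rt a * (b - a))"
    proof (rule YI)
      fix s assume s: "b \<le> s"
      have "rt a * (b - a) \<le> rt a * (s - a)" using s lnn by (intro mult_left_mono) auto
      then have "Q s * (1 + rt a * (b - a)) \<le> Q s * (1 + rt a * (s - a))"
        using Q(1)[of s] s ab by (intro mult_left_mono) auto
      also have "\<dots> \<le> Y a" by (rule core2) (use s ab in auto)
      finally show "Q s \<le> Y a / (1 + rt a * (b - a))" using p by (simp add: pos_le_divide_eq)
    qed
    then show ?thesis using p by (simp add: pos_le_divide_eq rt_def)
  qed
  obtain K where K: "\<And>t. T + 1 \<le> t \<Longrightarrow> Y t \<le> K * exp (- (\<kappa> * m powr n) * t)"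
    using decay_with_limiting_rate[where Y = Y and T = T, OF Ymono Ynn pos Ysmall Ystep] by blast
  have "Q t \<le> K * exp (- (\<kappa> * m powr n) * t)" if "T + 1 \<le> t" for t
    using QY[of t t] K[OF that] that by simp
  then show ?thesis using that by blast
qed

subsection \<open>Exponential convergence to a positive minimizer\<close>

text \<open>
  A solution that stays close to the positive steady state \<open>v\<close> from time \<open>T\<close> on; \<open>p\<close> is a version
  of \<open>u\<^sub>x\<^sub>x\<^sub>x + \<alpha>\<^sup>2 u\<^sub>x - sin x\<close>.
\<close>

locale positive_flow =
  fixes n \<alpha> M C T m B :: real and u ux uxx :: "real \<Rightarrow> real \<Rightarrow> real"
    and v v' :: "real \<Rightarrow> real" and p :: "real \<times> real \<Rightarrow> real"
  assumes n: "0 < n" and alpha: "0 < \<alpha>" "\<alpha> < 1" and T: "0 < T" and m: "0 < m"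
    and dv: "\<And>x. (v has_real_derivative v' x) (at x)"
    and dv': "\<And>x. (v' has_real_derivative C - \<alpha>\<^sup>2 * v x - cos x) (at x)"
    and pv: "circle_fun v" and v_mass: "circle_int v = M"
    and cu: "continuous_on ({0<..} \<times> UNIV) (\<lambda>(t, x). u t x)"
    and pu: "\<And>t. 0 \<le> t \<Longrightarrow> circle_fun (u t)" and uH1: "\<And>t. 0 \<le> t \<Longrightarrow> u t \<in> H1"
    and u_mass: "\<And>t. 0 \<le> t \<Longrightarrow> circle_int (u t) = M"
    and u_le: "\<And>t x. T \<le> t \<Longrightarrow> u t x \<le> B"
    and u_ge: "\<And>t x. T \<le> t \<Longrightarrow> m - sqrt pi * dist_H1 (u t) v \<le> u t x"
    and small: "\<And>t. T \<le> t \<Longrightarrow> dist_H1 (u t) v \<le> m * sqrt (1 - \<alpha>\<^sup>2) / (2 * sqrt pi)"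
    and ux_meas: "(\<lambda>(t, x). ux t x) \<in> borel_measurable borel"
    and ux: "AE t in lborel. 0 < t \<longrightarrow> has_weak_deriv 1 UNIV (u t) (ux t)"
    and weak: "\<And>\<phi>. test_fun \<phi> \<Longrightarrow>
      \<exists>g. (AE t in lborel. 0 < t \<longrightarrow> has_weak_deriv 1 UNIV (\<lambda>x. u t x powr n * deriv (\<phi> t) x) (g t)) \<and>
          set_integrable lborel ({0<..} \<times> {0..2*pi})
            (\<lambda>(t, x). u t x * deriv (\<lambda>s. \<phi> s x) t - (uxx t x + \<alpha>\<^sup>2 * u t x + cos x) * g t x) \<and>
          (LINT (t, x):{0<..} \<times> {0..2*pi}|lborel.
             u t x * deriv (\<lambda>s. \<phi> s x) t - (uxx t x + \<alpha>\<^sup>2 * u t x + cos x) * g t x) = 0"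
    and p_meas: "p \<in> borel_measurable borel"
    and diss: "\<And>a b. T \<le> a \<Longrightarrow>
      set_integrable lborel ({a..b} \<times> {0..2*pi}) (\<lambda>z. u (fst z) (snd z) powr n * (p z)\<^sup>2)"
    and regular: "AE t in lborel. T < t \<longrightarrow> (\<exists>V1 V2.
      (\<forall>x. (u t has_real_derivative V1 x) (at x)) \<and> (\<forall>x. (V1 has_real_derivative V2 x) (at x)) \<and>
      continuous_on UNIV V2 \<and> circle_fun V2 \<and> (AE x in lborel. uxx t x = V2 x) \<and>
      (\<forall>a b. primitive_on a b (\<lambda>x. p (t, x)) (\<lambda>x. V2 x + \<alpha>\<^sup>2 * u t x + cos x)))"
begin

section \<open>Quantities measuring the deviation from the steady state\<close>

abbreviation I where "I \<equiv> {0..2*pi}"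

definition d where "d t = dist_H1 (u t) v"

definition N where "N t = (LINT x:I|lborel. (u t x - v x)\<^sup>2)"

definition Q where "Q t = 1/2 * ((d t)\<^sup>2 - \<alpha>\<^sup>2 * N t)"

text \<open>A version of \<open>Q\<close> built from the jointly measurable \<open>ux\<close> and
  hence measurable in time; \<open>Q\<close> itself goes through \<open>weak_deriv\<close>, which is
  chosen for each time separately. The two agree at almost every time after
  \<open>T\<close>.\<close>

definition q where
  "q t = indicator {T<..} t * (1/2 * ((LINT x:I|lborel. (ux t x - v' x)\<^sup>2) - \<alpha>\<^sup>2 * N t))"

text \<open>Restricted to times from \<open>T\<close> on, where \<open>u\<close> is continuous, so
  that the result is Borel on the whole plane.\<close>

definition U :: "real \<times> real \<Rightarrow> real" where
  "U z = indicator ({T..} \<times> UNIV) z * u (fst z) (snd z)"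

definition J where "J z = U z powr n * p z"

definition D where "D t = (LINT x:I|lborel. J (t, x) * p (t, x))"

lemma alpha2: "0 < \<alpha>\<^sup>2" "\<alpha>\<^sup>2 < 1"
  using alpha by (auto simp: power_less_one_iff abs_square_less_1)

lemma cv: "continuous_on A v" and cv': "continuous_on A v'"
  using DERIV_continuous_on_UNIV[OF dv] DERIV_continuous_on_UNIV[OF dv'] by blast+

lemma v_primitive: "primitive_on a b v' v"
  by (rule primitive_on_DERIV[OF dv cv'])

lemma v_H1: "v \<in> H1" and v_weak: "has_weak_deriv 1 UNIV v v'"
  using primitive_H1[OF v_primitive pv] set_integrable_square_continuous[OF cv'] by blast+

lemma cut:
  assumes "0 < t" shows "continuous_on UNIV (u t)"
proof -
  have "continuous_on UNIV (\<lambda>x. (\<lambda>(t, x). u t x) (t, x))"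
    by (rule continuous_on_compose2[OF cu]) (use assms in \<open>auto intro!: continuous_intros\<close>)
  then show ?thesis by simp
qed

lemma u_primitive: "0 < t \<Longrightarrow> primitive_on a b (weak_deriv (u t)) (u t)"
  by (rule has_weak_deriv_continuous_primitive[OF H1_weak_deriv(1)[OF uH1] open_UNIV is_interval_univ cut]) auto

lemma diff_primitive: "0 < t \<Longrightarrow> primitive_on a b (\<lambda>x. weak_deriv (u t) x - v' x) (\<lambda>x. u t x - v x)"
  by (intro primitive_on_diff u_primitive v_primitive)

lemma diff_square_integrable: "0 < t \<Longrightarrow> set_integrable lborel I (\<lambda>x. (weak_deriv (u t) x - v' x)\<^sup>2)"
  using weak_deriv_measurable[OF uH1, of t] H1_weak_deriv(2)[OF uH1, of t]
    borel_measurable_continuous_onI[OF cv'] set_integrable_square_continuous[OF cv']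
  by (intro set_square_integrable_diff) auto

lemma d_square: "0 < t \<Longrightarrow> (d t)\<^sup>2 = (LINT x:I|lborel. (weak_deriv (u t) x - v' x)\<^sup>2)"
  unfolding d_def by (rule dist_H1_square[OF uH1 v_H1 H1_weak_deriv(1)[OF uH1] v_weak]) auto

lemma diff_periodic: "0 < t \<Longrightarrow> circle_fun (\<lambda>x. u t x - v x)"
  using pu[of t] pv by (simp add: circle_fun_def)

lemma u_integral: "0 \<le> t \<Longrightarrow> (LINT x:I|lborel. u t x) = M"
  and v_integral: "(LINT x:I|lborel. v x) = M"
  using u_mass v_mass by (auto simp: circle_int_def)

lemma diff_mean: "0 < t \<Longrightarrow> (LINT x:I|lborel. u t x - v x) = 0"
  using u_integral[of t] v_integral
  by (subst set_integral_diff(2)) (auto intro!: set_integrable_continuous_UNIV cut cv)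

lemma N_le: "0 < t \<Longrightarrow> N t \<le> (d t)\<^sup>2"
  unfolding N_def d_square
  by (rule wirtinger_circle[OF diff_primitive diff_periodic _ diff_square_integrable diff_mean])
     (auto intro: primitive_measurable[OF diff_primitive])

lemma N_nonneg: "0 \<le> N t"
  unfolding N_def by (rule set_integral_nonneg_real) simp

lemma d_nonneg: "0 \<le> d t"
  by (simp add: d_def dist_H1_nonneg)

text \<open>The form is comparable to the square of the distance; the lower constant comes from
  Wirtinger's inequality.\<close>

lemma Q_bounds:
  assumes "0 < t" shows "1/2 * (1 - \<alpha>\<^sup>2) * (d t)\<^sup>2 \<le> Q t" "Q t \<le> 1/2 * (d t)\<^sup>2" "0 \<le> Q t"
proof -
  have "\<alpha>\<^sup>2 * N t \<le> \<alpha>\<^sup>2 * (d t)\<^sup>2" using N_le[OF assms] by (intro mult_left_mono) auto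
  then show "1/2 * (1 - \<alpha>\<^sup>2) * (d t)\<^sup>2 \<le> Q t" by (simp add: Q_def algebra_simps)
  moreover have "0 \<le> 1/2 * (1 - \<alpha>\<^sup>2) * (d t)\<^sup>2" using alpha2 by simp
  ultimately show "0 \<le> Q t" by simp
  show "Q t \<le> 1/2 * (d t)\<^sup>2" using N_nonneg[of t] by (simp add: Q_def)
qed

text \<open>This bound removes the degeneracy of the mobility u^n.\<close>

lemma u_ge_half: "T \<le> t \<Longrightarrow> m / 2 \<le> u t x"
proof -
  assume t: "T \<le> t"
  have "sqrt pi * d t \<le> sqrt pi * (m * sqrt (1 - \<alpha>\<^sup>2) / (2 * sqrt pi))"
    using small[OF t] by (intro mult_left_mono) (auto simp: d_def)
  also have "\<dots> = m / 2 * sqrt (1 - \<alpha>\<^sup>2)" by (simp add: field_simps)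
  also have "\<dots> \<le> m / 2 * 1" using m by (intro mult_left_mono) auto
  finally show ?thesis using u_ge[OF t, of x] by (simp add: d_def)
qed

lemma u_pos: "T \<le> t \<Longrightarrow> 0 < u t x"
  using u_ge_half[of t x] m by simp

lemma N_continuous: "continuous_on {0<..} N"
  unfolding N_def
proof (rule integral_continuous_in_parameter)
  have "continuous_on ({0<..} \<times> I) (\<lambda>z. ((\<lambda>(t, x). u t x) z - v (snd z))\<^sup>2)"
    by (intro continuous_intros continuous_on_subset[OF cu] continuous_on_compose2[OF cv[of UNIV] continuous_on_snd])
       (auto intro!: continuous_intros)
  then show "continuous_on ({0<..} \<times> I) (\<lambda>(t, x). (u t x - v x)\<^sup>2)" by (simp add: split_beta')
qed

text \<open>The term \<open>N\<close>, which enters with a minus sign, is continuous in time, so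
  lower semicontinuity of the Dirichlet part is enough; \<alpha>^2 < 1 keeps the errors below
  \<open>e\<close>.\<close>

lemma Q_lsc: assumes t: "0 < t" and e: "0 < e" shows "eventually (\<lambda>s. Q t - e < Q s) (nhds t)"
proof -
  have c: "continuous_on ({0<..} \<times> UNIV) (\<lambda>z. (\<lambda>(t, x). u t x) z - v (snd z))"
    by (intro continuous_intros cu continuous_on_compose2[OF cv[of UNIV] continuous_on_snd])
       (auto intro!: continuous_intros)
  have cw: "continuous_on ({0<..} \<times> UNIV) (\<lambda>(t, x). u t x - v x)" using c by (simp add: split_beta')
  have ev1: "eventually (\<lambda>s. (LINT x:I|lborel. (weak_deriv (u t) x - v' x)\<^sup>2) - e
       < (LINT x:I|lborel. (weak_deriv (u s) x - v' x)\<^sup>2)) (nhds t)"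
    by (rule dirichlet_integral_lsc[OF cw diff_primitive diff_square_integrable t _ e]) auto
  have "(N \<longlongrightarrow> N t) (nhds t)"
    using t N_continuous
    by (metis continuous_on_eq_continuous_at greaterThan_iff isCont_def open_greaterThan tendsto_at_iff_tendsto_nhds)
  then have ev2: "eventually (\<lambda>s. N s < N t + e) (nhds t)" by (rule order_tendstoD(2)) (use e in simp)
  have ev3: "eventually (\<lambda>s. s \<in> {0<..}) (nhds t)" using t by (intro eventually_nhds_in_open) auto
  show ?thesis using ev1 ev2 ev3
  proof eventually_elim
    case (elim s)
    have "\<alpha>\<^sup>2 * N s \<le> \<alpha>\<^sup>2 * (N t + e)" using elim(2) by (intro mult_left_mono) auto
    also have "\<dots> \<le> \<alpha>\<^sup>2 * N t + 1 * e" unfolding distrib_left using alpha2 e by (intro add_left_mono mult_right_mono) auto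
    finally have "\<alpha>\<^sup>2 * N s \<le> \<alpha>\<^sup>2 * N t + e" by simp
    moreover have "(d t)\<^sup>2 - e < (d s)\<^sup>2" using elim(1,3) t by (simp add: d_square)
    ultimately show ?case unfolding Q_def by argo
  qed
qed

lemma q_eq_Q: "AE t in lborel. T < t \<longrightarrow> q t = Q t"
  using ux
proof eventually_elim
  case (elim t)
  show ?case
  proof
    assume t: "T < t"
    then have "has_weak_deriv 1 UNIV (u t) (ux t)" using elim T by simp
    then have "(d t)\<^sup>2 = (LINT x:I|lborel. (ux t x - v' x)\<^sup>2)"
      unfolding d_def using t T by (intro dist_H1_square uH1 v_H1 v_weak) auto
    then show "q t = Q t" using t by (simp add: q_def Q_def)
  qed
qed

lemma q_measurable [measurable]: "q \<in> borel_measurable borel"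
proof -
  have [measurable]: "v' \<in> borel_measurable borel" by (rule borel_measurable_continuous_onI[OF cv'])
  have [measurable]: "(\<lambda>z. ux (fst z) (snd z)) \<in> borel_measurable (lborel \<Otimes>\<^sub>M lborel)"
    using ux_meas by (simp add: split_beta' lborel_prod)
  have "(\<lambda>(t, x). indicator I x *\<^sub>R (ux t x - v' x)\<^sup>2) \<in> borel_measurable (lborel \<Otimes>\<^sub>M lborel)"
    unfolding split_beta' by measurable
  then have [measurable]: "(\<lambda>t. LINT x:I|lborel. (ux t x - v' x)\<^sup>2) \<in> borel_measurable borel"
    unfolding set_lebesgue_integral_def using lborel.borel_measurable_lebesgue_integral by fastforce
  have "(\<lambda>t. indicator {T<..} t *\<^sub>R N t) \<in> borel_measurable borel"
    by (rule borel_measurable_continuous_on_indicator[OF _ continuous_on_subset[OF N_continuous]]) (use T in auto)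
  then have [measurable]: "(\<lambda>t. indicator {T<..} t * N t) \<in> borel_measurable borel" by simp
  have "q = (\<lambda>t. 1/2 * (indicator {T<..} t * (LINT x:I|lborel. (ux t x - v' x)\<^sup>2) - \<alpha>\<^sup>2 * (indicator {T<..} t * N t)))"
    by (auto simp: q_def indicator_def fun_eq_iff)
  then show ?thesis by simp
qed

lemma q_integrable: "set_integrable lborel {a..b} q"
  unfolding set_integrable_def
proof (rule Bochner_Integration.integrable_bound)
  define R where "R = m * sqrt (1 - \<alpha>\<^sup>2) / (2 * sqrt pi)"
  show "integrable lborel (\<lambda>t. (1/2 * R\<^sup>2) * indicator {a..b} t)"
    by (intro integrable_mult_right integrable_real_indicator) (auto simp: emeasure_lborel_Icc_eq)
  show "AE t in lborel. norm (indicator {a..b} t *\<^sub>R q t) \<le> norm ((1/2 * R\<^sup>2) * indicator {a..b} t)"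
    using q_eq_Q
  proof eventually_elim
    case (elim t)
    have "\<bar>q t\<bar> \<le> 1/2 * R\<^sup>2"
    proof (cases "T < t")
      case True
      have "(d t)\<^sup>2 \<le> R\<^sup>2" using small[of t] True d_nonneg[of t] by (intro power_mono) (auto simp: R_def d_def)
      then show ?thesis using Q_bounds[of t] True T elim by simp
    qed (simp add: q_def)
    then show ?case by (auto simp: indicator_def)
  qed
qed measurable

section \<open>The flux and the energy balance\<close>

lemma U_eq: "T \<le> t \<Longrightarrow> U (t, x) = u t x"
  by (simp add: U_def)

lemma U_measurable [measurable]: "U \<in> borel_measurable borel"
proof -
  have "(\<lambda>z. indicator ({T..} \<times> UNIV) z *\<^sub>R (\<lambda>(t, x). u t x) z) \<in> borel_measurable borel"
    by (rule borel_measurable_continuous_on_indicator[OF _ continuous_on_subset[OF cu]])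
       (use T in \<open>auto intro!: borel_closed closed_Times\<close>)
  then show ?thesis by (simp add: U_def[abs_def] split_beta')
qed

lemma J_measurable [measurable]: "J \<in> borel_measurable borel"
  unfolding J_def[abs_def] using p_meas by measurable

text \<open>The dissipation density is divided by the lower bound (m/2)^n of the mobility.\<close>

lemma p_square_integrable:
  assumes "T \<le> a" shows "set_integrable lborel ({a..b} \<times> I) (\<lambda>z. (p z)\<^sup>2)"
proof (rule set_integrable_bound)
  show "set_integrable lborel ({a..b} \<times> I) (\<lambda>z. (m / 2) powr (- n) * (u (fst z) (snd z) powr n * (p z)\<^sup>2))"
    by (intro set_integrable_mult_right diss assms)
  have "(p z)\<^sup>2 \<le> (m / 2) powr (- n) * (u (fst z) (snd z) powr n * (p z)\<^sup>2)" if "z \<in> {a..b} \<times> I" for z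
  proof -
    have "T \<le> fst z" using that assms by auto
    then have "(m / 2) powr n \<le> u (fst z) (snd z) powr n" using u_ge_half m n by (intro powr_mono2) auto
    then have "1 \<le> (m / 2) powr (- n) * u (fst z) (snd z) powr n"
      using m by (simp add: powr_minus field_simps)
    then have "1 * (p z)\<^sup>2 \<le> ((m / 2) powr (- n) * u (fst z) (snd z) powr n) * (p z)\<^sup>2"
      by (intro mult_right_mono) auto
    then show ?thesis by (simp add: mult.assoc)
  qed
  then show "AE z in lborel. z \<in> {a..b} \<times> I \<longrightarrow>
      norm ((p z)\<^sup>2) \<le> norm ((m / 2) powr (- n) * (u (fst z) (snd z) powr n * (p z)\<^sup>2))"
    by (intro AE_I2) (auto intro: order_trans[OF _ abs_ge_self])
qed (use p_meas in \<open>simp add: set_borel_measurable_def\<close>)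

text \<open>J^2 = u^n (u^n p^2), where the upper bound \<open>B\<close> controls the first factor
  and the dissipation the second.\<close>

lemma J_square_integrable:
  assumes "T \<le> a" shows "set_integrable lborel ({a..b} \<times> I) (\<lambda>z. (J z)\<^sup>2)"
proof (rule set_integrable_bound)
  show "set_integrable lborel ({a..b} \<times> I) (\<lambda>z. B powr n * (u (fst z) (snd z) powr n * (p z)\<^sup>2))"
    by (intro set_integrable_mult_right diss assms)
  have "(J z)\<^sup>2 \<le> B powr n * (u (fst z) (snd z) powr n * (p z)\<^sup>2)" if "z \<in> {a..b} \<times> I" for z
  proof -
    have Tz: "T \<le> fst z" using that assms by auto
    then have U: "U z = u (fst z) (snd z)" using U_eq[of "fst z" "snd z"] by simp
    have "u (fst z) (snd z) powr n \<le> B powr n" using u_le[OF Tz] u_pos[OF Tz] n by (intro powr_mono2) (auto simp: less_imp_le)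
    then have "u (fst z) (snd z) powr n * (u (fst z) (snd z) powr n * (p z)\<^sup>2) \<le> B powr n * (u (fst z) (snd z) powr n * (p z)\<^sup>2)"
      by (intro mult_right_mono) auto
    then show ?thesis by (simp add: J_def U power2_eq_square mult_ac)
  qed
  then show "AE z in lborel. z \<in> {a..b} \<times> I \<longrightarrow>
      norm ((J z)\<^sup>2) \<le> norm (B powr n * (u (fst z) (snd z) powr n * (p z)\<^sup>2))"
    by (intro AE_I2) (auto intro: order_trans[OF _ abs_ge_self])
qed (simp add: set_borel_measurable_def)

lemma Jp_integrable: "T \<le> a \<Longrightarrow> set_integrable lborel ({a..b} \<times> I) (\<lambda>z. J z * p z)"
  using p_meas by (intro set_square_integrable_mult(1) J_square_integrable p_square_integrable)
    (auto simp: set_borel_measurable_def)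

text \<open>The increment of \<open>u\<close> is minus the x-derivative of the time-integrated flux,
  in a form that admits test functions which are only absolutely continuous.\<close>

lemma increment:
  assumes st: "T < s" "s \<le> t" and G: "primitive_on 0 (2*pi) g G" "G (2*pi) = G 0"
  shows "(LINT x:I|lborel. (u t x - u s x) * G x) = (LINT x:I|lborel. (LINT \<tau>:{s..t}|lborel. J (\<tau>, x)) * g x)"
proof (rule increment_identity[OF _ J_measurable J_square_integrable _ _ _ G])
  fix \<eta> assume \<eta>: "smooth \<eta>" "circle_fun \<eta>"
  show "(LINT x:I|lborel. u t x * \<eta> x) - (LINT x:I|lborel. u s x * \<eta> x)
       = (LINT \<tau>:{s..t}|lborel. LINT x:I|lborel. J (\<tau>, x) * deriv \<eta> x)"
  proof (rule integrated_equation[OF less_imp_le[OF T] cu pu _ weak _ J_measurable J_square_integrable _ \<eta> st])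
    show "AE t in lborel. T < t \<longrightarrow> (\<exists>V. continuous_on UNIV V \<and> circle_fun V \<and> (AE x in lborel. uxx t x = V x) \<and>
        (\<forall>a b. primitive_on a b (\<lambda>x. p (t, x)) (\<lambda>x. V x + \<alpha>\<^sup>2 * u t x + cos x)))"
      using regular by eventually_elim blast
  qed (auto simp: J_def U_eq u_pos)
qed (use st T cut u_integral in auto)

text \<open>Convexity at a regular time \<open>t\<close>; the exceptional null set does not depend
  on \<open>s\<close>. By the Euler-Lagrange equation the gradient of the form at u - v is, up to
  sign, \<open>G - C\<close>; the constant drops out because increments have mean 0, and the
  increment paired with \<open>G\<close> is expressed by the flux.\<close>

lemma Q_difference:
  "AE t in lborel. T < t \<longrightarrow> (\<forall>s. T < s \<longrightarrow> s \<le> t \<longrightarrow>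
     Q t - Q s \<le> - (LINT x:I|lborel. (LINT \<tau>:{s..t}|lborel. J (\<tau>, x)) * p (t, x)))"
  using regular
proof (eventually_elim, intro impI allI)
  fix t s assume st: "T < s" "s \<le> t" and "T < t" and "T < t \<longrightarrow> (\<exists>V1 V2.
      (\<forall>x. (u t has_real_derivative V1 x) (at x)) \<and> (\<forall>x. (V1 has_real_derivative V2 x) (at x)) \<and>
      continuous_on UNIV V2 \<and> circle_fun V2 \<and> (AE x in lborel. uxx t x = V2 x) \<and>
      (\<forall>a b. primitive_on a b (\<lambda>x. p (t, x)) (\<lambda>x. V2 x + \<alpha>\<^sup>2 * u t x + cos x)))"
  then obtain V1 V2 where V1: "\<And>x. (u t has_real_derivative V1 x) (at x)"
    and V2: "\<And>x. (V1 has_real_derivative V2 x) (at x)" and cV2: "continuous_on UNIV V2" and pV2: "circle_fun V2"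
    and P: "\<And>a b. primitive_on a b (\<lambda>x. p (t, x)) (\<lambda>x. V2 x + \<alpha>\<^sup>2 * u t x + cos x)" by blast
  have ts: "0 < t" "0 < s" using st T \<open>T < t\<close> by auto
  define G where "G = (\<lambda>x. V2 x + \<alpha>\<^sup>2 * u t x + cos x)"
  define v'' where "v'' = (\<lambda>x. C - \<alpha>\<^sup>2 * v x - cos x)"
  have cG: "continuous_on UNIV G" unfolding G_def by (intro continuous_intros cV2 cut ts)
  have perG: "G (2*pi) = G 0" using circle_fun_2pi[OF pV2] circle_fun_2pi[OF pu[of t]] ts by (simp add: G_def)
  have Ft: "((\<lambda>x. u t x - v x) has_real_derivative V1 x - v' x) (at x)"
    "((\<lambda>x. V1 x - v' x) has_real_derivative V2 x - v'' x) (at x)" for x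
    unfolding v''_def by (intro DERIV_diff V1 V2 dv dv')+
  have V1w: "has_weak_deriv 1 UNIV (u t) V1"
  proof (rule primitive_imp_has_weak_deriv)
    show "primitive_on a b V1 (u t)" for a b
      by (rule primitive_on_DERIV[OF V1 DERIV_continuous_on_UNIV[OF V2]])
  qed (auto intro: borel_measurable_continuous_onI cut ts)
  have dt: "(d t)\<^sup>2 = (LINT x:I|lborel. (V1 x - v' x)\<^sup>2)"
    unfolding d_def using ts by (intro dist_H1_square uH1 v_H1 V1w v_weak) auto
  have "Q t - Q s = 1/2 * ((LINT x:I|lborel. (V1 x - v' x)\<^sup>2) - \<alpha>\<^sup>2 * (LINT x:I|lborel. (u t x - v x)\<^sup>2))
      - 1/2 * ((LINT x:I|lborel. (weak_deriv (u s) x - v' x)\<^sup>2) - \<alpha>\<^sup>2 * (LINT x:I|lborel. (u s x - v x)\<^sup>2))"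
    using ts by (simp add: Q_def N_def dt d_square)
  also have "\<dots> \<le> - (LINT x:I|lborel. ((u t x - v x) - (u s x - v x)) * ((V2 x - v'' x) + \<alpha>\<^sup>2 * (u t x - v x)))"
    by (rule quadratic_form_convex[OF Ft _ _ diff_primitive diff_periodic diff_square_integrable])
       (use ts cV2 cv alpha2 in \<open>auto simp: diff_mean diff_periodic v''_def intro!: continuous_intros\<close>)
  also have "(LINT x:I|lborel. ((u t x - v x) - (u s x - v x)) * ((V2 x - v'' x) + \<alpha>\<^sup>2 * (u t x - v x)))
      = (LINT x:I|lborel. (u t x - u s x) * G x - C * (u t x - u s x))"
    by (simp add: G_def v''_def algebra_simps)
  also have "\<dots> = (LINT x:I|lborel. (u t x - u s x) * G x) - (LINT x:I|lborel. C * (u t x - u s x))"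
    by (intro set_integral_diff(2) set_integrable_continuous_UNIV continuous_intros cut ts cG)
  also have "(LINT x:I|lborel. C * (u t x - u s x)) = 0"
  proof -
    have "(LINT x:I|lborel. u t x - u s x) = 0"
      using u_integral ts by (subst set_integral_diff(2)) (auto intro!: set_integrable_continuous_UNIV cut)
    then show ?thesis by simp
  qed
  also have "(LINT x:I|lborel. (u t x - u s x) * G x) = (LINT x:I|lborel. (LINT \<tau>:{s..t}|lborel. J (\<tau>, x)) * p (t, x))"
    by (rule increment[OF st _ perG]) (use P in \<open>simp add: G_def\<close>)
  finally show "Q t - Q s \<le> - (LINT x:I|lborel. (LINT \<tau>:{s..t}|lborel. J (\<tau>, x)) * p (t, x))" by simp
qed

text \<open>The case s = t - h of the convexity estimate. Since a shifted null set of times is null,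
  \<open>q\<close> may replace \<open>Q\<close> at both ends.\<close>

lemma averaged_energy_inequality:
  assumes "T + 1 < a\<^sub>1" "a\<^sub>1 < a\<^sub>2" "a\<^sub>2 \<le> b\<^sub>1" "b\<^sub>1 < b\<^sub>2"
  shows "(LINT t:{b\<^sub>1..b\<^sub>2}|lborel. q t) / (b\<^sub>2 - b\<^sub>1) + (LINT t:{a\<^sub>2..b\<^sub>1}|lborel. D t)
      \<le> (LINT t:{a\<^sub>1..a\<^sub>2}|lborel. q t) / (a\<^sub>2 - a\<^sub>1)"
  unfolding D_def
proof (rule averaged_dissipation[OF q_measurable q_integrable J_measurable J_square_integrable p_meas p_square_integrable _ _ assms])
  show "0 \<le> J z * p z" for z
    by (simp add: J_def mult.assoc)
  fix h :: real assume h: "0 < h" "h \<le> 1"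
  have sh: "AE t in lborel. T < t - h \<longrightarrow> q (t - h) = Q (t - h)"
    using AE_lborel_shift[OF q_eq_Q, of "- h"] by simp
  show "AE t in lborel. T + 1 < t \<longrightarrow>
       q t - q (t - h) \<le> - (LINT x:I|lborel. (LINT \<tau>:{t - h..t}|lborel. J (\<tau>, x)) * p (t, x))"
    using Q_difference q_eq_Q sh
  proof eventually_elim
    case (elim t)
    show ?case
    proof
      assume "T + 1 < t"
      then have "T < t" "T < t - h" "t - h \<le> t" using h by auto
      then show "q t - q (t - h) \<le> - (LINT x:I|lborel. (LINT \<tau>:{t - h..t}|lborel. J (\<tau>, x)) * p (t, x))"
        using elim by simp
    qed
  qed
qed auto

lemma D_integrable: "T \<le> a \<Longrightarrow> set_integrable lborel {a..b} D"
  unfolding D_def[abs_def] by (rule set_integral_prod(2)[OF _ _ Jp_integrable]) auto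

text \<open>By lower semicontinuity the averages of \<open>q\<close> over short intervals before
  \<open>b\<close> are at least Q b - e/2, and the dissipation over such an interval is at most e/2;
  the later average thus becomes a value at every time.\<close>

lemma energy_inequality_from_average:
  assumes o: "T + 1 < a\<^sub>1" "a\<^sub>1 < a\<^sub>2" "a\<^sub>2 < b"
  shows "Q b + (LINT t:{a\<^sub>2..b}|lborel. D t) \<le> (LINT t:{a\<^sub>1..a\<^sub>2}|lborel. q t) / (a\<^sub>2 - a\<^sub>1)"
proof (rule field_le_epsilon)
  fix e :: real assume "0 < e"
  then have e: "0 < e / 2" by simp
  have b: "0 < b" using o T by simp
  obtain \<delta> where \<delta>: "0 < \<delta>" "\<And>s. dist s b < \<delta> \<Longrightarrow> Q b - e / 2 < Q s"
    using Q_lsc[OF b e] unfolding eventually_nhds_metric by blast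
  have Di: "set_integrable lborel {a\<^sub>2..b} D" by (rule D_integrable) (use o in simp)
  obtain \<delta>' where \<delta>': "0 < \<delta>'" "\<And>s. s \<in> {a\<^sub>2..b} \<Longrightarrow> dist s b < \<delta>' \<Longrightarrow>
      dist (LINT t:{a\<^sub>2..s}|lborel. D t) (LINT t:{a\<^sub>2..b}|lborel. D t) < e / 2"
    using set_integrable_imp_continuous_primitive[OF Di] e o unfolding continuous_on_iff
    by (metis atLeastAtMost_iff less_imp_le order_refl)
  define c where "c = max ((a\<^sub>2 + b) / 2) (b - min \<delta> \<delta>' / 2)"
  have c: "a\<^sub>2 \<le> c" "c < b" "b - c < \<delta>" "b - c < \<delta>'"
    using o \<delta>(1) \<delta>'(1) by (auto simp: c_def max_def min_def field_simps)
  have "(LINT t:{c..b}|lborel. Q b - e / 2) \<le> (LINT t:{c..b}|lborel. q t)"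
  proof (rule set_integral_mono_AE)
    show "AE t\<in>{c..b} in lborel. Q b - e / 2 \<le> q t"
      using q_eq_Q
    proof eventually_elim
      case (elim t)
      show ?case
      proof
        assume "t \<in> {c..b}"
        then have "dist t b < \<delta>" "T < t" using c o by (auto simp: dist_real_def)
        then show "Q b - e / 2 \<le> q t" using \<delta>(2)[of t] elim by simp
      qed
    qed
  qed (intro q_integrable set_integrable_continuous_Icc continuous_intros)+
  then have "Q b - e / 2 \<le> (LINT t:{c..b}|lborel. q t) / (b - c)"
    using c by (simp add: set_integral_const_Icc pos_le_divide_eq mult.commute)
  moreover have "dist (LINT t:{a\<^sub>2..c}|lborel. D t) (LINT t:{a\<^sub>2..b}|lborel. D t) < e / 2"
    by (rule \<delta>'(2)) (use c in \<open>auto simp: dist_real_def\<close>)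
  then have "(LINT t:{a\<^sub>2..b}|lborel. D t) \<le> (LINT t:{a\<^sub>2..c}|lborel. D t) + e / 2"
    unfolding dist_real_def abs_less_iff by linarith
  moreover note averaged_energy_inequality[OF o(1,2) c(1,2)]
  ultimately show "Q b + (LINT t:{a\<^sub>2..b}|lborel. D t) \<le> (LINT t:{a\<^sub>1..a\<^sub>2}|lborel. q t) / (a\<^sub>2 - a\<^sub>1) + e"
    by linarith
qed

section \<open>Decay of the quadratic form\<close>

definition c\<^sub>0 where "c\<^sub>0 = sqrt (2 * pi / (1 - \<alpha>\<^sup>2))"

lemma c0_pos: "0 < c\<^sub>0"
  using alpha2 by (simp add: c\<^sub>0_def)

text \<open>\<open>c\<^sub>0\<close> joins the factor sqrt pi of the sup bound with the coercivity
  constant (1 - \<alpha>^2) / 2, so that the minimum of \<open>u\<close> is at least m minus this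
  multiple of the root of \<open>Q\<close>.\<close>

lemma d_le_sqrt_Q: "0 < t \<Longrightarrow> sqrt pi * d t \<le> c\<^sub>0 * sqrt (Q t)"
proof -
  assume t: "0 < t"
  have "(d t)\<^sup>2 \<le> 2 * Q t / (1 - \<alpha>\<^sup>2)"
    using Q_bounds(1)[OF t] alpha2 by (simp add: pos_le_divide_eq mult.commute)
  then have "pi * (d t)\<^sup>2 \<le> pi * (2 * Q t / (1 - \<alpha>\<^sup>2))" by (rule mult_left_mono) simp
  then have "pi * (d t)\<^sup>2 \<le> 2 * pi / (1 - \<alpha>\<^sup>2) * Q t" by (simp add: mult_ac)
  then have le: "sqrt (pi * (d t)\<^sup>2) \<le> sqrt (2 * pi / (1 - \<alpha>\<^sup>2) * Q t)" by (rule real_sqrt_le_mono)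
  have "sqrt pi * d t = sqrt (pi * (d t)\<^sup>2)" using d_nonneg[of t] by (simp add: real_sqrt_mult)
  also note le
  also have "sqrt (2 * pi / (1 - \<alpha>\<^sup>2) * Q t) = c\<^sub>0 * sqrt (Q t)" by (simp only: c\<^sub>0_def real_sqrt_mult)
  finally show ?thesis .
qed

text \<open>The factor sqrt (1 - \<alpha>^2) in the smallness assumption cancels the one in
  \<open>c\<^sub>0\<close>; the base of the power in the decay rate therefore stays at least
  m/2.\<close>

lemma sqrt_Q_small: "T \<le> t \<Longrightarrow> c\<^sub>0 * sqrt (Q t) \<le> m / 2"
proof -
  assume t: "T \<le> t"
  then have t0: "0 < t" using T by simp
  have s: "0 < sqrt (1 - \<alpha>\<^sup>2)" using alpha2 by simp
  have "c\<^sub>0 * sqrt (Q t) = sqrt (2 * pi / (1 - \<alpha>\<^sup>2) * Q t)" by (simp only: c\<^sub>0_def real_sqrt_mult)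
  also have "\<dots> \<le> sqrt (2 * pi / (1 - \<alpha>\<^sup>2) * (1/2 * (d t)\<^sup>2))"
    using Q_bounds(2)[OF t0] alpha2 by (intro real_sqrt_le_mono mult_left_mono) auto
  also have "2 * pi / (1 - \<alpha>\<^sup>2) * (1/2 * (d t)\<^sup>2) = pi * (d t)\<^sup>2 / (1 - \<alpha>\<^sup>2)"
    using alpha2 by (simp add: field_simps)
  also have "sqrt \<dots> = sqrt pi * d t / sqrt (1 - \<alpha>\<^sup>2)"
    using d_nonneg[of t] by (simp add: real_sqrt_mult real_sqrt_divide)
  also have "\<dots> \<le> sqrt pi * (m * sqrt (1 - \<alpha>\<^sup>2) / (2 * sqrt pi)) / sqrt (1 - \<alpha>\<^sup>2)"
    using small[OF t] s by (intro divide_right_mono mult_left_mono) (auto simp: d_def)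
  also have "\<dots> = m / 2" using s by (simp add: field_simps)
  finally show ?thesis .
qed

text \<open>Exhaustion of the times after \<open>T\<close> by countably many bounded
  intervals.\<close>

lemma AE_slice_integrable:
  fixes h :: "real \<times> real \<Rightarrow> real"
  assumes "\<And>b. set_integrable lborel ({T..b} \<times> I) h"
  shows "AE t in lborel. T < t \<longrightarrow> set_integrable lborel I (\<lambda>x. h (t, x))"
proof -
  have "AE t in lborel. \<forall>k::nat. t \<in> {T..real k} \<longrightarrow> set_integrable lborel I (\<lambda>x. h (t, x))"
    unfolding AE_all_countable using set_integral_prod(3)[OF _ _ assms] by auto
  then show ?thesis
  proof eventually_elim
    case (elim t)
    obtain k :: nat where "t \<le> real k" using real_arch_simple by blast
    then show ?case using elim by auto
  qed
qed

text \<open>The mobility has a pointwise lower bound in terms of \<open>Q t\<close>, and the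
  dissipation without mobility is handled by \<open>quadratic_form_dissipation\<close>. Subtracting
  \<open>C\<close> from the primitive of \<open>p\<close> shows that \<open>p\<close> is also the
  third-order expression of u - v.\<close>

lemma D_lower_bound:
  "AE t in lborel. T < t \<longrightarrow> 2 * (1 - \<alpha>\<^sup>2) * (m - c\<^sub>0 * sqrt (Q t)) powr n * Q t \<le> D t"
  using regular AE_slice_integrable[OF p_square_integrable[OF order_refl]]
    AE_slice_integrable[OF Jp_integrable[OF order_refl]]
proof (eventually_elim, intro impI)
  fix t assume t: "T < t" and "T < t \<longrightarrow> (\<exists>V1 V2.
      (\<forall>x. (u t has_real_derivative V1 x) (at x)) \<and> (\<forall>x. (V1 has_real_derivative V2 x) (at x)) \<and>
      continuous_on UNIV V2 \<and> circle_fun V2 \<and> (AE x in lborel. uxx t x = V2 x) \<and>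
      (\<forall>a b. primitive_on a b (\<lambda>x. p (t, x)) (\<lambda>x. V2 x + \<alpha>\<^sup>2 * u t x + cos x)))"
    and "T < t \<longrightarrow> set_integrable lborel I (\<lambda>x. (p (t, x))\<^sup>2)"
    and "T < t \<longrightarrow> set_integrable lborel I (\<lambda>x. J (t, x) * p (t, x))"
  then obtain V1 V2 where V1: "\<And>x. (u t has_real_derivative V1 x) (at x)"
    and V2: "\<And>x. (V1 has_real_derivative V2 x) (at x)" and cV2: "continuous_on UNIV V2" and pV2: "circle_fun V2"
    and P: "\<And>a b. primitive_on a b (\<lambda>x. p (t, x)) (\<lambda>x. V2 x + \<alpha>\<^sup>2 * u t x + cos x)"
    and p2: "set_integrable lborel I (\<lambda>x. (p (t, x))\<^sup>2)"
    and Jp: "set_integrable lborel I (\<lambda>x. J (t, x) * p (t, x))" by blast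
  have t0: "0 < t" using t T by simp
  define v'' where "v'' = (\<lambda>x. C - \<alpha>\<^sup>2 * v x - cos x)"
  have Ft: "((\<lambda>x. u t x - v x) has_real_derivative V1 x - v' x) (at x)"
    "((\<lambda>x. V1 x - v' x) has_real_derivative V2 x - v'' x) (at x)" for x
    unfolding v''_def by (intro DERIV_diff V1 V2 dv dv')+
  have V1w: "has_weak_deriv 1 UNIV (u t) V1"
  proof (rule primitive_imp_has_weak_deriv)
    show "primitive_on a b V1 (u t)" for a b
      by (rule primitive_on_DERIV[OF V1 DERIV_continuous_on_UNIV[OF V2]])
  qed (auto intro: borel_measurable_continuous_onI cut t0)
  have dt: "(d t)\<^sup>2 = (LINT x:I|lborel. (V1 x - v' x)\<^sup>2)"
    unfolding d_def using t0 by (intro dist_H1_square uH1 v_H1 V1w v_weak) auto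
  have P': "primitive_on a b (\<lambda>x. p (t, x)) (\<lambda>x. (V2 x - v'' x) + \<alpha>\<^sup>2 * (u t x - v x))" for a b
    using primitive_on_diff[OF P primitive_on_const[of a b C]] by (simp add: v''_def algebra_simps)
  have "(1 - \<alpha>\<^sup>2) * ((LINT x:I|lborel. (V1 x - v' x)\<^sup>2) - \<alpha>\<^sup>2 * (LINT x:I|lborel. (u t x - v x)\<^sup>2))
      \<le> (LINT x:I|lborel. (p (t, x))\<^sup>2)"
    by (rule quadratic_form_dissipation[OF Ft _ diff_periodic[OF t0] _ diff_mean[OF t0] P' p2 alpha2(2)])
       (use cV2 cv pV2 pv in \<open>auto simp: v''_def circle_fun_def intro!: continuous_intros\<close>)
  moreover have "2 * a * (1/2 * b) = a * b" for a b :: real by simp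
  ultimately have pQ: "2 * (1 - \<alpha>\<^sup>2) * Q t \<le> (LINT x:I|lborel. (p (t, x))\<^sup>2)"
    unfolding Q_def N_def dt by (simp only:)
  define \<nu> where "\<nu> = (m - c\<^sub>0 * sqrt (Q t)) powr n"
  have "0 \<le> \<nu>" by (simp add: \<nu>_def)
  then have "\<nu> * (2 * (1 - \<alpha>\<^sup>2) * Q t) \<le> \<nu> * (LINT x:I|lborel. (p (t, x))\<^sup>2)" using pQ by (rule mult_left_mono[rotated])
  also have "\<dots> = (LINT x:I|lborel. \<nu> * (p (t, x))\<^sup>2)" by simp
  also have "\<dots> \<le> D t" unfolding D_def
  proof (rule set_integral_mono[OF set_integrable_mult_right[OF p2] Jp])
    fix x
    have "m - c\<^sub>0 * sqrt (Q t) \<le> u t x" using d_le_sqrt_Q[OF t0] u_ge[of t x] t by (simp add: d_def)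
    moreover have "0 \<le> m - c\<^sub>0 * sqrt (Q t)" using sqrt_Q_small[of t] t m by simp
    ultimately have "\<nu> \<le> u t x powr n" unfolding \<nu>_def using n by (intro powr_mono2) auto
    then have "\<nu> * (p (t, x))\<^sup>2 \<le> u t x powr n * (p (t, x))\<^sup>2" by (rule mult_right_mono) simp
    then show "\<nu> * (p (t, x))\<^sup>2 \<le> J (t, x) * p (t, x)"
      using t by (simp add: J_def U_eq power2_eq_square mult.assoc)
  qed
  finally show "2 * (1 - \<alpha>\<^sup>2) * (m - c\<^sub>0 * sqrt (Q t)) powr n * Q t \<le> D t"
    by (simp add: \<nu>_def mult_ac)
qed

text \<open>\<open>Q\<close> decays at the rate 2 \<mu> and dominates a multiple of the squared
  distance. The delay by 2 consists of 1 for the backward translations and 1 for the start of the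
  Gronwall argument.\<close>

lemma exponential_decay:
  obtains K where "\<And>t. T + 2 \<le> t \<Longrightarrow> dist_H1 (u t) v \<le> K * exp (- ((1 - \<alpha>\<^sup>2) * m powr n) * t)"
proof -
  define \<mu> where "\<mu> = (1 - \<alpha>\<^sup>2) * m powr n"
  have \<kappa>: "0 < 2 * (1 - \<alpha>\<^sup>2)" using alpha2 by simp
  have "\<exists>K. \<forall>t. T + 1 + 1 \<le> t \<longrightarrow> Q t \<le> K * exp (- (2 * (1 - \<alpha>\<^sup>2) * m powr n) * t)"
  proof (rule averaged_gronwall[of "T + 1" Q c\<^sub>0 m n "2 * (1 - \<alpha>\<^sup>2)" q D])
    show "AE t in lborel. T + 1 < t \<longrightarrow> q t = Q t" using q_eq_Q by eventually_elim auto
    show "AE t in lborel. T + 1 < t \<longrightarrow> 2 * (1 - \<alpha>\<^sup>2) * (m - c\<^sub>0 * sqrt (Q t)) powr n * Q t \<le> D t"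
      using D_lower_bound by eventually_elim auto
  qed (use T m n \<kappa> c0_pos Q_bounds(3) sqrt_Q_small q_integrable D_integrable energy_inequality_from_average in auto)
  moreover have "2 * (1 - \<alpha>\<^sup>2) * m powr n = 2 * \<mu>" by (simp only: \<mu>_def mult.assoc)
  ultimately obtain K where "\<And>t. T + 1 + 1 \<le> t \<Longrightarrow> Q t \<le> K * exp (- (2 * \<mu>) * t)" by auto
  then have K: "\<And>t. T + 2 \<le> t \<Longrightarrow> Q t \<le> K * exp (- (2 * \<mu>) * t)" by simp
  define L where "L = sqrt (2 * K / (1 - \<alpha>\<^sup>2))"
  have "d t \<le> L * exp (- \<mu> * t)" if t: "T + 2 \<le> t" for t
  proof -
    have t0: "0 < t" using t T by simp
    have "(d t)\<^sup>2 \<le> 2 / (1 - \<alpha>\<^sup>2) * Q t" using Q_bounds(1)[OF t0] alpha2 by (simp add: field_simps)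
    also have "\<dots> \<le> 2 / (1 - \<alpha>\<^sup>2) * (K * exp (- (2 * \<mu>) * t))" using K[OF t] alpha2 by (intro mult_left_mono) auto
    also have "exp (- (2 * \<mu>) * t) = (exp (- \<mu> * t))\<^sup>2" by (simp add: power2_eq_square exp_add[symmetric])
    finally have "(d t)\<^sup>2 \<le> 2 * K / (1 - \<alpha>\<^sup>2) * (exp (- \<mu> * t))\<^sup>2" by simp
    then have le: "sqrt ((d t)\<^sup>2) \<le> sqrt (2 * K / (1 - \<alpha>\<^sup>2) * (exp (- \<mu> * t))\<^sup>2)" by (rule real_sqrt_le_mono)
    have "d t = sqrt ((d t)\<^sup>2)" using d_nonneg[of t] by simp
    also note le
    also have "sqrt (2 * K / (1 - \<alpha>\<^sup>2) * (exp (- \<mu> * t))\<^sup>2) = L * exp (- \<mu> * t)"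
      by (simp only: L_def real_sqrt_mult real_sqrt_abs abs_exp_cancel)
    finally show ?thesis .
  qed
  then show ?thesis using that unfolding d_def \<mu>_def by blast
qed

end

section \<open>Pointwise closeness and bounds for all times\<close>

lemma continuous_AE_le_imp_le:
  fixes f :: "real \<Rightarrow> real"
  assumes f: "continuous_on {a..b} f" and ab: "a < b" and le: "AE x in lborel. x \<in> {a..b} \<longrightarrow> f x \<le> c"
    and x: "x \<in> {a..b}"
  shows "f x \<le> c"
proof -
  have "f x = min (f x) c"
  proof (rule continuous_AE_eq_imp_eq[where f = f and g = "\<lambda>x. min (f x) c", OF f _ ab _ x])
    show "continuous_on {a..b} (\<lambda>x. min (f x) c)" by (intro continuous_intros f)
    show "AE x in lborel. x \<in> {a..b} \<longrightarrow> f x = min (f x) c" using le by eventually_elim auto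
  qed
  then show ?thesis by simp
qed

lemma abs_diff_le_dist_H1:
  assumes u: "u \<in> H1" "continuous_on UNIV u" and v: "v \<in> H1" "continuous_on UNIV v"
    and mass: "circle_int u = circle_int v"
  shows "\<bar>u x - v x\<bar> \<le> sqrt pi * dist_H1 u v"
proof -
  have per: "circle_fun (\<lambda>x. \<bar>u x - v x\<bar>)"
    using H1_L2[OF u(1)] H1_L2[OF v(1)] by (simp add: L2_def circle_fun_def)
  obtain y where y: "y \<in> {0..2*pi}" "\<bar>u y - v y\<bar> = \<bar>u x - v x\<bar>"
    using circle_fun_reduce[OF per, of x] by blast
  have "\<bar>u y - v y\<bar> \<le> sqrt pi * dist_H1 u v"
    by (rule continuous_AE_le_imp_le[OF _ _ AE_abs_diff_le_dist_H1[OF u(1) v(1) mass] y(1)])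
       (auto intro!: continuous_intros continuous_on_subset[OF u(2)] continuous_on_subset[OF v(2)])
  then show ?thesis using y(2) by simp
qed

text \<open>Controls the initial time interval, which the decay estimate does not reach, through
  coercivity of the energy and its bound by the initial value.\<close>

lemma dist_H1_bounded_by_energy:
  assumes conv: "converging_solution n \<alpha> M K v u" and v: "v \<in> H1" and \<alpha>: "0 < \<alpha>" "\<alpha> < 1"
  obtains R where "\<And>t. 0 \<le> t \<Longrightarrow> dist_H1 (u t) v \<le> R"
proof -
  let ?I = "{0..2*pi}"
  have u0: "u 0 \<in> H1" by (rule converging_solution_H1[OF conv]) simp
  define E where "E = real_of_ereal (energy \<alpha> (u 0))"
  have E: "energy \<alpha> (u 0) = ereal E" using u0 by (simp add: E_def energy_def)
  have Et: "energy \<alpha> (u t) \<le> ereal E" if "0 \<le> t" for t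
  proof (cases "t = 0")
    case False
    then have "t > 0" using that by simp
    then obtain X where X: "energy \<alpha> (u t) + enn2ereal X \<le> energy \<alpha> (u 0)"
      using conv unfolding converging_solution_def energy_inequality_def by meson
    have "energy \<alpha> (u t) \<le> energy \<alpha> (u t) + enn2ereal X"
      using add_left_mono[OF enn2ereal_nonneg[of X], of "energy \<alpha> (u t)"] by simp
    then show ?thesis using X E by simp
  qed (simp add: E)
  define A where "A = (2 * E + 2 * M + \<alpha>\<^sup>2 * (M\<^sup>2 / (2 * pi))) / (1 - \<alpha>\<^sup>2)"
  define V where "V = (LINT x:?I|lborel. (weak_deriv v x)\<^sup>2)"
  have \<alpha>2: "\<alpha>\<^sup>2 < 1" using \<alpha> by (simp add: abs_square_less_1)
  have "dist_H1 (u t) v \<le> sqrt (2 * A + 2 * V)" if t: "0 \<le> t" for t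
  proof -
    have ut: "u t \<in> H1" by (rule converging_solution_H1[OF conv t])
    note m = weak_deriv_measurable[OF ut] weak_deriv_measurable[OF v]
    note i = H1_weak_deriv(2)[OF ut] H1_weak_deriv(2)[OF v]
    have "(1 - \<alpha>\<^sup>2) * (LINT x:?I|lborel. (weak_deriv (u t) x)\<^sup>2) \<le> 2 * E + 2 * M + \<alpha>\<^sup>2 * (M\<^sup>2 / (2 * pi))"
      using converging_solution_mass[OF conv t] by (intro energy_coercive[OF ut _ _ \<alpha> Et[OF t]]) auto
    then have A: "(LINT x:?I|lborel. (weak_deriv (u t) x)\<^sup>2) \<le> A"
      using \<alpha>2 by (simp add: A_def pos_le_divide_eq mult.commute)
    have ptw: "(a - b)\<^sup>2 \<le> 2 * a\<^sup>2 + 2 * b\<^sup>2" for a b :: real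
      using zero_le_power2[of "a + b"] by (simp add: power2_eq_square algebra_simps)
    have "(LINT x:?I|lborel. (weak_deriv (u t) x - weak_deriv v x)\<^sup>2)
      \<le> (LINT x:?I|lborel. 2 * (weak_deriv (u t) x)\<^sup>2 + 2 * (weak_deriv v x)\<^sup>2)"
    proof (rule set_integral_mono[OF _ _ ptw])
      show "set_integrable lborel ?I (\<lambda>x. (weak_deriv (u t) x - weak_deriv v x)\<^sup>2)"
        by (rule set_square_integrable_diff[OF _ _ _ i]) (use m in auto)
      show "set_integrable lborel ?I (\<lambda>x. 2 * (weak_deriv (u t) x)\<^sup>2 + 2 * (weak_deriv v x)\<^sup>2)"
        by (intro set_integral_add set_integrable_mult_right i)
    qed
    also have "\<dots> = (LINT x:?I|lborel. 2 * (weak_deriv (u t) x)\<^sup>2) + (LINT x:?I|lborel. 2 * (weak_deriv v x)\<^sup>2)"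
      by (intro set_integral_add set_integrable_mult_right i)
    also have "\<dots> \<le> 2 * A + 2 * V" using A by (simp add: V_def)
    finally show ?thesis unfolding dist_H1_def circle_int_def by (rule real_sqrt_le_mono)
  qed
  then show ?thesis using that by blast
qed

text \<open>Convergence provides a time \<open>T\<close> after which \<open>u\<close> is so close to
  \<open>v\<close> that the assumptions of \<open>positive_flow\<close> hold; the times before
  \<open>T + 2\<close> are absorbed into the constant.\<close>

lemma exponential_convergence:
  assumes n: "0 < n" and \<alpha>: "0 < \<alpha>" "\<alpha> < 1" and M: "0 < M"
    and min: "energy_minimizer \<alpha> M v" and cv: "continuous_on UNIV v" and pos: "\<And>x. 0 < v x"
    and conv: "converging_solution n \<alpha> M K v u"
  shows "\<exists>L. \<forall>t\<ge>0. dist_H1 (u t) v \<le> L * exp (- ((1 - \<alpha>\<^sup>2) * (INF x\<in>{0..2*pi}. v x) powr n) * t)"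
proof -
  let ?I = "{0..2*pi}"
  have vH1: "v \<in> H1" by (rule energy_minimizer_H1[OF min M])
  have pv: "circle_fun v" using H1_L2[OF vH1] by (simp add: L2_def)
  have vM: "circle_int v = M" using min by (simp add: energy_minimizer_def mass_class_def)
  obtain v' C where dv: "\<And>x. (v has_real_derivative v' x) (at x)"
    and dv': "\<And>x. (v' has_real_derivative C - \<alpha>\<^sup>2 * v x - cos x) (at x)"
    using euler_lagrange[OF min M cv pos] by blast
  obtain y where y: "y \<in> ?I" "\<And>x. v y \<le> v x" using continuous_circle_attains_inf[OF cv pv] by blast
  define m where "m = v y"
  have m: "0 < m" using pos by (simp add: m_def)
  have mI: "(INF x\<in>?I. v x) = m"
    unfolding m_def
  proof (rule antisym)
    show "(INF x\<in>?I. v x) \<le> v y" by (rule cINF_lower[OF bdd_belowI2[of _ "v y"] y(1)]) (rule y(2))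
    show "v y \<le> (INF x\<in>?I. v x)" by (rule cINF_greatest) (use y in auto)
  qed
  obtain Bv where Bv: "\<And>x. \<bar>v x\<bar> \<le> Bv" using continuous_circle_bounded[OF cv pv] by blast
  have \<alpha>2: "\<alpha>\<^sup>2 < 1" using \<alpha> by (simp add: abs_square_less_1)
  \<comment> \<open>Closeness m / (2 sqrt pi) would suffice for u \<ge> m/2; the factor sqrt (1 -
    \<alpha>^2) serves the bound of the minimum through \<open>Q\<close>.\<close>
  define \<delta> where "\<delta> = m * sqrt (1 - \<alpha>\<^sup>2) / (2 * sqrt pi)"
  have \<delta>: "0 < \<delta>" using m \<alpha>2 by (simp add: \<delta>_def)
  have cu: "continuous_on ({0<..} \<times> UNIV) (\<lambda>(t, x). u t x)"
    and ss: "strong_solution n \<alpha> u" and ei: "energy_inequality n \<alpha> u"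
    and lim: "((\<lambda>t. dist_H1 (u t) v) \<longlongrightarrow> 0) at_top" and E0: "energy \<alpha> (u 0) < \<infinity>"
    using conv unfolding converging_solution_def continuous_version_def by blast+
  have uH1: "u t \<in> H1" if "0 \<le> t" for t by (rule converging_solution_H1[OF conv that])
  have pu: "circle_fun (u t)" if "0 \<le> t" for t using H1_L2[OF uH1[OF that]] by (simp add: L2_def)
  have cut: "continuous_on UNIV (u t)" if "0 < t" for t
  proof -
    have "continuous_on UNIV (\<lambda>x. (\<lambda>(t, x). u t x) (t, x))"
      by (rule continuous_on_compose2[OF cu]) (use that in \<open>auto intro!: continuous_intros\<close>)
    then show ?thesis by simp
  qed
  have "eventually (\<lambda>t. dist_H1 (u t) v < \<delta>) at_top" using lim \<delta> by (rule order_tendstoD(2))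
  then obtain T\<^sub>0 where T0: "\<And>t. T\<^sub>0 \<le> t \<Longrightarrow> dist_H1 (u t) v < \<delta>" by (auto simp: eventually_at_top_linorder)
  define T where "T = max T\<^sub>0 1"
  have T: "0 < T" "T\<^sub>0 \<le> T" by (auto simp: T_def)
  have small: "dist_H1 (u t) v \<le> \<delta>" if "T \<le> t" for t using T0[of t] T that by simp
  have close: "\<bar>u t x - v x\<bar> \<le> sqrt pi * dist_H1 (u t) v" if "T \<le> t" for t x
    using that T vM converging_solution_mass(1)[OF conv, of t]
    by (intro abs_diff_le_dist_H1 uH1 cut vH1 cv) auto
  have u_ge: "m - sqrt pi * dist_H1 (u t) v \<le> u t x" if "T \<le> t" for t x
    using close[OF that, of x] y(2)[of x] by (simp add: m_def abs_le_iff)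
  have u_le: "u t x \<le> Bv + sqrt pi * \<delta>" if "T \<le> t" for t x
  proof -
    have "sqrt pi * dist_H1 (u t) v \<le> sqrt pi * \<delta>" using small[OF that] by (intro mult_left_mono) auto
    then show ?thesis using close[OF that, of x] Bv[of x] unfolding abs_le_iff by linarith
  qed
  have u_pos: "0 < u t x" if "T \<le> t" for t x
  proof -
    have "sqrt pi * dist_H1 (u t) v \<le> sqrt pi * \<delta>" using small[OF that] by (intro mult_left_mono) auto
    also have "\<dots> = m / 2 * sqrt (1 - \<alpha>\<^sup>2)" by (simp add: \<delta>_def field_simps)
    also have "\<dots> \<le> m / 2 * 1" using m by (intro mult_left_mono) auto
    finally show ?thesis using u_ge[OF that, of x] m by simp
  qed
  obtain ux uxx where uxm: "(\<lambda>(t, x). ux t x) \<in> borel_measurable borel"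
    and ux: "AE t in lborel. 0 < t \<longrightarrow> has_weak_deriv 1 UNIV (u t) (ux t) \<and> has_weak_deriv 2 UNIV (u t) (uxx t)"
    and weak: "\<forall>\<phi>. test_fun \<phi> \<longrightarrow>
           (\<exists>g. (\<lambda>(t, x). g t x) \<in> borel_measurable borel \<and>
              (AE t in lborel. 0 < t \<longrightarrow>
                 has_weak_deriv 1 UNIV (\<lambda>x. u t x powr n * deriv (\<phi> t) x) (g t)) \<and>
              set_integrable lborel ({0<..} \<times> {0..2*pi})
                (\<lambda>(t, x). u t x * deriv (\<lambda>s. \<phi> s x) t
                           - (uxx t x + \<alpha>\<^sup>2 * u t x + cos x) * g t x) \<and>
              (LINT (t, x):{0<..} \<times> {0..2*pi}|lborel.
                 u t x * deriv (\<lambda>s. \<phi> s x) t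
                 - (uxx t x + \<alpha>\<^sup>2 * u t x + cos x) * g t x) = 0)"
    using ss unfolding strong_solution_def by (elim conjE exE) blast
  obtain y1 uxxx where y1m: "(\<lambda>(t, x). y1 t x) \<in> borel_measurable borel"
    and uxxxm: "(\<lambda>(t, x). uxxx t x) \<in> borel_measurable borel"
    and y1: "AE t in lborel. 0 < t \<longrightarrow> has_weak_deriv 1 UNIV (u t) (y1 t) \<and>
        has_weak_deriv 3 {x. 0 < u t x} (u t) (uxxx t)"
    and dissipation: "\<forall>S>0. energy \<alpha> (u S)
           + enn2ereal (\<integral>\<^sup>+p\<in>{(t, x). 0 < t \<and> t < S \<and> x \<in> {0..2*pi} \<and> 0 < u t x}.
               (case p of (t, x) \<Rightarrow>
                  ennreal (u t x powr n * (uxxx t x + \<alpha>\<^sup>2 * y1 t x - sin x)\<^sup>2)) \<partial>lborel)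
           \<le> energy \<alpha> (u 0)"
    using ei unfolding energy_inequality_def by (elim conjE exE) blast
  define p where "p = (\<lambda>z. uxxx (fst z) (snd z) + \<alpha>\<^sup>2 * y1 (fst z) (snd z) - sin (snd z))"
  have sinm: "(\<lambda>z::real \<times> real. sin (snd z)) \<in> borel_measurable borel"
    by (intro borel_measurable_continuous_onI continuous_intros)
  have p_meas: "p \<in> borel_measurable borel"
    unfolding p_def using y1m uxxxm sinm by (simp add: split_beta')
  have diss: "set_integrable lborel ({a..b} \<times> ?I) (\<lambda>z. u (fst z) (snd z) powr n * (p z)\<^sup>2)" if a: "T \<le> a" for a b
  proof -
    \<comment> \<open>The dissipation is integrated over times strictly below \<open>S\<close>,
      which therefore has to be positive and larger than \<open>b\<close>.\<close>
    define S where "S = max b 0 + 1"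
    have S: "0 < S" "b < S" by (auto simp: S_def)
    define X where "X = (\<integral>\<^sup>+p\<in>{(t, x). 0 < t \<and> t < S \<and> x \<in> ?I \<and> 0 < u t x}.
               (case p of (t, x) \<Rightarrow> ennreal (u t x powr n * (uxxx t x + \<alpha>\<^sup>2 * y1 t x - sin x)\<^sup>2)) \<partial>lborel)"
    have "energy \<alpha> (u S) + enn2ereal X \<le> energy \<alpha> (u 0)" using dissipation S(1) unfolding X_def by blast
    moreover obtain r where "energy \<alpha> (u S) = ereal r" using uH1[of S] S(1) by (auto simp: energy_def)
    ultimately have "enn2ereal X \<noteq> \<infinity>" using E0 by auto
    then have X: "X < \<infinity>" by (simp add: less_top)
    define f where "f = (\<lambda>z. indicator ({a..b} \<times> ?I) z *\<^sub>R (u (fst z) (snd z) powr n * (p z)\<^sup>2))"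
    have "(\<lambda>z. indicator ({a..b} \<times> ?I) z *\<^sub>R (\<lambda>(t, x). u t x) z) \<in> borel_measurable borel"
      by (rule borel_measurable_continuous_on_indicator[OF rectangle_borel continuous_on_subset[OF cu]]) (use a T in auto)
    then have "(\<lambda>z. indicator ({a..b} \<times> ?I) z * u (fst z) (snd z)) \<in> borel_measurable borel"
      by (simp add: split_beta')
    \<comment> \<open>Measurability is obtained with the cutoff inside the power, next to
      \<open>u\<close>; the values are unchanged because \<open>0 powr n = 0\<close>.\<close>
    then have "(\<lambda>z. (indicator ({a..b} \<times> ?I) z * u (fst z) (snd z)) powr n * (p z)\<^sup>2) \<in> borel_measurable borel"
      using p_meas by measurable
    moreover have "(\<lambda>z. (indicator ({a..b} \<times> ?I) z * u (fst z) (snd z)) powr n * (p z)\<^sup>2) = f"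
      by (auto simp: f_def indicator_def fun_eq_iff)
    ultimately have fm: "f \<in> borel_measurable lborel" by simp
    have "(\<integral>\<^sup>+z. ennreal (norm (f z)) \<partial>lborel) \<le> X"
      unfolding X_def
    proof (rule nn_integral_mono)
      fix z :: "real \<times> real"
      show "ennreal (norm (f z)) \<le> (case z of (t, x) \<Rightarrow> ennreal (u t x powr n * (uxxx t x + \<alpha>\<^sup>2 * y1 t x - sin x)\<^sup>2))
          * indicator {(t, x). 0 < t \<and> t < S \<and> x \<in> ?I \<and> 0 < u t x} z"
        using a T S u_pos[of "fst z" "snd z"] by (cases z) (auto simp: f_def indicator_def p_def)
    qed
    then have "integrable lborel f" using fm X by (simp add: integrable_iff_bounded)
    then show ?thesis by (simp add: set_integrable_def f_def)
  qed
  have regular: "AE t in lborel. T < t \<longrightarrow> (\<exists>V1 V2.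
      (\<forall>x. (u t has_real_derivative V1 x) (at x)) \<and> (\<forall>x. (V1 has_real_derivative V2 x) (at x)) \<and>
      continuous_on UNIV V2 \<and> circle_fun V2 \<and> (AE x in lborel. uxx t x = V2 x) \<and>
      (\<forall>a b. primitive_on a b (\<lambda>x. p (t, x)) (\<lambda>x. V2 x + \<alpha>\<^sup>2 * u t x + cos x)))"
    using ux y1
  proof (eventually_elim, intro impI)
    fix t assume "T < t"
      and "0 < t \<longrightarrow> has_weak_deriv 1 UNIV (u t) (ux t) \<and> has_weak_deriv 2 UNIV (u t) (uxx t)"
      and "0 < t \<longrightarrow> has_weak_deriv 1 UNIV (u t) (y1 t) \<and> has_weak_deriv 3 {x. 0 < u t x} (u t) (uxxx t)"
    \<comment> \<open>Positivity everywhere makes the third derivative on the positivity set a weak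
      derivative on the whole line.\<close>
    moreover have "{x. 0 < u t x} = UNIV" using u_pos[of t] \<open>T < t\<close> by auto
    ultimately have w: "has_weak_deriv 1 UNIV (u t) (ux t)" "has_weak_deriv 2 UNIV (u t) (uxx t)"
      "has_weak_deriv 1 UNIV (u t) (y1 t)" "has_weak_deriv 3 UNIV (u t) (uxxx t)" and t: "0 < t" using T by auto
    obtain V1 V2 where V: "\<And>x. (u t has_real_derivative V1 x) (at x)" "\<And>x. (V1 has_real_derivative V2 x) (at x)"
      "circle_fun V1" "circle_fun V2" "continuous_on UNIV V2"
      "AE x in lborel. ux t x = V1 x" "AE x in lborel. uxx t x = V2 x" "AE x in lborel. y1 t x = V1 x"
      "\<And>a b. primitive_on a b (uxxx t) V2"
      by (rule has_weak_deriv_3_regular[OF pu[OF less_imp_le[OF t]] cut[OF t] w]) blast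
    have c1: "continuous_on UNIV V1" by (rule DERIV_continuous_on_UNIV[OF V(2)])
    have y1p: "primitive_on a b (y1 t) (u t)" for a b
    proof (rule primitive_on_cong_AE)
      show "primitive_on a b V1 (u t)" by (rule primitive_on_DERIV[OF V(1) c1])
      show "AE x in lborel. V1 x = y1 t x" using V(8) by eventually_elim simp
      show "V1 \<in> borel_measurable borel" by (rule borel_measurable_continuous_onI[OF c1])
      show "y1 t \<in> borel_measurable borel" by (rule has_weak_deriv_measurable(2)[OF w(3)])
    qed
    have sinp: "primitive_on a b (\<lambda>x. - sin x) cos" for a b :: real
      by (rule primitive_on_DERIV) (auto intro!: derivative_eq_intros continuous_intros)
    have X: "primitive_on a b (\<lambda>x. p (t, x)) (\<lambda>x. V2 x + \<alpha>\<^sup>2 * u t x + cos x)" for a b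
      using primitive_on_add[OF primitive_on_add[OF V(9) primitive_on_cmult[OF y1p]] sinp] by (simp add: p_def)
    show "\<exists>V1 V2. (\<forall>x. (u t has_real_derivative V1 x) (at x)) \<and> (\<forall>x. (V1 has_real_derivative V2 x) (at x)) \<and>
      continuous_on UNIV V2 \<and> circle_fun V2 \<and> (AE x in lborel. uxx t x = V2 x) \<and>
      (\<forall>a b. primitive_on a b (\<lambda>x. p (t, x)) (\<lambda>x. V2 x + \<alpha>\<^sup>2 * u t x + cos x))"
      by (intro exI[of _ V1] exI[of _ V2]) (simp add: V X)
  qed
  interpret positive_flow n \<alpha> M C T m "Bv + sqrt pi * \<delta>" u ux uxx v v' p
  proof
    show "AE t in lborel. 0 < t \<longrightarrow> has_weak_deriv 1 UNIV (u t) (ux t)" using ux by eventually_elim blast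
    show "circle_int (u t) = M" if "0 \<le> t" for t by (rule converging_solution_mass(1)[OF conv that])
    show "dist_H1 (u t) v \<le> m * sqrt (1 - \<alpha>\<^sup>2) / (2 * sqrt pi)" if "T \<le> t" for t
      using small[OF that] by (simp add: \<delta>_def)
  qed (use n \<alpha> T(1) m dv dv' pv vM cu pu uH1 u_le u_ge uxm weak p_meas diss regular in blast)+
  obtain L where L: "\<And>t. T + 2 \<le> t \<Longrightarrow> dist_H1 (u t) v \<le> L * exp (- ((1 - \<alpha>\<^sup>2) * m powr n) * t)"
    using exponential_decay by blast
  obtain R where R: "\<And>t. 0 \<le> t \<Longrightarrow> dist_H1 (u t) v \<le> R"
    using dist_H1_bounded_by_energy[OF conv vH1 \<alpha>] by blast
  define \<mu> where "\<mu> = (1 - \<alpha>\<^sup>2) * m powr n"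
  have \<mu>: "0 \<le> \<mu>" using \<alpha>2 by (simp add: \<mu>_def)
  \<comment> \<open>The second entry raises the uniform bound \<open>R\<close> so far that it
    dominates up to time T + 2 in spite of the decaying exponential.\<close>
  define L' where "L' = max L (R * exp (\<mu> * (T + 2)))"
  have "dist_H1 (u t) v \<le> L' * exp (- \<mu> * t)" if t: "0 \<le> t" for t
  proof (cases "T + 2 \<le> t")
    case True
    have "dist_H1 (u t) v \<le> L * exp (- \<mu> * t)" using L[OF True] by (simp add: \<mu>_def)
    also have "\<dots> \<le> L' * exp (- \<mu> * t)" by (intro mult_right_mono) (auto simp: L'_def)
    finally show ?thesis .
  next
    case False
    have R0: "0 \<le> R" using R[of 0] dist_H1_nonneg[of "u 0" v] by simp
    have "\<mu> * t \<le> \<mu> * (T + 2)" using False \<mu> by (intro mult_left_mono) auto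
    then have "R * 1 \<le> R * exp (\<mu> * (T + 2) - \<mu> * t)" using R0 by (intro mult_left_mono) auto
    then have "dist_H1 (u t) v \<le> R * exp (\<mu> * (T + 2) + - \<mu> * t)" using R[OF t] by simp
    also have "\<dots> = (R * exp (\<mu> * (T + 2))) * exp (- \<mu> * t)" by (simp only: exp_add mult.assoc)
    also have "\<dots> \<le> L' * exp (- \<mu> * t)" by (intro mult_right_mono) (auto simp: L'_def)
    finally show ?thesis .
  qed
  then show ?thesis unfolding mI \<mu>_def by blast
qed

theorem theorem5p2:
  fixes n \<alpha> M \<beta> :: real and ustar :: "real \<Rightarrow> real"
  assumes "n > 0" and "\<alpha> > 0" and "M > 0" and "\<beta> = n - 3/2"
    and "energy_minimizer \<alpha> M ustar" and "continuous_on UNIV ustar"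
  shows
    "(n > 3/2 \<longrightarrow>
       (\<forall>u K\<^sub>0 S\<^sub>0 A L.
          converging_solution n \<alpha> M K\<^sub>0 ustar u \<and> entropy n (u 0) = ereal S\<^sub>0 \<and>
          A \<in> sets lebesgue \<and> A \<subseteq> {0..2*pi} \<and> (\<forall>x\<in>A. ustar x = 0) \<and>
          L = measure lebesgue A \<and> L > 0 \<longrightarrow>
          (\<forall>t\<ge>0. dist_H1 (u t) ustar \<ge> 1 / sqrt pi * (L / (S\<^sub>0 + K\<^sub>0 * t)) powr (1 / \<beta>)))) \<and>
     (n > 2 \<and> (\<exists>x\<^sub>0. vanishes_quadratically_at ustar x\<^sub>0) \<longrightarrow>
       (\<forall>K\<^sub>0 E\<^sub>0 S\<^sub>0. \<exists>K\<^sub>1>0. \<exists>K\<^sub>2>0. \<forall>u.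
          converging_solution n \<alpha> M K\<^sub>0 ustar u \<and>
          energy \<alpha> (u 0) = ereal E\<^sub>0 \<and> entropy n (u 0) = ereal S\<^sub>0 \<longrightarrow>
          (\<forall>t\<ge>0. dist_H1 (u t) ustar \<ge> (K\<^sub>1 + K\<^sub>2 * t) powr (- (2 / (2 * \<beta> - 1)))))) \<and>
     (\<alpha> < 1 \<and> (\<forall>x. ustar x > 0) \<longrightarrow>
       (\<forall>u K\<^sub>0 \<mu>.
          converging_solution n \<alpha> M K\<^sub>0 ustar u \<and>
          \<mu> = (1 - \<alpha>\<^sup>2) * (INF x\<in>{0..2*pi}. ustar x) powr n \<longrightarrow>
          (\<exists>K\<^sub>3. \<forall>t\<ge>0. dist_H1 (u t) ustar \<le> K\<^sub>3 * exp (- \<mu> * t))))"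
proof (intro conjI impI allI)
  fix u K\<^sub>0 S\<^sub>0 A L and t :: real
  assume "n > 3/2" and "converging_solution n \<alpha> M K\<^sub>0 ustar u \<and> entropy n (u 0) = ereal S\<^sub>0 \<and>
          A \<in> sets lebesgue \<and> A \<subseteq> {0..2*pi} \<and> (\<forall>x\<in>A. ustar x = 0) \<and>
          L = measure lebesgue A \<and> L > 0" and "0 \<le> t"
  then show "1 / sqrt pi * (L / (S\<^sub>0 + K\<^sub>0 * t)) powr (1 / \<beta>) \<le> dist_H1 (u t) ustar"
    using assms by (intro lower_bound_if_vanishing_on_set[of n \<alpha> M]) auto
next
  fix K\<^sub>0 E\<^sub>0 S\<^sub>0
  assume "n > 2 \<and> (\<exists>x\<^sub>0. vanishes_quadratically_at ustar x\<^sub>0)"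
  \<comment> \<open>n > 2 means \<beta> > 1/2, so that the exponent 1/2 - \<beta> of the entropy
    bound is negative.\<close>
  then obtain x\<^sub>0 where "vanishes_quadratically_at ustar x\<^sub>0" "1/2 < \<beta>" using assms(4) by auto
  then show "\<exists>K\<^sub>1>0. \<exists>K\<^sub>2>0. \<forall>u.
          converging_solution n \<alpha> M K\<^sub>0 ustar u \<and>
          energy \<alpha> (u 0) = ereal E\<^sub>0 \<and> entropy n (u 0) = ereal S\<^sub>0 \<longrightarrow>
          (\<forall>t\<ge>0. dist_H1 (u t) ustar \<ge> (K\<^sub>1 + K\<^sub>2 * t) powr (- (2 / (2 * \<beta> - 1))))"
    using lower_bound_if_vanishing_quadratically[OF assms(5,3,4), of x\<^sub>0 K\<^sub>0 S\<^sub>0] by blast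
next
  fix u K\<^sub>0 \<mu>
  assume "\<alpha> < 1 \<and> (\<forall>x. ustar x > 0)" and "converging_solution n \<alpha> M K\<^sub>0 ustar u \<and>
          \<mu> = (1 - \<alpha>\<^sup>2) * (INF x\<in>{0..2*pi}. ustar x) powr n"
  then show "\<exists>K\<^sub>3. \<forall>t\<ge>0. dist_H1 (u t) ustar \<le> K\<^sub>3 * exp (- \<mu> * t)"
    using exponential_convergence[OF assms(1,2) _ assms(3,5,6), of K\<^sub>0 u] by blast
qed

end
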